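(* Let $\Omega=\mathbb{R}^3\setminus\overline{B(0,1)}$. Let $u_0,u_1$ and $F$ be radial in the $x$ variable, let $I$ be a time interval with $0\in I$, and let $u:I\times\Omega\to\mathbb{R}$ be a solution of the linear wave equation $$\begin{cases}\partial_t^2u-\Delta u=F,& (t,x)\in I\times\Omega,\\ u(0,x)=u_0(x),\ \ \partial_tu(0,x)=u_1(x),& x\in\Omega,\\ u(t,x)=0,& x\in\partial\Omega.\end{cases}$$ If $q>4$ and $s=1-3/q$, then $$\|u\|_{L^2_tL^q_x(I\times\Omega)}\lesssim\|(u_0,u_1)\|_{\dot H^s_{D,rad}(\Omega)\times\dot H^{s-1}_{D,rad}(\Omega)}+\|F\|_{L^1_t(I;\dot H^{s-1}_{D,rad}(\Omega))},$$ with an implicit constant independent of $I$, $u_0$, $u_1$, $F$.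
   Context: $-\Delta_\Omega$ denotes the Dirichlet Laplacian on $\Omega$ with domain $H^2(\Omega)\cap H^1_0(\Omega)$, a positive self-adjoint operator on $L^2(\Omega)$; functions of $\sqrt{-\Delta_\Omega}$ are defined by the spectral functional calculus. For radial $f$ it is given by $m(\sqrt{-\Delta_\Omega})f=\mathcal{F}_D^{-1}(m\,\mathcal{F}_Df)$, where for $\lambda>0$ and $r=|x|\ge1$ $$\mathcal{F}_Df(\lambda)=\sqrt{\tfrac2\pi}\int_1^\infty\tfrac{\sin\lambda(r-1)}{r}f(r)\,r^2\,dr,\qquad \mathcal{F}_D^{-1}g(r)=\sqrt{\tfrac2\pi}\int_0^\infty\tfrac{\sin\lambda(r-1)}{r}g(\lambda)\,d\lambda.$$ The solution of the linear problem is given by $$u(t)=\cos(t\sqrt{-\Delta_\Omega})u_0+\tfrac{\sin(t\sqrt{-\Delta_\Omega})}{\sqrt{-\Delta_\Omega}}u_1+\int_0^t\tfrac{\sin((t-\tau)\sqrt{-\Delta_\Omega})}{\sqrt{-\Delta_\Omega}}F(\tau)\,d\tau.$$ For $\sigma\in\mathbb{R}$, $\dot H^\sigma_D(\Omega)$ is the completion of (the functions of finite norm in) $C_c^\infty(\Omega)$ under $\|f\|_{\dot H^\sigma_D}=\|(-\Delta_\Omega)^{\sigma/2}f\|_{L^2(\Omega)}$; the subscript $rad$ denotes the subspace of radial elements. *)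

theory Defs
  imports "HOL-Analysis.Analysis"
begin

section \<open>Lebesgue norms with values in the extended nonnegative reals\<close>

definition enn_powr :: "ennreal \<Rightarrow> real \<Rightarrow> ennreal"
  where "enn_powr y a = (if y = top then top else ennreal (enn2real y powr a))"

text \<open>Only used for finite exponents \<open>p \<ge> 1\<close>. The argument is already nonnegative, so that mixed
  norms are obtained by iteration.\<close>

definition Lnorm :: "real \<Rightarrow> 'a measure \<Rightarrow> ('a \<Rightarrow> ennreal) \<Rightarrow> ennreal"
  where "Lnorm p M f = enn_powr (\<integral>\<^sup>+ x. enn_powr (f x) p \<partial>M) (1 / p)"


section \<open>The exterior domain and radial test functions\<close>

definition Omega :: "(real ^ 3) set"
  where "Omega = - cball 0 1"

definition radial :: "(real ^ 3 \<Rightarrow> real) \<Rightarrow> bool"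
  where "radial f \<longleftrightarrow> (\<forall>x y. norm x = norm y \<longrightarrow> f x = f y)"

text \<open>The value \<open>f(r)\<close> of a radial function at radius \<open>r \<ge> 0\<close>.\<close>

definition profile :: "(real ^ 3 \<Rightarrow> real) \<Rightarrow> real \<Rightarrow> real"
  where "profile f r = f (r *\<^sub>R axis 1 1)"

primrec C_k :: "nat \<Rightarrow> (real ^ 3 \<Rightarrow> real) \<Rightarrow> bool"
  where
    "C_k 0 f \<longleftrightarrow> continuous_on UNIV f"
  | "C_k (Suc k) f \<longleftrightarrow>
       (\<forall>x. f differentiable (at x)) \<and>
       (\<forall>i. C_k k (\<lambda>x. frechet_derivative f (at x) (axis i 1)))"

text \<open>\<open>C\<^sub>c\<^sup>\<infinity>(\<Omega>)\<close>, its elements being extended by zero to the whole space.\<close>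

definition test_functions :: "(real ^ 3 \<Rightarrow> real) set"
  where "test_functions =
    {f. (\<forall>k. C_k k f) \<and> compact (closure {x. f x \<noteq> 0}) \<and> closure {x. f x \<noteq> 0} \<subseteq> Omega}"


section \<open>Distorted Fourier transform and functional calculus on radial functions\<close>

definition FD :: "(real ^ 3 \<Rightarrow> real) \<Rightarrow> real \<Rightarrow> real"
  where "FD f l =
    sqrt (2 / pi) * (LBINT r:{1<..}. sin (l * (r - 1)) / r * profile f r * r\<^sup>2)"

definition FD_inv :: "(real \<Rightarrow> real) \<Rightarrow> real \<Rightarrow> real"
  where "FD_inv g r = sqrt (2 / pi) * (LBINT l:{0<..}. sin (l * (r - 1)) / r * g l)"

text \<open>\<open>fcalc m f\<close> is \<open>m(\<surd>(-\<Delta>\<^sub>\<Omega>)) f\<close> for radial \<open>f\<close>; only its values on \<open>\<Omega>\<close> matter.\<close>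

definition fcalc :: "(real \<Rightarrow> real) \<Rightarrow> (real ^ 3 \<Rightarrow> real) \<Rightarrow> real ^ 3 \<Rightarrow> real"
  where "fcalc m f x = FD_inv (\<lambda>l. m l * FD f l) (norm x)"


section \<open>Homogeneous Sobolev spaces of radial functions\<close>

text \<open>\<open>(-\<Delta>\<^sub>\<Omega>)\<^bsup>\<sigma>/2\<^esup>\<close> is the multiplier \<open>\<lambda>\<^sup>\<sigma>\<close> of \<open>\<surd>(-\<Delta>\<^sub>\<Omega>)\<close>. For a radial test function \<open>f\<close> the
  transform \<open>FD f\<close> decays rapidly and vanishes at least linearly at \<open>0\<close>, so that the Lebesgue
  integrals below converge absolutely and the norm is finite whenever \<open>\<sigma> > -3/2\<close>; in the theorem
  \<open>\<sigma> > -3/4\<close>.\<close>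

definition HD_norm :: "real \<Rightarrow> (real ^ 3 \<Rightarrow> real) \<Rightarrow> ennreal"
  where "HD_norm \<sigma> f =
    Lnorm 2 (restrict_space lborel Omega) (\<lambda>x. ennreal \<bar>fcalc (\<lambda>l. l powr \<sigma>) f x\<bar>)"

definition HD_test :: "real \<Rightarrow> (real ^ 3 \<Rightarrow> real) set"
  where "HD_test \<sigma> = {f \<in> test_functions. radial f \<and> HD_norm \<sigma> f < top}"

text \<open>The type \<open>'h\<close> together with the canonical embedding \<open>j\<close> is the completion of the normed space
  \<open>HD_test \<sigma>\<close>. Completions are unique up to isometric isomorphism, and this one is separable, whence
  \<open>second_countable_topology\<close> costs no generality. The completion of the radial test functions is
  the closed subspace of radial elements in the completion of all test functions, since averaging
  over rotations is a contraction that fixes the radial elements.\<close>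

definition is_HD_rad ::
    "real \<Rightarrow> ((real ^ 3 \<Rightarrow> real) \<Rightarrow> 'h::{banach, second_countable_topology}) \<Rightarrow> bool"
  where "is_HD_rad \<sigma> j \<longleftrightarrow>
    (\<forall>f \<in> HD_test \<sigma>. \<forall>g \<in> HD_test \<sigma>. j (\<lambda>x. f x + g x) = j f + j g) \<and>
    (\<forall>f \<in> HD_test \<sigma>. \<forall>c. j (\<lambda>x. c * f x) = c *\<^sub>R j f) \<and>
    (\<forall>f \<in> HD_test \<sigma>. ennreal (norm (j f)) = HD_norm \<sigma> f) \<and>
    closure (j ` HD_test \<sigma>) = UNIV"

text \<open>Identification of elements of the completion with functions on \<open>\<Omega>\<close>, by means of
  \<open>L\<^sup>1\<^sub>l\<^sub>o\<^sub>c(\<Omega>)\<close> limits. For \<open>0 \<le> \<sigma> < 3/2\<close> Sobolev embedding makes this a well-defined injection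
  of the completion into \<open>L\<^sup>1\<^sub>l\<^sub>o\<^sub>c(\<Omega>)\<close>.\<close>

definition HD_function ::
    "real \<Rightarrow> ((real ^ 3 \<Rightarrow> real) \<Rightarrow> 'h::{banach, second_countable_topology}) \<Rightarrow>
     'h \<Rightarrow> (real ^ 3 \<Rightarrow> real) \<Rightarrow> bool"
  where "HD_function \<sigma> j h f \<longleftrightarrow>
    (\<exists>\<phi>. (\<forall>n. \<phi> n \<in> HD_test \<sigma>) \<and> (\<lambda>n. j (\<phi> n)) \<longlonglongrightarrow> h \<and>
         (\<forall>K. compact K \<and> K \<subseteq> Omega \<longrightarrow>
            (\<lambda>n. \<integral>\<^sup>+ x\<in>K. ennreal \<bar>\<phi> n x - f x\<bar> \<partial>lborel) \<longlonglongrightarrow> 0))"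

text \<open>Extension by continuity of \<open>m(\<surd>(-\<Delta>\<^sub>\<Omega>))\<close> to a map from the completion of order \<open>\<sigma>\<close> to the
  completion of order \<open>\<tau>\<close>, for \<open>m\<close> with \<open>\<bar>m(\<lambda>)\<bar> \<lambda>\<^sup>\<tau> \<le> C \<lambda>\<^sup>\<sigma>\<close>. The image \<open>fcalc m f\<close> of a test
  function \<open>f\<close> need not be a test function, hence the second sequence.\<close>

definition has_fcalc ::
    "real \<Rightarrow> ((real ^ 3 \<Rightarrow> real) \<Rightarrow> 'h::{banach, second_countable_topology}) \<Rightarrow>
     real \<Rightarrow> ((real ^ 3 \<Rightarrow> real) \<Rightarrow> 'k::{banach, second_countable_topology}) \<Rightarrow>
     (real \<Rightarrow> real) \<Rightarrow> 'h \<Rightarrow> 'k \<Rightarrow> bool"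
  where "has_fcalc \<sigma> j \<tau> i m h k \<longleftrightarrow>
    (\<exists>\<phi> \<psi>. (\<forall>n. \<phi> n \<in> HD_test \<sigma>) \<and> (\<forall>n. \<psi> n \<in> HD_test \<tau>) \<and>
       (\<lambda>n. j (\<phi> n)) \<longlonglongrightarrow> h \<and> (\<lambda>n. i (\<psi> n)) \<longlonglongrightarrow> k \<and>
       (\<lambda>n. HD_norm \<tau> (\<lambda>x. \<psi> n x - fcalc m (\<phi> n) x)) \<longlonglongrightarrow> 0)"

definition fcalc_ext ::
    "real \<Rightarrow> ((real ^ 3 \<Rightarrow> real) \<Rightarrow> 'h::{banach, second_countable_topology}) \<Rightarrow>
     real \<Rightarrow> ((real ^ 3 \<Rightarrow> real) \<Rightarrow> 'k::{banach, second_countable_topology}) \<Rightarrow>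
     (real \<Rightarrow> real) \<Rightarrow> 'h \<Rightarrow> 'k"
  where "fcalc_ext \<sigma> j \<tau> i m h = (THE k. has_fcalc \<sigma> j \<tau> i m h k)"


section \<open>The linear wave equation\<close>

text \<open>The right-hand side of Duhamel's formula at time \<open>t\<close> (which may be negative), as an element
  of the space of order \<open>s\<close>; the integral is an oriented Bochner integral in that space.\<close>

definition duhamel ::
    "real \<Rightarrow> ((real ^ 3 \<Rightarrow> real) \<Rightarrow> 'a::{banach, second_countable_topology}) \<Rightarrow>
     ((real ^ 3 \<Rightarrow> real) \<Rightarrow> 'b::{banach, second_countable_topology}) \<Rightarrow>
     'a \<Rightarrow> 'b \<Rightarrow> (real \<Rightarrow> 'b) \<Rightarrow> real \<Rightarrow> 'a"
  where "duhamel s j0 j1 u0 u1 F t =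
    fcalc_ext s j0 s j0 (\<lambda>l. cos (t * l)) u0 +
    fcalc_ext (s - 1) j1 s j0 (\<lambda>l. sin (t * l) / l) u1 +
    (LBINT \<tau>=ereal 0..ereal t.
       fcalc_ext (s - 1) j1 s j0 (\<lambda>l. sin ((t - \<tau>) * l) / l) (F \<tau>))"

text \<open>Solutions with Dirichlet boundary condition are the functions given by Duhamel's formula.\<close>

definition wave_solution ::
    "real \<Rightarrow> ((real ^ 3 \<Rightarrow> real) \<Rightarrow> 'a::{banach, second_countable_topology}) \<Rightarrow>
     ((real ^ 3 \<Rightarrow> real) \<Rightarrow> 'b::{banach, second_countable_topology}) \<Rightarrow>
     real set \<Rightarrow> 'a \<Rightarrow> 'b \<Rightarrow> (real \<Rightarrow> 'b) \<Rightarrow> (real \<Rightarrow> real ^ 3 \<Rightarrow> real) \<Rightarrow> bool"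
  where "wave_solution s j0 j1 I u0 u1 F u \<longleftrightarrow>
    (\<lambda>(t, x). u t x) \<in> borel_measurable (restrict_space borel (I \<times> Omega)) \<and>
    (\<forall>t\<in>I. HD_function s j0 (duhamel s j0 j1 u0 u1 F t) (u t))"

definition mixed_norm :: "real \<Rightarrow> real \<Rightarrow> real set \<Rightarrow> (real \<Rightarrow> real ^ 3 \<Rightarrow> real) \<Rightarrow> ennreal"
  where "mixed_norm p q I u =
    Lnorm p (restrict_space lborel I)
      (\<lambda>t. Lnorm q (restrict_space lborel Omega) (\<lambda>x. ennreal \<bar>u t x\<bar>))"

end

theory Submission
  imports Defs "HOL-Probability.Sinc_Integral" "HOL-Real_Asymp.Real_Asymp"
begin

text \<open>
  For radial \<open>f\<close> the function \<open>w(y) = (1 + y) f(1 + y)\<close> on the half-line turns the Dirichlet Laplacian into the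
  second derivative and \<open>F\<^sub>D\<close> into the sine transform, so that the flow acts by translating the odd extension of \<open>w\<close>.
  The norm of \<open>f\<close> in \<open>L\<^sup>q(\<Omega>)\<close> becomes that of \<open>(1 + y)\<^bsup>2/q - 1\<^esup> w\<close> in \<open>L\<^sup>q(0, \<infinity>)\<close>, where \<open>1 + y\<close> may be replaced
  by \<open>y\<close>. Let \<open>\<Delta>(k, l)\<close> be the difference of the means of \<open>w\<close> over the dyadic interval \<open>2\<^sup>k [l, l + 1)\<close> and over
  its parent. Every mean telescopes into the \<open>O(log l)\<close> differences along its ancestors, and \<open>\<ell>\<^sup>2 \<subseteq> \<ell>\<^sup>q\<close> bounds the
  squared weighted \<open>L\<^sup>q\<close> norm by the sum of the \<open>\<Delta>(k, l)\<^sup>2\<close> with weights \<open>2\<^bsup>-2ks\<^esup> l\<^bsup>-\<beta>\<^esup>\<close>, \<open>\<beta> = 3/2 - 2/q\<close>. This bound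
  is quadratic, hence can be integrated in \<open>t\<close> term by term: \<open>\<Delta>(k, l)\<close> is the pairing of the sine transform of \<open>w\<close>
  with an explicit kernel of size at most \<open>2 min(1, 2\<^sup>k \<lambda>)\<close>, and Plancherel in \<open>t\<close> reduces the claim to
  \<open>\<Sum> 2\<^bsup>-2ks\<^esup> l\<^bsup>-\<beta>\<^esup> min(1, 2\<^sup>k \<lambda>)\<^sup>2 \<lesssim> \<lambda>\<^bsup>2s\<^esup>\<close>. The sum over \<open>l\<close> converges because \<open>\<beta> > 1\<close>, which is the
  condition \<open>q > 4\<close>, and the sum over \<open>k\<close> because \<open>0 < s < 1\<close>.
\<close>

section \<open>Plancherel identity and inversion for the sine transform\<close>

text \<open>The margin q > 4 is spent twice. Scaling alone would allow the weight l^(-(2 - 4/q)),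
  whose exponent exceeds 1 by 4 \<epsilon> with \<epsilon> = 1/4 - 1/q; the sum over ancestors costs
  l^(2 \<epsilon>) and leaves \<beta> = 1 + 2 \<epsilon>, still summable over l. The rest is shaped
  by the fact that data and solution are elements of abstract completions: the flow is given there
  by limits, and it does not preserve test functions. An element h is therefore accessed only
  through continuous functionals \<open>Lam \<kappa>\<close>, the extensions of w \<mapsto>
  \<integral> \<kappa> times the sine transform of w. The flow moves from h to the kernel \<kappa>,
  the functional passes under the Duhamel integral, and Fatou carries estimates from test functions
  to the completion. The functionals of the dyadic means are also the bridge back to the function
  u(t): the step functions built from them converge to it in L^1 on shells, so no pointwise values
  of u(t) are ever used.\<close>

abbreviation hl :: "real measure" where "hl \<equiv> restrict_space lborel {0<..}"

lemma sets_hl [measurable_cong]: "sets hl = sets (restrict_space borel {0<..})"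
  by (simp add: sets_restrict_space)

lemma space_hl [simp]: "space hl = {0<..}"
  by (simp add: space_restrict_space)

lemma sigma_finite_hl: "sigma_finite_measure hl"
  by (rule sigma_finite_measure_restrict_space) (auto intro: lborel.sigma_finite_measure_axioms)

interpretation hl: sigma_finite_measure hl by (rule sigma_finite_hl)
interpretation hl_lborel: pair_sigma_finite hl lborel ..
interpretation hl_hl: pair_sigma_finite hl hl ..

lemma borel_measurable_hlI: "f \<in> borel_measurable borel \<Longrightarrow> f \<in> borel_measurable hl"
  by (rule measurable_restrict_space1) simp

lemma borel_measurable_hl_pairI:
  assumes "f \<in> borel_measurable (borel \<Otimes>\<^sub>M borel)"
  shows "f \<in> borel_measurable (hl \<Otimes>\<^sub>M lborel)"
proof -
  have "(\<lambda>p. (fst p, snd p)) \<in> hl \<Otimes>\<^sub>M lborel \<rightarrow>\<^sub>M borel \<Otimes>\<^sub>M borel"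
    by (intro measurable_Pair measurable_compose[OF measurable_fst borel_measurable_hlI]
        measurable_compose[OF measurable_snd]) auto
  from measurable_compose[OF this assms] show ?thesis by simp
qed

lemma borel_measurable_hl_cont:
  fixes f :: "real \<Rightarrow> 'b::topological_space"
  shows "continuous_on {0<..} f \<Longrightarrow> f \<in> borel_measurable hl"
  using borel_measurable_continuous_on_restrict[of "{0<..}" f]
  by (subst measurable_cong_sets[OF sets_hl refl])

lemma integrable_hl_iff: "integrable hl f \<longleftrightarrow> set_integrable lborel {0<..} f" for f :: "real \<Rightarrow> real"
  unfolding set_integrable_def by (subst integrable_restrict_space) auto

lemma integral_hl: "integral\<^sup>L hl f = (LBINT x:{0<..}. f x)" for f :: "real \<Rightarrow> real"
  unfolding set_lebesgue_integral_def by (subst integral_restrict_space) auto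

lemma nn_integral_hl: "(\<integral>\<^sup>+x. f x \<partial>hl) = (\<integral>\<^sup>+x\<in>{0<..}. f x \<partial>lborel)"
  by (subst nn_integral_restrict_space) auto

lemma AE_hlI: "(\<And>x. x > 0 \<Longrightarrow> P x) \<Longrightarrow> AE x in hl. P x"
  by (rule AE_I2) simp

lemma exp_integrable_hl: "0 < u \<Longrightarrow> integrable hl (\<lambda>x. exp (- (u * x)))" for u :: real
  using integrable_I0i_exp_mscale[of u] by (simp add: integrable_hl_iff mult.commute)

text \<open>The Laplace transform of the cosine is the Poisson kernel. Damping by exp(-e y) makes
  the double integrals below absolutely convergent; the limit e \<rightarrow> 0 is taken at the end
  (Abel summation).\<close>

lemma exp_cos_integral:
  fixes e x :: real
  assumes "e > 0"
  shows "integrable hl (\<lambda>y. exp (- (e * y)) * cos (x * y))"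
    and "(\<integral>y. exp (- (e * y)) * cos (x * y) \<partial>hl) = e / (e\<^sup>2 + x\<^sup>2)"
proof -
  show I: "integrable hl (\<lambda>y. exp (- (e * y)) * cos (x * y))"
    by (rule Bochner_Integration.integrable_bound[OF exp_integrable_hl[OF assms]])
       (auto intro!: borel_measurable_hlI simp: abs_mult)
  have pos: "e\<^sup>2 + x\<^sup>2 > 0" using assms by (simp add: add_pos_nonneg)
  define F where "F = (\<lambda>y. exp (- (e * y)) * (x * sin (x * y) - e * cos (x * y)) / (e\<^sup>2 + x\<^sup>2))"
  have d: "(F has_real_derivative exp (- (e * y)) * cos (x * y)) (at y)" for y
  proof -
    have d1: "(F has_real_derivative (exp (- (e * y)) * (- e) * (x * sin (x * y) - e * cos (x * y))
        + exp (- (e * y)) * (x * (cos (x * y) * x) + e * (sin (x * y) * x))) / (e\<^sup>2 + x\<^sup>2)) (at y)"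
      unfolding F_def by (rule DERIV_cdivide) (auto intro!: derivative_eq_intros simp: algebra_simps)
    have eq: "(exp (- (e * y)) * (- e) * (x * sin (x * y) - e * cos (x * y))
        + exp (- (e * y)) * (x * (cos (x * y) * x) + e * (sin (x * y) * x)))
        = exp (- (e * y)) * cos (x * y) * (e\<^sup>2 + x\<^sup>2)"
      by (simp add: algebra_simps power2_eq_square)
    have "e\<^sup>2 + x\<^sup>2 \<noteq> 0" using pos by linarith
    from d1[unfolded eq nonzero_mult_div_cancel_right[OF this]] show ?thesis .
  qed
  have lim: "(F \<longlongrightarrow> 0) at_top"
  proof -
    have ex: "((\<lambda>y. exp (- (e * y)) * ((\<bar>x\<bar> + e) / (e\<^sup>2 + x\<^sup>2))) \<longlongrightarrow> 0 * ((\<bar>x\<bar> + e) / (e\<^sup>2 + x\<^sup>2))) at_top"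
    proof (intro tendsto_mult tendsto_const)
      show "((\<lambda>y. exp (- (e * y))) \<longlongrightarrow> 0) at_top"
        using assms by (auto intro!: exp_at_bot[THEN filterlim_compose]
           filterlim_tendsto_pos_mult_at_top filterlim_ident simp: filterlim_uminus_at_bot)
    qed
    show ?thesis
    proof (rule Lim_null_comparison)
      show "((\<lambda>y. exp (- (e * y)) * ((\<bar>x\<bar> + e) / (e\<^sup>2 + x\<^sup>2))) \<longlongrightarrow> 0) at_top" using ex by simp
      have "norm (F y) \<le> exp (- (e * y)) * ((\<bar>x\<bar> + e) / (e\<^sup>2 + x\<^sup>2))" for y
      proof -
        have "\<bar>x * sin (x * y) - e * cos (x * y)\<bar> \<le> \<bar>x * sin (x * y)\<bar> + \<bar>e * cos (x * y)\<bar>" by linarith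
        also have "\<dots> \<le> \<bar>x\<bar> + e"
          using assms by (intro add_mono) (auto simp: abs_mult mult_left_le)
        finally show ?thesis using pos unfolding F_def
          by (simp add: abs_mult divide_simps mult_left_mono)
      qed
      then show "\<forall>\<^sub>F y in at_top. norm (F y) \<le> exp (- (e * y)) * ((\<bar>x\<bar> + e) / (e\<^sup>2 + x\<^sup>2))" by simp
    qed
  qed
  have "(LBINT y=0..\<infinity>. exp (- (e * y)) * cos (x * y)) = 0 - F 0"
  proof (rule interval_integral_FTC_integrable[where F=F])
    show "set_integrable lborel (einterval 0 \<infinity>) (\<lambda>y. exp (- (e * y)) * cos (x * y))"
      using I by (simp add: integrable_hl_iff zero_ereal_def)
    have "isCont F 0" using d by (rule DERIV_isCont)
    then have "(F \<longlongrightarrow> F 0) (at_right 0)" by (simp add: continuous_at filterlim_at_split)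
    then show "((F \<circ> real_of_ereal) \<longlongrightarrow> F 0) (at_right 0)"
      by (simp add: zero_ereal_def ereal_tendsto_simps)
    show "((F \<circ> real_of_ereal) \<longlongrightarrow> 0) (at_left \<infinity>)"
      using lim by (simp add: ereal_tendsto_simps)
  qed (use d in \<open>auto simp: has_real_derivative_iff_has_vector_derivative intro!: continuous_intros\<close>)
  then show "(\<integral>y. exp (- (e * y)) * cos (x * y) \<partial>hl) = e / (e\<^sup>2 + x\<^sup>2)"
    by (simp add: integral_hl interval_lebesgue_integral_0_infty F_def)
qed

section \<open>The Poisson kernel as approximate identity, and Plancherel on the line\<close>

lemma inverse_one_plus_square:
  "integrable lborel (\<lambda>x::real. 1 / (1 + x\<^sup>2))" "(\<integral>x. 1 / (1 + x\<^sup>2) \<partial>lborel) = pi" for x :: real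
  using integrable_inverse_1_plus_square LBINT_inverse_1_plus_square
  by (simp_all add: set_integrable_def interval_lebesgue_integral_def set_lebesgue_integral_def
      inverse_eq_divide)

text \<open>Rescaling x by \<open>e n\<close> turns the kernel into 1 / (1 + x^2), which is
  independent of n and has mass pi. Dominated convergence then uses continuity of f at the single
  point 0.\<close>

lemma poisson_tendsto:
  fixes f :: "real \<Rightarrow> real"
  assumes [measurable]: "f \<in> borel_measurable borel" and b: "\<And>x. \<bar>f x\<bar> \<le> M" and c: "isCont f 0"
    and e: "e \<longlonglongrightarrow> 0" "\<And>n. e n > (0::real)"
  shows "(\<lambda>n. \<integral>x. f x * (e n / ((e n)\<^sup>2 + x\<^sup>2)) \<partial>lborel) \<longlonglongrightarrow> pi * f 0"
proof -
  have M: "M \<ge> 0" using b[of 0] by linarith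
  have eq: "(\<integral>x. f x * (e n / ((e n)\<^sup>2 + x\<^sup>2)) \<partial>lborel) = (\<integral>x. f (e n * x) * (1 / (1 + x\<^sup>2)) \<partial>lborel)" for n
  proof -
    have p: "1 + x\<^sup>2 \<noteq> 0" for x :: real by (metis add_nonneg_eq_0_iff zero_le_one zero_le_power2 zero_neq_one)
    have "(\<integral>x. f x * (e n / ((e n)\<^sup>2 + x\<^sup>2)) \<partial>lborel)
        = e n * (\<integral>x. f (e n * x) * (e n / ((e n)\<^sup>2 + (e n * x)\<^sup>2)) \<partial>lborel)"
      using lborel_integral_real_affine[of "e n" "\<lambda>x. f x * (e n / ((e n)\<^sup>2 + x\<^sup>2))" 0] e(2)[of n] by simp
    also have "\<dots> = (\<integral>x. e n * (f (e n * x) * (e n / ((e n)\<^sup>2 + (e n * x)\<^sup>2))) \<partial>lborel)"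
      by (rule integral_mult_right_zero[symmetric])
    also have "\<dots> = (\<integral>x. f (e n * x) * (1 / (1 + x\<^sup>2)) \<partial>lborel)"
    proof (rule Bochner_Integration.integral_cong[OF refl])
      fix x
      have "(e n)\<^sup>2 + (e n * x)\<^sup>2 = (e n)\<^sup>2 * (1 + x\<^sup>2)" by (simp add: algebra_simps power2_eq_square)
      then show "e n * (f (e n * x) * (e n / ((e n)\<^sup>2 + (e n * x)\<^sup>2))) = f (e n * x) * (1 / (1 + x\<^sup>2))"
        using e(2)[of n] p[of x] by (simp add: power2_eq_square)
    qed
    finally show ?thesis .
  qed
  have "(\<lambda>n. \<integral>x. f (e n * x) * (1 / (1 + x\<^sup>2)) \<partial>lborel) \<longlonglongrightarrow> (\<integral>x. f 0 * (1 / (1 + x\<^sup>2)) \<partial>lborel)"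
  proof (rule integral_dominated_convergence[where w="\<lambda>x. M * (1 / (1 + x\<^sup>2))"])
    show "integrable lborel (\<lambda>x. M * (1 / (1 + x\<^sup>2)))" by (rule integrable_mult_right) (rule inverse_one_plus_square(1))
    have "(\<lambda>n. f (e n * x)) \<longlonglongrightarrow> f 0" for x
    proof -
      have "(\<lambda>n. e n * x) \<longlonglongrightarrow> 0 * x" by (intro tendsto_mult e tendsto_const)
      then show ?thesis using isCont_tendsto_compose[OF c] by simp
    qed
    then show "AE x in lborel. (\<lambda>n. f (e n * x) * (1 / (1 + x\<^sup>2))) \<longlonglongrightarrow> f 0 * (1 / (1 + x\<^sup>2))"
      by (intro AE_I2 tendsto_mult tendsto_const)
    show "\<And>n. AE x in lborel. norm (f (e n * x) * (1 / (1 + x\<^sup>2))) \<le> M * (1 / (1 + x\<^sup>2))"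
      using b by (auto simp: abs_mult intro!: divide_right_mono)
  qed auto
  then have "(\<lambda>n. \<integral>x. f (e n * x) * (1 / (1 + x\<^sup>2)) \<partial>lborel) \<longlonglongrightarrow> f 0 * (\<integral>x. 1 / (1 + x\<^sup>2) \<partial>lborel)"
    by (simp only: integral_mult_right_zero)
  then show ?thesis unfolding eq inverse_one_plus_square(2) by (simp only: mult.commute)
qed

text \<open>The power spectrum of G is the cosine transform of its autocorrelation \<open>A\<close>,
  and \<open>A 0\<close> is the integral of G^2. Damping the spectral integral turns it into a
  Poisson integral of \<open>A\<close>, so continuity of \<open>A\<close> at 0 gives the identity.
  Continuity of G is asked almost everywhere because an odd extension may jump at 0.\<close>

lemma plancherel_line:
  fixes G :: "real \<Rightarrow> real"
  assumes [measurable]: "G \<in> borel_measurable borel" and int: "integrable lborel G"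
    and bd: "\<And>x. \<bar>G x\<bar> \<le> M" and cont: "AE x in lborel. isCont G x"
  shows "(\<integral>\<^sup>+y. ennreal ((\<integral>x. cos (x * y) * G x \<partial>lborel)\<^sup>2 + (\<integral>x. sin (x * y) * G x \<partial>lborel)\<^sup>2) \<partial>hl)
      = ennreal (pi * (\<integral>x. (G x)\<^sup>2 \<partial>lborel))"
proof -
  define A where "A m = (\<integral>x. G x * G (x + m) \<partial>lborel)" for m
  define H where "H y = (\<integral>x. cos (x * y) * G x \<partial>lborel)\<^sup>2 + (\<integral>x. sin (x * y) * G x \<partial>lborel)\<^sup>2" for y
  have shift: "(\<integral>m. f (x + m) \<partial>lborel) = (\<integral>m. f m \<partial>lborel)" for f :: "real \<Rightarrow> real" and x
    using lborel_integral_real_affine[of 1 f x] by simp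
  have shift_int: "integrable lborel (\<lambda>m. f (x + m)) \<longleftrightarrow> integrable lborel f" for f :: "real \<Rightarrow> real" and x
    using lborel_integrable_real_affine_iff[of 1 f x] by simp
  have M: "M \<ge> 0" using bd[of 0] by linarith
  have pair: "integrable (lborel \<Otimes>\<^sub>M lborel) (\<lambda>(x, m). G x * G (x + m))"
  proof (rule lborel_pair.Fubini_integrable)
    show "(\<lambda>(x, m). G x * G (x + m)) \<in> borel_measurable (lborel \<Otimes>\<^sub>M lborel)" by measurable
    have "(\<integral>m. norm (G x * G (x + m)) \<partial>lborel) = \<bar>G x\<bar> * (\<integral>m. \<bar>G m\<bar> \<partial>lborel)" for x
      using shift[of "\<lambda>m. \<bar>G m\<bar>" x] by (simp add: abs_mult)
    then show "integrable lborel (\<lambda>x. \<integral>m. norm (case (x, m) of (x, m) \<Rightarrow> G x * G (x + m)) \<partial>lborel)"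
      using int by simp
    show "AE x in lborel. integrable lborel (\<lambda>m. case (x, m) of (x, m) \<Rightarrow> G x * G (x + m))"
      using shift_int[of G] int by simp
  qed
  have pairc: "integrable (lborel \<Otimes>\<^sub>M lborel) (\<lambda>(x, m). G x * G (x + m) * cos (m * y))" for y
    by (rule Bochner_Integration.integrable_bound[OF pair]) (auto simp: abs_mult mult_left_le)
  have Aint: "integrable lborel A"
    unfolding A_def using lborel_pair.integrable_snd[OF pair] by simp
  have Ab: "\<bar>A m\<bar> \<le> M * (\<integral>x. \<bar>G x\<bar> \<partial>lborel)" for m
  proof -
    have i: "integrable lborel (\<lambda>x. G x * G (x + m))"
      by (rule Bochner_Integration.integrable_bound[of lborel "\<lambda>x. M * G x"])
         (use int M mult_left_mono[OF bd, of "\<bar>G x\<bar>" for x] in \<open>auto simp: abs_mult mult.commute\<close>)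
    have "\<bar>A m\<bar> \<le> (\<integral>x. \<bar>G x * G (x + m)\<bar> \<partial>lborel)" unfolding A_def by (rule integral_abs_bound)
    also have "\<dots> \<le> (\<integral>x. M * \<bar>G x\<bar> \<partial>lborel)"
      by (rule integral_mono[OF integrable_abs[OF i]])
        (use int mult_left_mono[OF bd, of "\<bar>G x\<bar>" for x] in \<open>auto simp: abs_mult mult.commute\<close>)
    finally show ?thesis by simp
  qed
  \<comment> \<open>Almost everywhere continuity and boundedness of G suffice here: M |G| dominates
    the products.\<close>
  have Acont: "isCont A 0"
  proof (subst continuous_at_sequentially, safe)
    fix e :: "nat \<Rightarrow> real" assume e: "e \<longlonglongrightarrow> 0"
    show "(A \<circ> e) \<longlonglongrightarrow> A 0"
      unfolding A_def comp_def
    proof (rule integral_dominated_convergence[where w="\<lambda>x. M * \<bar>G x\<bar>"])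
      show "AE x in lborel. (\<lambda>i. G x * G (x + e i)) \<longlonglongrightarrow> G x * G (x + 0)"
        using cont
      proof eventually_elim
        case (elim x)
        have "(\<lambda>i. x + e i) \<longlonglongrightarrow> x + 0" by (intro tendsto_add tendsto_const e)
        then have "(\<lambda>i. G (x + e i)) \<longlonglongrightarrow> G x"
          using isCont_tendsto_compose[OF elim] by simp
        then show ?case by (auto intro: tendsto_mult)
      qed
      show "AE x in lborel. norm (G x * G (x + e i)) \<le> M * \<bar>G x\<bar>" for i
        using mult_left_mono[OF bd, of "\<bar>G x\<bar>" for x] by (auto simp: abs_mult mult.commute)
    qed (use int in auto)
  qed
  have [measurable]: "A \<in> borel_measurable borel" using Aint by auto
  have Gc: "integrable lborel (\<lambda>x. cos (x * y) * G x)" "integrable lborel (\<lambda>x. sin (x * y) * G x)" for y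
    by (rule Bochner_Integration.integrable_bound[OF int]; auto simp: abs_mult mult_left_le_one_le)+
  have HA: "H y = (\<integral>m. A m * cos (m * y) \<partial>lborel)" for y
  proof -
    have "(\<integral>m. A m * cos (m * y) \<partial>lborel) = (\<integral>m. (\<integral>x. G x * G (x + m) * cos (m * y) \<partial>lborel) \<partial>lborel)"
      unfolding A_def by (simp add: mult.commute)
    also have "\<dots> = (\<integral>x. (\<integral>m. G x * G (x + m) * cos (m * y) \<partial>lborel) \<partial>lborel)"
      using lborel_pair.Fubini_integral[OF pairc[of y]] by simp
    also have "\<dots> = (\<integral>x. cos (x * y) * G x * (\<integral>m. cos (m * y) * G m \<partial>lborel)
       + sin (x * y) * G x * (\<integral>m. sin (m * y) * G m \<partial>lborel) \<partial>lborel)"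
    proof (rule Bochner_Integration.integral_cong[OF refl])
      fix x
      \<comment> \<open>Writing m = (x + m) - x lets translation invariance separate the two factors
        before the addition theorem is applied.\<close>
      have "(\<integral>m. G x * G (x + m) * cos (m * y) \<partial>lborel) = (\<integral>m. G x * G (x + m) * cos ((x + m - x) * y) \<partial>lborel)"
        by simp
      also have "\<dots> = (\<integral>m. G x * G m * cos ((m - x) * y) \<partial>lborel)"
        by (rule shift[of "\<lambda>m. G x * G m * cos ((m - x) * y)" x])
      also have "\<dots> = (\<integral>m. cos (x * y) * G x * (cos (m * y) * G m) + sin (x * y) * G x * (sin (m * y) * G m) \<partial>lborel)"
        by (rule Bochner_Integration.integral_cong[OF refl]) (simp add: left_diff_distrib cos_diff algebra_simps)
      also have "\<dots> = cos (x * y) * G x * (\<integral>m. cos (m * y) * G m \<partial>lborel)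
         + sin (x * y) * G x * (\<integral>m. sin (m * y) * G m \<partial>lborel)"
        using Gc[of y] by (subst Bochner_Integration.integral_add) auto
      finally show "(\<integral>m. G x * G (x + m) * cos (m * y) \<partial>lborel) = cos (x * y) * G x * (\<integral>m. cos (m * y) * G m \<partial>lborel)
         + sin (x * y) * G x * (\<integral>m. sin (m * y) * G m \<partial>lborel)" .
    qed
    also have "\<dots> = H y"
      using Gc[of y] by (subst Bochner_Integration.integral_add) (auto simp: H_def power2_eq_square)
    finally show ?thesis by simp
  qed
  define e where "e n = 1 / (real n + 1)" for n
  have e: "e \<longlonglongrightarrow> 0" "\<And>n. e n > 0"
    unfolding e_def by (real_asymp | simp)+
  have Hn: "H y \<ge> 0" for y unfolding H_def by simp
  have Hm [measurable]: "H \<in> borel_measurable borel" unfolding HA[abs_def] by measurable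
  have [measurable]: "H \<in> borel_measurable hl" by (rule borel_measurable_hlI[OF Hm])
  have step: "(\<integral>\<^sup>+y. ennreal (exp (- (e n * y)) * H y) \<partial>hl)
      = ennreal (\<integral>m. A m * (e n / ((e n)\<^sup>2 + m\<^sup>2)) \<partial>lborel)" for n
  proof -
    have p: "integrable (hl \<Otimes>\<^sub>M lborel) (\<lambda>(y, m). exp (- (e n * y)) * (A m * cos (m * y)))"
    proof (rule hl_lborel.Fubini_integrable)
      show "(\<lambda>(y, m). exp (- (e n * y)) * (A m * cos (m * y))) \<in> borel_measurable (hl \<Otimes>\<^sub>M lborel)"
        by (rule borel_measurable_hl_pairI) measurable
      have Ac: "integrable lborel (\<lambda>m. A m * cos (m * y))" for y
        by (rule Bochner_Integration.integrable_bound[OF Aint]) (auto simp: abs_mult mult_left_le)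
      have "integrable hl (\<lambda>y. exp (- (e n * y)) * (\<integral>m. \<bar>A m * cos (m * y)\<bar> \<partial>lborel))"
      proof (rule Bochner_Integration.integrable_bound)
        show "integrable hl (\<lambda>y. exp (- (e n * y)) * (\<integral>m. \<bar>A m\<bar> \<partial>lborel))"
          using exp_integrable_hl[of "e n"] e by simp
        have "(\<integral>m. \<bar>A m * cos (m * y)\<bar> \<partial>lborel) \<le> (\<integral>m. \<bar>A m\<bar> \<partial>lborel)" for y
          by (rule integral_mono[OF integrable_abs[OF Ac] integrable_abs[OF Aint]]) (auto simp: abs_mult mult_left_le)
        then show "AE y in hl. norm (exp (- (e n * y)) * (\<integral>m. \<bar>A m * cos (m * y)\<bar> \<partial>lborel))
           \<le> norm (exp (- (e n * y)) * (\<integral>m. \<bar>A m\<bar> \<partial>lborel))"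
          by (auto simp: abs_mult)
      qed (auto intro!: borel_measurable_hlI)
      then show "integrable hl (\<lambda>y. \<integral>m. norm (case (y, m) of (y, m) \<Rightarrow> exp (- (e n * y)) * (A m * cos (m * y))) \<partial>lborel)"
        by (simp add: abs_mult)
      show "AE y in hl. integrable lborel (\<lambda>m. case (y, m) of (y, m) \<Rightarrow> exp (- (e n * y)) * (A m * cos (m * y)))"
        using Ac by simp
    qed
    have "(\<integral>\<^sup>+y. ennreal (exp (- (e n * y)) * H y) \<partial>hl) = ennreal (\<integral>y. exp (- (e n * y)) * H y \<partial>hl)"
      using hl_lborel.integrable_fst[OF p] Hn by (intro nn_integral_eq_integral) (auto simp: HA)
    also have "(\<integral>y. exp (- (e n * y)) * H y \<partial>hl) = (\<integral>m. (\<integral>y. exp (- (e n * y)) * (A m * cos (m * y)) \<partial>hl) \<partial>lborel)"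
      using hl_lborel.Fubini_integral[OF p] by (simp add: HA)
    also have "\<dots> = (\<integral>m. A m * (e n / ((e n)\<^sup>2 + m\<^sup>2)) \<partial>lborel)"
    proof (rule Bochner_Integration.integral_cong[OF refl])
      fix m
      have "(\<integral>y. exp (- (e n * y)) * (A m * cos (m * y)) \<partial>hl) = (\<integral>y. A m * (exp (- (e n * y)) * cos (m * y)) \<partial>hl)"
        by (simp add: ac_simps)
      also have "\<dots> = A m * (\<integral>y. exp (- (e n * y)) * cos (m * y) \<partial>hl)" by (rule integral_mult_right_zero)
      finally show "(\<integral>y. exp (- (e n * y)) * (A m * cos (m * y)) \<partial>hl) = A m * (e n / ((e n)\<^sup>2 + m\<^sup>2))"
        using exp_cos_integral(2)[of "e n" m] e by simp
    qed
    finally show ?thesis .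
  qed
  \<comment> \<open>The damping decreases with n, so monotone convergence applies although the
    undamped integral is not yet known to be finite.\<close>
  have mono: "AE y in hl. ennreal (exp (- (e n * y)) * H y) \<le> ennreal (exp (- (e (Suc n) * y)) * H y)" for n
  proof (rule AE_hlI)
    fix y :: real assume "y > 0"
    then have "e (Suc n) * y \<le> e n * y"
      by (intro mult_right_mono) (auto simp: e_def field_simps)
    then show "ennreal (exp (- (e n * y)) * H y) \<le> ennreal (exp (- (e (Suc n) * y)) * H y)"
      using Hn[of y] by (intro ennreal_leI mult_right_mono) auto
  qed
  have SUP: "(SUP n. ennreal (exp (- (e n * y)) * H y)) = ennreal (H y)" if "y > 0" for y
  proof (rule LIMSEQ_unique)
    show "(\<lambda>n. ennreal (exp (- (e n * y)) * H y)) \<longlonglongrightarrow> (SUP n. ennreal (exp (- (e n * y)) * H y))"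
    proof (rule LIMSEQ_SUP, rule incseq_SucI)
      fix n
      have "e (Suc n) * y \<le> e n * y"
        using that by (intro mult_right_mono) (auto simp: e_def field_simps)
      then show "ennreal (exp (- (e n * y)) * H y) \<le> ennreal (exp (- (e (Suc n) * y)) * H y)"
        using Hn[of y] by (intro ennreal_leI mult_right_mono) auto
    qed
    have "(\<lambda>n. exp (- (e n * y)) * H y) \<longlonglongrightarrow> exp (- (0 * y)) * H y"
      by (intro tendsto_mult tendsto_const tendsto_exp tendsto_minus e)
    then show "(\<lambda>n. ennreal (exp (- (e n * y)) * H y)) \<longlonglongrightarrow> ennreal (H y)"
      by (auto intro: tendsto_ennrealI)
  qed
  have "(\<integral>\<^sup>+y. ennreal (H y) \<partial>hl) = (\<integral>\<^sup>+y. (SUP n. ennreal (exp (- (e n * y)) * H y)) \<partial>hl)"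
    by (rule nn_integral_cong) (simp add: SUP)
  also have "\<dots> = (SUP n. \<integral>\<^sup>+y. ennreal (exp (- (e n * y)) * H y) \<partial>hl)"
    by (rule nn_integral_monotone_convergence_SUP_AE, rule mono, rule borel_measurable_hlI, measurable)
  finally have eq: "(\<integral>\<^sup>+y. ennreal (H y) \<partial>hl) = (SUP n. \<integral>\<^sup>+y. ennreal (exp (- (e n * y)) * H y) \<partial>hl)" .
  have "(\<lambda>n. \<integral>\<^sup>+y. ennreal (exp (- (e n * y)) * H y) \<partial>hl) \<longlonglongrightarrow> (\<integral>\<^sup>+y. ennreal (H y) \<partial>hl)"
    unfolding eq by (rule LIMSEQ_SUP, rule incseq_SucI, rule nn_integral_mono_AE, rule mono)
  moreover have "(\<lambda>n. \<integral>\<^sup>+y. ennreal (exp (- (e n * y)) * H y) \<partial>hl) \<longlonglongrightarrow> ennreal (pi * A 0)"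
    unfolding step using poisson_tendsto[OF _ Ab Acont e] by (auto intro: tendsto_ennrealI)
  ultimately have "(\<integral>\<^sup>+y. ennreal (H y) \<partial>hl) = ennreal (pi * A 0)"
    by (rule LIMSEQ_unique)
  then show ?thesis by (simp add: H_def A_def power2_eq_square)
qed

section \<open>Even and odd extensions: the sine and cosine transforms on the half-line\<close>

lemma lborel_integrable_reflect: "integrable lborel (\<lambda>x. f (- x)) \<longleftrightarrow> integrable lborel f"
  for f :: "real \<Rightarrow> real"
  using lborel_integrable_real_affine_iff[of "-1" f 0] by simp

text \<open>Both parities at once: c = 1 extends f evenly and c = -1 oddly; the origin receives the
  value 0.\<close>

lemma integral_even:
  fixes f :: "real \<Rightarrow> real"
  assumes f: "integrable hl f"
  shows "integrable lborel (\<lambda>x. if x > 0 then f x else if x < 0 then c * f (- x) else 0)" (is "integrable _ ?g")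
    and "(\<integral>x. (if x > 0 then f x else if x < 0 then c * f (- x) else 0) \<partial>lborel) = (1 + c) * (\<integral>x. f x \<partial>hl)"
proof -
  let ?f = "\<lambda>x. indicator {0<..} x *\<^sub>R f x"
  have i: "integrable lborel ?f" using f by (simp add: integrable_hl_iff set_integrable_def)
  have i': "integrable lborel (\<lambda>x. ?f (- x))" using i by (subst lborel_integrable_reflect)
  have eq: "?g = (\<lambda>x. ?f x + c * ?f (- x))" by (auto simp: fun_eq_iff indicator_def)
  show "integrable lborel ?g" unfolding eq using i i' by auto
  have "(\<integral>x. ?f (- x) \<partial>lborel) = (\<integral>x. ?f x \<partial>lborel)"
    using lborel_integral_real_affine[of "-1" ?f 0] by simp
  then show "(\<integral>x. ?g x \<partial>lborel) = (1 + c) * (\<integral>x. f x \<partial>hl)"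
    unfolding eq using i i' by (simp add: integral_hl set_lebesgue_integral_def ring_distribs)
qed

lemma square_integrable_hl:
  fixes g :: "real \<Rightarrow> real"
  assumes int: "integrable hl g" and bd: "\<And>x. x > 0 \<Longrightarrow> \<bar>g x\<bar> \<le> M"
  shows "integrable hl (\<lambda>x. (g x)\<^sup>2)"
proof (rule Bochner_Integration.integrable_bound[OF integrable_mult_right[OF int, of M]])
  have M: "M \<ge> 0" using bd[of 1] by linarith
  show "(\<lambda>x. (g x)\<^sup>2) \<in> borel_measurable hl" using int by auto
  show "AE x in hl. norm ((g x)\<^sup>2) \<le> norm (M * g x)"
  proof (rule AE_hlI)
    fix x :: real assume "x > 0"
    then have "\<bar>g x\<bar> * \<bar>g x\<bar> \<le> M * \<bar>g x\<bar>" by (intro mult_right_mono bd) auto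
    then show "norm ((g x)\<^sup>2) \<le> norm (M * g x)" using M by (simp add: power2_eq_square abs_mult)
  qed
qed

text \<open>The sign \<open>c\<close> distinguishes the even extension of \<open>g\<close> to the line from the odd one.\<close>

lemma plancherel_ext:
  fixes g :: "real \<Rightarrow> real"
  assumes c: "c = 1 \<or> c = - 1" and int: "integrable hl g" and cont: "continuous_on {0<..} g"
    and bd: "\<And>x. x > 0 \<Longrightarrow> \<bar>g x\<bar> \<le> M"
  shows "(\<integral>\<^sup>+y. ennreal (((1 + c) * (\<integral>x. cos (x * y) * g x \<partial>hl))\<^sup>2 + ((1 - c) * (\<integral>x. sin (x * y) * g x \<partial>hl))\<^sup>2) \<partial>hl)
      = ennreal (2 * pi * (\<integral>x. (g x)\<^sup>2 \<partial>hl))"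
proof -
  define G where "G x = (if x > 0 then g x else if x < 0 then c * g (- x) else 0)" for x
  have c1: "\<bar>c\<bar> = 1" "c * c = 1" using c by auto
  have M: "M \<ge> 0" using bd[of 1] by linarith
  have Gint: "integrable lborel G" unfolding G_def by (rule integral_even(1)[OF int])
  have gm [measurable]: "g \<in> borel_measurable hl" using int by auto
  have scm [measurable]: "(\<lambda>x. cos (x * y)) \<in> borel_measurable hl" "(\<lambda>x. sin (x * y)) \<in> borel_measurable hl" for y
    by (auto intro!: borel_measurable_hlI)
  have ic: "integrable hl (\<lambda>x. cos (x * y) * g x)" "integrable hl (\<lambda>x. sin (x * y) * g x)" for y
    by (rule Bochner_Integration.integrable_bound[OF int];
      simp add: abs_mult mult_left_le_one_le)+
  have i2: "integrable hl (\<lambda>x. (g x)\<^sup>2)"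
    by (rule square_integrable_hl[OF int bd])
  have C: "(\<integral>x. cos (x * y) * G x \<partial>lborel) = (1 + c) * (\<integral>x. cos (x * y) * g x \<partial>hl)" for y
  proof -
    have "(\<lambda>x. cos (x * y) * G x) = (\<lambda>x. if x > 0 then cos (x * y) * g x else if x < 0 then c * (cos (- x * y) * g (- x)) else 0)"
      by (auto simp: G_def fun_eq_iff)
    then show ?thesis using integral_even(2)[OF ic(1)[of y], of c] by simp
  qed
  have S: "(\<integral>x. sin (x * y) * G x \<partial>lborel) = (1 - c) * (\<integral>x. sin (x * y) * g x \<partial>hl)" for y
  proof -
    have "(\<lambda>x. sin (x * y) * G x) = (\<lambda>x. if x > 0 then sin (x * y) * g x else if x < 0 then (- c) * (sin (- x * y) * g (- x)) else 0)"
      by (auto simp: G_def fun_eq_iff)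
    then show ?thesis using integral_even(2)[OF ic(2)[of y], of "- c"] by simp
  qed
  have G2: "(\<integral>x. (G x)\<^sup>2 \<partial>lborel) = 2 * (\<integral>x. (g x)\<^sup>2 \<partial>hl)"
  proof -
    have "(\<lambda>x. (G x)\<^sup>2) = (\<lambda>x. if x > 0 then (g x)\<^sup>2 else if x < 0 then 1 * (g (- x))\<^sup>2 else 0)"
      using c by (auto simp: G_def fun_eq_iff power_mult_distrib)
    then show ?thesis using integral_even(2)[OF i2, of 1] by simp
  qed
  have cont': "isCont G x" if "x \<noteq> 0" for x
  proof (cases "x > 0")
    case True
    have "isCont g x" using cont True by (simp add: continuous_on_eq_continuous_at)
    moreover have "\<forall>\<^sub>F y in nhds x. G y = g y"
      using eventually_nhds_in_open[of "{0<..}" x] True by (auto simp: G_def elim!: eventually_mono)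
    ultimately show ?thesis by (simp add: isCont_cong)
  next
    case False
    then have x: "x < 0" using that by simp
    have "isCont g (- x)" using cont x by (simp add: continuous_on_eq_continuous_at)
    then have "isCont (\<lambda>x. c * g (- x)) x"
      by (intro continuous_intros isCont_o2[where g=g and f=uminus]) auto
    moreover have "\<forall>\<^sub>F y in nhds x. G y = c * g (- y)"
      using eventually_nhds_in_open[of "{..<0}" x] x by (auto simp: G_def elim!: eventually_mono)
    ultimately show ?thesis by (simp add: isCont_cong)
  qed
  have "AE x in lborel. x \<noteq> (0::real)" by (rule AE_lborel_singleton)
  then have AEc: "AE x in lborel. isCont G x" by eventually_elim (rule cont')
  have Gb: "\<bar>G x\<bar> \<le> M" for x
    using bd M c1 by (auto simp: G_def abs_mult)
  have "(\<integral>\<^sup>+y. ennreal ((\<integral>x. cos (x * y) * G x \<partial>lborel)\<^sup>2 + (\<integral>x. sin (x * y) * G x \<partial>lborel)\<^sup>2) \<partial>hl)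
      = ennreal (pi * (\<integral>x. (G x)\<^sup>2 \<partial>lborel))"
    by (rule plancherel_line[OF _ Gint Gb AEc]) (use Gint in auto)
  then show ?thesis unfolding C S G2 by (simp only: mult.assoc[symmetric] mult.commute[of pi 2])
qed

text \<open>For either parity one of 1 + c and 1 - c vanishes and the other equals 2. Its square 4
  divides the constant 2 pi of the extension, which leaves pi / 2.\<close>

lemma plancherel_sin_cos:
  fixes g :: "real \<Rightarrow> real"
  assumes int: "integrable hl g" and cont: "continuous_on {0<..} g"
    and bd: "\<And>x. x > 0 \<Longrightarrow> \<bar>g x\<bar> \<le> M"
  shows plancherel_sin: "(\<integral>\<^sup>+y. ennreal ((\<integral>x. sin (x * y) * g x \<partial>hl)\<^sup>2) \<partial>hl) = (\<integral>\<^sup>+x. ennreal (pi / 2 * (g x)\<^sup>2) \<partial>hl)"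
    and plancherel_cos: "(\<integral>\<^sup>+y. ennreal ((\<integral>x. cos (x * y) * g x \<partial>hl)\<^sup>2) \<partial>hl) = (\<integral>\<^sup>+x. ennreal (pi / 2 * (g x)\<^sup>2) \<partial>hl)"
proof -
  have *: "a = b" if "ennreal 4 * a = ennreal 4 * b" for a b :: ennreal
    using that by (subst (asm) ennreal_mult_cancel_left) auto
  have r: "ennreal 4 * (\<integral>\<^sup>+x. ennreal (pi / 2 * (g x)\<^sup>2) \<partial>hl) = ennreal (2 * pi * (\<integral>x. (g x)\<^sup>2 \<partial>hl))"
    using square_integrable_hl[OF int bd]
    by (subst nn_integral_eq_integral) (auto simp: ennreal_mult'[symmetric] simp del: ennreal_numeral)
  have m: "(\<lambda>y. (\<integral>x. sin (x * y) * g x \<partial>hl)) \<in> borel_measurable hl" "(\<lambda>y. (\<integral>x. cos (x * y) * g x \<partial>hl)) \<in> borel_measurable hl"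
  proof -
    have [measurable]: "g \<in> borel_measurable hl" using int by auto
    have [measurable]: "(\<lambda>x::real. x) \<in> hl \<rightarrow>\<^sub>M borel" by (rule borel_measurable_hlI) simp
    show "(\<lambda>y. (\<integral>x. sin (x * y) * g x \<partial>hl)) \<in> borel_measurable hl" "(\<lambda>y. (\<integral>x. cos (x * y) * g x \<partial>hl)) \<in> borel_measurable hl"
      by measurable
  qed
  show "(\<integral>\<^sup>+y. ennreal ((\<integral>x. sin (x * y) * g x \<partial>hl)\<^sup>2) \<partial>hl) = (\<integral>\<^sup>+x. ennreal (pi / 2 * (g x)\<^sup>2) \<partial>hl)"
    by (rule *, unfold r, subst plancherel_ext[of "- 1", OF _ int cont bd, symmetric])
       (use m in \<open>simp_all add: power_mult_distrib ennreal_mult' nn_integral_cmult\<close>)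
  show "(\<integral>\<^sup>+y. ennreal ((\<integral>x. cos (x * y) * g x \<partial>hl)\<^sup>2) \<partial>hl) = (\<integral>\<^sup>+x. ennreal (pi / 2 * (g x)\<^sup>2) \<partial>hl)"
    by (rule *, unfold r, subst plancherel_ext[of "1", OF _ int cont bd, symmetric])
       (use m in \<open>simp_all add: power_mult_distrib ennreal_mult' nn_integral_cmult\<close>)
qed

text \<open>Abel summation again. Through the odd extension \<open>V\<close>, twice sin(l z) times
  the transform is the cosine transform of \<open>V\<close> centred at z, and its damped integral is
  a Poisson integral of \<open>V\<close> at z. Integrability of the transform allows dominated
  convergence as the damping is removed.\<close>

lemma sine_inversion:
  fixes v :: "real \<Rightarrow> real"
  assumes int: "integrable hl v" and bd: "\<And>y. y > 0 \<Longrightarrow> \<bar>v y\<bar> \<le> M"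
    and z: "z > 0" "isCont v z"
    and int2: "integrable hl (\<lambda>l. \<integral>y. sin (l * y) * v y \<partial>hl)"
  shows "(\<integral>l. sin (l * z) * (\<integral>y. sin (l * y) * v y \<partial>hl) \<partial>hl) = pi / 2 * v z"
proof -
  define a where "a l = (\<integral>y. sin (l * y) * v y \<partial>hl)" for l
  define V where "V x = (if x > 0 then v x else if x < 0 then - 1 * v (- x) else 0)" for x
  define e where "e n = 1 / (real n + 1)" for n
  have e: "e \<longlonglongrightarrow> 0" "\<And>n. e n > 0"
    unfolding e_def by (real_asymp | simp)+
  have M: "M \<ge> 0" using bd[of 1] by linarith
  have Vint: "integrable lborel V" unfolding V_def by (rule integral_even(1)[OF int])
  have [measurable]: "V \<in> borel_measurable borel" using Vint by auto
  have [measurable]: "v \<in> borel_measurable hl" using int by auto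
  have scm [measurable]: "(\<lambda>x. cos (l * x)) \<in> borel_measurable hl" "(\<lambda>x. sin (l * x)) \<in> borel_measurable hl" for l
    by (auto intro!: borel_measurable_hlI)
  have ic: "integrable hl (\<lambda>x. sin (l * x) * v x)" "integrable hl (\<lambda>x. cos (l * x) * v x)" for l
    by (rule Bochner_Integration.integrable_bound[OF int];
      simp add: abs_mult mult_left_le_one_le)+
  have Vb: "\<bar>V x\<bar> \<le> M" for x using bd M by (auto simp: V_def)
  have Vc: "isCont (\<lambda>x. V (x + z)) 0"
  proof -
    have "\<forall>\<^sub>F y in nhds z. V y = v y"
      using eventually_nhds_in_open[of "{0<..}" z] z by (auto simp: V_def elim!: eventually_mono)
    then have "isCont V z" using z by (simp add: isCont_cong)
    then show ?thesis by (intro isCont_o2[where f="\<lambda>x. x + z" and g=V]) auto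
  qed
  have VC: "(\<integral>x. V x * cos ((x - z) * l) \<partial>lborel) = 2 * (sin (l * z) * a l)" for l
  proof -
    have 1: "integrable lborel (\<lambda>x. cos (l * x) * V x)" "(\<integral>x. cos (l * x) * V x \<partial>lborel) = 0"
    proof -
      have "(\<lambda>x. cos (l * x) * V x) = (\<lambda>x. if x > 0 then cos (l * x) * v x else if x < 0 then - 1 * (cos (l * - x) * v (- x)) else 0)"
        by (auto simp: V_def fun_eq_iff)
      then show "integrable lborel (\<lambda>x. cos (l * x) * V x)" "(\<integral>x. cos (l * x) * V x \<partial>lborel) = 0"
        using integral_even[OF ic(2)[of l], of "- 1"] by simp_all
    qed
    have 2: "integrable lborel (\<lambda>x. sin (l * x) * V x)" "(\<integral>x. sin (l * x) * V x \<partial>lborel) = 2 * a l"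
    proof -
      have "(\<lambda>x. sin (l * x) * V x) = (\<lambda>x. if x > 0 then sin (l * x) * v x else if x < 0 then 1 * (sin (l * - x) * v (- x)) else 0)"
        by (auto simp: V_def fun_eq_iff)
      then show "integrable lborel (\<lambda>x. sin (l * x) * V x)" "(\<integral>x. sin (l * x) * V x \<partial>lborel) = 2 * a l"
        using integral_even[OF ic(1)[of l], of 1] by (simp_all add: a_def)
    qed
    have "(\<integral>x. V x * cos ((x - z) * l) \<partial>lborel)
       = (\<integral>x. cos (l * z) * (cos (l * x) * V x) + sin (l * z) * (sin (l * x) * V x) \<partial>lborel)"
      by (rule Bochner_Integration.integral_cong[OF refl]) (simp add: left_diff_distrib cos_diff algebra_simps)
    also have "\<dots> = 2 * (sin (l * z) * a l)"
      using 1 2 by (subst Bochner_Integration.integral_add) auto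
    finally show ?thesis .
  qed
  have step: "(\<integral>l. exp (- (e n * l)) * (2 * (sin (l * z) * a l)) \<partial>hl)
      = (\<integral>x. V (x + z) * (e n / ((e n)\<^sup>2 + x\<^sup>2)) \<partial>lborel)" for n
  proof -
    have p: "integrable (hl \<Otimes>\<^sub>M lborel) (\<lambda>(l, x). exp (- (e n * l)) * (V x * cos ((x - z) * l)))"
    proof (rule hl_lborel.Fubini_integrable)
      show "(\<lambda>(l, x). exp (- (e n * l)) * (V x * cos ((x - z) * l))) \<in> borel_measurable (hl \<Otimes>\<^sub>M lborel)"
        by (rule borel_measurable_hl_pairI) measurable
      have Ac: "integrable lborel (\<lambda>x. V x * cos ((x - z) * l))" for l
        by (rule Bochner_Integration.integrable_bound[OF Vint]) (auto simp: abs_mult mult_left_le)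
      have "integrable hl (\<lambda>l. exp (- (e n * l)) * (\<integral>x. \<bar>V x * cos ((x - z) * l)\<bar> \<partial>lborel))"
      proof (rule Bochner_Integration.integrable_bound)
        show "integrable hl (\<lambda>y. exp (- (e n * y)) * (\<integral>m. \<bar>V m\<bar> \<partial>lborel))"
          using exp_integrable_hl[of "e n"] e by simp
        have "(\<integral>x. \<bar>V x * cos ((x - z) * l)\<bar> \<partial>lborel) \<le> (\<integral>x. \<bar>V x\<bar> \<partial>lborel)" for l
          by (rule integral_mono[OF integrable_abs[OF Ac] integrable_abs[OF Vint]]) (auto simp: abs_mult mult_left_le)
        then show "AE l in hl. norm (exp (- (e n * l)) * (\<integral>x. \<bar>V x * cos ((x - z) * l)\<bar> \<partial>lborel))
           \<le> norm (exp (- (e n * l)) * (\<integral>m. \<bar>V m\<bar> \<partial>lborel))"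
          by (auto simp: abs_mult)
      qed (auto intro!: borel_measurable_hlI)
      then show "integrable hl (\<lambda>l. \<integral>x. norm (case (l, x) of (l, x) \<Rightarrow> exp (- (e n * l)) * (V x * cos ((x - z) * l))) \<partial>lborel)"
        by (simp add: abs_mult)
      show "AE l in hl. integrable lborel (\<lambda>x. case (l, x) of (l, x) \<Rightarrow> exp (- (e n * l)) * (V x * cos ((x - z) * l)))"
        using Ac by simp
    qed
    have "(\<integral>l. exp (- (e n * l)) * (2 * (sin (l * z) * a l)) \<partial>hl)
        = (\<integral>l. (\<integral>x. exp (- (e n * l)) * (V x * cos ((x - z) * l)) \<partial>lborel) \<partial>hl)"
      by (simp add: VC)
    also have "\<dots> = (\<integral>x. (\<integral>l. exp (- (e n * l)) * (V x * cos ((x - z) * l)) \<partial>hl) \<partial>lborel)"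
      using hl_lborel.Fubini_integral[OF p] by simp
    also have "\<dots> = (\<integral>x. V x * (e n / ((e n)\<^sup>2 + (x - z)\<^sup>2)) \<partial>lborel)"
    proof (rule Bochner_Integration.integral_cong[OF refl])
      fix x
      have "(\<integral>y. exp (- (e n * y)) * (V x * cos ((x - z) * y)) \<partial>hl) = (\<integral>y. V x * (exp (- (e n * y)) * cos ((x - z) * y)) \<partial>hl)"
        by (simp add: ac_simps)
      also have "\<dots> = V x * (\<integral>y. exp (- (e n * y)) * cos ((x - z) * y) \<partial>hl)" by (rule integral_mult_right_zero)
      finally show "(\<integral>y. exp (- (e n * y)) * (V x * cos ((x - z) * y)) \<partial>hl) = V x * (e n / ((e n)\<^sup>2 + (x - z)\<^sup>2))"
        using exp_cos_integral(2)[of "e n" "x - z"] e by simp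
    qed
    also have "\<dots> = (\<integral>x. V (x + z) * (e n / ((e n)\<^sup>2 + x\<^sup>2)) \<partial>lborel)"
      using lborel_integral_real_affine[of 1 "\<lambda>x. V x * (e n / ((e n)\<^sup>2 + (x - z)\<^sup>2))" z] by (simp add: add.commute)
    finally show ?thesis .
  qed
  have [measurable]: "a \<in> borel_measurable hl" using int2 unfolding a_def by auto
  have ai: "integrable hl (\<lambda>l. 2 * (sin (l * z) * a l))"
    by (rule Bochner_Integration.integrable_bound[OF integrable_mult_right[OF int2[folded a_def], of 2]])
       (auto simp: abs_mult mult_left_le_one_le intro!: borel_measurable_times borel_measurable_hlI[of "\<lambda>x. sin (x * z)"])
  have "(\<lambda>n. \<integral>l. exp (- (e n * l)) * (2 * (sin (l * z) * a l)) \<partial>hl) \<longlonglongrightarrow> (\<integral>l. 2 * (sin (l * z) * a l) \<partial>hl)"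
  proof (rule integral_dominated_convergence[where w="\<lambda>l. \<bar>2 * (sin (l * z) * a l)\<bar>"])
    show "AE x in hl. (\<lambda>i. exp (- (e i * x)) * (2 * (sin (x * z) * a x))) \<longlonglongrightarrow> 2 * (sin (x * z) * a x)"
    proof (rule AE_I2)
      fix x
      have "(\<lambda>i. exp (- (e i * x)) * (2 * (sin (x * z) * a x))) \<longlonglongrightarrow> exp (- (0 * x)) * (2 * (sin (x * z) * a x))"
        by (intro tendsto_mult tendsto_const tendsto_exp tendsto_minus e)
      then show "(\<lambda>i. exp (- (e i * x)) * (2 * (sin (x * z) * a x))) \<longlonglongrightarrow> 2 * (sin (x * z) * a x)" by simp
    qed
    show "AE x in hl. norm (exp (- (e i * x)) * (2 * (sin (x * z) * a x))) \<le> \<bar>2 * (sin (x * z) * a x)\<bar>" for i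
      using e(2)[of i] by (intro AE_hlI) (simp add: abs_mult mult_left_le_one_le)
  qed (use ai in \<open>auto intro!: borel_measurable_times borel_measurable_hlI[of "\<lambda>x. sin (x * z)"]
       borel_measurable_hlI[of "\<lambda>x. exp (- (_ * x))"]\<close>)
  moreover have "(\<lambda>n. \<integral>x. V (x + z) * (e n / ((e n)\<^sup>2 + x\<^sup>2)) \<partial>lborel) \<longlonglongrightarrow> pi * V (0 + z)"
    by (rule poisson_tendsto[OF _ _ Vc e]) (use Vb in auto)
  ultimately have "(\<integral>l. 2 * (sin (l * z) * a l) \<partial>hl) = pi * V (0 + z)"
    unfolding step by (rule LIMSEQ_unique)
  then show ?thesis using z by (simp add: V_def a_def)
qed

section \<open>Smooth radial functions\<close>

text \<open>The one-variable counterpart of \<open>C_k\<close>. The derivative is existentially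
  quantified, so each closure property below supplies it in explicit form.\<close>

primrec Ck1 :: "nat \<Rightarrow> (real \<Rightarrow> real) \<Rightarrow> bool" where
  "Ck1 0 f \<longleftrightarrow> continuous_on UNIV f"
| "Ck1 (Suc k) f \<longleftrightarrow> (\<exists>f'. (\<forall>x. (f has_real_derivative f' x) (at x)) \<and> Ck1 k f')"

lemma Ck1_cont: "Ck1 k f \<Longrightarrow> continuous_on UNIV f"
  by (cases k) (auto simp: continuous_on_eq_continuous_at intro: DERIV_isCont)

lemma Ck1_SucD: "Ck1 (Suc k) f \<Longrightarrow> Ck1 k f"
  by (induction k arbitrary: f) (auto simp: continuous_on_eq_continuous_at intro: DERIV_isCont)

lemma Ck1_SucI: "(\<And>x. (f has_real_derivative f' x) (at x)) \<Longrightarrow> Ck1 k f' \<Longrightarrow> Ck1 (Suc k) f"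
  by auto

lemma Ck1_const: "Ck1 k (\<lambda>x. c)"
proof (induction k arbitrary: c)
  case (Suc k) then show ?case by (intro Ck1_SucI[of _ "\<lambda>x. 0"]) auto
qed auto

lemma Ck1_ident: "Ck1 k (\<lambda>x. x)"
proof (cases k)
  case (Suc k') then show ?thesis by (auto intro!: exI[of _ "\<lambda>x. 1"] Ck1_const)
qed auto

lemma Ck1_add: "Ck1 k f \<Longrightarrow> Ck1 k g \<Longrightarrow> Ck1 k (\<lambda>x. f x + g x)"
proof (induction k arbitrary: f g)
  case (Suc k)
  then obtain f' g' where "\<And>x. (f has_real_derivative f' x) (at x)" "Ck1 k f'"
    "\<And>x. (g has_real_derivative g' x) (at x)" "Ck1 k g'" by auto
  then show ?case using Suc.IH[of f' g'] by (intro Ck1_SucI[of _ "\<lambda>x. f' x + g' x"]) (auto intro!: derivative_eq_intros)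
qed (auto intro: continuous_intros)

lemma Ck1_mult: "Ck1 k f \<Longrightarrow> Ck1 k g \<Longrightarrow> Ck1 k (\<lambda>x. f x * g x)"
proof (induction k arbitrary: f g)
  case (Suc k)
  then obtain f' g' where d: "\<And>x. (f has_real_derivative f' x) (at x)" "Ck1 k f'"
    "\<And>x. (g has_real_derivative g' x) (at x)" "Ck1 k g'" by auto
  show ?case
  proof (rule Ck1_SucI[of _ "\<lambda>x. f' x * g x + f x * g' x"])
    show "Ck1 k (\<lambda>x. f' x * g x + f x * g' x)"
      using Suc.IH d Suc.prems by (intro Ck1_add Suc.IH d Ck1_SucD[of k f] Ck1_SucD[of k g])
  qed (auto intro!: derivative_eq_intros d)
qed (auto intro: continuous_intros)

lemma Ck1_cmult: "Ck1 k f \<Longrightarrow> Ck1 k (\<lambda>x. c * f x)"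
  by (intro Ck1_mult Ck1_const)

lemma Ck1_minus: "Ck1 k f \<Longrightarrow> Ck1 k (\<lambda>x. - f x)"
  using Ck1_cmult[of k f "-1"] by simp

lemma Ck1_diff: "Ck1 k f \<Longrightarrow> Ck1 k g \<Longrightarrow> Ck1 k (\<lambda>x. f x - g x)"
  using Ck1_add[of k f "\<lambda>x. - g x"] Ck1_minus by simp

lemma Ck1_affine: "Ck1 k f \<Longrightarrow> Ck1 k (\<lambda>x. f (a * x + b))"
proof (induction k arbitrary: f)
  case 0 then show ?case by (auto intro!: continuous_on_compose2[of UNIV f] continuous_intros)
next
  case (Suc k)
  then obtain f' where d: "\<And>x. (f has_real_derivative f' x) (at x)" "Ck1 k f'" by auto
  show ?case
  proof (rule Ck1_SucI[of _ "\<lambda>x. f' (a * x + b) * a"])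
    have "((\<lambda>x. a * x + b) has_real_derivative a) (at x)" for x
      by (auto intro!: derivative_eq_intros)
    from DERIV_chain2[OF d(1) this]
    show "((\<lambda>x. f (a * x + b)) has_real_derivative f' (a * x + b) * a) (at x)" for x .
    show "Ck1 k (\<lambda>x. f' (a * x + b) * a)" by (intro Ck1_mult Ck1_const Suc.IH d)
  qed
qed

lemma Ck1_inverse: "Ck1 k f \<Longrightarrow> (\<And>x. f x \<noteq> 0) \<Longrightarrow> Ck1 k (\<lambda>x. 1 / f x)"
proof (induction k)
  case 0 then show ?case by (auto intro!: continuous_intros)
next
  case (Suc k)
  then obtain f' where d: "\<And>x. (f has_real_derivative f' x) (at x)" "Ck1 k f'" by auto
  have I: "Ck1 k (\<lambda>x. 1 / f x)" by (intro Suc.IH Suc.prems Ck1_SucD)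
  show ?case
  proof (rule Ck1_SucI[of _ "\<lambda>x. - (f' x * (1 / f x * (1 / f x)))"])
    show "((\<lambda>x. 1 / f x) has_real_derivative - (f' x * (1 / f x * (1 / f x)))) (at x)" for x
      using Suc.prems(2) by (auto intro!: derivative_eq_intros d simp: field_simps)
  qed (intro Ck1_minus Ck1_mult d I)
qed

lemma derivative_zero_on_open:
  assumes d: "\<And>x. (f has_real_derivative f' x) (at x)" and z: "\<And>x. x \<in> S \<Longrightarrow> f x = 0" "open S" "x \<in> S"
  shows "f' x = (0::real)"
proof -
  have "\<forall>\<^sub>F y in nhds x. f y = 0"
    using eventually_nhds_in_open[of S x] z by (auto elim!: eventually_mono)
  then have "(f has_real_derivative 0) (at x)"
    by (subst DERIV_cong_ev[OF refl _ refl]) auto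
  then show ?thesis using d(1) DERIV_unique by blast
qed

text \<open>Near the cut both branches are 0 because f vanishes on both sides of c. The derivative
  inherits this property, which closes the induction.\<close>

lemma Ck1_cut:
  assumes "Ck1 k f" "d > 0" "\<And>x. c - d < x \<Longrightarrow> x < c + d \<Longrightarrow> f x = 0"
  shows "Ck1 k (\<lambda>x. if x > c then f x else 0)"
  using assms(1,3)
proof (induction k arbitrary: f)
  have loc: "\<forall>\<^sub>F y in nhds x. (if y > c then f y else 0) = (if x > c then f y else 0)"
    if z: "\<And>x. c - d < x \<Longrightarrow> x < c + d \<Longrightarrow> f x = 0" for f :: "real \<Rightarrow> real" and x
  proof -
    consider "x < c" | "c - d < x" "x < c + d" | "x > c" using assms(2) by fastforce
    then show ?thesis
    proof cases
      case 1 then show ?thesis using eventually_nhds_in_open[of "{..<c}" x] by (auto elim!: eventually_mono)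
    next
      case 2 then show ?thesis using eventually_nhds_in_open[of "{c-d<..<c+d}" x] z by (auto elim!: eventually_mono)
    next
      case 3 then show ?thesis using eventually_nhds_in_open[of "{c<..}" x] by (auto elim!: eventually_mono)
    qed
  qed
  {
    case 0
    then have "isCont f x" for x by (simp add: continuous_on_eq_continuous_at)
    then have "isCont (\<lambda>x. if c < x then f x else 0) x" for x
      using isCont_cong[OF loc[of f x, OF 0(2)]] by (cases "x > c") auto
    then show ?case by (simp add: continuous_on_eq_continuous_at)
  next
    case (Suc k)
    then obtain f' where d: "\<And>x. (f has_real_derivative f' x) (at x)" "Ck1 k f'" by auto
    have z: "f' x = 0" if "c - d < x" "x < c + d" for x
      by (rule derivative_zero_on_open[OF d(1), of "{c-d<..<c+d}"]) (use that Suc.prems(2) in auto)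
    show ?case
    proof (rule Ck1_SucI[of _ "\<lambda>x. if x > c then f' x else 0"])
      show "((\<lambda>x. if c < x then f x else 0) has_real_derivative (if c < x then f' x else 0)) (at x)" for x
        using DERIV_cong_ev[OF refl loc[of f x, OF Suc.prems(2)] refl] d(1)[of x] by (auto split: if_splits)
      show "Ck1 k (\<lambda>x. if c < x then f' x else 0)" by (rule Suc.IH[OF d(2) z])
    qed
  }
qed

text \<open>The factor 1 / x is harmless where f vanishes. The derivative f' / x - (f / x) / x
  consists of quotients of the same shape, so the induction runs over all f.\<close>

lemma Ck1_divide_ident:
  assumes "Ck1 k f" "\<And>x. x < 1 \<Longrightarrow> f x = 0"
  shows "Ck1 k (\<lambda>x. f x / x)"
  using assms
proof (induction k arbitrary: f)
  case 0
  have "isCont (\<lambda>x. f x / x) x" for x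
  proof (cases "x < 1")
    case True
    have "\<forall>\<^sub>F y in nhds x. f y / y = 0"
      using eventually_nhds_in_open[of "{..<1}" x] True 0(2) by (auto elim!: eventually_mono)
    from isCont_cong[OF this] show ?thesis by simp
  next
    case False then show ?thesis using 0(1) by (auto intro!: continuous_intros simp: continuous_on_eq_continuous_at)
  qed
  then show ?case by (auto simp: continuous_on_eq_continuous_at)
next
  case (Suc k)
  then obtain f' where d: "\<And>x. (f has_real_derivative f' x) (at x)" "Ck1 k f'" by auto
  have z: "f' x = 0" if "x < 1" for x
    by (rule derivative_zero_on_open[OF d(1), of "{..<1}"]) (use that Suc.prems(2) in auto)
  show ?case
  proof (rule Ck1_SucI[of _ "\<lambda>x. f' x / x - (f x / x) / x"])
    show "((\<lambda>x. f x / x) has_real_derivative f' x / x - f x / x / x) (at x)" for x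
    proof (cases "x < 1")
      case True
      have "\<forall>\<^sub>F y in nhds x. f y / y = 0"
        using eventually_nhds_in_open[of "{..<1}" x] True Suc.prems(2) by (auto elim!: eventually_mono)
      from iffD2[OF DERIV_cong_ev[OF refl this refl] DERIV_const]
      have "((\<lambda>x. f x / x) has_real_derivative 0) (at x)" .
      then show ?thesis using True Suc.prems(2) z by simp
    next
      case False then show ?thesis by (auto intro!: derivative_eq_intros d simp: field_simps)
    qed
    show "Ck1 k (\<lambda>x. f' x / x - f x / x / x)"
      using Suc.prems z by (intro Ck1_diff Suc.IH d Ck1_SucD[of k f]) auto
  qed
qed

lemma Ck1_antiderivative:
  assumes "\<And>k. Ck1 k f" "\<And>x. (F has_real_derivative f x) (at x)"
  shows "Ck1 k F"
  by (cases k) (use assms in \<open>auto simp: continuous_on_eq_continuous_at intro: DERIV_isCont\<close>)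

definition flat :: "real poly \<Rightarrow> real \<Rightarrow> real" where
  "flat p x = (if x > 0 then poly p (1 / x) * exp (- (1 / x)) else 0)"

lemma flat_tendsto: "(flat p \<longlongrightarrow> 0) (at 0)"
proof -
  have 1: "((\<lambda>x. poly p x / exp x) \<longlongrightarrow> 0) at_top"
  proof -
    have "((\<lambda>x. \<Sum>i\<le>degree p. coeff p i * (x ^ i / exp x)) \<longlongrightarrow> (\<Sum>i\<le>degree p. coeff p i * 0)) at_top"
      by (intro tendsto_sum tendsto_mult tendsto_const tendsto_power_div_exp_0)
    then show ?thesis by (simp add: poly_altdef sum_divide_distrib)
  qed
  have "((\<lambda>x. poly p (inverse x) / exp (inverse x)) \<longlongrightarrow> 0) (at_right 0)"
    by (rule filterlim_compose[OF 1 filterlim_inverse_at_top_right])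
  then have "(flat p \<longlongrightarrow> 0) (at_right 0)"
  proof (rule Lim_transform_eventually)
    show "\<forall>\<^sub>F x in at_right 0. poly p (inverse x) / exp (inverse x) = flat p x"
      using eventually_at_right_less[of "0::real"] by eventually_elim (simp add: flat_def exp_minus inverse_eq_divide)
  qed
  moreover have "(flat p \<longlongrightarrow> 0) (at_left 0)"
  proof (rule Lim_transform_eventually[OF tendsto_const])
    show "\<forall>\<^sub>F x in at_left 0. 0 = flat p x"
      using eventually_at_left_real[of "-1" "0::real"] by (auto simp: flat_def elim!: eventually_mono)
  qed
  ultimately show ?thesis by (simp add: filterlim_at_split)
qed

text \<open>With t = 1 / x the chain rule gives t^2 (p(t) - p'(t)) exp(-t), and
  \<open>[:0,0,1:]\<close> is t^2.\<close>

lemma flat_deriv: "(flat p has_real_derivative flat ([:0,0,1:] * (p - pderiv p)) x) (at x)"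
proof -
  consider "x < 0" | "x > 0" | "x = 0" by linarith
  then show ?thesis
  proof cases
    case 1
    have "\<forall>\<^sub>F y in nhds x. flat p y = 0"
      using eventually_nhds_in_open[of "{..<0}" x] 1 by (auto simp: flat_def elim!: eventually_mono)
    then have "(flat p has_real_derivative 0) (at x)" by (subst DERIV_cong_ev[OF refl _ refl]) auto
    then show ?thesis using 1 by (simp add: flat_def)
  next
    case 2
    have "\<forall>\<^sub>F y in nhds x. flat p y = poly p (1 / y) * exp (- (1 / y))"
      using eventually_nhds_in_open[of "{0<..}" x] 2 by (auto simp: flat_def elim!: eventually_mono)
    moreover have "((\<lambda>y. poly p (1 / y) * exp (- (1 / y))) has_real_derivative
        poly (pderiv p) (1 / x) * (- (1 / x\<^sup>2)) * exp (- (1 / x)) + exp (- (1 / x)) * (1 / x\<^sup>2) * poly p (1 / x)) (at x)"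
      using 2 by (auto intro!: derivative_eq_intros DERIV_chain2[OF poly_DERIV] simp: power2_eq_square field_simps)
    ultimately have "(flat p has_real_derivative
        poly (pderiv p) (1 / x) * (- (1 / x\<^sup>2)) * exp (- (1 / x)) + exp (- (1 / x)) * (1 / x\<^sup>2) * poly p (1 / x)) (at x)"
      by (subst DERIV_cong_ev[OF refl _ refl])
    then show ?thesis using 2
      by (elim DERIV_cong) (simp add: flat_def power2_eq_square divide_simps algebra_simps)
  next
    case 3
    \<comment> \<open>The difference quotient at 0 is again in the family, with one more factor 1 /
      h.\<close>
    have "((\<lambda>h. flat ([:0,1:] * p) h) \<longlongrightarrow> 0) (at 0)" by (rule flat_tendsto)
    then have "((\<lambda>h. (flat p (0 + h) - flat p 0) / h) \<longlongrightarrow> 0) (at 0)"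
      by (rule Lim_transform_eventually) (auto simp: flat_def eventually_at_filter)
    then show ?thesis using 3 by (simp add: DERIV_def flat_def)
  qed
qed

lemma Ck1_flat: "Ck1 k (flat p)"
  by (induction k arbitrary: p)
    (auto simp: continuous_on_eq_continuous_at intro!: exI flat_deriv DERIV_isCont[OF flat_deriv])

text \<open>The standard quotient a / (a + b), where a vanishes for x \<le> 1 and b for x \<ge> 2;
  the two are never zero together.\<close>

lemma smooth_step_exists:
  obtains h :: "real \<Rightarrow> real" where "\<And>k. Ck1 k h" "\<And>x. x \<le> 1 \<Longrightarrow> h x = 0" "\<And>x. x \<ge> 2 \<Longrightarrow> h x = 1"
    "\<And>x. 0 \<le> h x" "\<And>x. h x \<le> 1"
proof
  let ?a = "\<lambda>x. flat 1 (1 * x + (- 1))" and ?b = "\<lambda>x. flat 1 ((- 1) * x + 2)"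
  let ?h = "\<lambda>x. ?a x * (1 / (?a x + ?b x))"
  have nn: "flat 1 x \<ge> 0" "x > 0 \<Longrightarrow> flat 1 x > 0" for x by (auto simp: flat_def)
  have pos: "?a x + ?b x > 0" for x
    using nn(1)[of "x - 1"] nn(1)[of "2 - x"] nn(2)[of "x - 1"] nn(2)[of "2 - x"] by (cases "x > 1") auto
  show "Ck1 k ?h" for k
    using pos by (intro Ck1_mult Ck1_inverse Ck1_add Ck1_affine Ck1_flat) (metis less_irrefl)
  show "x \<le> 1 \<Longrightarrow> ?h x = 0" for x by (simp add: flat_def)
  show "x \<ge> 2 \<Longrightarrow> ?h x = 1" for x using pos[of x] by (simp add: flat_def)
  show "0 \<le> ?h x" "?h x \<le> 1" for x
    using pos[of x] nn(1)[of "x - 1"] nn(1)[of "2 - x"] by (auto simp: divide_simps)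
qed

section \<open>Calculus of \<open>C_k\<close> functions on three-dimensional space and of their
  radial profiles\<close>

lemma C_k_SucD: "C_k (Suc k) f \<Longrightarrow> C_k k f"
  by (induction k arbitrary: f) (auto simp: continuous_on_eq_continuous_at intro: differentiable_imp_continuous_within)

lemma C_k_SucI:
  assumes "\<And>x. (f has_derivative D x) (at x)" "\<And>i. C_k k (\<lambda>x. D x (axis i 1))"
  shows "C_k (Suc k) f"
proof -
  have "frechet_derivative f (at x) = D x" for x
    using frechet_derivative_at[OF assms(1)] by simp
  then show ?thesis using assms by (auto simp: differentiable_def)
qed

lemma C_k_SucE:
  assumes "C_k (Suc k) f"
  shows "\<exists>D. (\<forall>x. (f has_derivative D x) (at x)) \<and> (\<forall>i. C_k k (\<lambda>x. D x (axis i 1)))"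
  by (rule exI[of _ "\<lambda>x. frechet_derivative f (at x)"]) (use assms in \<open>simp add: frechet_derivative_works\<close>)

lemma C_k_const: "C_k k (\<lambda>x. c)"
proof (induction k arbitrary: c)
  case (Suc k) then show ?case by (intro C_k_SucI[where D="\<lambda>x h. 0"]) auto
qed auto

lemma C_k_add: "C_k k f \<Longrightarrow> C_k k g \<Longrightarrow> C_k k (\<lambda>x. f x + g x)"
proof (induction k arbitrary: f g)
  case (Suc k)
  obtain D where D: "\<And>x. (f has_derivative D x) (at x)" "\<And>i. C_k k (\<lambda>x. D x (axis i 1))"
    using C_k_SucE[OF Suc.prems(1)] by blast
  obtain E where E: "\<And>x. (g has_derivative E x) (at x)" "\<And>i. C_k k (\<lambda>x. E x (axis i 1))"
    using C_k_SucE[OF Suc.prems(2)] by blast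
  show ?case
    by (rule C_k_SucI[where D="\<lambda>x h. D x h + E x h"]) (intro has_derivative_add Suc.IH D E)+
qed (auto intro: continuous_intros)

lemma C_k_mult: "C_k k f \<Longrightarrow> C_k k g \<Longrightarrow> C_k k (\<lambda>x. f x * g x)"
proof (induction k arbitrary: f g)
  case (Suc k)
  obtain D where D: "\<And>x. (f has_derivative D x) (at x)" "\<And>i. C_k k (\<lambda>x. D x (axis i 1))"
    using C_k_SucE[OF Suc.prems(1)] by blast
  obtain E where E: "\<And>x. (g has_derivative E x) (at x)" "\<And>i. C_k k (\<lambda>x. E x (axis i 1))"
    using C_k_SucE[OF Suc.prems(2)] by blast
  show ?case
  proof (rule C_k_SucI[where D="\<lambda>x h. f x * E x h + D x h * g x"])
    show "((\<lambda>x. f x * g x) has_derivative (\<lambda>h. f x * E x h + D x h * g x)) (at x)" for x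
      by (rule has_derivative_mult[OF D(1) E(1)])
    show "C_k k (\<lambda>x. f x * E x (axis i 1) + D x (axis i 1) * g x)" for i
      using Suc.prems by (intro C_k_add Suc.IH D E C_k_SucD[of k f] C_k_SucD[of k g])
  qed
qed (auto intro: continuous_intros)

lemma C_k_component: "C_k k (\<lambda>x. x $ i)"
proof (cases k)
  case (Suc k')
  have "((\<lambda>x. x $ i) has_derivative (\<lambda>h. h $ i)) (at x)" for x :: "real ^ 3"
    by (intro bounded_linear_imp_has_derivative bounded_linear_vec_nth)
  then show ?thesis unfolding Suc by (rule C_k_SucI) (rule C_k_const)
qed (auto intro!: continuous_intros)

text \<open>The i-th partial derivative is (g'(r) / r) times the i-th coordinate. Since g' vanishes
  for r < 1, division by r stays in the class and the induction hypothesis applies to g'(r) / r; the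
  same vanishing hides the singularity of the norm at the origin.\<close>

lemma C_k_radial:
  assumes "Ck1 k g" "\<And>r. r < 1 \<Longrightarrow> g r = 0"
  shows "C_k k (\<lambda>x. g (norm x))"
  using assms
proof (induction k arbitrary: g)
  case 0 then show ?case by (auto intro!: continuous_on_compose2[of UNIV g] continuous_intros)
next
  case (Suc k)
  then obtain g' where d: "\<And>x. (g has_real_derivative g' x) (at x)" "Ck1 k g'" by auto
  have z: "g' x = 0" if "x < 1" for x
    by (rule derivative_zero_on_open[OF d(1), of "{..<1}"]) (use that Suc.prems(2) in auto)
  show ?case
  proof (rule C_k_SucI[where D="\<lambda>x h. (g' (norm x) / norm x) * (x \<bullet> h)"])
    fix x :: "real ^ 3"
    show "((\<lambda>x. g (norm x)) has_derivative (\<lambda>h. (g' (norm x) / norm x) * (x \<bullet> h))) (at x)"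
    proof (cases "x = 0")
      case True
      have "\<forall>\<^sub>F y in nhds x. 0 = g (norm y)"
        using eventually_nhds_in_open[of "ball 0 1" x] True Suc.prems(2) by (auto elim!: eventually_mono)
      moreover have "((\<lambda>x. 0) has_derivative (\<lambda>h. (g' (norm x) / norm x) * (x \<bullet> h))) (at x)"
        using True by simp
      ultimately show ?thesis
        using has_derivative_transform_eventually[of "\<lambda>x. 0" _ x UNIV "\<lambda>x. g (norm x)"]
        by (simp add: eventually_nhds_conv_at)
    next
      case False
      have "((\<lambda>x. g (norm x)) has_derivative (\<lambda>h. g' (norm x) * (h \<bullet> sgn x))) (at x)"
        using has_derivative_compose[OF has_derivative_norm[OF False], of g "(*) (g' (norm x))"] d(1)[of "norm x"]
        by (simp add: has_field_derivative_def)
      then show ?thesis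
        by (rule has_derivative_eq_rhs) (auto simp: sgn_div_norm inner_commute fun_eq_iff divide_inverse)
    qed
  next
    fix i
    have "C_k k (\<lambda>x. g' (norm x) / norm x)"
      using Suc.IH[of "\<lambda>r. g' r / r"] Ck1_divide_ident[OF d(2) z] z by simp
    then have "C_k k (\<lambda>x. g' (norm x) / norm x * x $ i)" by (intro C_k_mult C_k_component)
    then show "C_k k (\<lambda>x. g' (norm x) / norm x * (x \<bullet> axis i 1))"
      by (simp add: inner_axis)
  qed
qed

lemma Ck1_profile:
  assumes "C_k k f" shows "Ck1 k (profile f)"
  using assms
proof (induction k arbitrary: f)
  case 0 then show ?case
    by (auto simp: profile_def[abs_def] intro!: continuous_on_compose2[of UNIV f] continuous_intros)
next
  case (Suc k)
  obtain D where d: "\<And>x. (f has_derivative D x) (at x)" "\<And>i. C_k k (\<lambda>x. D x (axis i 1))"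
    using C_k_SucE[OF Suc.prems] by blast
  show ?case
  proof (rule Ck1_SucI[of _ "profile (\<lambda>x. D x (axis 1 1))"])
    fix r :: real
    have "((\<lambda>r. f (r *\<^sub>R axis 1 1)) has_derivative (\<lambda>h. D (r *\<^sub>R axis 1 1) (h *\<^sub>R axis 1 1))) (at r)"
      by (rule has_derivative_compose[OF _ d(1)]) (intro bounded_linear_imp_has_derivative bounded_linear_scaleR_left)
    moreover have "D (r *\<^sub>R axis 1 1) (h *\<^sub>R axis 1 1) = D (r *\<^sub>R axis 1 1) (axis 1 1) * h" for h
      by (simp add: linear_scale[OF has_derivative_linear[OF d(1)[of "r *\<^sub>R axis 1 1"]]])
    ultimately show "(profile f has_real_derivative profile (\<lambda>x. D x (axis 1 1)) r) (at r)"
      by (simp add: has_field_derivative_def profile_def[abs_def])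
  qed (intro Suc.IH d)
qed

section \<open>Radial test functions on the exterior domain as bumps on the half-line; polar
  coordinates\<close>

definition bumps :: "(real \<Rightarrow> real) set" where
  "bumps = {w. (\<forall>k. Ck1 k w) \<and> (\<exists>d>0. \<exists>M. \<forall>y. y < d \<or> y > M \<longrightarrow> w y = 0)}"

text \<open>Inverse of the substitution w(y) = (1 + y) f(1 + y). For a bump the value in the closed
  unit ball is 0, since w vanishes for y \<le> 0.\<close>

definition tf :: "(real \<Rightarrow> real) \<Rightarrow> real ^ 3 \<Rightarrow> real" where
  "tf w x = w (norm x - 1) / norm x"

lemma bumps_add: "v \<in> bumps \<Longrightarrow> w \<in> bumps \<Longrightarrow> (\<lambda>y. v y + w y) \<in> bumps"
proof -
  assume a: "v \<in> bumps" "w \<in> bumps"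
  from a obtain d1 d2 M1 M2 where "d1 > 0" "\<And>y. y < d1 \<or> y > M1 \<Longrightarrow> v y = 0"
    "d2 > 0" "\<And>y. y < d2 \<or> y > M2 \<Longrightarrow> w y = 0" unfolding bumps_def by blast
  then have "min d1 d2 > 0" "\<forall>y. y < min d1 d2 \<or> y > max M1 M2 \<longrightarrow> v y + w y = 0" by auto
  then show ?thesis using a unfolding bumps_def by (blast intro: Ck1_add)
qed

lemma bumps_cmult: "w \<in> bumps \<Longrightarrow> (\<lambda>y. c * w y) \<in> bumps"
  unfolding bumps_def by (auto intro!: Ck1_cmult)

lemma bumps_diff: "v \<in> bumps \<Longrightarrow> w \<in> bumps \<Longrightarrow> (\<lambda>y. v y - w y) \<in> bumps"
  using bumps_add[of v "\<lambda>y. (- 1) * w y"] bumps_cmult[of w "- 1"] by simp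

lemma radial_tf: "radial (tf w)"
  by (simp add: radial_def tf_def)

lemma tf_test_function:
  assumes "w \<in> bumps" shows "tf w \<in> test_functions"
proof -
  obtain d M where w: "\<And>k. Ck1 k w" and d: "d > 0" and z: "\<And>y. y < d \<or> y > M \<Longrightarrow> w y = 0"
    using assms unfolding bumps_def by blast
  have "C_k k (tf w)" for k
    unfolding tf_def
  proof (rule C_k_radial)
    have "Ck1 k (\<lambda>r. w (1 * r + (- 1)))" by (rule Ck1_affine[OF w])
    then show "Ck1 k (\<lambda>r. w (r - 1) / r)" using z d by (intro Ck1_divide_ident) auto
    show "\<And>r. r < 1 \<Longrightarrow> w (r - 1) / r = 0" using z d by auto
  qed
  moreover
  let ?K = "{x::real^3. 1 + d \<le> norm x \<and> norm x \<le> 1 + M}"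
  have K: "closed ?K" by (intro closed_Collect_conj closed_Collect_le continuous_intros)
  have sub: "closure {x. tf w x \<noteq> 0} \<subseteq> ?K"
  proof (rule closure_minimal[OF _ K], safe)
    fix x assume "tf w x \<noteq> 0"
    then have "\<not> (norm x - 1 < d \<or> norm x - 1 > M)" using z[of "norm x - 1"] by (auto simp: tf_def)
    then show "1 + d \<le> norm x" "norm x \<le> 1 + M" by auto
  qed
  moreover have "?K \<subseteq> Omega" using d by (auto simp: Omega_def)
  moreover have "bounded ?K" by (rule bounded_subset[of "cball 0 (1 + M)"]) auto
  ultimately show ?thesis unfolding test_functions_def
    by (auto simp: compact_eq_bounded_closed intro: bounded_subset)
qed

text \<open>Compactness of the support inside the open set \<open>Omega\<close> yields a gap d to
  the unit sphere, which becomes the vanishing of w near 0.\<close>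

lemma test_function_tf:
  assumes "f \<in> test_functions" "radial f"
  obtains w where "w \<in> bumps" "f = tf w"
proof -
  define K where "K = closure {x. f x \<noteq> 0}"
  have K: "compact K" "K \<subseteq> Omega" and Ck: "\<And>k. C_k k f" using assms by (auto simp: test_functions_def K_def)
  have zK: "x \<notin> K \<Longrightarrow> f x = 0" for x using closure_subset[of "{x. f x \<noteq> 0}"] by (auto simp: K_def)
  have "\<exists>d>0. \<forall>x\<in>K. norm x \<ge> 1 + d"
  proof (cases "K = {}")
    case False
    have "continuous_on K norm" by (intro continuous_intros)
    then obtain x where x: "x \<in> K" "\<forall>y\<in>K. norm x \<le> norm y"
      using continuous_attains_inf[OF K(1) False, of norm] by blast
    then have "norm x > 1" using K(2) by (auto simp: Omega_def)
    then show ?thesis using x by (intro exI[of _ "norm x - 1"]) simp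
  next
    case True then show ?thesis by (intro exI[of _ 1]) simp
  qed
  then obtain d where d: "d > 0" "\<And>x. x \<in> K \<Longrightarrow> norm x \<ge> 1 + d" by blast
  obtain M where M: "\<And>x. x \<in> K \<Longrightarrow> norm x \<le> M" using compact_imp_bounded[OF K(1)] unfolding bounded_iff by blast
  have pf: "f x = profile f (norm x)" for x
    unfolding profile_def by (rule assms(2)[unfolded radial_def, rule_format]) simp
  have z: "profile f r = 0" if "\<bar>r\<bar> < 1 + d \<or> \<bar>r\<bar> > M" for r
  proof -
    have "r *\<^sub>R axis 1 1 \<notin> K" using d(2)[of "r *\<^sub>R axis 1 1"] M[of "r *\<^sub>R axis 1 1"] that by auto
    then show ?thesis by (simp add: profile_def zK)
  qed
  \<comment> \<open>The profile of a radial function is even in r. Without the cut its mirror image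
    would reappear for y < -2, where a bump has to vanish.\<close>
  define w where "w y = (if y > 0 then (y + 1) * profile f (y + 1) else 0)" for y
  have wz: "w y = 0" if "y < d \<or> y > M" for y
    using z[of "y + 1"] that by (auto simp: w_def)
  have "Ck1 k w" for k
    unfolding w_def
  proof (rule Ck1_cut)
    show "Ck1 k (\<lambda>y. (y + 1) * profile f (y + 1))"
      using Ck1_affine[OF Ck1_profile[OF Ck], of k 1 1] by (intro Ck1_mult Ck1_add Ck1_ident Ck1_const) simp
    show "min d 1 > 0" using d by simp
    show "(y + 1) * profile f (y + 1) = 0" if "0 - min d 1 < y" "y < 0 + min d 1" for y
      using z[of "y + 1"] that by auto
  qed
  then have "w \<in> bumps" using wz d(1) unfolding bumps_def by blast
  moreover have "f x = tf w x" for x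
  proof (cases "norm x > 1")
    case True
    then have "x \<noteq> 0" by auto
    then show ?thesis using True pf[of x] by (simp add: tf_def w_def)
  next
    case False then show ?thesis using zK[of x] d(2)[of x] d(1) by (auto simp: tf_def w_def)
  qed
  ultimately show thesis using that by blast
qed

text \<open>Polar coordinates for radial integrands, derived from the volume of balls: both measures
  assign 4/3 pi a^3 to {..a} for a \<ge> 0, and these rays form a generator stable under
  intersection.\<close>

lemma distr_norm: "distr lborel borel (norm :: real ^ 3 \<Rightarrow> real)
   = density lborel (\<lambda>r. ennreal (4 * pi * r\<^sup>2) * indicator {0<..} r)"
proof (rule measure_eqI_generator_eq[where E="range atMost" and \<Omega>=UNIV and A="\<lambda>n. {..real n}"])
  show "Int_stable (range (atMost :: real \<Rightarrow> _))"
    by (auto simp: Int_stable_def intro!: image_eqI[where x="min _ _"])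
  show "sets (distr lborel borel norm) = sigma_sets UNIV (range (atMost :: real \<Rightarrow> _))"
    by (simp add: borel_eq_atMost)
  show "sets (density lborel (\<lambda>r. ennreal (4 * pi * r\<^sup>2) * indicator {0<..} r)) = sigma_sets UNIV (range (atMost :: real \<Rightarrow> _))"
    by (simp add: borel_eq_atMost)
  have n: "emeasure (distr lborel borel (norm :: real ^ 3 \<Rightarrow> real)) {..a} = (if a \<ge> 0 then ennreal (4/3 * pi * a ^ 3) else 0)" for a
  proof -
    have "emeasure (distr lborel borel (norm :: real ^ 3 \<Rightarrow> real)) {..a} = emeasure lborel (cball (0 :: real ^ 3) a)"
      by (subst emeasure_distr) (auto intro!: arg_cong[where f="emeasure lborel"])
    then show ?thesis by (auto simp: emeasure_cball unit_ball_vol_3)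
  qed
  have d: "emeasure (density lborel (\<lambda>r. ennreal (4 * pi * r\<^sup>2) * indicator {0<..} r)) {..a} = (if a \<ge> 0 then ennreal (4/3 * pi * a ^ 3) else 0)" for a
  proof (cases "a \<ge> 0")
    case True
    have "emeasure (density lborel (\<lambda>r. ennreal (4 * pi * r\<^sup>2) * indicator {0<..} r)) {..a}
      = (\<integral>\<^sup>+r. ennreal (4 * pi * r\<^sup>2) * indicator {0..a} r \<partial>lborel)"
      using AE_lborel_singleton[of "0::real"]
      by (subst emeasure_density) (auto intro!: nn_integral_cong_AE split: split_indicator)
    also have "\<dots> = ennreal (4/3 * pi * a ^ 3 - 4/3 * pi * 0 ^ 3)"
      by (rule nn_integral_FTC_Icc[where F="\<lambda>a. 4/3 * pi * a ^ 3"]) (use True in \<open>auto intro!: derivative_eq_intros\<close>)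
    finally show ?thesis using True by simp
  next
    case False
    then show ?thesis by (subst emeasure_density) (auto intro!: nn_integral_zero' split: split_indicator)
  qed
  show "X \<in> range (atMost :: real \<Rightarrow> _) \<Longrightarrow> emeasure (distr lborel borel (norm :: real ^ 3 \<Rightarrow> real)) X =
      emeasure (density lborel (\<lambda>r. ennreal (4 * pi * r\<^sup>2) * indicator {0<..} r)) X" for X
    using n d by auto
  show "emeasure (distr lborel borel (norm :: real ^ 3 \<Rightarrow> real)) {..real n} \<noteq> \<infinity>" for n :: nat using n by simp
  show "(\<Union>i. {..real i}) = UNIV" using real_arch_simple by blast
qed auto

lemma sets_Omega [measurable]: "Omega \<in> sets borel"
  by (simp add: Omega_def borel_open)

lemma nn_integral_Omega_radial:
  assumes [measurable]: "g \<in> borel_measurable borel"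
  shows "(\<integral>\<^sup>+x. g (norm x) \<partial>restrict_space lborel Omega) = (\<integral>\<^sup>+y. ennreal (4 * pi * (1 + y)\<^sup>2) * g (1 + y) \<partial>hl)"
proof -
  have "(\<integral>\<^sup>+x. g (norm x) \<partial>restrict_space lborel Omega) = (\<integral>\<^sup>+x. g (norm x) * indicator Omega x \<partial>lborel)"
    by (subst nn_integral_restrict_space) auto
  also have "\<dots> = (\<integral>\<^sup>+x. (\<lambda>r. g r * indicator {1<..} r) (norm (x :: real ^ 3)) \<partial>lborel)"
    by (rule nn_integral_cong) (auto simp: Omega_def split: split_indicator)
  also have "\<dots> = (\<integral>\<^sup>+r. g r * indicator {1<..} r \<partial>distr lborel borel (norm :: real ^ 3 \<Rightarrow> real))"
    by (subst nn_integral_distr) auto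
  also have "\<dots> = (\<integral>\<^sup>+r. ennreal (4 * pi * r\<^sup>2) * g r * indicator {1<..} r \<partial>lborel)"
    unfolding distr_norm by (subst nn_integral_density) (auto intro!: nn_integral_cong split: split_indicator)
  also have "\<dots> = (\<integral>\<^sup>+y. ennreal (4 * pi * (1 + y)\<^sup>2) * g (1 + y) * indicator {0<..} y \<partial>lborel)"
    by (subst nn_integral_real_affine[where c=1 and t=1]) (auto intro!: nn_integral_cong split: split_indicator)
  finally show ?thesis by (simp add: nn_integral_hl)
qed

section \<open>The sine transform and the Sobolev norms\<close>

lemma compact_support_bounded:
  fixes f :: "real \<Rightarrow> real"
  assumes c: "continuous_on UNIV f" and z: "\<And>y. y > M \<Longrightarrow> f y = 0"
  obtains B where "B \<ge> 0" "\<And>y. y \<ge> 0 \<Longrightarrow> \<bar>f y\<bar> \<le> B"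
proof -
  have "compact (f ` {0..M})" by (intro compact_continuous_image continuous_on_subset[OF c]) auto
  from compact_imp_bounded[OF this] obtain B where B: "\<forall>y\<in>{0..M}. \<bar>f y\<bar> \<le> B"
    unfolding bounded_iff by auto
  have "\<bar>f y\<bar> \<le> max B 0" if "y \<ge> 0" for y
    using bspec[OF B, of y] z[of y] that by (cases "y > M") auto
  then show thesis using that[of "max B 0"] by simp
qed

lemma compact_support_integrable:
  fixes f :: "real \<Rightarrow> real"
  assumes c: "continuous_on UNIV f" and z: "\<And>y. y > M \<Longrightarrow> f y = 0"
  shows "integrable hl f"
proof -
  have "set_integrable lborel {0..M} f"
    by (rule borel_integrable_atLeastAtMost') (rule continuous_on_subset[OF c], simp)
  then have "set_integrable lborel {0<..M} f"
    by (rule set_integrable_subset) auto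
  then have "set_integrable lborel {0<..} f"
    unfolding set_integrable_def
    by (rule Bochner_Integration.integrable_cong[THEN iffD1, rotated 2])
       (use z in \<open>auto split: split_indicator\<close>)
  then show ?thesis by (simp add: integrable_hl_iff)
qed

lemma compact_support_FTC:
  fixes F f :: "real \<Rightarrow> real"
  assumes c: "continuous_on UNIV f" and d: "\<And>x. (F has_real_derivative f x) (at x)"
    and z: "\<And>y. y > M \<Longrightarrow> F y = 0"
  shows "integrable hl f" "(\<integral>y. f y \<partial>hl) = - F 0"
proof -
  have fz: "f y = 0" if "y > M" for y
    by (rule derivative_zero_on_open[OF d, of "{M<..}"]) (use that z in auto)
  show "integrable hl f" by (rule compact_support_integrable[OF c fz])
  define K where "K = max M 0 + 1"
  have "(\<integral>y. f y \<partial>hl) = (LBINT y:{0..K}. f y)"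
    unfolding integral_hl set_lebesgue_integral_def
  proof (rule integral_cong_AE)
    show "AE x in lborel. indicator {0<..} x *\<^sub>R f x = indicator {0..K} x *\<^sub>R f x"
      using AE_lborel_singleton[of "0::real"] by eventually_elim (use fz in \<open>auto simp: K_def split: split_indicator\<close>)
  qed (use c borel_measurable_continuous_onI[OF c] in auto)
  also have "\<dots> = F K - F 0"
    unfolding set_lebesgue_integral_def real_scaleR_def
    by (subst mult.commute, rule integral_FTC_Icc_real)
       (use d c in \<open>auto simp: K_def continuous_on_eq_continuous_at\<close>)
  finally show "(\<integral>y. f y \<partial>hl) = - F 0" using z[of K] by (simp add: K_def)
qed

text \<open>Regularity that survives the flow: two continuous derivatives and the Dirichlet
  condition at 0, without vanishing near 0. The support is bounded on the right only, since the
  transform integrates over the positive half-line.\<close>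

definition nice :: "(real \<Rightarrow> real) \<Rightarrow> bool" where
  "nice e \<longleftrightarrow> Ck1 2 e \<and> e 0 = 0 \<and> (\<exists>M. \<forall>y>M. e y = 0)"

definition ST :: "(real \<Rightarrow> real) \<Rightarrow> real \<Rightarrow> real" where
  "ST e l = sqrt (2 / pi) * (\<integral>y. sin (l * y) * e y \<partial>hl)"

definition derivs2 :: "(real \<Rightarrow> real) \<Rightarrow> (real \<Rightarrow> real) \<Rightarrow> (real \<Rightarrow> real) \<Rightarrow> real \<Rightarrow> bool" where
  "derivs2 e e' e'' M \<longleftrightarrow> e 0 = 0 \<and>
    (\<forall>x. (e has_real_derivative e' x) (at x)) \<and> (\<forall>x. (e' has_real_derivative e'' x) (at x)) \<and>
    continuous_on UNIV e \<and> continuous_on UNIV e' \<and> continuous_on UNIV e'' \<and>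
    (\<forall>y>M. e y = 0) \<and> (\<forall>y>M. e' y = 0) \<and> (\<forall>y>M. e'' y = 0)"

lemma nice_derivs2:
  assumes "nice e"
  obtains e' e'' M where "derivs2 e e' e'' M"
proof -
  from assms obtain M where M: "\<And>y. y > M \<Longrightarrow> e y = 0" by (auto simp: nice_def)
  from assms obtain e' e'' where d: "\<And>x. (e has_real_derivative e' x) (at x)"
     "\<And>x. (e' has_real_derivative e'' x) (at x)" "continuous_on UNIV e''"
    by (auto simp: nice_def numeral_2_eq_2)
  have c: "continuous_on UNIV e" "continuous_on UNIV e'"
    using d by (auto simp: continuous_on_eq_continuous_at intro: DERIV_isCont)
  have z: "e' y = 0" if "y > M" for y
    by (rule derivative_zero_on_open[OF d(1), of "{M<..}"]) (use that M in auto)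
  have z2: "e'' y = 0" if "y > M" for y
    by (rule derivative_zero_on_open[OF d(2), of "{M<..}"]) (use that z in auto)
  have "e 0 = 0" using assms by (simp add: nice_def)
  then have "derivs2 e e' e'' M" using d c M z z2 by (simp add: derivs2_def)
  then show thesis by (rule that)
qed

lemma nice_add:
  assumes "nice e" "nice f" shows "nice (\<lambda>y. e y + f y)"
proof -
  from assms obtain M N where "\<forall>y>M. e y = 0" "\<forall>y>N. f y = 0" unfolding nice_def by blast
  then have "\<forall>y > max M N. e y + f y = 0" by simp
  moreover have "Ck1 2 (\<lambda>y. e y + f y)" "e 0 + f 0 = 0" using assms by (auto simp: nice_def intro: Ck1_add)
  ultimately show ?thesis unfolding nice_def by blast
qed

lemma nice_cmult:
  assumes "nice e" shows "nice (\<lambda>y. c * e y)"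
proof -
  from assms obtain M where "\<forall>y>M. e y = 0" unfolding nice_def by blast
  then have "\<forall>y > M. c * e y = 0" by simp
  moreover have "Ck1 2 (\<lambda>y. c * e y)" "c * e 0 = 0" using assms by (auto simp: nice_def intro: Ck1_cmult)
  ultimately show ?thesis unfolding nice_def by blast
qed

lemma nice_diff: "nice e \<Longrightarrow> nice f \<Longrightarrow> nice (\<lambda>y. e y - f y)"
  using nice_add[of e "\<lambda>y. (- 1) * f y"] nice_cmult[of f "- 1"] by simp

lemma bumps_nice: "w \<in> bumps \<Longrightarrow> nice w"
  unfolding bumps_def nice_def by blast

lemma nice_integrable:
  assumes "nice e" shows "integrable hl e" "integrable hl (\<lambda>y. sin (l * y) * e y)"
proof -
  obtain e' e'' M where e: "derivs2 e e' e'' M" by (rule nice_derivs2[OF assms])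
  show "integrable hl e" "integrable hl (\<lambda>y. sin (l * y) * e y)"
    by (rule compact_support_integrable[where M=M]; use e[unfolded derivs2_def] in \<open>auto intro!: continuous_intros\<close>)+
qed

lemma ST_diff: "nice e \<Longrightarrow> nice f \<Longrightarrow> ST (\<lambda>y. e y - f y) l = ST e l - ST f l"
  using nice_integrable(2)[of e l] nice_integrable(2)[of f l]
  by (simp add: ST_def right_diff_distrib)

lemma ST_add: "nice e \<Longrightarrow> nice f \<Longrightarrow> ST (\<lambda>y. e y + f y) l = ST e l + ST f l"
  using nice_integrable(2)[of e l] nice_integrable(2)[of f l]
  by (simp add: ST_def distrib_left)

lemma ST_cmult: "ST (\<lambda>y. c * e y) l = c * ST e l"
proof -
  have "(\<integral>y. sin (l * y) * (c * e y) \<partial>hl) = (\<integral>y. c * (sin (l * y) * e y) \<partial>hl)" by (simp add: mult.left_commute)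
  then show ?thesis by (simp add: ST_def)
qed

lemma integral_hl_abs_sin_le:
  assumes "integrable hl f"
  shows "\<bar>\<integral>y. sin (l * y) * f y \<partial>hl\<bar> \<le> (\<integral>y. \<bar>f y\<bar> \<partial>hl)"
proof -
  have [measurable]: "f \<in> borel_measurable hl" "(\<lambda>y. sin (l * y)) \<in> borel_measurable hl"
    using assms by (auto intro!: borel_measurable_hlI)
  have i: "integrable hl (\<lambda>y. sin (l * y) * f y)"
    by (rule Bochner_Integration.integrable_bound[OF assms]) (simp_all add: abs_mult mult_left_le_one_le)
  have "\<bar>\<integral>y. sin (l * y) * f y \<partial>hl\<bar> \<le> (\<integral>y. \<bar>sin (l * y) * f y\<bar> \<partial>hl)" by (rule integral_abs_bound)
  also have "\<dots> \<le> (\<integral>y. \<bar>f y\<bar> \<partial>hl)"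
    by (rule integral_mono[OF integrable_abs[OF i] integrable_abs[OF assms]]) (simp add: abs_mult mult_left_le_one_le)
  finally show ?thesis .
qed

text \<open>Two integrations by parts. The boundary term of the first vanishes by e 0 = 0 and that
  of the second by sin 0 = 0, so the value of the derivative at 0 does not enter.\<close>

lemma nice_parts:
  assumes e: "derivs2 e e' e'' M"
  shows "l * (\<integral>y. sin (l * y) * e y \<partial>hl) = (\<integral>y. cos (l * y) * e' y \<partial>hl)"
    and "l * (\<integral>y. cos (l * y) * e' y \<partial>hl) = - (\<integral>y. sin (l * y) * e'' y \<partial>hl)"
proof -
  have i: "integrable hl (\<lambda>y. sin (l * y) * e y)" "integrable hl (\<lambda>y. cos (l * y) * e' y)" "integrable hl (\<lambda>y. sin (l * y) * e'' y)"
    by (rule compact_support_integrable[where M=M]; use e[unfolded derivs2_def] in \<open>auto intro!: continuous_intros\<close>)+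
  have "(\<integral>y. cos (l * y) * e' y - l * (sin (l * y) * e y) \<partial>hl) = - (cos (l * 0) * e 0)"
    by (rule compact_support_FTC(2)[where F="\<lambda>y. cos (l * y) * e y" and M=M]; use e[unfolded derivs2_def] in
     \<open>auto intro!: continuous_intros derivative_eq_intros simp: algebra_simps\<close>)
  then show "l * (\<integral>y. sin (l * y) * e y \<partial>hl) = (\<integral>y. cos (l * y) * e' y \<partial>hl)"
    using i e[unfolded derivs2_def] by (subst (asm) Bochner_Integration.integral_diff) auto
  have "(\<integral>y. sin (l * y) * e'' y + l * (cos (l * y) * e' y) \<partial>hl) = - (sin (l * 0) * e' 0)"
    by (rule compact_support_FTC(2)[where F="\<lambda>y. sin (l * y) * e' y" and M=M]; use e[unfolded derivs2_def] in
     \<open>auto intro!: continuous_intros derivative_eq_intros simp: algebra_simps\<close>)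
  then show "l * (\<integral>y. cos (l * y) * e' y \<partial>hl) = - (\<integral>y. sin (l * y) * e'' y \<partial>hl)"
    using i e[unfolded derivs2_def] by (subst (asm) Bochner_Integration.integral_add) auto
qed

text \<open>Linear vanishing at 0 and inverse square decay at infinity: enough for l^\<sigma> times
  a to be integrable, square integrable and bounded whenever -1 < \<sigma> < 1.\<close>

definition tame :: "(real \<Rightarrow> real) \<Rightarrow> bool" where
  "tame a \<longleftrightarrow> continuous_on {0<..} a \<and> (\<exists>C\<ge>0. \<forall>l>0. \<bar>a l\<bar> \<le> C * l \<and> \<bar>a l\<bar> \<le> C / l\<^sup>2)"

text \<open>The bound at 0 comes from |sin (l y)| \<le> l y, the bound at infinity from two
  integrations by parts.\<close>

lemma tame_ST: assumes "nice e" shows "tame (ST e)"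
proof -
  obtain e' e'' M where e: "derivs2 e e' e'' M" by (rule nice_derivs2[OF assms])
  have i2: "integrable hl e''" by (rule compact_support_integrable[where M=M]; use e[unfolded derivs2_def] in auto)
  have ye: "integrable hl (\<lambda>y. y * e y)" by (rule compact_support_integrable[where M=M]; use e[unfolded derivs2_def] in \<open>auto intro!: continuous_intros\<close>)
  define C1 where "C1 = (\<integral>y. \<bar>y * e y\<bar> \<partial>hl)"
  define C2 where "C2 = (\<integral>y. \<bar>e'' y\<bar> \<partial>hl)"
  have C: "C1 \<ge> 0" "C2 \<ge> 0" unfolding C1_def C2_def by auto
  have I1: "\<bar>\<integral>y. sin (l * y) * e y \<partial>hl\<bar> \<le> C1 * l" if "l > 0" for l
  proof -
    have "\<bar>\<integral>y. sin (l * y) * e y \<partial>hl\<bar> \<le> (\<integral>y. \<bar>sin (l * y) * e y\<bar> \<partial>hl)" by (rule integral_abs_bound)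
    also have "\<dots> \<le> (\<integral>y. l * \<bar>y * e y\<bar> \<partial>hl)"
    proof (rule integral_mono)
      fix y assume "y \<in> space hl"
      have "\<bar>sin (l * y)\<bar> \<le> \<bar>l * y\<bar>" by (rule abs_sin_x_le_abs_x)
      then have "\<bar>sin (l * y)\<bar> * \<bar>e y\<bar> \<le> \<bar>l * y\<bar> * \<bar>e y\<bar>" by (rule mult_right_mono) simp
      then show "\<bar>sin (l * y) * e y\<bar> \<le> l * \<bar>y * e y\<bar>" using that by (simp add: abs_mult)
    qed (use nice_integrable(2)[OF assms] ye in auto)
    finally show ?thesis by (simp add: C1_def mult.commute)
  qed
  have I2: "\<bar>\<integral>y. sin (l * y) * e y \<partial>hl\<bar> \<le> C2 / l\<^sup>2" if "l > 0" for l
  proof -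
    have "l\<^sup>2 * (\<integral>y. sin (l * y) * e y \<partial>hl) = - (\<integral>y. sin (l * y) * e'' y \<partial>hl)"
      using nice_parts[OF e, of l] by (simp only: power2_eq_square mult.assoc)
    then have "l\<^sup>2 * \<bar>\<integral>y. sin (l * y) * e y \<partial>hl\<bar> \<le> C2"
      using integral_hl_abs_sin_le[OF i2, of l] abs_mult[of "l\<^sup>2" "\<integral>y. sin (l * y) * e y \<partial>hl"] by (simp add: C2_def)
    then show ?thesis using that by (simp add: pos_le_divide_eq mult.commute)
  qed
  define k where "k = sqrt (2 / pi)"
  have k: "k \<ge> 0" by (simp add: k_def)
  have "\<forall>l>0. \<bar>ST e l\<bar> \<le> k * (C1 + C2) * l \<and> \<bar>ST e l\<bar> \<le> k * (C1 + C2) / l\<^sup>2"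
  proof (intro allI impI conjI)
    fix l :: real assume l: "l > 0"
    have "\<bar>ST e l\<bar> = k * \<bar>\<integral>y. sin (l * y) * e y \<partial>hl\<bar>" using k by (simp add: ST_def k_def abs_mult)
    moreover have "C1 * l \<le> (C1 + C2) * l" "C2 / l\<^sup>2 \<le> (C1 + C2) / l\<^sup>2"
      using C l by (auto intro!: mult_right_mono divide_right_mono)
    then have "k * \<bar>\<integral>y. sin (l * y) * e y \<partial>hl\<bar> \<le> k * ((C1 + C2) * l)"
      "k * \<bar>\<integral>y. sin (l * y) * e y \<partial>hl\<bar> \<le> k * ((C1 + C2) / l\<^sup>2)"
      by - (rule mult_left_mono[OF order_trans[OF I1[OF l]] k], assumption,
          rule mult_left_mono[OF order_trans[OF I2[OF l]] k], assumption)
    ultimately show "\<bar>ST e l\<bar> \<le> k * (C1 + C2) * l" "\<bar>ST e l\<bar> \<le> k * (C1 + C2) / l\<^sup>2" by simp_all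
  qed
  moreover have "continuous_on {0<..} (ST e)"
  proof -
    have "isCont (\<lambda>l. \<integral>y. sin (l * y) * e y \<partial>hl) l" for l
      unfolding continuous_at_sequentially
    proof (intro allI impI)
    fix u :: "nat \<Rightarrow> real" assume u: "u \<longlonglongrightarrow> l"
    have em: "e \<in> borel_measurable hl" using nice_integrable(1)[OF assms] by auto
    show "((\<lambda>l. \<integral>y. sin (l * y) * e y \<partial>hl) \<circ> u) \<longlonglongrightarrow> (\<integral>y. sin (l * y) * e y \<partial>hl)"
      unfolding comp_def
    proof (rule integral_dominated_convergence[where w="\<lambda>y. \<bar>e y\<bar>"])
      show "AE y in hl. (\<lambda>i. sin (u i * y) * e y) \<longlonglongrightarrow> sin (l * y) * e y"
        by (intro AE_I2 tendsto_intros u)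
      show "integrable hl (\<lambda>y. \<bar>e y\<bar>)" by (rule integrable_abs[OF nice_integrable(1)[OF assms]])
      show "(\<lambda>y. sin (l * y) * e y) \<in> borel_measurable hl" "\<And>i. (\<lambda>y. sin (u i * y) * e y) \<in> borel_measurable hl"
        by (rule borel_measurable_integrable[OF nice_integrable(2)[OF assms]])+
      show "AE y in hl. norm (sin (u i * y) * e y) \<le> \<bar>e y\<bar>" for i
        by (intro AE_I2) (simp add: abs_mult mult_left_le_one_le)
    qed
    qed
    then have "isCont (ST e) l" for l
      unfolding ST_def[abs_def] by (rule isCont_mult[OF continuous_const])
    then show ?thesis by (simp add: continuous_at_imp_continuous_on)
  qed
  moreover have "k * (C1 + C2) \<ge> 0" using k C by simp
  ultimately show ?thesis unfolding tame_def by blast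
qed

lemma powr_min_integrable:
  assumes "b < - 1"
  shows "integrable hl (\<lambda>l. if l \<le> 1 then 1 else l powr b :: real)"
proof (rule integrableI_bounded)
  have "(\<integral>\<^sup>+l. ennreal (l powr b) * indicator {1..} l \<partial>lborel) = ennreal (0 - 1 powr (b + 1) / (b + 1))"
  proof (rule nn_integral_FTC_atLeast[where F="\<lambda>l. l powr (b + 1) / (b + 1)" and f="\<lambda>l. l powr b" and T=0])
    show "((\<lambda>l. l powr (b + 1) / (b + 1)) has_real_derivative l powr b) (at l)" if "1 \<le> l" for l
      using that assms by (auto intro!: derivative_eq_intros)
    show "((\<lambda>l. l powr (b + 1) / (b + 1)) \<longlongrightarrow> 0) at_top"
      using tendsto_divide[OF tendsto_neg_powr[OF _ filterlim_ident, of "b + 1"] tendsto_const[of "b + 1"]] assms by simp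
  qed auto
  then have fin: "(\<integral>\<^sup>+l. ennreal (l powr b) * indicator {1..} l \<partial>lborel) < \<infinity>" by simp
  have "(\<integral>\<^sup>+l. ennreal (norm (if l \<le> 1 then 1 else l powr b)) \<partial>hl)
     \<le> (\<integral>\<^sup>+l. indicator {0..1} l + ennreal (l powr b) * indicator {1..} l \<partial>lborel)"
    unfolding nn_integral_hl by (rule nn_integral_mono) (auto split: split_indicator)
  also have "\<dots> = 1 + (\<integral>\<^sup>+l. ennreal (l powr b) * indicator {1..} l \<partial>lborel)"
    by (subst nn_integral_add) auto
  also have "\<dots> < \<infinity>" using fin by simp
  finally show "(\<integral>\<^sup>+l. ennreal (norm (if l \<le> 1 then 1 else l powr b)) \<partial>hl) < \<infinity>" .
  show "(\<lambda>l. if l \<le> 1 then 1 else l powr b) \<in> borel_measurable hl"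
    by (rule borel_measurable_hlI) measurable
qed

text \<open>Comparison with the constant C for l \<le> 1, by \<sigma> > -1, and with C l^(\<sigma> -
  2) beyond, integrable by \<sigma> < 1.\<close>

lemma tame_powr:
  assumes a: "tame a" and s: "- 1 < \<sigma>" "\<sigma> < 1"
  shows "continuous_on {0<..} (\<lambda>l. l powr \<sigma> * a l)" "integrable hl (\<lambda>l. l powr \<sigma> * a l)"
    "\<exists>B. \<forall>l>0. \<bar>l powr \<sigma> * a l\<bar> \<le> B"
proof -
  obtain C where C: "C \<ge> 0" "\<And>l. l > 0 \<Longrightarrow> \<bar>a l\<bar> \<le> C * l" "\<And>l. l > 0 \<Longrightarrow> \<bar>a l\<bar> \<le> C / l\<^sup>2"
    and ac: "continuous_on {0<..} a" using a unfolding tame_def by blast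
  show c: "continuous_on {0<..} (\<lambda>l. l powr \<sigma> * a l)"
    by (intro continuous_intros ac) auto
  have b: "\<bar>l powr \<sigma> * a l\<bar> \<le> C * (if l \<le> 1 then 1 else l powr (\<sigma> - 2))" if "l > 0" for l
  proof (cases "l \<le> 1")
    case True
    have "\<bar>l powr \<sigma> * a l\<bar> \<le> l powr \<sigma> * (C * l)"
      unfolding abs_mult abs_of_nonneg[OF powr_ge_zero] by (rule mult_left_mono[OF C(2)[OF that]]) simp
    also have "\<dots> = C * l powr (\<sigma> + 1)" using that by (simp add: powr_add)
    also have "\<dots> \<le> C * 1" using True that s C(1) by (intro mult_left_mono powr_le1) auto
    finally show ?thesis using True by simp
  next
    case False
    have "\<bar>l powr \<sigma> * a l\<bar> \<le> l powr \<sigma> * (C / l\<^sup>2)"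
      unfolding abs_mult abs_of_nonneg[OF powr_ge_zero] by (rule mult_left_mono[OF C(3)[OF that]]) simp
    also have "\<dots> = C * l powr (\<sigma> - 2)" using that by (simp add: powr_diff)
    finally show ?thesis using False by simp
  qed
  have m: "integrable hl (\<lambda>l. C * (if l \<le> 1 then 1 else l powr (\<sigma> - 2)))"
    using powr_min_integrable[of "\<sigma> - 2"] s by (intro integrable_mult_right) auto
  have nn: "(if l \<le> 1 then 1 else l powr (\<sigma> - 2)) \<ge> 0" for l by simp
  show "integrable hl (\<lambda>l. l powr \<sigma> * a l)"
  proof (rule Bochner_Integration.integrable_bound[OF m])
    show "(\<lambda>l. l powr \<sigma> * a l) \<in> borel_measurable hl" by (rule borel_measurable_hl_cont[OF c])
    show "AE l in hl. norm (l powr \<sigma> * a l) \<le> norm (C * (if l \<le> 1 then 1 else l powr (\<sigma> - 2)))"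
    proof (rule AE_hlI)
      fix l :: real assume "l > 0"
      from b[OF this] show "norm (l powr \<sigma> * a l) \<le> norm (C * (if l \<le> 1 then 1 else l powr (\<sigma> - 2)))"
        unfolding real_norm_def by (rule order_trans) simp
    qed
  qed
  have "\<bar>l powr \<sigma> * a l\<bar> \<le> C" if "l > 0" for l
  proof -
    have "l powr (\<sigma> - 2) \<le> 1" if "\<not> l \<le> 1"
    proof -
      have "l powr (\<sigma> - 2) \<le> l powr 0" using that s by (intro powr_mono) auto
      then show ?thesis using that by simp
    qed
    then have "C * (if l \<le> 1 then 1 else l powr (\<sigma> - 2)) \<le> C * 1" using C(1) by (intro mult_left_mono) auto
    then show ?thesis using b[OF that] by simp
  qed
  then show "\<exists>B. \<forall>l>0. \<bar>l powr \<sigma> * a l\<bar> \<le> B" by blast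
qed

lemma tame_integrable: "tame a \<Longrightarrow> integrable hl a"
proof -
  assume "tame a"
  from tame_powr(2)[OF this, of 0] have "integrable hl (\<lambda>l. l powr 0 * a l)" by simp
  then show ?thesis by (rule Bochner_Integration.integrable_cong[THEN iffD1, rotated 2]) auto
qed

lemma tame_diff: assumes "tame a" "tame b" shows "tame (\<lambda>l. a l - b l)"
proof -
  obtain C D where C: "C \<ge> 0" "\<And>l. l > 0 \<Longrightarrow> \<bar>a l\<bar> \<le> C * l" "\<And>l. l > 0 \<Longrightarrow> \<bar>a l\<bar> \<le> C / l\<^sup>2"
    "D \<ge> 0" "\<And>l. l > 0 \<Longrightarrow> \<bar>b l\<bar> \<le> D * l" "\<And>l. l > 0 \<Longrightarrow> \<bar>b l\<bar> \<le> D / l\<^sup>2"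
    using assms unfolding tame_def by blast
  have "\<bar>a l - b l\<bar> \<le> (C + D) * l \<and> \<bar>a l - b l\<bar> \<le> (C + D) / l\<^sup>2" if "l > 0" for l
    unfolding distrib_right add_divide_distrib using C(2,3,5,6)[OF that] by (intro conjI) linarith+
  moreover have "continuous_on {0<..} (\<lambda>l. a l - b l)" using assms by (intro continuous_intros) (auto simp: tame_def)
  ultimately show ?thesis using C unfolding tame_def by (intro conjI exI[of _ "C + D"]) auto
qed

text \<open>For a = \<open>ST w\<close> this is the squared Sobolev norm of order \<sigma> of the
  radial function belonging to w, up to the factor 4 pi.\<close>

definition Nsq :: "real \<Rightarrow> (real \<Rightarrow> real) \<Rightarrow> real" where
  "Nsq \<sigma> a = (\<integral>l. (l powr \<sigma> * a l)\<^sup>2 \<partial>hl)"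

lemma Nsq_nonneg [simp]: "Nsq \<sigma> a \<ge> 0"
  by (simp add: Nsq_def)

lemma tame_square_integrable:
  assumes "tame a" "- 1 < \<sigma>" "\<sigma> < 1"
  shows "integrable hl (\<lambda>l. (l powr \<sigma> * a l)\<^sup>2)"
proof -
  obtain B where "\<And>l. l > 0 \<Longrightarrow> \<bar>l powr \<sigma> * a l\<bar> \<le> B" using tame_powr(3)[OF assms] by blast
  from square_integrable_hl[OF tame_powr(2)[OF assms] this] show ?thesis by simp
qed

lemma nn_integral_Nsq:
  assumes "tame a" "- 1 < \<sigma>" "\<sigma> < 1"
  shows "(\<integral>\<^sup>+l. ennreal ((l powr \<sigma> * a l)\<^sup>2) \<partial>hl) = ennreal (Nsq \<sigma> a)"
  unfolding Nsq_def by (rule nn_integral_eq_integral[OF tame_square_integrable[OF assms]]) simp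

section \<open>Sobolev norms and multipliers in terms of the sine transform\<close>

lemma FD_eq_ST:
  assumes "\<And>y. y > 0 \<Longrightarrow> (1 + y) * profile f (1 + y) = e y"
  shows "FD f l = ST e l"
proof -
  let ?f = "\<lambda>r. indicator {1<..} r *\<^sub>R (sin (l * (r - 1)) / r * profile f r * r\<^sup>2)"
  have "(LBINT r:{1<..}. sin (l * (r - 1)) / r * profile f r * r\<^sup>2) = (\<integral>y. ?f (1 + y) \<partial>lborel)"
    unfolding set_lebesgue_integral_def using lborel_integral_real_affine[of 1 ?f 1] by simp
  also have "\<dots> = (\<integral>y. indicator {0<..} y *\<^sub>R (sin (l * y) * e y) \<partial>lborel)"
  proof (rule Bochner_Integration.integral_cong[OF refl])
    fix y
    have "sin (l * y) / (1 + y) * profile f (1 + y) * (1 + y)\<^sup>2 = sin (l * y) * ((1 + y) * profile f (1 + y))" if "y > 0"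
      using that by (simp add: power2_eq_square)
    then show "?f (1 + y) = indicator {0<..} y *\<^sub>R (sin (l * y) * e y)"
      using assms[of y] by (simp add: indicator_def)
  qed
  finally show ?thesis by (simp add: FD_def ST_def integral_hl set_lebesgue_integral_def)
qed

lemma FD_inv_eq:
  "FD_inv g r = sqrt (2 / pi) * (\<integral>l. sin (l * (r - 1)) * g l \<partial>hl) / r"
proof -
  have "(\<integral>l. sin (l * (r - 1)) / r * g l \<partial>hl) = (\<integral>l. sin (l * (r - 1)) * g l / r \<partial>hl)" by simp
  also have "\<dots> = (\<integral>l. sin (l * (r - 1)) * g l \<partial>hl) / r" by (rule integral_divide_zero)
  finally show ?thesis by (simp add: FD_inv_def integral_hl)
qed

lemma enn_powr_ennreal: "a \<ge> 0 \<Longrightarrow> enn_powr (ennreal a) p = ennreal (a powr p)"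
  by (simp add: enn_powr_def)

lemma enn_powr_2: "a \<ge> 0 \<Longrightarrow> enn_powr (ennreal a) 2 = ennreal (a\<^sup>2)"
  by (simp add: enn_powr_ennreal)

lemma enn_powr_half: "a \<ge> 0 \<Longrightarrow> enn_powr (ennreal a) (1 / 2) = ennreal (sqrt a)"
  by (simp add: enn_powr_ennreal powr_half_sqrt)

text \<open>The constant is 4 pi from polar coordinates, times 2 / pi from \<open>FD_inv\<close>,
  times pi / 2 from Plancherel. The function f enters only through its profile outside the unit
  ball, so the lemma also covers differences of a test function and an image under a
  multiplier.\<close>

lemma HD_norm_eq:
  assumes e: "nice e" and f: "\<And>y. y > 0 \<Longrightarrow> (1 + y) * profile f (1 + y) = e y" and s: "- 1 < \<sigma>" "\<sigma> < 1"
  shows "HD_norm \<sigma> f = ennreal (sqrt (4 * pi * Nsq \<sigma> (ST e)))"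
proof -
  define g where "g l = l powr \<sigma> * ST e l" for l
  have t: "tame (ST e)" by (rule tame_ST[OF e])
  have g: "continuous_on {0<..} g" "integrable hl g" unfolding g_def using tame_powr[OF t s] by auto
  obtain B where B: "\<And>l. l > 0 \<Longrightarrow> \<bar>g l\<bar> \<le> B" unfolding g_def using tame_powr(3)[OF t s] by blast
  define T where "T y = (\<integral>l. sin (l * y) * g l \<partial>hl)" for y
  have [measurable]: "g \<in> borel_measurable hl" using g by auto
  have [measurable]: "(\<lambda>l::real. l) \<in> borel_measurable hl" by (rule borel_measurable_hlI) simp
  have Tm [measurable]: "T \<in> borel_measurable borel" unfolding T_def by measurable
  have FDe: "FD f l = ST e l" for l by (rule FD_eq_ST[OF f])
  have fc: "fcalc (\<lambda>l. l powr \<sigma>) f x = sqrt (2 / pi) * T (norm x - 1) / norm x" for x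
    by (simp add: fcalc_def FD_inv_eq FDe T_def g_def)
  have "(\<integral>\<^sup>+x. enn_powr (ennreal \<bar>fcalc (\<lambda>l. l powr \<sigma>) f x\<bar>) 2 \<partial>restrict_space lborel Omega)
      = (\<integral>\<^sup>+x. (\<lambda>r. ennreal ((sqrt (2 / pi) * T (r - 1) / r)\<^sup>2)) (norm x) \<partial>restrict_space lborel Omega)"
    by (simp add: fc enn_powr_2 power_divide power_mult_distrib)
  also have "\<dots> = (\<integral>\<^sup>+y. ennreal (4 * pi * (1 + y)\<^sup>2) * ennreal ((sqrt (2 / pi) * T (1 + y - 1) / (1 + y))\<^sup>2) \<partial>hl)"
    by (rule nn_integral_Omega_radial) measurable
  \<comment> \<open>The factors (1 + y)^2 cancel, and 4 pi times 2 / pi is 8.\<close>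
  also have "\<dots> = (\<integral>\<^sup>+y. ennreal 8 * ennreal ((T y)\<^sup>2) \<partial>hl)"
  proof (rule nn_integral_cong)
    fix y assume "y \<in> space hl"
    then have "1 + y > 0" by simp
    then have "4 * pi * (1 + y)\<^sup>2 * (sqrt (2 / pi) * T (1 + y - 1) / (1 + y))\<^sup>2 = 8 * (T y)\<^sup>2"
      by (simp add: power_mult_distrib power_divide)
    then show "ennreal (4 * pi * (1 + y)\<^sup>2) * ennreal ((sqrt (2 / pi) * T (1 + y - 1) / (1 + y))\<^sup>2) = ennreal 8 * ennreal ((T y)\<^sup>2)"
      by (simp add: ennreal_mult[symmetric] del: ennreal_numeral)
  qed
  also have "\<dots> = ennreal 8 * (\<integral>\<^sup>+y. ennreal ((T y)\<^sup>2) \<partial>hl)"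
    by (rule nn_integral_cmult) (rule borel_measurable_hlI, measurable)
  also have "(\<integral>\<^sup>+y. ennreal ((T y)\<^sup>2) \<partial>hl) = (\<integral>\<^sup>+l. ennreal (pi / 2 * (g l)\<^sup>2) \<partial>hl)"
    unfolding T_def by (rule plancherel_sin[OF g(2,1) B])
  also have "\<dots> = ennreal (pi / 2) * (\<integral>\<^sup>+l. ennreal ((g l)\<^sup>2) \<partial>hl)"
    by (simp only: ennreal_mult' pi_ge_zero divide_nonneg_nonneg zero_le_numeral) (rule nn_integral_cmult, measurable)
  also have "\<dots> = ennreal (pi / 2) * ennreal (Nsq \<sigma> (ST e))"
    using nn_integral_Nsq[OF t s] by (simp add: g_def)
  also have "ennreal 8 * \<dots> = ennreal (4 * pi * Nsq \<sigma> (ST e))"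
    by (simp add: ennreal_mult[symmetric] del: ennreal_numeral)
  finally show ?thesis unfolding HD_norm_def Lnorm_def by (simp add: enn_powr_half)
qed

lemma profile_tf: "y > 0 \<Longrightarrow> (1 + y) * profile (tf w) (1 + y) = w y"
  by (simp add: profile_def tf_def)

lemma HD_norm_tf:
  assumes "w \<in> bumps" "- 1 < \<sigma>" "\<sigma> < 1"
  shows "HD_norm \<sigma> (tf w) = ennreal (sqrt (4 * pi * Nsq \<sigma> (ST w)))"
  by (rule HD_norm_eq[OF bumps_nice[OF assms(1)] profile_tf assms(2,3)])

text \<open>In this range of orders the norm of a radial test function is always finite, so the
  space of test functions does not change with \<sigma>.\<close>

lemma HD_test_eq:
  assumes "- 1 < \<sigma>" "\<sigma> < 1"
  shows "HD_test \<sigma> = tf ` bumps"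
proof safe
  fix f assume "f \<in> HD_test \<sigma>"
  then have "f \<in> test_functions" "radial f" by (auto simp: HD_test_def)
  then obtain w where "w \<in> bumps" "f = tf w" by (rule test_function_tf)
  then show "f \<in> tf ` bumps" by blast
next
  fix w assume w: "w \<in> bumps"
  show "tf w \<in> HD_test \<sigma>"
    using tf_test_function[OF w] radial_tf HD_norm_tf[OF w assms] by (simp add: HD_test_def)
qed

text \<open>When m times the transform of v is itself the transform of a nice function w, sine
  inversion identifies the spectrally defined image with w at every point. This is how explicit
  d'Alembert solutions enter.\<close>

lemma profile_fcalc:
  assumes v: "v \<in> bumps" and w: "nice w" and m: "\<And>l. l > 0 \<Longrightarrow> ST w l = m l * ST v l" and y: "y > 0"
  shows "(1 + y) * profile (fcalc m (tf v)) (1 + y) = w y"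
proof -
  define k where "k = sqrt (2 / pi)"
  have k: "k * k = 2 / pi" by (simp add: k_def)
  have k0: "k \<noteq> 0" by (simp add: k_def)
  have sw: "ST w l = k * (\<integral>y. sin (l * y) * w y \<partial>hl)" for l by (simp add: ST_def k_def)
  obtain w' w'' M where d: "derivs2 w w' w'' M" by (rule nice_derivs2[OF w])
  have wc: "continuous_on UNIV w" and wz: "\<And>y. y > M \<Longrightarrow> w y = 0" using d by (auto simp: derivs2_def)
  obtain B where B: "\<And>y. y \<ge> 0 \<Longrightarrow> \<bar>w y\<bar> \<le> B" using compact_support_bounded[OF wc wz] by blast
  have "integrable hl (\<lambda>l. (1 / k) * ST w l)"
    by (intro integrable_mult_right tame_integrable tame_ST w)
  then have i: "integrable hl (\<lambda>l. \<integral>y. sin (l * y) * w y \<partial>hl)" using k0 by (simp add: sw)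
  have FDe: "FD (tf v) l = ST v l" for l by (rule FD_eq_ST[OF profile_tf])
  then have "(1 + y) * profile (fcalc m (tf v)) (1 + y) = k * (\<integral>l. sin (l * y) * (m l * ST v l) \<partial>hl)"
    using y by (simp add: profile_def fcalc_def FD_inv_eq FDe k_def)
  also have "(\<integral>l. sin (l * y) * (m l * ST v l) \<partial>hl) = (\<integral>l. k * (sin (l * y) * (\<integral>y. sin (l * y) * w y \<partial>hl)) \<partial>hl)"
  proof (rule Bochner_Integration.integral_cong[OF refl])
    fix l assume "l \<in> space hl"
    then have "m l * ST v l = k * (\<integral>y. sin (l * y) * w y \<partial>hl)" using m[of l] sw[of l] by simp
    then show "sin (l * y) * (m l * ST v l) = k * (sin (l * y) * (\<integral>y. sin (l * y) * w y \<partial>hl))" by simp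
  qed
  also have "\<dots> = k * (pi / 2 * w y)"
    using sine_inversion[OF nice_integrable(1)[OF w] B _ _ i, of y] y wc
    by (simp add: continuous_on_eq_continuous_at)
  finally show ?thesis using k by (simp add: mult.assoc[symmetric])
qed

section \<open>D'Alembert's formula for bumps\<close>

lemma compact_support_integrable_line:
  fixes f :: "real \<Rightarrow> real"
  assumes c: "continuous_on UNIV f" and z: "\<And>y. \<bar>y\<bar> > M \<Longrightarrow> f y = 0"
  shows "integrable lborel f"
proof -
  have "set_integrable lborel {- M..M} f"
    by (rule borel_integrable_atLeastAtMost') (rule continuous_on_subset[OF c], simp)
  then have "integrable lborel (\<lambda>x. indicator {- M..M} x *\<^sub>R f x)" by (simp add: set_integrable_def)
  moreover have "(\<lambda>x. indicator {- M..M} x *\<^sub>R f x) = f"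
  proof
    show "indicator {- M..M} x *\<^sub>R f x = f x" for x
      using z[of x] by (cases "\<bar>x\<bar> > M") (auto simp: indicator_def)
  qed
  ultimately show ?thesis by (simp only:)
qed

lemma integral_even_line:
  fixes f :: "real \<Rightarrow> real"
  assumes f: "integrable lborel f" and even: "\<And>x. f (- x) = f x"
  shows "(\<integral>x. f x \<partial>lborel) = 2 * (\<integral>x. f x \<partial>hl)"
proof -
  have "set_integrable lborel {0<..} f"
    unfolding set_integrable_def by (rule integrable_mult_indicator) (use f in auto)
  then have i: "integrable hl f" by (simp add: integrable_hl_iff)
  have "(\<integral>x. f x \<partial>lborel) = (\<integral>x. (if x > 0 then f x else if x < 0 then 1 * f (- x) else 0) \<partial>lborel)"
  proof (rule integral_cong_AE)
    show "AE x in lborel. f x = (if x > 0 then f x else if x < 0 then 1 * f (- x) else 0)"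
      using AE_lborel_singleton[of "0::real"] by eventually_elim (auto simp: even)
  qed (use f integral_even(1)[OF i, of 1] in auto)
  also have "\<dots> = 2 * (\<integral>x. f x \<partial>hl)" by (subst integral_even(2)[OF i]) simp
  finally show ?thesis .
qed

lemma integral_shift_line: "(\<integral>x. f (x + t) \<partial>lborel) = (\<integral>x. f x \<partial>lborel)" for f :: "real \<Rightarrow> real"
  using lborel_integral_real_affine[of 1 f t] by (simp add: add.commute)

text \<open>The form a bump takes under the flow: smooth up to the boundary and zero there, but
  possibly nonzero arbitrarily close to it, hence in general no longer a bump.\<close>

definition wavelike :: "(real \<Rightarrow> real) \<Rightarrow> bool" where
  "wavelike w \<longleftrightarrow> (\<forall>k. Ck1 k w) \<and> w 0 = 0 \<and> (\<exists>M. \<forall>y>M. w y = 0)"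

lemma wavelike_nice: "wavelike w \<Longrightarrow> nice w"
  unfolding wavelike_def nice_def by blast

text \<open>A bump vanishes on the negative half-line, so for bumps this is the odd extension to the
  whole line.\<close>

definition oddext :: "(real \<Rightarrow> real) \<Rightarrow> real \<Rightarrow> real" where
  "oddext v y = v y - v (- y)"

lemma Ck1_oddext: "v \<in> bumps \<Longrightarrow> Ck1 k (oddext v)"
  using Ck1_diff[of k v "\<lambda>y. v ((- 1) * y + 0)"] Ck1_affine[of k v "- 1" 0]
  by (auto simp: oddext_def[abs_def] bumps_def)

lemma oddext_uminus: "oddext v (- y) = - oddext v y"
  by (simp add: oddext_def)

lemma oddext_pos: "v \<in> bumps \<Longrightarrow> y > 0 \<Longrightarrow> oddext v y = v y"
  by (auto simp: oddext_def bumps_def)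

lemma oddext_support:
  assumes "v \<in> bumps" shows "\<exists>M>0. \<forall>y. \<bar>y\<bar> > M \<longrightarrow> oddext v y = 0"
proof -
  obtain d M where d: "d > 0" and z: "\<And>y. y < d \<or> y > M \<Longrightarrow> v y = 0"
    using assms unfolding bumps_def by blast
  have "oddext v y = 0" if "\<bar>y\<bar> > max M 1" for y
  proof (cases "y > 0")
    case True then show ?thesis using that z[of y] z[of "- y"] d by (simp add: oddext_def)
  next
    case False then show ?thesis using that z[of y] z[of "- y"] d by (simp add: oddext_def)
  qed
  then show ?thesis by (intro exI[of _ "max M 1"]) simp
qed

text \<open>The mean of the translates of the odd extension by t and -t is again odd, hence zero at
  0. In the sine transform the two translations combine to the factor cos (t l).\<close>

lemma wave_cos:
  assumes v: "v \<in> bumps"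
  obtains w where "wavelike w" "\<And>l. ST w l = cos (t * l) * ST v l"
proof -
  define V where "V = oddext v"
  obtain M where M: "M > 0" and z: "\<And>y. \<bar>y\<bar> > M \<Longrightarrow> V y = 0"
    unfolding V_def using oddext_support[OF v] by blast
  have VC: "Ck1 k V" and odd: "V (- y) = - V y" and Vv: "y > 0 \<Longrightarrow> V y = v y" for k y
    unfolding V_def by (rule Ck1_oddext[OF v] oddext_uminus oddext_pos[OF v])+
  have Vc [continuous_intros]: "continuous_on S f \<Longrightarrow> continuous_on S (\<lambda>x. V (f x))" for S and f :: "real \<Rightarrow> real"
    using Ck1_cont[OF VC[of 0]] by (rule continuous_on_compose2) auto
  define w where "w y = (1/2) * (V (1 * y + t) + V (1 * y + (- t)))" for y
  have w0: "w (- y) = - w y" for y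
  proof -
    have "V (1 * (- y) + t) = - V (y - t)" "V (1 * (- y) + (- t)) = - V (y + t)"
      using odd[of "y + t"] odd[of "y - t"] by (simp_all add: algebra_simps)
    then show ?thesis unfolding w_def by (simp add: field_simps)
  qed
  have wC: "Ck1 k w" for k unfolding w_def by (intro Ck1_cmult Ck1_add Ck1_affine VC)
  have wz: "w y = 0" if "\<bar>y\<bar> > M + \<bar>t\<bar>" for y
  proof -
    have "\<bar>y + t\<bar> > M" "\<bar>y - t\<bar> > M" using that by linarith+
    then show ?thesis using z[of "y + t"] z[of "y - t"] by (simp add: w_def)
  qed
  have "wavelike w"
    unfolding wavelike_def using wC w0[of 0] wz by (intro conjI allI exI[of _ "M + \<bar>t\<bar>"]) auto
  moreover have "(\<integral>y. sin (l * y) * w y \<partial>hl) = cos (t * l) * (\<integral>y. sin (l * y) * v y \<partial>hl)" for l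
  proof -
    have i: "integrable lborel (\<lambda>y. sin (l * y + c) * V (y + d))" for c d
    proof (rule compact_support_integrable_line[where M="M + \<bar>d\<bar>"])
      show "sin (l * y + c) * V (y + d) = 0" if "\<bar>y\<bar> > M + \<bar>d\<bar>" for y
        using that z[of "y + d"] by simp
    qed (intro continuous_intros)
    have iw: "integrable lborel (\<lambda>y. sin (l * y) * w y)"
      by (rule compact_support_integrable_line[where M="M + \<bar>t\<bar>"])
         (use wz in \<open>auto intro!: continuous_intros Ck1_cont[OF wC]\<close>)
    \<comment> \<open>Products of two odd functions are even, so integrals over the half-line become
      integrals over the line, where the translations can be moved onto the sine.\<close>
    have "2 * (\<integral>y. sin (l * y) * w y \<partial>hl) = (\<integral>y. sin (l * y) * w y \<partial>lborel)"
      by (rule integral_even_line[OF iw, symmetric]) (simp add: w0)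
    also have "\<dots> = (\<integral>y. (1/2) * (sin (l * y + 0) * V (y + t)) + (1/2) * (sin (l * y + 0) * V (y + (- t))) \<partial>lborel)"
      by (rule Bochner_Integration.integral_cong[OF refl]) (simp add: w_def algebra_simps)
    also have "\<dots> = (1/2) * (\<integral>y. sin (l * y + 0) * V (y + t) \<partial>lborel) + (1/2) * (\<integral>y. sin (l * y + 0) * V (y + (- t)) \<partial>lborel)"
      by (simp only: integral_mult_right_zero
          Bochner_Integration.integral_add[OF integrable_mult_right[OF i] integrable_mult_right[OF i]])
    also have "(\<integral>y. sin (l * y + 0) * V (y + t) \<partial>lborel) = (\<integral>y. sin (l * y + (- (l * t))) * V (y + 0) \<partial>lborel)"
      using integral_shift_line[of "\<lambda>y. sin (l * y + (- (l * t))) * V (y + 0)" t] by (simp add: algebra_simps)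
    also have "(\<integral>y. sin (l * y + 0) * V (y + (- t)) \<partial>lborel) = (\<integral>y. sin (l * y + l * t) * V (y + 0) \<partial>lborel)"
      using integral_shift_line[of "\<lambda>y. sin (l * y + l * t) * V (y + 0)" "- t"] by (simp add: algebra_simps)
    also have "(1/2) * (\<integral>y. sin (l * y + (- (l * t))) * V (y + 0) \<partial>lborel) + (1/2) * (\<integral>y. sin (l * y + l * t) * V (y + 0) \<partial>lborel)
        = (\<integral>y. (1/2) * (sin (l * y + (- (l * t))) * V (y + 0)) + (1/2) * (sin (l * y + l * t) * V (y + 0)) \<partial>lborel)"
      by (simp only: integral_mult_right_zero
          Bochner_Integration.integral_add[OF integrable_mult_right[OF i] integrable_mult_right[OF i]])
    also have "\<dots> = (\<integral>y. cos (l * t) * (sin (l * y) * V y) \<partial>lborel)"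
      by (rule Bochner_Integration.integral_cong[OF refl]) (simp add: sin_add sin_diff algebra_simps)
    also have "\<dots> = cos (l * t) * (\<integral>y. sin (l * y) * V y \<partial>lborel)" by (rule integral_mult_right_zero)
    also have "(\<integral>y. sin (l * y) * V y \<partial>lborel) = 2 * (\<integral>y. sin (l * y) * V y \<partial>hl)"
      using i[of 0 0] by (intro integral_even_line) (simp_all add: odd)
    also have "(\<integral>y. sin (l * y) * V y \<partial>hl) = (\<integral>y. sin (l * y) * v y \<partial>hl)"
      by (rule Bochner_Integration.integral_cong[OF refl]) (simp add: Vv)
    finally show ?thesis by (simp add: mult.commute)
  qed
  ultimately show thesis using that[of w] by (simp add: ST_def)
qed

lemma antiderivative_exists_line:
  fixes V :: "real \<Rightarrow> real"
  assumes "continuous_on UNIV V"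
  obtains F where "\<And>x. (F has_real_derivative V x) (at x)"
proof -
  define F where "F y = (LBINT u=0..y. V u)" for y :: real
  have "(F has_real_derivative V x) (at x)" for x
  proof -
    have "((\<lambda>u. LBINT y=(0::real)..u. V y) has_vector_derivative V x) (at x within {- \<bar>x\<bar> - 1..\<bar>x\<bar> + 1})"
      by (rule interval_integral_FTC2) (auto intro: continuous_on_subset[OF assms])
    moreover have "at x within {- \<bar>x\<bar> - 1..\<bar>x\<bar> + 1} = at x"
      by (rule at_within_interior) (auto simp: interior_atLeastAtMost_real)
    ultimately show ?thesis
      by (simp add: F_def[abs_def] has_real_derivative_iff_has_vector_derivative zero_ereal_def)
  qed
  then show thesis using that by blast
qed

text \<open>The factor 1 / l is an antiderivative: w is half the difference of the translates of a
  compactly supported even antiderivative \<open>A\<close> of the odd extension. One integration by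
  parts turns the cosine transform of \<open>A\<close> into -1 / l times the sine transform of
  v.\<close>

lemma wave_sin:
  assumes v: "v \<in> bumps"
  obtains w where "wavelike w" "\<And>l. l > 0 \<Longrightarrow> ST w l = sin (t * l) / l * ST v l"
proof -
  define V where "V = oddext v"
  obtain M where M: "M > 0" and z: "\<And>y. \<bar>y\<bar> > M \<Longrightarrow> V y = 0"
    unfolding V_def using oddext_support[OF v] by blast
  have VC: "Ck1 k V" and odd: "V (- y) = - V y" and Vv: "y > 0 \<Longrightarrow> V y = v y" for k y
    unfolding V_def by (rule Ck1_oddext[OF v] oddext_uminus oddext_pos[OF v])+
  have Vc: "continuous_on UNIV V" using Ck1_cont[OF VC[of 0]] .
  obtain F where F: "\<And>x. (F has_real_derivative V x) (at x)" using antiderivative_exists_line[OF Vc] by blast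
  have Feven: "F (- y) = F y" for y
  proof -
    have d: "((\<lambda>y. F (- y) - F y) has_real_derivative 0) (at x)" for x
    proof -
      have "(uminus has_real_derivative - 1) (at x)" by (auto intro!: derivative_eq_intros)
      from DERIV_diff[OF DERIV_chain2[OF F this] F[of x]] show ?thesis using odd[of x] by simp
    qed
    have "F (- y) - F y = F (- 0) - F 0" by (rule DERIV_isconst_all) (use d in blast)
    then show ?thesis by simp
  qed
  \<comment> \<open>Beyond the support F is constant. Subtracting the constant leaves a function
    that vanishes far to the right and, by evenness, far to the left.\<close>
  have "\<exists>c. \<forall>x\<in>{M<..}. F x = c"
  proof (rule has_field_derivative_zero_constant)
    show "(F has_real_derivative 0) (at x within {M<..})" if "x \<in> {M<..}" for x
      using F[of x] z[of x] that by (simp add: has_field_derivative_at_within)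
  qed simp
  then obtain c where c: "\<And>x. x > M \<Longrightarrow> F x = c" by auto
  define A where "A y = F y - c" for y
  have AV: "(A has_real_derivative V x) (at x)" for x
    unfolding A_def using F[of x] by (auto intro!: derivative_eq_intros)
  have AC: "Ck1 k A" for k by (rule Ck1_antiderivative[OF VC AV])
  have even: "A (- y) = A y" for y by (simp add: A_def Feven)
  have Az: "A y = 0" if "\<bar>y\<bar> > M" for y
    using c[of "\<bar>y\<bar>"] that even[of y] by (auto simp: A_def abs_if split: if_splits)
  have Ac [continuous_intros]: "continuous_on S f \<Longrightarrow> continuous_on S (\<lambda>x. A (f x))" for S and f :: "real \<Rightarrow> real"
    using Ck1_cont[OF AC[of 0]] by (rule continuous_on_compose2) auto
  define w where "w y = (1/2) * (A (1 * y + t) - A (1 * y + (- t)))" for y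
  have w0: "w (- y) = - w y" for y
  proof -
    have "A (1 * (- y) + t) = A (y - t)" "A (1 * (- y) + (- t)) = A (y + t)"
      using even[of "y + t"] even[of "y - t"] by (simp_all add: algebra_simps)
    then show ?thesis unfolding w_def by (simp add: field_simps)
  qed
  have wC: "Ck1 k w" for k unfolding w_def by (intro Ck1_cmult Ck1_diff Ck1_affine AC)
  have wz: "w y = 0" if "\<bar>y\<bar> > M + \<bar>t\<bar>" for y
  proof -
    have "\<bar>y + t\<bar> > M" "\<bar>y - t\<bar> > M" using that by linarith+
    then show ?thesis using Az[of "y + t"] Az[of "y - t"] by (simp add: w_def)
  qed
  have "wavelike w"
    unfolding wavelike_def using wC w0[of 0] wz by (intro conjI allI exI[of _ "M + \<bar>t\<bar>"]) auto
  moreover have "(\<integral>y. sin (l * y) * w y \<partial>hl) = sin (t * l) / l * (\<integral>y. sin (l * y) * v y \<partial>hl)" if l: "l > 0" for l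
  proof -
    have i: "integrable lborel (\<lambda>y. sin (l * y + c) * A (y + d))" "integrable lborel (\<lambda>y. cos (l * y + c) * A (y + d))" for c d
    proof -
      have "sin (l * y + c) * A (y + d) = 0" "cos (l * y + c) * A (y + d) = 0" if "\<bar>y\<bar> > M + \<bar>d\<bar>" for y
        using that Az[of "y + d"] by simp_all
      then show "integrable lborel (\<lambda>y. sin (l * y + c) * A (y + d))" "integrable lborel (\<lambda>y. cos (l * y + c) * A (y + d))"
        by (intro compact_support_integrable_line[where M="M + \<bar>d\<bar>"] continuous_intros; blast)+
    qed
    have iw: "integrable lborel (\<lambda>y. sin (l * y) * w y)"
      by (rule compact_support_integrable_line[where M="M + \<bar>t\<bar>"])
         (use wz in \<open>auto intro!: continuous_intros Ck1_cont[OF wC]\<close>)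
    have "2 * (\<integral>y. sin (l * y) * w y \<partial>hl) = (\<integral>y. sin (l * y) * w y \<partial>lborel)"
      by (rule integral_even_line[OF iw, symmetric]) (simp add: w0)
    also have "\<dots> = (\<integral>y. (1/2) * (sin (l * y + 0) * A (y + t)) - (1/2) * (sin (l * y + 0) * A (y + (- t))) \<partial>lborel)"
      by (rule Bochner_Integration.integral_cong[OF refl]) (simp add: w_def algebra_simps)
    also have "\<dots> = (1/2) * (\<integral>y. sin (l * y + 0) * A (y + t) \<partial>lborel) - (1/2) * (\<integral>y. sin (l * y + 0) * A (y + (- t)) \<partial>lborel)"
      by (simp only: integral_mult_right_zero
          Bochner_Integration.integral_diff[OF integrable_mult_right[OF i(1)] integrable_mult_right[OF i(1)]])
    also have "(\<integral>y. sin (l * y + 0) * A (y + t) \<partial>lborel) = (\<integral>y. sin (l * y + (- (l * t))) * A (y + 0) \<partial>lborel)"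
      using integral_shift_line[of "\<lambda>y. sin (l * y + (- (l * t))) * A (y + 0)" t] by (simp add: algebra_simps)
    also have "(\<integral>y. sin (l * y + 0) * A (y + (- t)) \<partial>lborel) = (\<integral>y. sin (l * y + l * t) * A (y + 0) \<partial>lborel)"
      using integral_shift_line[of "\<lambda>y. sin (l * y + l * t) * A (y + 0)" "- t"] by (simp add: algebra_simps)
    also have "(1/2) * (\<integral>y. sin (l * y + (- (l * t))) * A (y + 0) \<partial>lborel) - (1/2) * (\<integral>y. sin (l * y + l * t) * A (y + 0) \<partial>lborel)
        = (\<integral>y. (1/2) * (sin (l * y + (- (l * t))) * A (y + 0)) - (1/2) * (sin (l * y + l * t) * A (y + 0)) \<partial>lborel)"
      by (simp only: integral_mult_right_zero
          Bochner_Integration.integral_diff[OF integrable_mult_right[OF i(1)] integrable_mult_right[OF i(1)]])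
    also have "\<dots> = (\<integral>y. - sin (l * t) * (cos (l * y) * A y) \<partial>lborel)"
      by (rule Bochner_Integration.integral_cong[OF refl]) (simp add: sin_add sin_diff algebra_simps)
    also have "\<dots> = - sin (l * t) * (\<integral>y. cos (l * y) * A y \<partial>lborel)" by (rule integral_mult_right_zero)
    also have "(\<integral>y. cos (l * y) * A y \<partial>lborel) = 2 * (\<integral>y. cos (l * y) * A y \<partial>hl)"
      using i(2)[of 0 0] by (intro integral_even_line) (simp_all add: even)
    also have "(\<integral>y. cos (l * y) * A y \<partial>hl) = - (1 / l) * (\<integral>y. sin (l * y) * v y \<partial>hl)"
    proof -
      have i2: "integrable hl (\<lambda>y. sin (l * y) * V y)" "integrable hl (\<lambda>y. cos (l * y) * A y)"
        by (rule compact_support_integrable[where M=M]; use z Az in \<open>auto intro!: continuous_intros Vc\<close>)+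
      have "(\<integral>y. sin (l * y) * V y + l * (cos (l * y) * A y) \<partial>hl) = - (sin (l * 0) * A 0)"
      proof (rule compact_support_FTC(2)[where F="\<lambda>y. sin (l * y) * A y" and M=M])
        show "((\<lambda>y. sin (l * y) * A y) has_real_derivative sin (l * y) * V y + l * (cos (l * y) * A y)) (at y)" for y
          by (auto intro!: derivative_eq_intros AV simp: algebra_simps)
      qed (use Az in \<open>auto intro!: continuous_intros Vc\<close>)
      then have "(\<integral>y. sin (l * y) * V y \<partial>hl) + l * (\<integral>y. cos (l * y) * A y \<partial>hl) = 0"
        using i2 by (subst (asm) Bochner_Integration.integral_add) auto
      moreover have "(\<integral>y. sin (l * y) * V y \<partial>hl) = (\<integral>y. sin (l * y) * v y \<partial>hl)"
        by (rule Bochner_Integration.integral_cong[OF refl]) (simp add: Vv)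
      ultimately show ?thesis using l by (simp add: field_simps)
    qed
    finally show ?thesis using l by (simp add: field_simps)
  qed
  ultimately show thesis using that[of w] by (simp add: ST_def)
qed

section \<open>Approximation of wavelike functions by bumps in positive order\<close>

lemma Nsq_ST_le:
  assumes e: "derivs2 e e' e'' M" "nice e" and s: "0 < s" "s < 1"
  shows "ennreal (Nsq s (ST e)) \<le> (\<integral>\<^sup>+y. ennreal ((e y)\<^sup>2) \<partial>hl) + (\<integral>\<^sup>+y. ennreal ((e' y)\<^sup>2) \<partial>hl)"
proof -
  have t: "tame (ST e)" by (rule tame_ST[OF e(2)])
  have m [measurable]: "ST e \<in> borel_measurable hl" by (rule borel_measurable_hl_cont) (use t in \<open>auto simp: tame_def\<close>)
  have [measurable]: "(\<lambda>l::real. l) \<in> borel_measurable hl" by (rule borel_measurable_hlI) simp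
  have c: "continuous_on UNIV e" "continuous_on UNIV e'" and z: "\<And>y. y > M \<Longrightarrow> e y = 0" "\<And>y. y > M \<Longrightarrow> e' y = 0"
    using e(1) by (auto simp: derivs2_def)
  obtain B where B: "\<And>y. y \<ge> 0 \<Longrightarrow> \<bar>e y\<bar> \<le> B" using compact_support_bounded[OF c(1) z(1)] by blast
  obtain B' where B': "\<And>y. y \<ge> 0 \<Longrightarrow> \<bar>e' y\<bar> \<le> B'" using compact_support_bounded[OF c(2) z(2)] by blast
  have i: "integrable hl e" "integrable hl e'" using compact_support_integrable[OF c(1) z(1)] compact_support_integrable[OF c(2) z(2)] by auto
  have em [measurable]: "e \<in> borel_measurable hl" "e' \<in> borel_measurable hl" using i by auto
  \<comment> \<open>Since l^(2 s) \<le> 1 + l^2, the norm of order s is dominated by those of orders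
    0 and 1, which Plancherel evaluates as the L^2 norms of e and e'.\<close>
  have le: "(l powr s * a)\<^sup>2 \<le> a\<^sup>2 + (l * a)\<^sup>2" if "l > 0" for l a :: real
  proof (cases "l \<le> 1")
    case True
    have "(l powr s)\<^sup>2 \<le> 1" using True that s by (simp add: abs_square_le_1 powr_le1)
    then have "(l powr s)\<^sup>2 * a\<^sup>2 \<le> 1 * a\<^sup>2" by (rule mult_right_mono) simp
    then show ?thesis by (simp add: power_mult_distrib add_increasing2)
  next
    case False
    have "l powr s \<le> l powr 1" using False s by (intro powr_mono) auto
    then have "(l powr s)\<^sup>2 \<le> l\<^sup>2" using that by (intro power_mono) auto
    then have "(l powr s)\<^sup>2 * a\<^sup>2 \<le> l\<^sup>2 * a\<^sup>2" by (rule mult_right_mono) simp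
    then show ?thesis by (simp add: power_mult_distrib add_increasing)
  qed
  have scale: "(\<integral>\<^sup>+y. ennreal ((sqrt (2 / pi) * f y)\<^sup>2) \<partial>hl) = (\<integral>\<^sup>+y. ennreal ((g y)\<^sup>2) \<partial>hl)"
    if "(\<integral>\<^sup>+y. ennreal ((f y)\<^sup>2) \<partial>hl) = (\<integral>\<^sup>+y. ennreal (pi / 2 * (g y)\<^sup>2) \<partial>hl)"
      and [measurable]: "f \<in> borel_measurable hl" "g \<in> borel_measurable hl" for f g
  proof -
    have "(\<integral>\<^sup>+y. ennreal ((sqrt (2 / pi) * f y)\<^sup>2) \<partial>hl) = ennreal (2 / pi) * (\<integral>\<^sup>+y. ennreal ((f y)\<^sup>2) \<partial>hl)"
      by (subst nn_integral_cmult[symmetric]) (auto simp: power_mult_distrib ennreal_mult'[symmetric])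
    also have "\<dots> = (\<integral>\<^sup>+y. ennreal (2 / pi) * ennreal (pi / 2 * (g y)\<^sup>2) \<partial>hl)"
      unfolding that(1) by (rule nn_integral_cmult[symmetric]) measurable
    also have "\<dots> = (\<integral>\<^sup>+y. ennreal ((g y)\<^sup>2) \<partial>hl)"
      by (simp add: ennreal_mult'[symmetric])
    finally show ?thesis .
  qed
  have sm: "(\<lambda>y. \<integral>x. sin (x * y) * e x \<partial>hl) \<in> borel_measurable hl" "(\<lambda>y. \<integral>x. cos (x * y) * e' x \<partial>hl) \<in> borel_measurable hl"
    by measurable
  have 1: "(\<integral>\<^sup>+l. ennreal ((ST e l)\<^sup>2) \<partial>hl) = (\<integral>\<^sup>+y. ennreal ((e y)\<^sup>2) \<partial>hl)"
    using scale[OF plancherel_sin[OF i(1) continuous_on_subset[OF c(1)] B] sm(1) em(1)]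
    by (simp add: ST_def mult.commute[of _ "_::real"])
  have "l * ST e l = sqrt (2 / pi) * (\<integral>y. cos (y * l) * e' y \<partial>hl)" for l
    using nice_parts(1)[OF e(1), of l] by (simp add: ST_def mult.left_commute mult.commute[of l])
  then have 2: "(\<integral>\<^sup>+l. ennreal ((l * ST e l)\<^sup>2) \<partial>hl) = (\<integral>\<^sup>+y. ennreal ((e' y)\<^sup>2) \<partial>hl)"
    using scale[OF plancherel_cos[OF i(2) continuous_on_subset[OF c(2)] B'] sm(2) em(2)] by simp
  have "ennreal (Nsq s (ST e)) = (\<integral>\<^sup>+l. ennreal ((l powr s * ST e l)\<^sup>2) \<partial>hl)"
    using nn_integral_Nsq[OF t] s by simp
  also have "\<dots> \<le> (\<integral>\<^sup>+l. ennreal ((ST e l)\<^sup>2) + ennreal ((l * ST e l)\<^sup>2) \<partial>hl)"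
    by (rule nn_integral_mono) (auto simp: ennreal_plus[symmetric] le simp del: ennreal_plus intro!: ennreal_leI)
  also have "\<dots> = (\<integral>\<^sup>+l. ennreal ((ST e l)\<^sup>2) \<partial>hl) + (\<integral>\<^sup>+l. ennreal ((l * ST e l)\<^sup>2) \<partial>hl)"
    by (rule nn_integral_add) measurable
  finally show ?thesis unfolding 1 2 .
qed

lemma nn_integral_bound_interval:
  assumes "\<And>y. y > 0 \<Longrightarrow> \<bar>f y\<bar> \<le> K" "\<And>y. y > b \<Longrightarrow> f y = 0" "b > 0"
  shows "(\<integral>\<^sup>+y. ennreal ((f y)\<^sup>2) \<partial>hl) \<le> ennreal (K\<^sup>2 * b)"
proof -
  have "(\<integral>\<^sup>+y. ennreal ((f y)\<^sup>2) \<partial>hl) \<le> (\<integral>\<^sup>+y. ennreal (K\<^sup>2) * indicator {0..b} y \<partial>lborel)"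
    unfolding nn_integral_hl
  proof (rule nn_integral_mono)
    fix y :: real
    have "(f y)\<^sup>2 \<le> K\<^sup>2" if "y > 0" using power_mono[OF assms(1)[OF that] abs_ge_zero, of 2] by simp
    then show "ennreal ((f y)\<^sup>2) * indicator {0<..} y \<le> ennreal (K\<^sup>2) * indicator {0..b} y"
      using assms(2)[of y] by (auto simp: indicator_def intro!: ennreal_leI)
  qed
  also have "\<dots> = ennreal (K\<^sup>2 * b)"
    using assms(3) by (simp add: nn_integral_cmult ennreal_mult')
  finally show ?thesis .
qed

text \<open>Cutting off at scale \<open>1/n\<close> costs little in \<open>H\<^sup>1\<close>, since a wavelike function vanishes linearly at \<open>0\<close>.\<close>

lemma wavelike_approx:
  assumes w: "wavelike w" and s: "0 < s" "s < 1" and \<epsilon>: "\<epsilon> > 0"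
  shows "\<exists>u\<in>bumps. Nsq s (ST (\<lambda>y. w y - u y)) < \<epsilon>"
proof -
  obtain h :: "real \<Rightarrow> real" where hC: "\<And>k. Ck1 k h" and h0: "\<And>x. x \<le> 1 \<Longrightarrow> h x = 0"
    and h1: "\<And>x. x \<ge> 2 \<Longrightarrow> h x = 1" and hb: "\<And>x. 0 \<le> h x" "\<And>x. h x \<le> 1"
    using smooth_step_exists by blast
  obtain h' where h': "\<And>x. (h has_real_derivative h' x) (at x)" "Ck1 0 h'" using hC[of "Suc 0"] by auto
  have h'z: "h' x = 0" if "x > 2" for x
  proof -
    have "((\<lambda>x. h x - 1) has_real_derivative h' x) (at x)" for x using h'(1)[of x] by (auto intro!: derivative_eq_intros)
    from derivative_zero_on_open[OF this, of "{2<..}" x] show ?thesis using that h1 by auto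
  qed
  obtain H where H: "H \<ge> 0" "\<And>x. x \<ge> 0 \<Longrightarrow> \<bar>h' x\<bar> \<le> H"
    using compact_support_bounded[of h' 2] h'(2) h'z by (auto simp: )
  have nw: "nice w" by (rule wavelike_nice[OF w])
  obtain w' w'' M where d: "derivs2 w w' w'' M" by (rule nice_derivs2[OF nw])
  have wC: "Ck1 k w" for k using w by (auto simp: wavelike_def)
  have wd: "\<And>x. (w has_real_derivative w' x) (at x)" and wc: "continuous_on UNIV w" "continuous_on UNIV w'"
    and wz: "\<And>y. y > M \<Longrightarrow> w y = 0" "\<And>y. y > M \<Longrightarrow> w' y = 0" and w00: "w 0 = 0"
    using d by (auto simp: derivs2_def)
  obtain B where B: "B \<ge> 0" "\<And>y. y \<ge> 0 \<Longrightarrow> \<bar>w y\<bar> \<le> B" using compact_support_bounded[OF wc(1) wz(1)] by blast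
  obtain B' where B': "B' \<ge> 0" "\<And>y. y \<ge> 0 \<Longrightarrow> \<bar>w' y\<bar> \<le> B'" using compact_support_bounded[OF wc(2) wz(2)] by blast
  have wlin: "\<bar>w y\<bar> \<le> B' * y" if "y > 0" for y
  proof -
    have "\<exists>z>0. z < y \<and> w y - w 0 = (y - 0) * w' z" by (rule MVT2[OF that wd])
    then obtain z where z: "0 < z" "z < y" "w y - w 0 = (y - 0) * w' z" by blast
    then have "\<bar>w y\<bar> = y * \<bar>w' z\<bar>" using w00 that by (simp add: abs_mult)
    also have "\<dots> \<le> y * B'" using B'(2)[of z] z that by (intro mult_left_mono) auto
    finally show ?thesis by (simp add: mult.commute)
  qed
  \<comment> \<open>Bound for the derivative of w (1 - h (n y)): \<open>B'\<close> from w', and 2 B'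
    H from the term with n h'(n y), where |w y| \<le> B' y compensates the factor n because only y
    \<le> 2 / n matters.\<close>
  define K where "K = B' + 2 * B' * H"
  \<comment> \<open>The error and its derivative vanish beyond 2 / n, so the sum of their squared
    L^2 norms is at most (B^2 + K^2) 2 / n.\<close>
  obtain n :: nat where n: "(B\<^sup>2 + K\<^sup>2) * 2 / \<epsilon> < n" using reals_Archimedean2 by blast
  then have n0: "real n > 0" using \<epsilon> by (smt (verit) divide_nonneg_pos mult_nonneg_nonneg zero_le_power2)
  define u where "u y = w y * h (real n * y + 0)" for y
  have uC: "Ck1 k u" for k unfolding u_def by (intro Ck1_mult Ck1_affine wC hC)
  have "u y = 0" if "y < 1 / real n \<or> y > M" for y
  proof (cases "y > M")
    case False
    then have "real n * y \<le> 1" using that n0 by (simp add: field_simps)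
    then show ?thesis by (simp add: u_def h0)
  qed (simp add: u_def wz)
  then have "\<exists>d>0. \<exists>M. \<forall>y. y < d \<or> y > M \<longrightarrow> u y = 0"
    using n0 by (intro exI[of _ "1 / real n"] conjI exI[of _ M]) auto
  then have u: "u \<in> bumps" unfolding bumps_def using uC by simp
  define e where "e y = w y - u y" for y
  have ne: "nice e" unfolding e_def by (rule nice_diff[OF nw bumps_nice[OF u]])
  obtain e' e'' N where ed: "derivs2 e e' e'' N" by (rule nice_derivs2[OF ne])
  have ee: "e y = w y * (1 - h (real n * y))" for y by (simp add: e_def u_def algebra_simps)
  have e'e: "e' y = w' y * (1 - h (real n * y)) - w y * (real n * h' (real n * y))" for y
  proof (rule DERIV_unique)
    show "(e has_real_derivative e' y) (at y)" using ed by (simp add: derivs2_def)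
    have "((\<lambda>y. real n * y) has_real_derivative real n) (at y)" by (auto intro!: derivative_eq_intros)
    from DERIV_chain2[OF h'(1) this] have "((\<lambda>y. h (real n * y)) has_real_derivative h' (real n * y) * real n) (at y)" .
    then show "(e has_real_derivative w' y * (1 - h (real n * y)) - w y * (real n * h' (real n * y))) (at y)"
      unfolding ee[abs_def] by (auto intro!: derivative_eq_intros wd)
  qed
  have far: "e y = 0" "e' y = 0" if "y > 2 / real n" for y
  proof -
    have "real n * y > 2" using that n0 by (simp add: field_simps)
    then show "e y = 0" "e' y = 0" using h1[of "real n * y"] h'z[of "real n * y"] by (auto simp: ee e'e)
  qed
  have b1: "\<bar>e y\<bar> \<le> B" if "y > 0" for y
  proof -
    have "\<bar>1 - h (real n * y)\<bar> \<le> 1" using hb[of "real n * y"] by simp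
    then have "\<bar>w y\<bar> * \<bar>1 - h (real n * y)\<bar> \<le> B * 1" using B(2)[of y] B(1) that by (intro mult_mono) auto
    then show ?thesis by (simp add: ee abs_mult)
  qed
  have b2: "\<bar>e' y\<bar> \<le> K" if "y > 0" for y
  proof (cases "y > 2 / real n")
    case True then show ?thesis using far B'(1) H(1) by (simp add: K_def)
  next
    case False
    then have ny: "y * real n \<le> 2" using n0 by (simp add: field_simps)
    have "\<bar>1 - h (real n * y)\<bar> \<le> 1" using hb[of "real n * y"] by simp
    then have p1: "\<bar>w' y\<bar> * \<bar>1 - h (real n * y)\<bar> \<le> B' * 1" using B'(2)[of y] B'(1) that by (intro mult_mono) auto
    have "\<bar>w y\<bar> * (real n * \<bar>h' (real n * y)\<bar>) \<le> (B' * y) * (real n * H)"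
      using wlin[OF that] H that B'(1) by (intro mult_mono) auto
    also have "\<dots> = B' * H * (y * real n)" by simp
    also have "\<dots> \<le> B' * H * 2" using ny B'(1) H(1) by (intro mult_left_mono) auto
    finally have p2: "\<bar>w y\<bar> * (real n * \<bar>h' (real n * y)\<bar>) \<le> 2 * B' * H" by simp
    have "\<bar>e' y\<bar> \<le> \<bar>w' y * (1 - h (real n * y))\<bar> + \<bar>w y * (real n * h' (real n * y))\<bar>"
      unfolding e'e by (rule abs_triangle_ineq4)
    then show ?thesis using p1 p2 by (simp add: abs_mult K_def)
  qed
  have "ennreal (Nsq s (ST e)) \<le> ennreal (B\<^sup>2 * (2 / real n)) + ennreal (K\<^sup>2 * (2 / real n))"
    by (rule order_trans[OF Nsq_ST_le[OF ed ne s]], rule add_mono; rule nn_integral_bound_interval)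
       (use b1 b2 far n0 in auto)
  also have "\<dots> = ennreal ((B\<^sup>2 + K\<^sup>2) * 2 / real n)"
    by (subst ennreal_plus[symmetric]) (auto simp: distrib_right add_divide_distrib)
  finally have "Nsq s (ST e) \<le> (B\<^sup>2 + K\<^sup>2) * 2 / real n"
    by (subst (asm) ennreal_le_iff) auto
  also have "\<dots> < \<epsilon>" using n n0 \<epsilon> by (simp add: field_simps)
  finally show ?thesis using u unfolding e_def by blast
qed

section \<open>Functionals and multipliers on the completion\<close>

lemma Cauchy_Schwarz_integral:
  fixes f g :: "'a \<Rightarrow> real"
  assumes [measurable]: "f \<in> borel_measurable M" "g \<in> borel_measurable M"
    and f: "integrable M (\<lambda>x. (f x)\<^sup>2)" and g: "integrable M (\<lambda>x. (g x)\<^sup>2)"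
  shows "integrable M (\<lambda>x. f x * g x)"
    and "\<bar>\<integral>x. f x * g x \<partial>M\<bar> \<le> sqrt (\<integral>x. (f x)\<^sup>2 \<partial>M) * sqrt (\<integral>x. (g x)\<^sup>2 \<partial>M)"
proof -
  show i: "integrable M (\<lambda>x. f x * g x)"
  proof (rule Bochner_Integration.integrable_bound[OF Bochner_Integration.integrable_add[OF f g]])
    have "\<bar>a * b\<bar> \<le> a\<^sup>2 + b\<^sup>2" for a b :: real
    proof -
      have "0 \<le> (\<bar>a\<bar> - \<bar>b\<bar>)\<^sup>2" by simp
      then have "2 * (\<bar>a\<bar> * \<bar>b\<bar>) \<le> a\<^sup>2 + b\<^sup>2" by (simp add: power2_diff)
      moreover have "0 \<le> \<bar>a\<bar> * \<bar>b\<bar>" by simp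
      ultimately show ?thesis unfolding abs_mult by linarith
    qed
    then show "AE x in M. norm (f x * g x) \<le> norm ((f x)\<^sup>2 + (g x)\<^sup>2)" by simp
  qed measurable
  have "(ennreal (\<integral>x. \<bar>f x * g x\<bar> \<partial>M))\<^sup>2 = (\<integral>\<^sup>+x. ennreal \<bar>f x\<bar> * ennreal \<bar>g x\<bar> \<partial>M)\<^sup>2"
    using nn_integral_eq_integral[OF integrable_abs[OF i]] by (simp add: abs_mult ennreal_mult'')
  also have "\<dots> \<le> (\<integral>\<^sup>+x. (ennreal \<bar>f x\<bar>)\<^sup>2 \<partial>M) * (\<integral>\<^sup>+x. (ennreal \<bar>g x\<bar>)\<^sup>2 \<partial>M)"
    by (rule Cauchy_Schwarz_nn_integral) measurable
  also have "\<dots> = ennreal (\<integral>x. (f x)\<^sup>2 \<partial>M) * ennreal (\<integral>x. (g x)\<^sup>2 \<partial>M)"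
    using nn_integral_eq_integral[OF f] nn_integral_eq_integral[OF g] by (simp add: ennreal_power)
  finally have "(\<integral>x. \<bar>f x * g x\<bar> \<partial>M)\<^sup>2 \<le> (\<integral>x. (f x)\<^sup>2 \<partial>M) * (\<integral>x. (g x)\<^sup>2 \<partial>M)"
    by (simp add: ennreal_power ennreal_mult[symmetric])
  then have "(\<integral>x. \<bar>f x * g x\<bar> \<partial>M) \<le> sqrt ((\<integral>x. (f x)\<^sup>2 \<partial>M) * (\<integral>x. (g x)\<^sup>2 \<partial>M))"
    by (rule real_le_rsqrt)
  then show "\<bar>\<integral>x. f x * g x \<partial>M\<bar> \<le> sqrt (\<integral>x. (f x)\<^sup>2 \<partial>M) * sqrt (\<integral>x. (g x)\<^sup>2 \<partial>M)"
    using order_trans[OF integral_abs_bound[of M "\<lambda>x. f x * g x"]] by (simp add: real_sqrt_mult)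
qed

text \<open>The range of \<sigma> is the one in which transforms of nice functions have finite
  weighted norms. For 0 < s < 1 it covers both orders s and s - 1 of the theorem.\<close>

locale completion =
  fixes \<sigma> :: real and j :: "(real ^ 3 \<Rightarrow> real) \<Rightarrow> 'h::{banach, second_countable_topology}"
  assumes HD: "is_HD_rad \<sigma> j" and \<sigma>: "- 1 < \<sigma>" "\<sigma> < 1"
begin

definition J :: "(real \<Rightarrow> real) \<Rightarrow> 'h" where "J w = j (tf w)"

lemma tf_mem: "w \<in> bumps \<Longrightarrow> tf w \<in> HD_test \<sigma>"
  using HD_test_eq[OF \<sigma>] by blast

lemma J_add: "v \<in> bumps \<Longrightarrow> w \<in> bumps \<Longrightarrow> J (\<lambda>y. v y + w y) = J v + J w"
proof -
  assume a: "v \<in> bumps" "w \<in> bumps"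
  have "tf (\<lambda>y. v y + w y) = (\<lambda>x. tf v x + tf w x)" by (simp add: tf_def fun_eq_iff add_divide_distrib)
  then show ?thesis using HD tf_mem[OF a(1)] tf_mem[OF a(2)] by (simp add: J_def is_HD_rad_def)
qed

lemma J_cmult: "w \<in> bumps \<Longrightarrow> J (\<lambda>y. c * w y) = c *\<^sub>R J w"
proof -
  assume a: "w \<in> bumps"
  have "tf (\<lambda>y. c * w y) = (\<lambda>x. c * tf w x)" by (simp add: tf_def fun_eq_iff)
  then show ?thesis using HD tf_mem[OF a] by (simp add: J_def is_HD_rad_def)
qed

lemma J_diff: "v \<in> bumps \<Longrightarrow> w \<in> bumps \<Longrightarrow> J (\<lambda>y. v y - w y) = J v - J w"
  using J_add[of v "\<lambda>y. (- 1) * w y"] J_cmult[of w "- 1"] bumps_cmult[of w "- 1"] by simp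

lemma norm_J: "w \<in> bumps \<Longrightarrow> norm (J w) = sqrt (4 * pi * Nsq \<sigma> (ST w))"
proof -
  assume a: "w \<in> bumps"
  have "ennreal (norm (J w)) = ennreal (sqrt (4 * pi * Nsq \<sigma> (ST w)))"
    using HD tf_mem[OF a] HD_norm_tf[OF a \<sigma>] by (simp add: J_def is_HD_rad_def)
  then show ?thesis by (subst (asm) ennreal_inj) auto
qed

lemma norm_J_diff:
  assumes "v \<in> bumps" "w \<in> bumps"
  shows "(norm (J v - J w))\<^sup>2 = 4 * pi * Nsq \<sigma> (\<lambda>l. ST v l - ST w l)"
proof -
  have "ST (\<lambda>y. v y - w y) = (\<lambda>l. ST v l - ST w l)"
    using ST_diff[OF bumps_nice bumps_nice, OF assms] by (rule ext)
  then show ?thesis using norm_J[OF bumps_diff[OF assms]] by (simp add: J_diff[OF assms])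
qed

lemma J_dense: "\<exists>w. (\<forall>n. w n \<in> bumps) \<and> (\<lambda>n. J (w n)) \<longlonglongrightarrow> h"
proof -
  have "closure (J ` bumps) = UNIV"
    using HD unfolding is_HD_rad_def HD_test_eq[OF \<sigma>] by (simp add: image_image J_def)
  then have "h \<in> closure (J ` bumps)" by simp
  then obtain x where x: "\<forall>n. x n \<in> J ` bumps" "x \<longlonglongrightarrow> h" unfolding closure_sequential by blast
  then have "\<forall>n. \<exists>w\<in>bumps. x n = J w" by blast
  then obtain w where w: "\<forall>n. w n \<in> bumps \<and> x n = J (w n)" using choice[of "\<lambda>n w. w \<in> bumps \<and> x n = J w"] by blast
  then have "x = (\<lambda>n. J (w n))" by (intro ext) simp
  then show ?thesis using w x(2) by (intro exI[of _ w]) simp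
qed

text \<open>Extension by continuity from a dense subspace. The functional is given on bumps, not on
  their images under \<open>J\<close>; the bound makes the limit independent of the approximating
  sequence.\<close>

lemma extend_functional:
  fixes T :: "(real \<Rightarrow> real) \<Rightarrow> real"
  assumes add: "\<And>v w. v \<in> bumps \<Longrightarrow> w \<in> bumps \<Longrightarrow> T (\<lambda>y. v y + w y) = T v + T w"
    and cmult: "\<And>c w. w \<in> bumps \<Longrightarrow> T (\<lambda>y. c * w y) = c * T w"
    and bound: "\<And>w. w \<in> bumps \<Longrightarrow> \<bar>T w\<bar> \<le> C * norm (J w)"
  shows "\<exists>L. bounded_linear L \<and> (\<forall>w\<in>bumps. L (J w) = T w) \<and> (\<forall>h. \<bar>L h\<bar> \<le> C * norm h)"
proof -
  have C: "\<bar>T v - T w\<bar> \<le> \<bar>C\<bar> * norm (J v - J w)" if "v \<in> bumps" "w \<in> bumps" for v w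
  proof -
    have "T (\<lambda>y. v y + (- 1) * w y) = T v - T w"
      using add[of v "\<lambda>y. (- 1) * w y"] cmult[of w "- 1"] bumps_cmult[of w "- 1"] that by simp
    then have "T (\<lambda>y. v y - w y) = T v - T w" by simp
    then have "\<bar>T v - T w\<bar> \<le> C * norm (J v - J w)"
      using bound[OF bumps_diff[OF that]] J_diff[OF that] by simp
    also have "\<dots> \<le> \<bar>C\<bar> * norm (J v - J w)" by (rule mult_right_mono) auto
    finally show ?thesis .
  qed
  define W where "W h = (SOME w. (\<forall>n. w n \<in> bumps) \<and> (\<lambda>n. J (w n)) \<longlonglongrightarrow> h)" for h
  have W: "W h n \<in> bumps" "(\<lambda>n. J (W h n)) \<longlonglongrightarrow> h" for h n
    using someI_ex[OF J_dense[of h]] unfolding W_def by auto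
  define L where "L h = lim (\<lambda>n. T (W h n))" for h
  have conv: "(\<lambda>n. T (W h n)) \<longlonglongrightarrow> L h" for h
  proof -
    have cJ: "Cauchy (\<lambda>n. J (W h n))" by (rule LIMSEQ_imp_Cauchy[OF W(2)])
    have "Cauchy (\<lambda>n. T (W h n))"
    proof (rule metric_CauchyI)
      fix e :: real assume e: "e > 0"
      then have "e / (\<bar>C\<bar> + 1) > 0" by simp
      from metric_CauchyD[OF cJ this] obtain M where
        M: "\<And>m n. m \<ge> M \<Longrightarrow> n \<ge> M \<Longrightarrow> dist (J (W h m)) (J (W h n)) < e / (\<bar>C\<bar> + 1)" by blast
      have "dist (T (W h m)) (T (W h n)) < e" if "m \<ge> M" "n \<ge> M" for m n
      proof -
        have "\<bar>T (W h m) - T (W h n)\<bar> \<le> \<bar>C\<bar> * norm (J (W h m) - J (W h n))" by (rule C[OF W(1) W(1)])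
        also have "\<dots> \<le> (\<bar>C\<bar> + 1) * norm (J (W h m) - J (W h n))" by (rule mult_right_mono) auto
        also have "\<dots> < e" using M[OF that] by (simp add: dist_norm field_simps)
        finally show ?thesis by (simp add: dist_real_def)
      qed
      then show "\<exists>M. \<forall>m\<ge>M. \<forall>n\<ge>M. dist (T (W h m)) (T (W h n)) < e" by (intro exI[of _ M] allI impI)
    qed
    then have "convergent (\<lambda>n. T (W h n))" by (rule Cauchy_convergent)
    then show ?thesis unfolding L_def by (rule convergent_LIMSEQ_iff[THEN iffD1])
  qed
  have lim: "(\<lambda>n. T (v n)) \<longlonglongrightarrow> L h" if v: "\<And>n. v n \<in> bumps" "(\<lambda>n. J (v n)) \<longlonglongrightarrow> h" for v h
  proof -
    have "(\<lambda>n. \<bar>C\<bar> * norm (J (v n) - J (W h n))) \<longlonglongrightarrow> \<bar>C\<bar> * norm (h - h)"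
      by (rule tendsto_mult[OF tendsto_const tendsto_norm[OF tendsto_diff[OF v(2) W(2)]]])
    then have 0: "(\<lambda>n. \<bar>C\<bar> * norm (J (v n) - J (W h n))) \<longlonglongrightarrow> 0" by simp
    have "(\<lambda>n. T (v n) - T (W h n)) \<longlonglongrightarrow> 0"
    proof (rule Lim_null_comparison[OF _ 0], rule always_eventually, rule allI)
      show "norm (T (v n) - T (W h n)) \<le> \<bar>C\<bar> * norm (J (v n) - J (W h n))" for n
        unfolding real_norm_def by (rule C[OF v(1) W(1)])
    qed
    from tendsto_add[OF this conv[of h]] show ?thesis by simp
  qed
  have LJ: "L (J w) = T w" if "w \<in> bumps" for w
    using lim[of "\<lambda>_. w" "J w"] that by (simp add: LIMSEQ_const_iff)
  have Lb: "\<bar>L h\<bar> \<le> C * norm h" for h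
  proof (rule LIMSEQ_le)
    show "(\<lambda>n. \<bar>T (W h n)\<bar>) \<longlonglongrightarrow> \<bar>L h\<bar>" by (intro tendsto_rabs conv)
    show "(\<lambda>n. C * norm (J (W h n))) \<longlonglongrightarrow> C * norm h" by (intro tendsto_intros W)
  qed (use bound W in auto)
  have "bounded_linear L"
  proof (rule bounded_linear_intro[where K=C])
    fix x y :: 'h and r :: real
    have "(\<lambda>n. T (\<lambda>t. W x n t + W y n t)) \<longlonglongrightarrow> L (x + y)"
    proof (rule lim)
      have "(\<lambda>n. J (W x n) + J (W y n)) \<longlonglongrightarrow> x + y" by (intro tendsto_add W)
      then show "(\<lambda>n. J (\<lambda>t. W x n t + W y n t)) \<longlonglongrightarrow> x + y" by (simp add: J_add W)
    qed (intro bumps_add W)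
    moreover have "(\<lambda>n. T (\<lambda>t. W x n t + W y n t)) \<longlonglongrightarrow> L x + L y"
      using tendsto_add[OF conv[of x] conv[of y]] by (simp add: add W)
    ultimately show "L (x + y) = L x + L y" by (rule LIMSEQ_unique)
    have "(\<lambda>n. T (\<lambda>t. r * W x n t)) \<longlonglongrightarrow> L (r *\<^sub>R x)"
    proof (rule lim)
      have "(\<lambda>n. r *\<^sub>R J (W x n)) \<longlonglongrightarrow> r *\<^sub>R x" by (intro tendsto_intros W)
      then show "(\<lambda>n. J (\<lambda>t. r * W x n t)) \<longlonglongrightarrow> r *\<^sub>R x" by (simp add: J_cmult W)
    qed (intro bumps_cmult W)
    moreover have "(\<lambda>n. T (\<lambda>t. r * W x n t)) \<longlonglongrightarrow> r * L x"
      using tendsto_mult[OF tendsto_const[of r] conv[of x]] by (simp add: cmult W)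
    ultimately have "L (r *\<^sub>R x) = r * L x" by (rule LIMSEQ_unique)
    then show "L (r *\<^sub>R x) = r *\<^sub>R L x" by simp
    show "norm (L x) \<le> norm x * C" using Lb[of x] by (simp add: mult.commute)
  qed
  then show ?thesis using LJ Lb by blast
qed

text \<open>Square integrability against the dual weight l^(-\<sigma>), as Cauchy-Schwarz asks for
  when \<kappa> is paired with transforms of order \<sigma>.\<close>

definition adm :: "(real \<Rightarrow> real) \<Rightarrow> bool" where
  "adm \<kappa> \<longleftrightarrow> \<kappa> \<in> borel_measurable hl \<and> integrable hl (\<lambda>l. (\<kappa> l * l powr (- \<sigma>))\<^sup>2)"

text \<open>The continuous extension of \<open>J w \<mapsto> \<integral> \<kappa> \<cdot> ST w\<close>; a junk value unless \<open>adm \<kappa>\<close>.\<close>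

definition Lam :: "(real \<Rightarrow> real) \<Rightarrow> 'h \<Rightarrow> real" where
  "Lam \<kappa> = (SOME L. bounded_linear L \<and> (\<forall>w\<in>bumps. L (J w) = (\<integral>l. \<kappa> l * ST w l \<partial>hl)) \<and>
     (\<forall>h. \<bar>L h\<bar> \<le> sqrt (Nsq (- \<sigma>) \<kappa>) * norm h))"

lemma ST_measurable: "nice w \<Longrightarrow> ST w \<in> borel_measurable hl"
  using tame_ST[of w] borel_measurable_hl_cont[of "ST w"] by (auto simp: tame_def)

lemma adm_pairing:
  assumes k: "adm \<kappa>" and a: "a \<in> borel_measurable hl" "integrable hl (\<lambda>l. (l powr \<sigma> * a l)\<^sup>2)"
  shows "integrable hl (\<lambda>l. \<kappa> l * a l)" "\<bar>\<integral>l. \<kappa> l * a l \<partial>hl\<bar> \<le> sqrt (Nsq (- \<sigma>) \<kappa>) * sqrt (Nsq \<sigma> a)"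
proof -
  have [measurable]: "\<kappa> \<in> borel_measurable hl" "a \<in> borel_measurable hl" using k a by (auto simp: adm_def)
  have [measurable]: "(\<lambda>l::real. l powr p) \<in> borel_measurable hl" for p by (rule borel_measurable_hlI) simp
  have e: "\<kappa> l * l powr (- \<sigma>) * (l powr \<sigma> * a l) = \<kappa> l * a l" if "l \<in> space hl" for l
    using that by (simp add: powr_minus field_simps)
  have k2: "integrable hl (\<lambda>l. (\<kappa> l * l powr (- \<sigma>))\<^sup>2)" using k by (simp add: adm_def)
  note CS = Cauchy_Schwarz_integral[OF _ _ k2 a(2)]
  have "integrable hl (\<lambda>l. \<kappa> l * l powr (- \<sigma>) * (l powr \<sigma> * a l))" by (rule CS(1)) measurable
  then show "integrable hl (\<lambda>l. \<kappa> l * a l)" by (rule Bochner_Integration.integrable_cong[THEN iffD1, OF refl e, rotated])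
  have "\<bar>\<integral>l. \<kappa> l * l powr (- \<sigma>) * (l powr \<sigma> * a l) \<partial>hl\<bar> \<le>
     sqrt (\<integral>l. (\<kappa> l * l powr (- \<sigma>))\<^sup>2 \<partial>hl) * sqrt (\<integral>l. (l powr \<sigma> * a l)\<^sup>2 \<partial>hl)" by (rule CS(2)) measurable
  moreover have "(\<integral>l. \<kappa> l * l powr (- \<sigma>) * (l powr \<sigma> * a l) \<partial>hl) = (\<integral>l. \<kappa> l * a l \<partial>hl)"
    by (rule Bochner_Integration.integral_cong[OF refl e])
  ultimately show "\<bar>\<integral>l. \<kappa> l * a l \<partial>hl\<bar> \<le> sqrt (Nsq (- \<sigma>) \<kappa>) * sqrt (Nsq \<sigma> a)"
    by (simp add: Nsq_def mult.commute[of "\<kappa> _"])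
qed

lemma bumps_pairing: "w \<in> bumps \<Longrightarrow> ST w \<in> borel_measurable hl"
  "w \<in> bumps \<Longrightarrow> integrable hl (\<lambda>l. (l powr \<sigma> * ST w l)\<^sup>2)"
  by (auto intro!: ST_measurable bumps_nice tame_square_integrable tame_ST \<sigma>)

lemma Lam_ex:
  assumes k: "adm \<kappa>"
  shows "\<exists>L. bounded_linear L \<and> (\<forall>w\<in>bumps. L (J w) = (\<integral>l. \<kappa> l * ST w l \<partial>hl)) \<and> (\<forall>h. \<bar>L h\<bar> \<le> sqrt (Nsq (- \<sigma>) \<kappa>) * norm h)"
proof (rule extend_functional)
  have i: "integrable hl (\<lambda>l. \<kappa> l * ST w l)" if "w \<in> bumps" for w
    by (rule adm_pairing(1)[OF k bumps_pairing[OF that]])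
  show "(\<integral>l. \<kappa> l * ST (\<lambda>y. v y + w y) l \<partial>hl) = (\<integral>l. \<kappa> l * ST v l \<partial>hl) + (\<integral>l. \<kappa> l * ST w l \<partial>hl)"
    if "v \<in> bumps" "w \<in> bumps" for v w
    using i that by (simp add: ST_add bumps_nice distrib_left)
  show "(\<integral>l. \<kappa> l * ST (\<lambda>y. c * w y) l \<partial>hl) = c * (\<integral>l. \<kappa> l * ST w l \<partial>hl)" for c w
    unfolding ST_cmult mult.left_commute[of _ c] by (rule integral_mult_right_zero)
  show "\<bar>\<integral>l. \<kappa> l * ST w l \<partial>hl\<bar> \<le> sqrt (Nsq (- \<sigma>) \<kappa>) * norm (J w)" if "w \<in> bumps" for w
  proof -
    have "\<bar>\<integral>l. \<kappa> l * ST w l \<partial>hl\<bar> \<le> sqrt (Nsq (- \<sigma>) \<kappa>) * sqrt (Nsq \<sigma> (ST w))"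
      by (rule adm_pairing(2)[OF k bumps_pairing[OF that]])
    also have "\<dots> \<le> sqrt (Nsq (- \<sigma>) \<kappa>) * norm (J w)"
    proof (rule mult_left_mono)
      \<comment> \<open>The norm of \<open>J w\<close> squared is 4 pi times
        \<open>Nsq \<sigma> (ST w)\<close>; the factor 4 pi \<ge> 1 is given away.\<close>
      have "1 * Nsq \<sigma> (ST w) \<le> 4 * pi * Nsq \<sigma> (ST w)" using pi_gt3 by (intro mult_right_mono) auto
      then show "sqrt (Nsq \<sigma> (ST w)) \<le> norm (J w)" by (simp add: norm_J[OF that])
    qed simp
    finally show ?thesis .
  qed
qed

lemma Lam:
  assumes "adm \<kappa>"
  shows Lam_bounded_linear: "bounded_linear (Lam \<kappa>)" and Lam_J: "w \<in> bumps \<Longrightarrow> Lam \<kappa> (J w) = (\<integral>l. \<kappa> l * ST w l \<partial>hl)"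
    and Lam_le: "\<bar>Lam \<kappa> h\<bar> \<le> sqrt (Nsq (- \<sigma>) \<kappa>) * norm h"
  using someI_ex[OF Lam_ex[OF assms], folded Lam_def] by simp_all

end

section \<open>Multipliers as maps between two completions\<close>

lemma Nsq_cong: "(\<And>l. l > 0 \<Longrightarrow> a l = b l) \<Longrightarrow> Nsq \<sigma> a = Nsq \<sigma> b"
  unfolding Nsq_def by (rule Bochner_Integration.integral_cong) auto

lemma Nsq_uminus: "Nsq \<sigma> (\<lambda>l. - a l) = Nsq \<sigma> a"
  by (simp only: Nsq_def mult_minus_right power2_minus)

lemma square_sum3_le: "(a + b + c)\<^sup>2 \<le> 3 * (a\<^sup>2 + b\<^sup>2 + c\<^sup>2)" for a b c :: real
proof -
  have "0 \<le> (a - b)\<^sup>2 + (b - c)\<^sup>2 + (a - c)\<^sup>2" by simp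
  then show ?thesis by (simp add: power2_eq_square algebra_simps)
qed

lemma Nsq_sum3_le:
  assumes "integrable hl (\<lambda>l. (l powr \<sigma> * a l)\<^sup>2)" "integrable hl (\<lambda>l. (l powr \<sigma> * b l)\<^sup>2)"
    "integrable hl (\<lambda>l. (l powr \<sigma> * c l)\<^sup>2)" "integrable hl (\<lambda>l. (l powr \<sigma> * (a l + b l + c l))\<^sup>2)"
  shows "Nsq \<sigma> (\<lambda>l. a l + b l + c l) \<le> 3 * (Nsq \<sigma> a + Nsq \<sigma> b + Nsq \<sigma> c)"
proof -
  have "Nsq \<sigma> (\<lambda>l. a l + b l + c l) \<le> (\<integral>l. 3 * ((l powr \<sigma> * a l)\<^sup>2 + (l powr \<sigma> * b l)\<^sup>2 + (l powr \<sigma> * c l)\<^sup>2) \<partial>hl)"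
    unfolding Nsq_def
  proof (rule integral_mono)
    fix l
    have "(l powr \<sigma> * (a l + b l + c l)) = l powr \<sigma> * a l + l powr \<sigma> * b l + l powr \<sigma> * c l" by (simp add: distrib_left)
    then show "(l powr \<sigma> * (a l + b l + c l))\<^sup>2 \<le> 3 * ((l powr \<sigma> * a l)\<^sup>2 + (l powr \<sigma> * b l)\<^sup>2 + (l powr \<sigma> * c l)\<^sup>2)"
      by (simp only: square_sum3_le)
  qed (use assms in auto)
  also have "\<dots> = 3 * (Nsq \<sigma> a + Nsq \<sigma> b + Nsq \<sigma> c)"
    using assms(1-3) unfolding Nsq_def by simp
  finally show ?thesis .
qed

text \<open>Properties of m under which \<open>fcalc_ext\<close> is an honest map. Bumps are sent to
  wavelike functions, which bumps approximate in positive order \<tau>; the bound with D makes the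
  map continuous from order \<sigma> to order \<tau>; continuity of m serves measurability.\<close>

locale multiplier = src: completion \<sigma> j + dst: completion \<tau> i
  for \<sigma> :: real and j :: "(real ^ 3 \<Rightarrow> real) \<Rightarrow> 'h::{banach, second_countable_topology}"
    and \<tau> :: real and i :: "(real ^ 3 \<Rightarrow> real) \<Rightarrow> 'k::{banach, second_countable_topology}" +
  fixes m :: "real \<Rightarrow> real" and D :: real
  assumes wave: "v \<in> bumps \<Longrightarrow> \<exists>w. wavelike w \<and> (\<forall>l>0. ST w l = m l * ST v l)"
    and m_bound: "l > 0 \<Longrightarrow> \<bar>m l\<bar> * l powr \<tau> \<le> D * l powr \<sigma>"
    and m_cont: "continuous_on {0<..} m"
    and \<tau>_pos: "\<tau> > 0" and D_nonneg: "D \<ge> 0"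
begin

text \<open>Up to 4 pi, the squared distance in order \<tau> between the bump u and the image of v
  under the multiplier. It is formed on the transform side, because this image need not come from a
  bump.\<close>

definition R :: "(real \<Rightarrow> real) \<Rightarrow> (real \<Rightarrow> real) \<Rightarrow> real" where
  "R u v = Nsq \<tau> (\<lambda>l. ST u l - m l * ST v l)"

lemma R_nonneg: "R u v \<ge> 0" by (simp add: R_def)

text \<open>For l > 0 the residual is the transform of the nice function u - w, where w is the
  wavelike image of v.\<close>

lemma R_integrable:
  assumes "u \<in> bumps" "v \<in> bumps"
  shows "(\<lambda>l. ST u l - m l * ST v l) \<in> borel_measurable hl" "integrable hl (\<lambda>l. (l powr \<tau> * (ST u l - m l * ST v l))\<^sup>2)"
proof -
  obtain w where w: "wavelike w" "\<And>l. l > 0 \<Longrightarrow> ST w l = m l * ST v l" using wave[OF assms(2)] by blast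
  have n: "nice (\<lambda>y. u y - w y)" by (intro nice_diff bumps_nice assms wavelike_nice w)
  have e: "ST (\<lambda>y. u y - w y) l = ST u l - m l * ST v l" if "l \<in> space hl" for l
    using ST_diff[OF bumps_nice[OF assms(1)] wavelike_nice[OF w(1)], of l] w(2)[of l] that by simp
  show "(\<lambda>l. ST u l - m l * ST v l) \<in> borel_measurable hl"
    using dst.ST_measurable[OF n] by (rule measurable_cong[THEN iffD1, OF e, rotated])
  show "integrable hl (\<lambda>l. (l powr \<tau> * (ST u l - m l * ST v l))\<^sup>2)"
    using tame_square_integrable[OF tame_ST[OF n] dst.\<sigma>]
    by (rule Bochner_Integration.integrable_cong[THEN iffD1, OF refl, rotated]) (simp add: e)
qed

lemma HD_norm_R:
  assumes "u \<in> bumps" "v \<in> bumps"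
  shows "HD_norm \<tau> (\<lambda>x. tf u x - fcalc m (tf v) x) = ennreal (sqrt (4 * pi * R u v))"
proof -
  obtain w where w: "wavelike w" "\<And>l. l > 0 \<Longrightarrow> ST w l = m l * ST v l" using wave[OF assms(2)] by blast
  have n: "nice (\<lambda>y. u y - w y)" by (intro nice_diff bumps_nice assms wavelike_nice w)
  have "R u v = Nsq \<tau> (ST (\<lambda>y. u y - w y))"
    unfolding R_def using ST_diff[OF bumps_nice[OF assms(1)] wavelike_nice[OF w(1)]] w(2) by (intro Nsq_cong) simp
  moreover have "HD_norm \<tau> (\<lambda>x. tf u x - fcalc m (tf v) x) = ennreal (sqrt (4 * pi * Nsq \<tau> (ST (\<lambda>y. u y - w y))))"
  proof (rule HD_norm_eq[OF n _ dst.\<sigma>])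
    fix y :: real assume y: "y > 0"
    show "(1 + y) * profile (\<lambda>x. tf u x - fcalc m (tf v) x) (1 + y) = u y - w y"
      using profile_tf[OF y, of u] profile_fcalc[OF assms(2) wavelike_nice[OF w(1)] w(2) y]
      by (simp add: profile_def right_diff_distrib)
  qed
  ultimately show ?thesis by simp
qed

lemma R_approx: "v \<in> bumps \<Longrightarrow> e > 0 \<Longrightarrow> \<exists>u\<in>bumps. R u v < e"
proof -
  assume v: "v \<in> bumps" and e: "e > 0"
  obtain w where w: "wavelike w" "\<And>l. l > 0 \<Longrightarrow> ST w l = m l * ST v l" using wave[OF v] by blast
  obtain u where u: "u \<in> bumps" "Nsq \<tau> (ST (\<lambda>y. w y - u y)) < e"
    using wavelike_approx[OF w(1) \<tau>_pos dst.\<sigma>(2) e] by blast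
  have "R u v = Nsq \<tau> (\<lambda>l. - ST (\<lambda>y. w y - u y) l)"
    unfolding R_def using ST_diff[OF wavelike_nice[OF w(1)] bumps_nice[OF u(1)]] w(2) by (intro Nsq_cong) simp
  then show ?thesis using u by (intro bexI[of _ u]) (simp_all add: Nsq_uminus)
qed

lemma Nsq_mult_le:
  assumes v: "v \<in> bumps"
  shows "integrable hl (\<lambda>l. (l powr \<tau> * (m l * ST v l))\<^sup>2)" "Nsq \<tau> (\<lambda>l. m l * ST v l) \<le> D\<^sup>2 * Nsq \<sigma> (ST v)"
proof -
  have 1: "integrable hl (\<lambda>l. D\<^sup>2 * (l powr \<sigma> * ST v l)\<^sup>2)"
    by (intro integrable_mult_right tame_square_integrable tame_ST bumps_nice v src.\<sigma>)
  have 2: "(l powr \<tau> * (m l * ST v l))\<^sup>2 \<le> D\<^sup>2 * (l powr \<sigma> * ST v l)\<^sup>2" if "l > 0" for l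
  proof -
    have "(\<bar>m l\<bar> * l powr \<tau>)\<^sup>2 \<le> (D * l powr \<sigma>)\<^sup>2" by (rule power_mono[OF m_bound[OF that]]) simp
    then have "(\<bar>m l\<bar> * l powr \<tau>)\<^sup>2 * (ST v l)\<^sup>2 \<le> (D * l powr \<sigma>)\<^sup>2 * (ST v l)\<^sup>2" by (rule mult_right_mono) simp
    then show ?thesis by (simp add: power_mult_distrib mult_ac)
  qed
  have [measurable]: "ST v \<in> borel_measurable hl" "m \<in> borel_measurable hl" "(\<lambda>l::real. l powr \<tau>) \<in> borel_measurable hl"
    by (rule src.ST_measurable[OF bumps_nice[OF v]], rule borel_measurable_hl_cont[OF m_cont], rule borel_measurable_hlI, measurable)
  show 3: "integrable hl (\<lambda>l. (l powr \<tau> * (m l * ST v l))\<^sup>2)"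
    by (rule Bochner_Integration.integrable_bound[OF 1]) (measurable, rule AE_hlI, simp only: real_norm_def abs_power2, rule order_trans[OF 2 abs_ge_self])
  show "Nsq \<tau> (\<lambda>l. m l * ST v l) \<le> D\<^sup>2 * Nsq \<sigma> (ST v)"
    unfolding Nsq_def integral_mult_right_zero[symmetric] by (rule integral_mono[OF 3 1]) (use 2 in simp)
qed

text \<open>On the transform side, u - u' = (u - m v) - (u' - m v') + m (v - v'). Squaring three
  summands costs the factor 3, whence 12 pi = 3 times 4 pi; the last summand is controlled by
  D.\<close>

lemma dist_image_le:
  assumes b: "u \<in> bumps" "v \<in> bumps" "u' \<in> bumps" "v' \<in> bumps"
  shows "(norm (dst.J u - dst.J u'))\<^sup>2 \<le> 12 * pi * (R u v + R u' v') + 3 * D\<^sup>2 * (norm (src.J v - src.J v'))\<^sup>2"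
proof -
  have vv: "(\<lambda>y. v y - v' y) \<in> bumps" by (rule bumps_diff[OF b(2,4)])
  have Sv: "ST (\<lambda>y. v y - v' y) l = ST v l - ST v' l" for l by (rule ST_diff[OF bumps_nice[OF b(2)] bumps_nice[OF b(4)]])
  have eq: "(\<lambda>l. ST u l - ST u' l) = (\<lambda>l. (ST u l - m l * ST v l) + - (ST u' l - m l * ST v' l) + m l * ST (\<lambda>y. v y - v' y) l)"
    by (simp add: fun_eq_iff Sv algebra_simps)
  have neg: "Nsq \<tau> (\<lambda>l. - (ST u' l - m l * ST v' l)) = R u' v'" unfolding R_def by (rule Nsq_uminus)
  have i2: "integrable hl (\<lambda>l. (l powr \<tau> * - (ST u' l - m l * ST v' l))\<^sup>2)" using R_integrable(2)[OF b(3,4)] by (simp only: mult_minus_right power2_minus)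
  have i0: "integrable hl (\<lambda>l. (l powr \<tau> * (ST u l - ST u' l))\<^sup>2)"
    by (intro tame_square_integrable tame_diff tame_ST bumps_nice b dst.\<sigma>)
  have "Nsq \<tau> (\<lambda>l. ST u l - ST u' l) \<le> 3 * (R u v + R u' v' + Nsq \<tau> (\<lambda>l. m l * ST (\<lambda>y. v y - v' y) l))"
    using Nsq_sum3_le[OF R_integrable(2)[OF b(1,2)] i2 Nsq_mult_le(1)[OF vv] i0[unfolded fun_cong[OF eq]]]
    unfolding neg eq by (simp only: R_def)
  also have "\<dots> \<le> 3 * (R u v + R u' v' + D\<^sup>2 * Nsq \<sigma> (\<lambda>l. ST v l - ST v' l))"
    using Nsq_mult_le(2)[OF vv] by (simp add: Sv[abs_def])
  finally have "4 * pi * Nsq \<tau> (\<lambda>l. ST u l - ST u' l) \<le> 4 * pi * (3 * (R u v + R u' v' + D\<^sup>2 * Nsq \<sigma> (\<lambda>l. ST v l - ST v' l)))"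
    by (rule mult_left_mono) simp
  then show ?thesis unfolding dst.norm_J_diff[OF b(1,3)] src.norm_J_diff[OF b(2,4)] by (simp add: algebra_simps)
qed

text \<open>Eliminates test functions and norms on \<open>Omega\<close> in favour of bumps and the
  residual \<open>R\<close>, so that existence and uniqueness become statements about
  transforms.\<close>

lemma has_fcalc_iff:
  "has_fcalc \<sigma> j \<tau> i m h k \<longleftrightarrow>
    (\<exists>v u. (\<forall>n. v n \<in> bumps) \<and> (\<forall>n. u n \<in> bumps) \<and> (\<lambda>n. src.J (v n)) \<longlonglongrightarrow> h \<and> (\<lambda>n. dst.J (u n)) \<longlonglongrightarrow> k \<and>
       (\<lambda>n. R (u n) (v n)) \<longlonglongrightarrow> 0)" (is "?A \<longleftrightarrow> ?B")
proof
  assume ?A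
  then obtain \<phi> \<psi> where p: "\<forall>n. \<phi> n \<in> tf ` bumps" "\<forall>n. \<psi> n \<in> tf ` bumps"
    "(\<lambda>n. j (\<phi> n)) \<longlonglongrightarrow> h" "(\<lambda>n. i (\<psi> n)) \<longlonglongrightarrow> k" "(\<lambda>n. HD_norm \<tau> (\<lambda>x. \<psi> n x - fcalc m (\<phi> n) x)) \<longlonglongrightarrow> 0"
    unfolding has_fcalc_def HD_test_eq[OF src.\<sigma>] HD_test_eq[OF dst.\<sigma>] by blast
  have "\<forall>n. \<exists>v. v \<in> bumps \<and> \<phi> n = tf v" "\<forall>n. \<exists>u. u \<in> bumps \<and> \<psi> n = tf u" using p by blast+
  from choice[OF this(1)] choice[OF this(2)] obtain v u
    where vu': "\<forall>n. v n \<in> bumps \<and> \<phi> n = tf (v n)" "\<forall>n. u n \<in> bumps \<and> \<psi> n = tf (u n)" by blast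
  then have vu: "v n \<in> bumps" "\<phi> n = tf (v n)" "u n \<in> bumps" "\<psi> n = tf (u n)" for n by auto
  have "(\<lambda>n. ennreal (sqrt (4 * pi * R (u n) (v n)))) \<longlonglongrightarrow> 0" using p(5) by (simp add: vu HD_norm_R)
  then have "(\<lambda>n. ennreal (sqrt (4 * pi * R (u n) (v n)))) \<longlonglongrightarrow> ennreal 0" by simp
  then have "(\<lambda>n. sqrt (4 * pi * R (u n) (v n))) \<longlonglongrightarrow> 0"
    by (subst (asm) tendsto_ennreal_iff) (auto simp: R_nonneg)
  then have "(\<lambda>n. (sqrt (4 * pi * R (u n) (v n)))\<^sup>2 / (4 * pi)) \<longlonglongrightarrow> 0\<^sup>2 / (4 * pi)"
    by (intro tendsto_divide tendsto_power tendsto_const) auto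
  then have "(\<lambda>n. R (u n) (v n)) \<longlonglongrightarrow> 0" by (simp add: R_nonneg)
  then show ?B using p(3,4) vu by (intro exI[of _ v] exI[of _ u]) (simp add: src.J_def dst.J_def)
next
  assume ?B
  then obtain v u where vu: "\<forall>n. v n \<in> bumps" "\<forall>n. u n \<in> bumps" "(\<lambda>n. src.J (v n)) \<longlonglongrightarrow> h" "(\<lambda>n. dst.J (u n)) \<longlonglongrightarrow> k"
    "(\<lambda>n. R (u n) (v n)) \<longlonglongrightarrow> 0" by blast
  have "(\<lambda>n. sqrt (4 * pi * R (u n) (v n))) \<longlonglongrightarrow> sqrt (4 * pi * 0)"
    by (intro tendsto_intros vu)
  then have "(\<lambda>n. ennreal (sqrt (4 * pi * R (u n) (v n)))) \<longlonglongrightarrow> ennreal (sqrt (4 * pi * 0))" by (rule tendsto_ennrealI)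
  then have "(\<lambda>n. HD_norm \<tau> (\<lambda>x. tf (u n) x - fcalc m (tf (v n)) x)) \<longlonglongrightarrow> 0" using vu by (simp add: HD_norm_R)
  then show ?A unfolding has_fcalc_def HD_test_eq[OF src.\<sigma>] HD_test_eq[OF dst.\<sigma>] using vu
    by (intro exI[of _ "\<lambda>n. tf (v n)"] exI[of _ "\<lambda>n. tf (u n)"]) (simp add: src.J_def dst.J_def)
qed

lemma has_fcalc_unique:
  assumes "has_fcalc \<sigma> j \<tau> i m h k" "has_fcalc \<sigma> j \<tau> i m h k'"
  shows "k = k'"
proof -
  obtain v u where 1: "\<forall>n. v n \<in> bumps" "\<forall>n. u n \<in> bumps" "(\<lambda>n. src.J (v n)) \<longlonglongrightarrow> h" "(\<lambda>n. dst.J (u n)) \<longlonglongrightarrow> k"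
    "(\<lambda>n. R (u n) (v n)) \<longlonglongrightarrow> 0" using assms(1) unfolding has_fcalc_iff by blast
  obtain v' u' where 2: "\<forall>n. v' n \<in> bumps" "\<forall>n. u' n \<in> bumps" "(\<lambda>n. src.J (v' n)) \<longlonglongrightarrow> h" "(\<lambda>n. dst.J (u' n)) \<longlonglongrightarrow> k'"
    "(\<lambda>n. R (u' n) (v' n)) \<longlonglongrightarrow> 0" using assms(2) unfolding has_fcalc_iff by blast
  have "(\<lambda>n. (norm (dst.J (u n) - dst.J (u' n)))\<^sup>2) \<longlonglongrightarrow> (norm (k - k'))\<^sup>2"
    by (intro tendsto_power tendsto_norm tendsto_diff 1 2)
  moreover have "(\<lambda>n. 12 * pi * (R (u n) (v n) + R (u' n) (v' n)) + 3 * D\<^sup>2 * (norm (src.J (v n) - src.J (v' n)))\<^sup>2)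
     \<longlonglongrightarrow> 12 * pi * (0 + 0) + 3 * D\<^sup>2 * (norm (h - h))\<^sup>2"
    by (intro tendsto_add tendsto_mult tendsto_const tendsto_power tendsto_norm tendsto_diff 1 2)
  moreover have "\<forall>n. (norm (dst.J (u n) - dst.J (u' n)))\<^sup>2 \<le>
      12 * pi * (R (u n) (v n) + R (u' n) (v' n)) + 3 * D\<^sup>2 * (norm (src.J (v n) - src.J (v' n)))\<^sup>2"
    using 1(1,2) 2(1,2) by (simp add: dist_image_le)
  ultimately have "(norm (k - k'))\<^sup>2 \<le> 12 * pi * (0 + 0) + 3 * D\<^sup>2 * (norm (h - h))\<^sup>2"
    by (intro LIMSEQ_le) auto
  then show ?thesis by simp
qed

text \<open>Along bumps v converging to h, choose bumps u whose residuals tend to 0. Then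
  \<open>dist_image_le\<close> makes their images Cauchy, and completeness of the target provides
  the limit.\<close>

lemma has_fcalc_exists: "\<exists>k. has_fcalc \<sigma> j \<tau> i m h k"
proof -
  obtain v where v: "\<forall>n. v n \<in> bumps" "(\<lambda>n. src.J (v n)) \<longlonglongrightarrow> h" using src.J_dense by blast
  have "\<forall>n. \<exists>u. u \<in> bumps \<and> R u (v n) < 1 / (real n + 1)"
  proof
    fix n :: nat
    have "1 / (real n + 1) > 0" by simp
    from R_approx[OF spec[OF v(1)] this] show "\<exists>u. u \<in> bumps \<and> R u (v n) < 1 / (real n + 1)" by blast
  qed
  from choice[OF this] obtain u where u: "\<forall>n. u n \<in> bumps \<and> R (u n) (v n) < 1 / (real n + 1)" by blast
  have lim0: "(\<lambda>n. 1 / (real n + 1)) \<longlonglongrightarrow> 0" by real_asymp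
  have R0: "(\<lambda>n. R (u n) (v n)) \<longlonglongrightarrow> 0"
  proof (rule Lim_null_comparison[OF _ lim0], rule always_eventually, rule allI)
    show "norm (R (u n) (v n)) \<le> 1 / (real n + 1)" for n using u R_nonneg[of "u n" "v n"] by (simp add: less_imp_le)
  qed
  have "Cauchy (\<lambda>n. dst.J (u n))"
  proof (rule metric_CauchyI)
    fix e :: real assume e: "e > 0"
    \<comment> \<open>The two residuals contribute 12 pi (\<delta> + \<delta>) and the distance of
      the sources 3 D^2 \<delta>; the summand 1 makes the final inequality strict.\<close>
    define \<delta> where "\<delta> = e\<^sup>2 / (24 * pi + 3 * D\<^sup>2 + 1)"
    have den: "24 * pi + 3 * D\<^sup>2 + 1 > 0" by (simp add: add_nonneg_pos)
    have \<delta>: "\<delta> > 0" unfolding \<delta>_def using e den by simp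
    obtain N1 where N1: "\<And>n. n \<ge> N1 \<Longrightarrow> norm (R (u n) (v n) - 0) < \<delta>" using LIMSEQ_D[OF R0 \<delta>] by blast
    have "sqrt \<delta> > 0" using \<delta> by simp
    from metric_CauchyD[OF LIMSEQ_imp_Cauchy[OF v(2)] this]
    obtain N2 where N2: "\<And>n p. n \<ge> N2 \<Longrightarrow> p \<ge> N2 \<Longrightarrow> dist (src.J (v n)) (src.J (v p)) < sqrt \<delta>" by blast
    have "dist (dst.J (u n)) (dst.J (u p)) < e" if "n \<ge> max N1 N2" "p \<ge> max N1 N2" for n p
    proof -
      have "(norm (src.J (v n) - src.J (v p)))\<^sup>2 \<le> (sqrt \<delta>)\<^sup>2"
        using N2[of n p] that by (intro power_mono) (auto simp: dist_norm)
      then have 1: "(norm (src.J (v n) - src.J (v p)))\<^sup>2 \<le> \<delta>" using \<delta> by simp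
      have "R (u n) (v n) \<le> \<delta>" "R (u p) (v p) \<le> \<delta>" using N1[of n] N1[of p] that by auto
      then have "12 * pi * (R (u n) (v n) + R (u p) (v p)) \<le> 12 * pi * (\<delta> + \<delta>)" by (intro mult_left_mono) auto
      moreover have "3 * D\<^sup>2 * (norm (src.J (v n) - src.J (v p)))\<^sup>2 \<le> 3 * D\<^sup>2 * \<delta>" using 1 by (intro mult_left_mono) auto
      ultimately have "(norm (dst.J (u n) - dst.J (u p)))\<^sup>2 \<le> 12 * pi * (\<delta> + \<delta>) + 3 * D\<^sup>2 * \<delta>"
        using dist_image_le[of "u n" "v n" "u p" "v p"] u v(1) by (simp add: order_trans[OF _ add_mono])
      also have "\<dots> < (24 * pi + 3 * D\<^sup>2 + 1) * \<delta>" using \<delta> by (simp add: algebra_simps)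
      also have "\<dots> = e\<^sup>2" using den by (simp add: \<delta>_def)
      finally show ?thesis using e by (simp add: dist_norm power2_less_imp_less)
    qed
    then show "\<exists>M. \<forall>n\<ge>M. \<forall>p\<ge>M. dist (dst.J (u n)) (dst.J (u p)) < e" by (intro exI[of _ "max N1 N2"] allI impI)
  qed
  then have "convergent (\<lambda>n. dst.J (u n))" by (rule Cauchy_convergent)
  then obtain k where "(\<lambda>n. dst.J (u n)) \<longlonglongrightarrow> k" unfolding convergent_def by blast
  then have "has_fcalc \<sigma> j \<tau> i m h k" unfolding has_fcalc_iff using v u R0 by (intro exI[of _ v] exI[of _ u]) simp
  then show ?thesis by blast
qed

lemma has_fcalc_ext: "has_fcalc \<sigma> j \<tau> i m h (fcalc_ext \<sigma> j \<tau> i m h)"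
  unfolding fcalc_ext_def by (rule theI', rule ex_ex1I[OF has_fcalc_exists has_fcalc_unique])

text \<open>Dual form of \<open>m_bound\<close>: dividing it by l^(\<sigma> + \<tau>) gives |m l|
  l^(-\<sigma>) \<le> D l^(-\<tau>).\<close>

lemma adm_mult:
  assumes "dst.adm \<kappa>"
  shows "src.adm (\<lambda>l. \<kappa> l * m l)" "Nsq (- \<sigma>) (\<lambda>l. \<kappa> l * m l) \<le> D\<^sup>2 * Nsq (- \<tau>) \<kappa>"
proof -
  have k: "\<kappa> \<in> borel_measurable hl" "integrable hl (\<lambda>l. (\<kappa> l * l powr (- \<tau>))\<^sup>2)"
    using assms by (auto simp: dst.adm_def)
  have [measurable]: "\<kappa> \<in> borel_measurable hl" by fact
  have m [measurable]: "m \<in> borel_measurable hl" by (rule borel_measurable_hl_cont[OF m_cont])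
  have [measurable]: "(\<lambda>l::real. l powr p) \<in> borel_measurable hl" for p by (rule borel_measurable_hlI) simp
  have 1: "integrable hl (\<lambda>l. D\<^sup>2 * (\<kappa> l * l powr (- \<tau>))\<^sup>2)" using k(2) by (rule integrable_mult_right)
  have 2: "(\<kappa> l * m l * l powr (- \<sigma>))\<^sup>2 \<le> D\<^sup>2 * (\<kappa> l * l powr (- \<tau>))\<^sup>2" if "l > 0" for l
  proof -
    have "\<bar>m l\<bar> * l powr \<tau> * (l powr (- \<sigma>) * l powr (- \<tau>)) \<le> D * l powr \<sigma> * (l powr (- \<sigma>) * l powr (- \<tau>))"
      by (rule mult_right_mono[OF m_bound[OF that]]) simp
    then have "\<bar>m l\<bar> * l powr (- \<sigma>) \<le> D * l powr (- \<tau>)" using that by (simp add: powr_minus field_simps)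
    then have "(\<bar>m l\<bar> * l powr (- \<sigma>))\<^sup>2 \<le> (D * l powr (- \<tau>))\<^sup>2" by (rule power_mono) simp
    then have "(\<kappa> l)\<^sup>2 * (\<bar>m l\<bar> * l powr (- \<sigma>))\<^sup>2 \<le> (\<kappa> l)\<^sup>2 * (D * l powr (- \<tau>))\<^sup>2" by (rule mult_left_mono) simp
    then show ?thesis by (simp add: power_mult_distrib mult_ac)
  qed
  have 3: "integrable hl (\<lambda>l. (\<kappa> l * m l * l powr (- \<sigma>))\<^sup>2)"
    by (rule Bochner_Integration.integrable_bound[OF 1]) (measurable, rule AE_hlI, simp only: real_norm_def abs_power2, rule order_trans[OF 2 abs_ge_self])
  then show "src.adm (\<lambda>l. \<kappa> l * m l)" using k m unfolding src.adm_def by simp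
  have "(\<integral>l. (\<kappa> l * m l * l powr (- \<sigma>))\<^sup>2 \<partial>hl) \<le> (\<integral>l. D\<^sup>2 * (\<kappa> l * l powr (- \<tau>))\<^sup>2 \<partial>hl)"
    by (rule integral_mono[OF 3 1]) (use 2 in simp)
  then show "Nsq (- \<sigma>) (\<lambda>l. \<kappa> l * m l) \<le> D\<^sup>2 * Nsq (- \<tau>) \<kappa>"
    by (simp add: Nsq_def mult.commute)
qed

text \<open>On approximating bumps the two sides differ by the pairing of \<kappa> with the
  residual, which tends to 0 with \<open>R\<close>. Both functionals being continuous, the
  multiplier moves from the element to the kernel; this is the only access to
  \<open>fcalc_ext\<close> in the estimates.\<close>

lemma Lam_fcalc_ext:
  assumes k: "dst.adm \<kappa>"
  shows "dst.Lam \<kappa> (fcalc_ext \<sigma> j \<tau> i m h) = src.Lam (\<lambda>l. \<kappa> l * m l) h"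
proof -
  obtain v u where vu: "\<forall>n. v n \<in> bumps" "\<forall>n. u n \<in> bumps" "(\<lambda>n. src.J (v n)) \<longlonglongrightarrow> h"
    "(\<lambda>n. dst.J (u n)) \<longlonglongrightarrow> fcalc_ext \<sigma> j \<tau> i m h" "(\<lambda>n. R (u n) (v n)) \<longlonglongrightarrow> 0"
    using has_fcalc_ext[of h] unfolding has_fcalc_iff by blast
  have L1: "(\<lambda>n. dst.Lam \<kappa> (dst.J (u n))) \<longlonglongrightarrow> dst.Lam \<kappa> (fcalc_ext \<sigma> j \<tau> i m h)"
    by (rule bounded_linear.tendsto[OF dst.Lam_bounded_linear[OF k] vu(4)])
  have L2: "(\<lambda>n. src.Lam (\<lambda>l. \<kappa> l * m l) (src.J (v n))) \<longlonglongrightarrow> src.Lam (\<lambda>l. \<kappa> l * m l) h"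
    by (rule bounded_linear.tendsto[OF src.Lam_bounded_linear[OF adm_mult(1)[OF k]] vu(3)])
  have d: "\<bar>dst.Lam \<kappa> (dst.J (u n)) - src.Lam (\<lambda>l. \<kappa> l * m l) (src.J (v n))\<bar> \<le> sqrt (Nsq (- \<tau>) \<kappa>) * sqrt (R (u n) (v n))" for n
  proof -
    have b: "u n \<in> bumps" "v n \<in> bumps" using vu by auto
    have i: "integrable hl (\<lambda>l. \<kappa> l * ST (u n) l)" by (rule dst.adm_pairing(1)[OF k dst.bumps_pairing[OF b(1)]])
    have i2: "integrable hl (\<lambda>l. \<kappa> l * m l * ST (v n) l)" by (rule src.adm_pairing(1)[OF adm_mult(1)[OF k] src.bumps_pairing[OF b(2)]])
    have "dst.Lam \<kappa> (dst.J (u n)) - src.Lam (\<lambda>l. \<kappa> l * m l) (src.J (v n)) = (\<integral>l. \<kappa> l * ST (u n) l - \<kappa> l * m l * ST (v n) l \<partial>hl)"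
      using i i2 by (simp add: dst.Lam_J[OF k b(1)] src.Lam_J[OF adm_mult(1)[OF k] b(2)])
    also have "\<dots> = (\<integral>l. \<kappa> l * (ST (u n) l - m l * ST (v n) l) \<partial>hl)" by (simp add: right_diff_distrib mult.assoc)
    finally show ?thesis using dst.adm_pairing(2)[OF k R_integrable[OF b]] by (simp add: R_def)
  qed
  have "(\<lambda>n. sqrt (Nsq (- \<tau>) \<kappa>) * sqrt (R (u n) (v n))) \<longlonglongrightarrow> sqrt (Nsq (- \<tau>) \<kappa>) * sqrt 0"
    by (intro tendsto_mult tendsto_const tendsto_real_sqrt vu)
  then have s0: "(\<lambda>n. sqrt (Nsq (- \<tau>) \<kappa>) * sqrt (R (u n) (v n))) \<longlonglongrightarrow> 0" by simp
  have "(\<lambda>n. dst.Lam \<kappa> (dst.J (u n)) - src.Lam (\<lambda>l. \<kappa> l * m l) (src.J (v n))) \<longlonglongrightarrow> 0"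
    by (rule Lim_null_comparison[OF _ s0], rule always_eventually) (use d in simp)
  from LIMSEQ_unique[OF this tendsto_diff[OF L1 L2]] show ?thesis by simp
qed

end

section \<open>Dyadic averages\<close>

text \<open>The mean over y in [a, b] of the inversion kernel sqrt (2 / pi) sin (l y). Paired with
  \<open>ST w\<close> it returns the mean of w over [a, b].\<close>

definition kap :: "real \<Rightarrow> real \<Rightarrow> real \<Rightarrow> real" where
  "kap a b l = sqrt (2 / pi) * ((cos (l * a) - cos (l * b)) / ((b - a) * l))"

lemma sqrt_2_pi: "0 < sqrt (2 / pi)" "sqrt (2 / pi) \<le> 1"
  using pi_gt3 by (auto simp: divide_le_eq_1)

lemma kap_mean:
  assumes "a < b" "l > 0"
  shows "\<exists>z. a < z \<and> z < b \<and> kap a b l = sqrt (2 / pi) * sin (l * z)"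
proof -
  have "\<exists>z>a. z < b \<and> cos (l * b) - cos (l * a) = (b - a) * (- (l * sin (l * z)))"
  proof (rule MVT2[OF assms(1)])
    show "((\<lambda>y. cos (l * y)) has_real_derivative - (l * sin (l * y))) (at y)" for y
      by (auto intro!: derivative_eq_intros)
  qed
  then obtain z where z: "a < z" "z < b" "cos (l * b) - cos (l * a) = (b - a) * (- (l * sin (l * z)))" by blast
  have "cos (l * a) - cos (l * b) = ((b - a) * l) * sin (l * z)" using z(3) by (simp add: algebra_simps)
  then have "kap a b l = sqrt (2 / pi) * sin (l * z)" using assms by (simp add: kap_def)
  then show ?thesis using z by blast
qed

lemma kap_cont: "a < b \<Longrightarrow> continuous_on {0<..} (kap a b)"
  unfolding kap_def[abs_def] by (intro continuous_intros) auto

text \<open>The first two bounds come from the mean value form. The decay 1 / l comes from the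
  closed form and makes the kernel admissible in positive order.\<close>

lemma kap_bounds:
  assumes "0 \<le> a" "a < b" "l > 0"
  shows "\<bar>kap a b l\<bar> \<le> 1" "\<bar>kap a b l\<bar> \<le> b * l" "\<bar>kap a b l\<bar> \<le> (2 / (b - a)) / l"
proof -
  obtain z where z: "a < z" "z < b" "kap a b l = sqrt (2 / pi) * sin (l * z)" using kap_mean[OF assms(2,3)] by blast
  have k: "\<bar>kap a b l\<bar> \<le> \<bar>sin (l * z)\<bar>"
    unfolding z(3) abs_mult using sqrt_2_pi by (intro mult_left_le_one_le) auto
  then show "\<bar>kap a b l\<bar> \<le> 1" by (rule order_trans) simp
  have "\<bar>sin (l * z)\<bar> \<le> \<bar>l * z\<bar>" by (rule abs_sin_x_le_abs_x)
  also have "\<dots> \<le> b * l" using z assms by (simp add: abs_mult)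
  finally show "\<bar>kap a b l\<bar> \<le> b * l" using k by simp
  have "\<bar>cos (l * a) - cos (l * b)\<bar> \<le> 2"
    using abs_cos_le_one[of "l * a"] abs_cos_le_one[of "l * b"] by linarith
  then have "\<bar>(cos (l * a) - cos (l * b)) / ((b - a) * l)\<bar> \<le> 2 / ((b - a) * l)"
    using assms by (simp add: divide_right_mono)
  moreover have "\<bar>kap a b l\<bar> \<le> \<bar>(cos (l * a) - cos (l * b)) / ((b - a) * l)\<bar>"
    unfolding kap_def abs_mult[of "sqrt _"] using sqrt_2_pi by (intro mult_left_le_one_le) auto
  ultimately show "\<bar>kap a b l\<bar> \<le> (2 / (b - a)) / l" by simp
qed

text \<open>Both kernels are values of the same sine at points of [A, B], so they differ by at most
  l times the length of that interval.\<close>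

lemma kap_diff_bound:
  assumes "0 \<le> A" "A \<le> a" "a < b" "b \<le> B" "l > 0"
  shows "\<bar>kap a b l - kap A B l\<bar> \<le> (B - A) * l"
proof -
  obtain z where z: "a < z" "z < b" "kap a b l = sqrt (2 / pi) * sin (l * z)" using kap_mean[of a b l] assms by blast
  obtain y where y: "A < y" "y < B" "kap A B l = sqrt (2 / pi) * sin (l * y)" using kap_mean[of A B l] assms by auto
  have "sin (l * z) - sin (l * y) = 2 * (sin ((l * z - l * y) / 2) * cos ((l * z + l * y) / 2))"
    by (simp add: sin_diff_sin)
  then have "\<bar>sin (l * z) - sin (l * y)\<bar> = 2 * (\<bar>sin ((l * z - l * y) / 2)\<bar> * \<bar>cos ((l * z + l * y) / 2)\<bar>)"
    by (simp add: abs_mult)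
  also have "\<dots> \<le> 2 * (\<bar>(l * z - l * y) / 2\<bar> * 1)"
    by (intro mult_left_mono mult_mono abs_sin_x_le_abs_x abs_cos_le_one) auto
  also have "\<dots> = l * \<bar>z - y\<bar>" using assms(5) by (simp add: right_diff_distrib[symmetric] abs_mult)
  also have "\<dots> \<le> l * (B - A)" using assms z y by (intro mult_left_mono) auto
  finally have *: "\<bar>sin (l * z) - sin (l * y)\<bar> \<le> l * (B - A)" .
  have "\<bar>kap a b l - kap A B l\<bar> = sqrt (2 / pi) * \<bar>sin (l * z) - sin (l * y)\<bar>"
    unfolding z(3) y(3) right_diff_distrib[symmetric] abs_mult by simp
  also have "\<dots> \<le> \<bar>sin (l * z) - sin (l * y)\<bar>" using sqrt_2_pi by (intro mult_left_le_one_le) auto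
  finally show ?thesis using * by (simp add: mult.commute)
qed

section \<open>Dyadic intervals and the square sum of the difference kernels\<close>

definition dy :: "int \<Rightarrow> real" where "dy k = 2 powr (real_of_int k)"

lemma dy_pos [simp]: "dy k > 0" "dy k \<ge> 0" "dy k \<noteq> 0" by (simp_all add: dy_def)

lemma dy_Suc: "dy (k + 1) = 2 * dy k" by (simp add: dy_def powr_add)

lemma dy_add: "dy (k + k') = dy k * dy k'" by (simp add: dy_def powr_add)

definition kd :: "int \<Rightarrow> nat \<Rightarrow> real \<Rightarrow> real" where
  "kd k l = kap (real l * dy k) ((real l + 1) * dy k)"

text \<open>The multipliers of the differences between the averages over a dyadic interval
  \<open>2\<^sup>k [l, l + 1)\<close> and over its dyadic parent; an interval with \<open>l = 1\<close> counts as having none.\<close>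

definition eta :: "int \<times> nat \<Rightarrow> real \<Rightarrow> real" where
  "eta p = (let (k, l) = p in if l = 0 then (\<lambda>_. 0) else if l = 1 then kd k 1 else (\<lambda>x. kd k l x - kd (k + 1) (l div 2) x))"

text \<open>An even l is the left half of its parent, an odd l the right half.\<close>

lemma dyadic_parent:
  "real (l div 2) * dy (k + 1) \<le> real l * dy k" "(real l + 1) * dy k \<le> (real (l div 2) + 1) * dy (k + 1)"
proof -
  have "2 * real (l div 2) \<le> real l" "real l + 1 \<le> 2 * real (l div 2) + 2" by linarith+
  then have "2 * real (l div 2) * dy k \<le> real l * dy k" "(real l + 1) * dy k \<le> (2 * real (l div 2) + 2) * dy k"
    by (intro mult_right_mono; simp)+
  moreover have "real (l div 2) * (2 * dy k) = 2 * real (l div 2) * dy k"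
    "(real (l div 2) + 1) * (2 * dy k) = (2 * real (l div 2) + 2) * dy k" by (simp_all add: algebra_simps)
  ultimately show "real (l div 2) * dy (k + 1) \<le> real l * dy k" "(real l + 1) * dy k \<le> (real (l div 2) + 1) * dy (k + 1)"
    unfolding dy_Suc by simp_all
qed

lemma kd_cont: "continuous_on {0<..} (kd k l)"
  unfolding kd_def by (rule kap_cont) simp

lemma eta_cont: "continuous_on {0<..} (eta p)"
  by (auto simp: eta_def split: prod.split intro!: continuous_intros kd_cont)

lemma kd_le_1: "x > 0 \<Longrightarrow> \<bar>kd k l x\<bar> \<le> 1"
  unfolding kd_def by (rule kap_bounds(1)) auto

text \<open>A difference is controlled by the length 2 \<open>dy k\<close> of the parent. For l = 1
  the kernel itself obeys the same bound, as its interval ends at 2 \<open>dy k\<close>.\<close>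

lemma eta_bounds:
  assumes "x > 0"
  shows "\<bar>eta (k, l) x\<bar> \<le> 2" "\<bar>eta (k, l) x\<bar> \<le> 2 * (dy k * x)"
proof -
  show "\<bar>eta (k, l) x\<bar> \<le> 2"
    using kd_le_1[OF assms, of k 1] kd_le_1[OF assms, of k l] kd_le_1[OF assms, of "k + 1" "l div 2"]
    by (auto simp: eta_def)
  have "\<bar>kd k 1 x\<bar> \<le> 2 * (dy k * x)"
    using kap_bounds(2)[of "1 * dy k" "(1 + 1) * dy k" x] assms by (simp add: kd_def)
  moreover have "\<bar>kd k l x - kd (k + 1) (l div 2) x\<bar> \<le> 2 * (dy k * x)"
    using kap_diff_bound[OF _ dyadic_parent(1)[of l k] _ dyadic_parent(2)[of l k], of x] assms
    by (simp add: kd_def dy_Suc dy_Suc[of k, unfolded add.commute[of k 1]] algebra_simps)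
  ultimately show "\<bar>eta (k, l) x\<bar> \<le> 2 * (dy k * x)" using assms by (auto simp: eta_def)
qed

text \<open>The two half-lines of integers both contain k0, which is counted twice; hence an
  inequality.\<close>

lemma nn_integral_int_le:
  "(\<integral>\<^sup>+k. g k \<partial>count_space (UNIV :: int set)) \<le> (\<Sum>n. g (k0 + int n)) + (\<Sum>n. g (k0 - int n))"
proof -
  have *: "(\<integral>\<^sup>+k. g k * indicator (range h) k \<partial>count_space UNIV) = (\<Sum>n. g (h n))" if "inj h" for h :: "nat \<Rightarrow> int"
  proof -
    have "(\<integral>\<^sup>+k. g k * indicator (range h) k \<partial>count_space UNIV) = (\<integral>\<^sup>+k. g k \<partial>count_space (range h))"
      by (subst nn_integral_count_space_indicator) auto
    also have "\<dots> = (\<integral>\<^sup>+n. g (h n) \<partial>count_space UNIV)"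
      by (rule nn_integral_bij_count_space[symmetric]) (use that in \<open>simp add: bij_betw_def\<close>)
    finally show ?thesis by (simp add: nn_integral_count_space_nat)
  qed
  have "g k \<le> g k * indicator (range (\<lambda>n. k0 + int n)) k + g k * indicator (range (\<lambda>n. k0 - int n)) k" for k
  proof (cases "k \<ge> k0")
    case True
    then have "k = k0 + int (nat (k - k0))" by simp
    then have "k \<in> range (\<lambda>n. k0 + int n)" by blast
    then show ?thesis by simp
  next
    case False
    then have "k = k0 - int (nat (k0 - k))" by simp
    then have "k \<in> range (\<lambda>n. k0 - int n)" by blast
    then show ?thesis by simp
  qed
  then have "(\<integral>\<^sup>+k. g k \<partial>count_space UNIV) \<le> (\<integral>\<^sup>+k. g k * indicator (range (\<lambda>n. k0 + int n)) k + g k * indicator (range (\<lambda>n. k0 - int n)) k \<partial>count_space UNIV)"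
    by (intro nn_integral_mono)
  also have "\<dots> = (\<integral>\<^sup>+k. g k * indicator (range (\<lambda>n. k0 + int n)) k \<partial>count_space UNIV) + (\<integral>\<^sup>+k. g k * indicator (range (\<lambda>n. k0 - int n)) k \<partial>count_space UNIV)"
    by (rule nn_integral_add) auto
  also have "\<dots> = (\<Sum>n. g (k0 + int n)) + (\<Sum>n. g (k0 - int n))"
    by (subst (1 2) *) (auto simp: inj_on_def)
  finally show ?thesis .
qed

lemma suminf_geometric_ennreal:
  assumes "0 \<le> r" "r < 1" "0 \<le> c"
  shows "(\<Sum>n. ennreal (c * r ^ n)) = ennreal (c * (1 / (1 - r)))"
proof (rule suminf_ennreal_eq)
  show "(\<lambda>n. c * r ^ n) sums (c * (1 / (1 - r)))"
    by (rule sums_mult, rule geometric_sums) (use assms in simp)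
qed (use assms in simp)

text \<open>At l = 0 the weight is 0, since 0 \<open>powr\<close> any exponent is 0; this agrees
  with the convention that \<open>eta (k, 0)\<close> is 0.\<close>

definition cw :: "real \<Rightarrow> real \<Rightarrow> int \<times> nat \<Rightarrow> real" where
  "cw s \<beta> p = (let (k, l) = p in dy k powr (- 2 * s) * real l powr (- \<beta>))"

lemma cw_nonneg [simp]: "cw s \<beta> p \<ge> 0" by (simp add: cw_def split: prod.split)

text \<open>The minimum switches at the scale 2^k comparable to 1 / x. Above this scale the terms
  decay like 2^(-2 s n), by s > 0; below it like 2^((2 s - 2) n), by s < 1.\<close>

lemma scale_sum_le:
  assumes s: "0 < s" "s < 1" and x: "x > 0"
  shows "(\<integral>\<^sup>+k. ennreal (dy k powr (- 2 * s) * (min 1 (dy k * x))\<^sup>2) \<partial>count_space UNIV)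
    \<le> ennreal ((1 / (1 - 2 powr (- 2 * s)) + 4 * (1 / (1 - 2 powr (2 * s - 2)))) * x powr (2 * s))"
proof -
  \<comment> \<open>The least k with 2^k \<ge> 1 / x, so \<open>dy k0\<close> lies between 1 / x and
    2 / x. The factor 2 lost here is squared to the constant 4 of the statement.\<close>
  define k0 where "k0 = \<lceil>- log 2 x\<rceil>"
  have k0: "- log 2 x \<le> real_of_int k0" "real_of_int k0 < - log 2 x + 1" unfolding k0_def by linarith+
  have lx: "2 powr (log 2 x) = x" using x by simp
  have "2 powr (- log 2 x) \<le> dy k0" "dy k0 \<le> 2 powr (- log 2 x + 1)" unfolding dy_def using k0 by (intro powr_mono; simp)+
  moreover have e1: "2 powr (- log 2 x) = 1 / x" using lx by (simp add: powr_minus inverse_eq_divide)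
  moreover have "2 powr (- log 2 x + 1) = 2 / x" unfolding powr_add e1 by simp
  ultimately have d: "1 / x \<le> dy k0" "dy k0 \<le> 2 / x" by simp_all
  have e: "dy k0 powr (- 2 * s) \<le> x powr (2 * s)"
  proof -
    have "dy k0 powr (- 2 * s) \<le> (1 / x) powr (- 2 * s)" using d x s by (intro powr_mono2') auto
    also have "\<dots> = x powr (2 * s)" using x by (simp add: powr_divide powr_minus field_simps)
    finally show ?thesis .
  qed
  have dn: "dy (int n) powr a = (2 powr a) ^ n" for n a by (simp add: dy_def powr_powr powr_realpow[symmetric] mult.commute)
  have dm: "dy (- int n) powr a = (2 powr (- a)) ^ n" for n a by (simp add: dy_def powr_powr powr_realpow[symmetric] mult.commute)
  have "(\<Sum>n. ennreal (dy (k0 + int n) powr (- 2 * s) * (min 1 (dy (k0 + int n) * x))\<^sup>2))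
     \<le> (\<Sum>n. ennreal (x powr (2 * s) * (2 powr (- 2 * s)) ^ n))"
  proof (intro suminf_le ennreal_leI)
    fix n
    have "dy (k0 + int n) powr (- 2 * s) * (min 1 (dy (k0 + int n) * x))\<^sup>2 \<le> dy (k0 + int n) powr (- 2 * s) * 1"
      using x by (intro mult_left_mono) (auto simp: abs_square_le_1 min_def)
    also have "\<dots> = dy k0 powr (- 2 * s) * (2 powr (- 2 * s)) ^ n" by (simp add: dy_add powr_mult dn)
    also have "\<dots> \<le> x powr (2 * s) * (2 powr (- 2 * s)) ^ n" using e by (intro mult_right_mono) auto
    finally show "dy (k0 + int n) powr (- 2 * s) * (min 1 (dy (k0 + int n) * x))\<^sup>2 \<le> x powr (2 * s) * (2 powr (- 2 * s)) ^ n" .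
  qed auto
  also have "\<dots> = ennreal (x powr (2 * s) * (1 / (1 - 2 powr (- 2 * s))))"
    using s by (intro suminf_geometric_ennreal) (auto simp: powr_less_one)
  finally have 1: "(\<Sum>n. ennreal (dy (k0 + int n) powr (- 2 * s) * (min 1 (dy (k0 + int n) * x))\<^sup>2)) \<le> ennreal (x powr (2 * s) * (1 / (1 - 2 powr (- 2 * s))))" .
  have "(\<Sum>n. ennreal (dy (k0 - int n) powr (- 2 * s) * (min 1 (dy (k0 - int n) * x))\<^sup>2))
     \<le> (\<Sum>n. ennreal (4 * x powr (2 * s) * (2 powr (2 * s - 2)) ^ n))"
  proof (intro suminf_le ennreal_leI)
    fix n
    have sp: "dy (k0 - int n) = dy k0 * dy (- int n)" using dy_add[of k0 "- int n"] by simp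
    have "min 1 (dy (k0 - int n) * x) \<le> 2 * dy (- int n)"
    proof -
      have "dy k0 * x \<le> 2" using d(2) x by (simp add: field_simps)
      have "min 1 (dy (k0 - int n) * x) \<le> dy k0 * x * dy (- int n)" by (simp add: sp mult_ac)
      also have "\<dots> \<le> 2 * dy (- int n)" by (rule mult_right_mono[OF \<open>dy k0 * x \<le> 2\<close>]) simp
      finally show ?thesis .
    qed
    then have "(min 1 (dy (k0 - int n) * x))\<^sup>2 \<le> (2 * dy (- int n))\<^sup>2" using x by (intro power_mono) auto
    then have "dy (k0 - int n) powr (- 2 * s) * (min 1 (dy (k0 - int n) * x))\<^sup>2 \<le> dy (k0 - int n) powr (- 2 * s) * (2 * dy (- int n))\<^sup>2"
      by (rule mult_left_mono) simp
    also have "\<dots> = 4 * dy k0 powr (- 2 * s) * (dy (- int n) powr (- 2 * s) * dy (- int n) powr 2)"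
      by (simp add: sp powr_mult power_mult_distrib)
    also have "dy (- int n) powr (- 2 * s) * dy (- int n) powr 2 = (2 powr (2 * s - 2)) ^ n"
      unfolding dm power_mult_distrib[symmetric] powr_add[symmetric] by simp
    also have "4 * dy k0 powr (- 2 * s) * (2 powr (2 * s - 2)) ^ n \<le> 4 * x powr (2 * s) * (2 powr (2 * s - 2)) ^ n"
      using e by (intro mult_right_mono) auto
    finally show "dy (k0 - int n) powr (- 2 * s) * (min 1 (dy (k0 - int n) * x))\<^sup>2 \<le> 4 * x powr (2 * s) * (2 powr (2 * s - 2)) ^ n" .
  qed auto
  also have "\<dots> = ennreal (4 * x powr (2 * s) * (1 / (1 - 2 powr (2 * s - 2))))"
    using s by (intro suminf_geometric_ennreal) (auto simp: powr_less_one)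
  finally have 2: "(\<Sum>n. ennreal (dy (k0 - int n) powr (- 2 * s) * (min 1 (dy (k0 - int n) * x))\<^sup>2)) \<le> ennreal (4 * x powr (2 * s) * (1 / (1 - 2 powr (2 * s - 2))))" .
  have p: "2 powr (- 2 * s) < 1" "2 powr (2 * s - 2) < 1" using s by (auto simp: powr_less_one)
  have "(\<integral>\<^sup>+k. ennreal (dy k powr (- 2 * s) * (min 1 (dy k * x))\<^sup>2) \<partial>count_space UNIV)
    \<le> ennreal (x powr (2 * s) * (1 / (1 - 2 powr (- 2 * s)))) + ennreal (4 * x powr (2 * s) * (1 / (1 - 2 powr (2 * s - 2))))"
    by (rule order_trans[OF nn_integral_int_le[of _ k0] add_mono[OF 1 2]])
  also have "\<dots> = ennreal ((1 / (1 - 2 powr (- 2 * s)) + 4 * (1 / (1 - 2 powr (2 * s - 2)))) * x powr (2 * s))"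
    using p by (subst ennreal_plus[symmetric]) (auto simp: algebra_simps)
  finally show ?thesis .
qed

text \<open>The bound 2 min (1, 2^k x) for the kernel is the same for all l, so the double sum
  factors into the sum over scales and the series of l^(-\<beta>), finite by \<beta> > 1.\<close>

lemma eta_sum_le:
  assumes s: "0 < s" "s < 1" and b: "\<beta> > 1"
  shows "\<exists>K\<ge>0. \<forall>x>0. (\<integral>\<^sup>+p. ennreal (cw s \<beta> p * (eta p x)\<^sup>2) \<partial>count_space UNIV) \<le> ennreal (K * x powr (2 * s))"
proof -
  have sm: "summable (\<lambda>l. real l powr (- \<beta>))" using b by (simp add: summable_real_powr_iff)
  define Z where "Z = (\<Sum>l. real l powr (- \<beta>))"
  have Z: "Z \<ge> 0" unfolding Z_def by (rule suminf_nonneg[OF sm]) simp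
  have Zs: "(\<Sum>l. ennreal (real l powr (- \<beta>))) = ennreal Z"
    unfolding Z_def by (rule suminf_ennreal2[OF _ sm]) simp
  define K where "K = 4 * Z * (1 / (1 - 2 powr (- 2 * s)) + 4 * (1 / (1 - 2 powr (2 * s - 2))))"
  have p: "2 powr (- 2 * s) < 1" "2 powr (2 * s - 2) < 1" using s by (auto simp: powr_less_one)
  then have K: "K \<ge> 0" unfolding K_def using Z by simp
  have "(\<integral>\<^sup>+p. ennreal (cw s \<beta> p * (eta p x)\<^sup>2) \<partial>count_space UNIV) \<le> ennreal (K * x powr (2 * s))" if x: "x > 0" for x
  proof -
    have "(\<integral>\<^sup>+p. ennreal (cw s \<beta> p * (eta p x)\<^sup>2) \<partial>count_space UNIV)
       \<le> (\<integral>\<^sup>+p. (case p of (k, l) \<Rightarrow> ennreal (dy k powr (- 2 * s) * (min 1 (dy k * x))\<^sup>2) * ennreal (4 * real l powr (- \<beta>))) \<partial>count_space UNIV)"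
    proof (rule nn_integral_mono)
      fix p :: "int \<times> nat"
      obtain k l where pp: "p = (k, l)" by force
      have "\<bar>eta (k, l) x\<bar> \<le> 2 * min 1 (dy k * x)" using eta_bounds[OF x, of k l] by (auto simp: min_def)
      then have "\<bar>eta (k, l) x\<bar>\<^sup>2 \<le> (2 * min 1 (dy k * x))\<^sup>2" by (rule power_mono) simp
      then have "(eta (k, l) x)\<^sup>2 \<le> 4 * (min 1 (dy k * x))\<^sup>2" by (simp add: power_mult_distrib)
      then have "cw s \<beta> p * (eta p x)\<^sup>2 \<le> cw s \<beta> p * (4 * (min 1 (dy k * x))\<^sup>2)"
        unfolding pp by (rule mult_left_mono) simp
      also have "\<dots> = dy k powr (- 2 * s) * (min 1 (dy k * x))\<^sup>2 * (4 * real l powr (- \<beta>))" by (simp add: cw_def pp)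
      finally show "ennreal (cw s \<beta> p * (eta p x)\<^sup>2) \<le> (case p of (k, l) \<Rightarrow> ennreal (dy k powr (- 2 * s) * (min 1 (dy k * x))\<^sup>2) * ennreal (4 * real l powr (- \<beta>)))"
        unfolding pp by (simp add: ennreal_mult[symmetric] ennreal_leI)
    qed
    also have "\<dots> = (\<integral>\<^sup>+k. \<integral>\<^sup>+l. ennreal (dy k powr (- 2 * s) * (min 1 (dy k * x))\<^sup>2) * ennreal (4 * real l powr (- \<beta>)) \<partial>count_space UNIV \<partial>count_space UNIV)"
      by (subst nn_integral_fst_count_space[symmetric]) simp
    also have "\<dots> = (\<integral>\<^sup>+k. ennreal (dy k powr (- 2 * s) * (min 1 (dy k * x))\<^sup>2) * ennreal (4 * Z) \<partial>count_space UNIV)"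
    proof (rule nn_integral_cong)
      fix k :: int
      have "(\<integral>\<^sup>+l. ennreal (4 * real l powr (- \<beta>)) \<partial>count_space UNIV) = ennreal (4 * Z)"
        using Zs Z by (simp add: nn_integral_count_space_nat ennreal_mult' ennreal_suminf_cmult)
      then show "(\<integral>\<^sup>+l. ennreal (dy k powr (- 2 * s) * (min 1 (dy k * x))\<^sup>2) * ennreal (4 * real l powr (- \<beta>)) \<partial>count_space UNIV)
         = ennreal (dy k powr (- 2 * s) * (min 1 (dy k * x))\<^sup>2) * ennreal (4 * Z)"
        by (subst nn_integral_cmult) simp_all
    qed
    also have "\<dots> = (\<integral>\<^sup>+k. ennreal (dy k powr (- 2 * s) * (min 1 (dy k * x))\<^sup>2) \<partial>count_space UNIV) * ennreal (4 * Z)"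
      by (rule nn_integral_multc) simp
    also have "\<dots> \<le> ennreal ((1 / (1 - 2 powr (- 2 * s)) + 4 * (1 / (1 - 2 powr (2 * s - 2)))) * x powr (2 * s)) * ennreal (4 * Z)"
      by (rule mult_right_mono[OF scale_sum_le[OF s x]]) simp
    also have "\<dots> = ennreal (K * x powr (2 * s))"
      using Z p by (subst ennreal_mult[symmetric]) (auto simp: K_def mult_ac)
    finally show ?thesis .
  qed
  then show ?thesis using K by blast
qed

section \<open>Dyadic averages of functions and their convergence\<close>

definition idx :: "nat \<Rightarrow> real \<Rightarrow> nat" where "idx N y = nat \<lfloor>y / dy (- int N)\<rfloor>"

definition avg :: "(real \<Rightarrow> real) \<Rightarrow> real \<Rightarrow> real \<Rightarrow> real" where
  "avg w a b = (1 / (b - a)) * (LBINT y:{a..b}. w y)"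

abbreviation (input) avgd :: "(real \<Rightarrow> real) \<Rightarrow> int \<Rightarrow> nat \<Rightarrow> real" where
  "avgd w k l \<equiv> avg w (real l * dy k) ((real l + 1) * dy k)"

definition dyint :: "int \<times> nat \<Rightarrow> real set" where
  "dyint p = (let (k, l) = p in {real l * dy k..<(real l + 1) * dy k})"

lemma idx_mem: "y \<ge> 0 \<Longrightarrow> y \<in> dyint (- int N, idx N y)"
proof -
  assume y: "y \<ge> 0"
  have "real (idx N y) = \<lfloor>y / dy (- int N)\<rfloor>" using y by (simp add: idx_def)
  then have "real (idx N y) \<le> y / dy (- int N)" "y / dy (- int N) < real (idx N y) + 1" by linarith+
  then show ?thesis by (simp add: dyint_def field_simps)
qed

lemma idx_unique: "y \<in> dyint (- int N, l) \<Longrightarrow> idx N y = l"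
proof -
  assume "y \<in> dyint (- int N, l)"
  then have "real l \<le> y / dy (- int N)" "y / dy (- int N) < real l + 1" by (simp_all add: dyint_def field_simps)
  then have "\<lfloor>y / dy (- int N)\<rfloor> = int l" by (simp add: floor_eq_iff)
  then show ?thesis by (simp add: idx_def)
qed

lemma idx_measurable [measurable]: "idx N \<in> borel \<rightarrow>\<^sub>M count_space UNIV"
  unfolding idx_def[abs_def] by measurable

lemma dyint_parent: "y \<in> dyint (k, l) \<Longrightarrow> y \<in> dyint (k + 1, l div 2)"
  using dyadic_parent[of l k] by (auto simp: dyint_def)

text \<open>For every N \<ge> M this set is a union of dyadic intervals of length 2^(-N), so
  averaging at these scales does not mix it with its complement.\<close>

definition shell :: "nat \<Rightarrow> real set" where "shell M = {dy (- int M)..<dy (int M)}"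

text \<open>The end points of the shell are the multiples 2^(N - M) and 2^(N + M) of 2^(-N), and
  integer thresholds pass through the floor.\<close>

lemma idx_shell:
  assumes "N \<ge> M" "y \<ge> 0"
  shows "y \<in> shell M \<longleftrightarrow> 2 ^ (N - M) \<le> idx N y \<and> idx N y < 2 ^ (N + M)"
proof -
  have d: "real (2 ^ n) * dy (- int N) = dy (int n - int N)" for n
    using dy_add[of "int n" "- int N"] by (simp add: dy_def powr_realpow)
  have iff: "dy (int n - int N) \<le> y \<longleftrightarrow> 2 ^ n \<le> idx N y" for n
  proof -
    have "2 ^ n \<le> idx N y \<longleftrightarrow> int (2 ^ n) \<le> \<lfloor>y / dy (- int N)\<rfloor>" using assms(2) by (simp add: idx_def le_nat_iff)
    also have "\<dots> \<longleftrightarrow> real (2 ^ n) \<le> y / dy (- int N)" by (simp add: le_floor_iff)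
    also have "\<dots> \<longleftrightarrow> real (2 ^ n) * dy (- int N) \<le> y" by (simp add: pos_le_divide_eq)
    finally show ?thesis by (simp only: d)
  qed
  show ?thesis
    using iff[of "N - M"] iff[of "N + M"] assms(1) by (auto simp: shell_def not_le[symmetric])
qed

lemma shell_sets [measurable]: "shell M \<in> sets borel" by (simp add: shell_def)

lemma shell_pos: "y \<in> shell M \<Longrightarrow> y > 0"
  using less_le_trans[OF dy_pos(1)] by (auto simp: shell_def)

lemma avg_abs_le:
  fixes w :: "real \<Rightarrow> real"
  assumes "continuous_on UNIV w" "a < b"
  shows "ennreal \<bar>avg w a b\<bar> \<le> ennreal (1 / (b - a)) * (\<integral>\<^sup>+y\<in>{a..b}. ennreal \<bar>w y\<bar> \<partial>lborel)"
proof -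
  have i: "set_integrable lborel {a..b} w"
    by (rule borel_integrable_atLeastAtMost') (rule continuous_on_subset[OF assms(1)], simp)
  have "\<bar>LBINT y:{a..b}. w y\<bar> \<le> (\<integral>y. \<bar>indicator {a..b} y *\<^sub>R w y\<bar> \<partial>lborel)"
    unfolding set_lebesgue_integral_def by (rule integral_abs_bound)
  then have "ennreal \<bar>LBINT y:{a..b}. w y\<bar> \<le> ennreal (\<integral>y. \<bar>indicator {a..b} y *\<^sub>R w y\<bar> \<partial>lborel)" by (rule ennreal_leI)
  also have "\<dots> = (\<integral>\<^sup>+y. ennreal \<bar>indicator {a..b} y *\<^sub>R w y\<bar> \<partial>lborel)"
    using i unfolding set_integrable_def by (intro nn_integral_eq_integral[symmetric] integrable_abs) auto
  also have "\<dots> = (\<integral>\<^sup>+y\<in>{a..b}. ennreal \<bar>w y\<bar> \<partial>lborel)"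
    by (rule nn_integral_cong) (auto simp: indicator_def)
  finally have 1: "ennreal \<bar>LBINT y:{a..b}. w y\<bar> \<le> (\<integral>\<^sup>+y\<in>{a..b}. ennreal \<bar>w y\<bar> \<partial>lborel)" .
  have "ennreal \<bar>avg w a b\<bar> = ennreal (1 / (b - a)) * ennreal \<bar>LBINT y:{a..b}. w y\<bar>"
    using assms(2) by (simp add: avg_def abs_mult ennreal_mult'[symmetric])
  then show ?thesis using mult_left_mono[OF 1, of "ennreal (1 / (b - a))"] by simp
qed

lemma dyint_eq_idx:
  assumes "z \<noteq> (real l + 1) * dy (- int N)" "z \<in> {real l * dy (- int N)..(real l + 1) * dy (- int N)}"
  shows "idx N z = l"
  by (rule idx_unique) (use assms in \<open>auto simp: dyint_def\<close>)

lemma real_idx_measurable [measurable]: "(\<lambda>y. real (idx N y)) \<in> borel_measurable borel"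
  unfolding idx_def by measurable

text \<open>Averaging is dominated by the integral operator with kernel 2^N on pairs of points of
  the same dyadic interval. The kernel integrates to at most 1 in either variable, so exchanging the
  integrals gives the contraction; points sharing an interval lie in the shell together.\<close>

lemma avg_contraction:
  fixes w :: "real \<Rightarrow> real"
  assumes c: "continuous_on UNIV w" and N: "N \<ge> M"
  shows "(\<integral>\<^sup>+y\<in>shell M. ennreal \<bar>avgd w (- int N) (idx N y)\<bar> \<partial>lborel) \<le> (\<integral>\<^sup>+y\<in>shell M. ennreal \<bar>w y\<bar> \<partial>lborel)"
proof -
  define \<delta> where "\<delta> = dy (- int N)"
  have \<delta>: "\<delta> > 0" by (simp add: \<delta>_def)
  have [measurable]: "w \<in> borel_measurable borel" by (rule borel_measurable_continuous_onI[OF c])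
  have "(\<integral>\<^sup>+y\<in>shell M. ennreal \<bar>avgd w (- int N) (idx N y)\<bar> \<partial>lborel)
     \<le> (\<integral>\<^sup>+y. \<integral>\<^sup>+z. ennreal (1 / \<delta>) * ennreal \<bar>w z\<bar> * (indicator (shell M) z * indicator {y. y \<ge> 0 \<and> real (idx N z) = real (idx N y)} y) \<partial>lborel \<partial>lborel)"
  proof (rule nn_integral_mono)
    fix y :: real
    show "ennreal \<bar>avgd w (- int N) (idx N y)\<bar> * indicator (shell M) y
      \<le> (\<integral>\<^sup>+z. ennreal (1 / \<delta>) * ennreal \<bar>w z\<bar> * (indicator (shell M) z * indicator {y. y \<ge> 0 \<and> real (idx N z) = real (idx N y)} y) \<partial>lborel)"
    proof (cases "y \<in> shell M")
      case True
      let ?l = "idx N y"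
      have y0: "y \<ge> 0" using shell_pos[OF True] by simp
      have "ennreal \<bar>avgd w (- int N) ?l\<bar> \<le> ennreal (1 / ((real ?l + 1) * \<delta> - real ?l * \<delta>)) * (\<integral>\<^sup>+z\<in>{real ?l * \<delta>..(real ?l + 1) * \<delta>}. ennreal \<bar>w z\<bar> \<partial>lborel)"
        unfolding \<delta>_def by (rule avg_abs_le[OF c]) simp
      also have "(real ?l + 1) * \<delta> - real ?l * \<delta> = \<delta>" by (simp add: algebra_simps)
      also have "ennreal (1 / \<delta>) * (\<integral>\<^sup>+z\<in>{real ?l * \<delta>..(real ?l + 1) * \<delta>}. ennreal \<bar>w z\<bar> \<partial>lborel)
        = (\<integral>\<^sup>+z. ennreal (1 / \<delta>) * (ennreal \<bar>w z\<bar> * indicator {real ?l * \<delta>..(real ?l + 1) * \<delta>} z) \<partial>lborel)"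
        by (rule nn_integral_cmult[symmetric]) measurable
      also have "\<dots> \<le> (\<integral>\<^sup>+z. ennreal (1 / \<delta>) * ennreal \<bar>w z\<bar> * (indicator (shell M) z * indicator {y. y \<ge> 0 \<and> real (idx N z) = real (idx N y)} y) \<partial>lborel)"
      proof (rule nn_integral_mono_AE)
        \<comment> \<open>The mean is taken over a closed interval while \<open>idx\<close> belongs
          to a half-open one; they differ at the right end point only.\<close>
        show "AE z in lborel. ennreal (1 / \<delta>) * (ennreal \<bar>w z\<bar> * indicator {real ?l * \<delta>..(real ?l + 1) * \<delta>} z)
          \<le> ennreal (1 / \<delta>) * ennreal \<bar>w z\<bar> * (indicator (shell M) z * indicator {y. y \<ge> 0 \<and> real (idx N z) = real (idx N y)} y)"
          using AE_lborel_singleton[of "(real ?l + 1) * \<delta>"]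
        proof eventually_elim
          case (elim z)
          show ?case
          proof (cases "z \<in> {real ?l * \<delta>..(real ?l + 1) * \<delta>}")
            case zin: True
            then have iz: "idx N z = ?l" using dyint_eq_idx[of z ?l N] elim by (simp add: \<delta>_def)
            have "0 \<le> real ?l * \<delta>" using \<delta> by simp
            then have z0: "z \<ge> 0" using zin by simp
            have "z \<in> shell M" using True idx_shell[OF N y0] idx_shell[OF N z0] iz by simp
            then show ?thesis using iz y0 zin by simp
          qed simp
        qed
      qed
      finally show ?thesis using True by simp
    qed simp
  qed
  also have "\<dots> = (\<integral>\<^sup>+z. \<integral>\<^sup>+y. ennreal (1 / \<delta>) * ennreal \<bar>w z\<bar> * (indicator (shell M) z * indicator {y. y \<ge> 0 \<and> real (idx N z) = real (idx N y)} y) \<partial>lborel \<partial>lborel)"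
    by (rule lborel_pair.Fubini') measurable
  also have "\<dots> \<le> (\<integral>\<^sup>+z. ennreal \<bar>w z\<bar> * indicator (shell M) z \<partial>lborel)"
  proof (rule nn_integral_mono)
    fix z :: real
    have "(\<integral>\<^sup>+y. ennreal (1 / \<delta>) * ennreal \<bar>w z\<bar> * (indicator (shell M) z * indicator {y. y \<ge> 0 \<and> real (idx N z) = real (idx N y)} y) \<partial>lborel)
       \<le> (\<integral>\<^sup>+y. ennreal (1 / \<delta>) * ennreal \<bar>w z\<bar> * indicator (shell M) z * indicator {real (idx N z) * \<delta>..(real (idx N z) + 1) * \<delta>} y \<partial>lborel)"
    proof (rule nn_integral_mono)
      fix y :: real
      have "indicator {y. y \<ge> 0 \<and> real (idx N z) = real (idx N y)} y \<le> (indicator {real (idx N z) * \<delta>..(real (idx N z) + 1) * \<delta>} y :: ennreal)"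
        using idx_mem[of y N] by (auto simp: indicator_def dyint_def \<delta>_def)
      then show "ennreal (1 / \<delta>) * ennreal \<bar>w z\<bar> * (indicator (shell M) z * indicator {y. y \<ge> 0 \<and> real (idx N z) = real (idx N y)} y)
         \<le> ennreal (1 / \<delta>) * ennreal \<bar>w z\<bar> * indicator (shell M) z * indicator {real (idx N z) * \<delta>..(real (idx N z) + 1) * \<delta>} y"
        by (simp add: mult.assoc mult_left_mono)
    qed
    also have "\<dots> = ennreal (1 / \<delta>) * ennreal \<bar>w z\<bar> * indicator (shell M) z * ennreal \<delta>"
      using \<delta> by (subst nn_integral_cmult_indicator) (auto simp: algebra_simps)
    also have "\<dots> = (ennreal (1 / \<delta>) * ennreal \<delta>) * (ennreal \<bar>w z\<bar> * indicator (shell M) z)" by (simp add: mult_ac)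
    also have "ennreal (1 / \<delta>) * ennreal \<delta> = 1" using \<delta> by (simp add: ennreal_mult'[symmetric])
    finally show "(\<integral>\<^sup>+y. ennreal (1 / \<delta>) * ennreal \<bar>w z\<bar> * (indicator (shell M) z * indicator {y. y \<ge> 0 \<and> real (idx N z) = real (idx N y)} y) \<partial>lborel)
      \<le> ennreal \<bar>w z\<bar> * indicator (shell M) z" by simp
  qed
  finally show ?thesis by simp
qed

lemma avg_diff:
  assumes "continuous_on UNIV v" "continuous_on UNIV w"
  shows "avg (\<lambda>y. v y - w y) a b = avg v a b - avg w a b"
proof -
  have "set_integrable lborel {a..b} f" if "continuous_on UNIV f" for f :: "real \<Rightarrow> real"
    by (rule borel_integrable_atLeastAtMost') (rule continuous_on_subset[OF that], simp)
  then show ?thesis using assms unfolding avg_def by (subst set_integral_diff(2)) (auto simp: right_diff_distrib)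
qed

text \<open>On [a, b] the function oscillates by at most B (b - a). With length 2^(-N) this makes
  the dyadic means of a fixed bump converge uniformly.\<close>

lemma avg_near:
  fixes w w' :: "real \<Rightarrow> real"
  assumes d: "\<And>x. (w has_real_derivative w' x) (at x)" and B: "\<And>y. y \<ge> 0 \<Longrightarrow> \<bar>w' y\<bar> \<le> B"
    and ab: "0 \<le> a" "a < b" "a \<le> y" "y \<le> b"
  shows "\<bar>w y - avg w a b\<bar> \<le> B * (b - a)"
proof -
  have c: "continuous_on UNIV w" using d by (auto simp: continuous_on_eq_continuous_at intro: DERIV_isCont)
  have i: "set_integrable lborel {a..b} w"
    by (rule borel_integrable_atLeastAtMost') (rule continuous_on_subset[OF c], simp)
  have ic: "set_integrable lborel {a..b} (\<lambda>_. w y)" by (rule borel_integrable_atLeastAtMost') (rule continuous_on_const)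
  have B0: "B \<ge> 0" using B[of 0] by simp
  have lip: "\<bar>w y - w z\<bar> \<le> B * (b - a)" if z: "z \<in> {a..b}" for z
  proof -
    have "norm (w y - w z) \<le> B * norm (y - z)"
    proof (rule field_differentiable_bound[of "{a..b}" w w'])
      show "(w has_field_derivative w' x) (at x within {a..b})" for x using d by (rule has_field_derivative_at_within)
      show "norm (w' x) \<le> B" if "x \<in> {a..b}" for x using B[of x] that ab by simp
    qed (use z ab in auto)
    also have "\<dots> \<le> B * (b - a)" using z ab B0 by (intro mult_left_mono) auto
    finally show ?thesis by simp
  qed
  have cst: "(LBINT z:{a..b}. c) = (b - a) * c" for c :: real
    using ab by (simp add: set_lebesgue_integral_def)
  have "(b - a) * (w y - avg w a b) = (LBINT z:{a..b}. w y) - (LBINT z:{a..b}. w z)"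
    using ab by (simp add: cst avg_def field_simps)
  also have "\<dots> = (LBINT z:{a..b}. w y - w z)" using i ic by (simp add: set_integral_diff)
  finally have eq: "(b - a) * (w y - avg w a b) = (LBINT z:{a..b}. w y - w z)" .
  have "\<bar>LBINT z:{a..b}. w y - w z\<bar> \<le> (LBINT z:{a..b}. \<bar>w y - w z\<bar>)"
    using set_integral_norm_bound[OF set_integral_diff(1)[OF ic i]] by simp
  also have "\<dots> \<le> (LBINT z:{a..b}. B * (b - a))"
  proof (rule set_integral_mono)
    show "set_integrable lborel {a..b} (\<lambda>z. \<bar>w y - w z\<bar>)" using set_integrable_abs[OF set_integral_diff(1)[OF ic i]] .
    show "set_integrable lborel {a..b} (\<lambda>z. B * (b - a))" by (rule borel_integrable_atLeastAtMost') (rule continuous_on_const)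
  qed (rule lip)
  finally have "(b - a) * \<bar>w y - avg w a b\<bar> \<le> (b - a) * (B * (b - a))"
    using ab unfolding cst eq[symmetric] by (simp add: abs_mult)
  then show ?thesis using ab by simp
qed

text \<open>Telescoping along the chain of dyadic ancestors, whose length is logarithmic in \<open>l\<close>.\<close>

lemma telescope_bound:
  fixes A d :: "int \<Rightarrow> nat \<Rightarrow> real"
  assumes top: "\<And>k. A k 1 = d k 1" and step: "\<And>k l. l \<ge> 2 \<Longrightarrow> A k l = d k l + A (k + 1) (l div 2)"
    and B: "\<And>k l. l \<ge> 1 \<Longrightarrow> y \<in> dyint (k, l) \<Longrightarrow> \<bar>d k l\<bar> \<le> B * real l powr (- \<epsilon>)"
    and B0: "B \<ge> 0" and e: "\<epsilon> > 0"
  shows "y \<in> dyint (k, l) \<Longrightarrow> 2 ^ n \<le> l \<Longrightarrow> l < 2 ^ (n + 1) \<Longrightarrow> \<bar>A k l\<bar> \<le> B * (\<Sum>i\<le>n. (2 powr (- \<epsilon>)) ^ i)"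
proof (induction n arbitrary: k l)
  case 0
  then have "l = 1" by simp
  then show ?case using B[of 1 k] 0 top by simp
next
  case (Suc n)
  have l2: "l \<ge> 2" using Suc.prems(2) one_le_power[of "2::nat" n] unfolding power_Suc by linarith
  have h: "2 ^ n \<le> l div 2" "l div 2 < 2 ^ (n + 1)" using Suc.prems by auto
  have "real l \<ge> 2 ^ Suc n" using Suc.prems(2) by (metis of_nat_le_iff of_nat_numeral of_nat_power)
  then have "real l powr (- \<epsilon>) \<le> (2 ^ Suc n) powr (- \<epsilon>)" using e by (intro powr_mono2') auto
  also have "(2 ^ Suc n) powr (- \<epsilon>) = (2 powr real (Suc n)) powr (- \<epsilon>)" by (simp only: powr_realpow zero_less_numeral)
  also have "\<dots> = (2 powr (- \<epsilon>)) powr real (Suc n)" by (simp only: powr_powr mult.commute)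
  also have "\<dots> = (2 powr (- \<epsilon>)) ^ Suc n" by (rule powr_realpow) simp
  finally have "B * real l powr (- \<epsilon>) \<le> B * (2 powr (- \<epsilon>)) ^ Suc n" by (rule mult_left_mono[OF _ B0])
  moreover have "\<bar>d k l\<bar> \<le> B * real l powr (- \<epsilon>)" using B[of l k] Suc.prems(1) l2 by simp
  moreover have "\<bar>A (k + 1) (l div 2)\<bar> \<le> B * (\<Sum>i\<le>n. (2 powr (- \<epsilon>)) ^ i)"
    by (rule Suc.IH[OF dyint_parent[OF Suc.prems(1)] h])
  ultimately show ?case using step[OF l2, of k] by (simp add: distrib_left)
qed

section \<open>Limits in L^1 and summation of q-th powers\<close>

lemma nat_dyadic_level: "l \<ge> 1 \<Longrightarrow> \<exists>n. 2 ^ n \<le> l \<and> l < (2::nat) ^ (n + 1)"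
  using ex_power_ivl1[of 2 l] by auto

text \<open>Choose \<open>r m\<close> such that the error on \<open>K m\<close> is below 2^(-m). The
  errors are then summable almost everywhere, and every point belongs to \<open>K m\<close> from
  some m on.\<close>

lemma L1_limit_subsequence:
  fixes f :: "'a \<Rightarrow> real" and g :: "nat \<Rightarrow> 'a \<Rightarrow> real"
  assumes [measurable]: "f \<in> borel_measurable M" "\<And>n. g n \<in> borel_measurable M" "\<And>m. K m \<in> sets M"
    and K: "incseq K" "(\<Union>m. K m) = space M"
    and lim: "\<And>m. (\<lambda>n. \<integral>\<^sup>+x\<in>K m. ennreal \<bar>f x - g n x\<bar> \<partial>M) \<longlonglongrightarrow> 0"
  shows "\<exists>r. AE x in M. (\<lambda>m. g (r m) x) \<longlonglongrightarrow> f x"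
proof -
  have "\<exists>n. (\<integral>\<^sup>+x\<in>K m. ennreal \<bar>f x - g n x\<bar> \<partial>M) < ennreal ((1 / 2) ^ m)" for m
    using order_tendstoD(2)[OF lim[of m], of "ennreal ((1 / 2) ^ m)"] by (auto simp: eventually_sequentially)
  then have "\<forall>m. \<exists>n. (\<integral>\<^sup>+x\<in>K m. ennreal \<bar>f x - g n x\<bar> \<partial>M) < ennreal ((1 / 2) ^ m)" by blast
  from choice[OF this] obtain r where r: "\<And>m. (\<integral>\<^sup>+x\<in>K m. ennreal \<bar>f x - g (r m) x\<bar> \<partial>M) < ennreal ((1 / 2) ^ m)" by blast
  have "(\<integral>\<^sup>+x. (\<Sum>m. ennreal \<bar>f x - g (r m) x\<bar> * indicator (K m) x) \<partial>M) = (\<Sum>m. \<integral>\<^sup>+x\<in>K m. ennreal \<bar>f x - g (r m) x\<bar> \<partial>M)"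
    by (rule nn_integral_suminf) measurable
  also have "\<dots> \<le> (\<Sum>m. ennreal (1 * (1 / 2) ^ m))"
    using r by (intro suminf_le) (auto intro: less_imp_le)
  also have "\<dots> = ennreal (1 * (1 / (1 - 1 / 2)))" by (rule suminf_geometric_ennreal) auto
  finally have "(\<integral>\<^sup>+x. (\<Sum>m. ennreal \<bar>f x - g (r m) x\<bar> * indicator (K m) x) \<partial>M) < \<infinity>"
    by (rule order.strict_trans1) simp
  then have "(\<integral>\<^sup>+x. (\<Sum>m. ennreal \<bar>f x - g (r m) x\<bar> * indicator (K m) x) \<partial>M) \<noteq> \<infinity>" by simp
  then have "AE x in M. (\<Sum>m. ennreal \<bar>f x - g (r m) x\<bar> * indicator (K m) x) \<noteq> \<infinity>"
    by (intro nn_integral_PInf_AE) auto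
  moreover have "AE x in M. x \<in> space M" by (rule AE_space)
  ultimately have "AE x in M. (\<lambda>m. g (r m) x) \<longlonglongrightarrow> f x"
  proof eventually_elim
    case (elim x)
    define a where "a m = \<bar>f x - g (r m) x\<bar> * indicator (K m) x" for m
    have "ennreal (a m) = ennreal \<bar>f x - g (r m) x\<bar> * indicator (K m) x" for m by (simp add: a_def indicator_def)
    then have "(\<Sum>m. ennreal (a m)) \<noteq> top" using elim(1) by simp
    then have "summable a" by (intro summable_suminf_not_top) (auto simp: a_def)
    then have a0: "a \<longlonglongrightarrow> 0" by (rule summable_LIMSEQ_zero)
    obtain m0 where "x \<in> K m0" using K(2) elim(2) by blast
    then have inK: "x \<in> K m" if "m \<ge> m0" for m using incseqD[OF K(1) that] by blast
    have "\<forall>\<^sub>F m in sequentially. a m = \<bar>f x - g (r m) x\<bar>"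
      using eventually_ge_at_top[of m0] by eventually_elim (simp add: inK a_def)
    from Lim_transform_eventually[OF a0 this]
    have "(\<lambda>m. \<bar>f x - g (r m) x\<bar>) \<longlonglongrightarrow> 0" .
    then have "(\<lambda>m. f x - g (r m) x) \<longlonglongrightarrow> 0" by (simp add: tendsto_rabs_zero_iff)
    from tendsto_diff[OF tendsto_const[of "f x"] this] show ?case by simp
  qed
  then show ?thesis by blast
qed

text \<open>Fatou along an almost everywhere convergent subsequence; in this way a bound for step
  functions passes to the solution.\<close>

lemma nn_integral_powr_le_of_L1_limit:
  fixes f :: "'a \<Rightarrow> real" and g :: "nat \<Rightarrow> 'a \<Rightarrow> real"
  assumes [measurable]: "f \<in> borel_measurable M" "\<And>n. g n \<in> borel_measurable M" "\<And>m. K m \<in> sets M"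
    and K: "incseq K" "(\<Union>m. K m) = space M"
    and lim: "\<And>m. (\<lambda>n. \<integral>\<^sup>+x\<in>K m. ennreal \<bar>f x - g n x\<bar> \<partial>M) \<longlonglongrightarrow> 0"
    and b: "\<And>n. (\<integral>\<^sup>+x. ennreal (\<bar>g n x\<bar> powr q) \<partial>M) \<le> C" and q: "q > 0"
  shows "(\<integral>\<^sup>+x. ennreal (\<bar>f x\<bar> powr q) \<partial>M) \<le> C"
proof -
  obtain r where r: "AE x in M. (\<lambda>m. g (r m) x) \<longlonglongrightarrow> f x"
    using L1_limit_subsequence[OF assms(1-3) K lim] by blast
  have "(\<integral>\<^sup>+x. ennreal (\<bar>f x\<bar> powr q) \<partial>M) = (\<integral>\<^sup>+x. liminf (\<lambda>m. ennreal (\<bar>g (r m) x\<bar> powr q)) \<partial>M)"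
  proof (rule nn_integral_cong_AE)
    show "AE x in M. ennreal (\<bar>f x\<bar> powr q) = liminf (\<lambda>m. ennreal (\<bar>g (r m) x\<bar> powr q))"
      using r
    proof eventually_elim
      case (elim x)
      have "(\<lambda>m. \<bar>g (r m) x\<bar> powr q) \<longlonglongrightarrow> \<bar>f x\<bar> powr q"
        using q by (intro tendsto_powr' tendsto_rabs elim tendsto_const) auto
      then have "(\<lambda>m. ennreal (\<bar>g (r m) x\<bar> powr q)) \<longlonglongrightarrow> ennreal (\<bar>f x\<bar> powr q)" by (rule tendsto_ennrealI)
      from lim_imp_Liminf[OF _ this] show ?case by simp
    qed
  qed
  also have "\<dots> \<le> liminf (\<lambda>m. \<integral>\<^sup>+x. ennreal (\<bar>g (r m) x\<bar> powr q) \<partial>M)"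
    by (rule nn_integral_liminf) measurable
  also have "\<dots> \<le> liminf (\<lambda>m. C)" by (rule Liminf_mono) (use b in simp)
  also have "\<dots> = C" by (rule Liminf_const) simp
  finally show ?thesis .
qed

text \<open>Each term is at most the total R, so x^r \<le> R^(r - 1) x. With r = q / 2 and squares
  as terms this is the embedding of l^2 into l^q.\<close>

lemma sum_powr_le_powr_sum:
  assumes x: "\<And>p. x p \<ge> 0" and R: "R \<ge> 0" "(\<integral>\<^sup>+p. ennreal (x p) \<partial>count_space UNIV) \<le> ennreal R" and r: "r \<ge> 1"
  shows "(\<integral>\<^sup>+p. ennreal (x p powr r) \<partial>count_space UNIV) \<le> ennreal (R powr r)"
proof -
  have xR: "x p \<le> R" for p
  proof -
    have "ennreal (x p) \<le> (\<integral>\<^sup>+p. ennreal (x p) \<partial>count_space UNIV)" by (rule nn_integral_ge_point) simp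
    then have "ennreal (x p) \<le> ennreal R" using R(2) by (rule order_trans)
    then show ?thesis using R(1) by (simp add: ennreal_le_iff)
  qed
  have "(\<integral>\<^sup>+p. ennreal (x p powr r) \<partial>count_space UNIV) \<le> (\<integral>\<^sup>+p. ennreal (R powr (r - 1)) * ennreal (x p) \<partial>count_space UNIV)"
  proof (rule nn_integral_mono)
    fix p
    have "x p powr r = x p powr (r - 1) * x p"
    proof (cases "x p = 0")
      case False
      then have "x p > 0" using x[of p] by simp
      then show ?thesis using powr_add[of "x p" "r - 1" 1] by simp
    qed simp
    also have "\<dots> \<le> R powr (r - 1) * x p" using xR x r by (intro mult_right_mono powr_mono2) auto
    finally show "ennreal (x p powr r) \<le> ennreal (R powr (r - 1)) * ennreal (x p)" by (simp add: ennreal_mult[symmetric] x ennreal_leI)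
  qed
  also have "\<dots> = ennreal (R powr (r - 1)) * (\<integral>\<^sup>+p. ennreal (x p) \<partial>count_space UNIV)" by (rule nn_integral_cmult) simp
  also have "\<dots> \<le> ennreal (R powr (r - 1)) * ennreal R" by (rule mult_left_mono[OF R(2)]) simp
  also have "\<dots> = ennreal (R powr r)"
  proof (cases "R = 0")
    case False
    then have "R powr (r - 1) * R = R powr r" using R(1) powr_add[of R "r - 1" 1] by simp
    then show ?thesis using R(1) by (simp add: ennreal_mult[symmetric])
  qed simp
  finally show ?thesis .
qed

lemma dyint_measurable [measurable]: "dyint p \<in> sets borel" by (simp add: dyint_def split: prod.split)

text \<open>The square sum enters through \<open>\<ell>\<^sup>2 \<subseteq> \<ell>\<^sup>q\<close>. A loss of \<open>l\<^bsup>1/4 - 1/q\<^esup>\<close> in the weights makes the telescoping sum over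
  the dyadic ancestors geometric.\<close>

lemma step_function_bound:
  fixes A d :: "int \<Rightarrow> nat \<Rightarrow> real" and q :: real
  assumes q: "q > 4" and top: "\<And>k. A k 1 = d k 1" and step: "\<And>k l. l \<ge> 2 \<Longrightarrow> A k l = d k l + A (k + 1) (l div 2)"
    and R: "R \<ge> 0" "(\<integral>\<^sup>+p. ennreal (cw (1 - 3 / q) (3 / 2 - 2 / q) p * (d (fst p) (snd p))\<^sup>2) \<partial>count_space UNIV) \<le> ennreal R"
  shows "(\<integral>\<^sup>+y. ennreal ((1 + y) powr (2 - q) * \<bar>if idx N y = 0 then 0 else A (- int N) (idx N y)\<bar> powr q) \<partial>hl)
    \<le> ennreal ((1 / (1 - 2 powr (- (1 / 4 - 1 / q)))) powr q * R powr (q / 2))"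
proof -
  define \<epsilon> where "\<epsilon> = 1 / 4 - 1 / q"
  have e: "\<epsilon> > 0" using q by (simp add: \<epsilon>_def field_simps)
  define G where "G = 1 / (1 - 2 powr (- \<epsilon>))"
  have r1: "2 powr (- \<epsilon>) < (1::real)" using e by (simp add: powr_less_one)
  have G: "G > 0" using r1 by (simp add: G_def)
  \<comment> \<open>The factor l^\<epsilon> is the reserve that pays for telescoping;
    \<open>E y\<close> adds up these q-th powers over all dyadic intervals that contain y.\<close>
  define T where "T p = (real (snd p) powr \<epsilon> * \<bar>d (fst p) (snd p)\<bar>) powr q" for p :: "int \<times> nat"
  define E where "E y = (\<integral>\<^sup>+p. ennreal (T p) * indicator (dyint p) y \<partial>count_space UNIV)" for y
  have pw: "ennreal (\<bar>A (- int N) (idx N y)\<bar> powr q) \<le> ennreal (G powr q) * E y" if y: "y > 0" "idx N y \<noteq> 0" for y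
  proof (cases "E y = top")
    case True then show ?thesis using G by (simp add: ennreal_mult_top)
  next
    case False
    then obtain b where b: "b \<ge> 0" "E y = ennreal b" by (cases "E y") auto
    define B where "B = b powr (1 / q)"
    \<comment> \<open>The sum over the intervals containing y dominates each of its terms, so the
      q-th root \<open>B\<close> of its value bounds all weighted differences at y uniformly in the
      scale.\<close>
    have bd: "\<bar>d k l\<bar> \<le> B * real l powr (- \<epsilon>)" if l: "l \<ge> 1" "y \<in> dyint (k, l)" for k l
    proof -
      have "ennreal (T (k, l)) * indicator (dyint (k, l)) y \<le> E y" unfolding E_def by (rule nn_integral_ge_point) simp
      then have "T (k, l) \<le> b" using l b by (simp add: ennreal_le_iff)
      then have "T (k, l) powr (1 / q) \<le> B" unfolding B_def using q by (intro powr_mono2) (auto simp: T_def)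
      then have "real l powr \<epsilon> * \<bar>d k l\<bar> \<le> B" using q by (simp add: T_def powr_powr)
      then have "real l powr (- \<epsilon>) * (real l powr \<epsilon> * \<bar>d k l\<bar>) \<le> real l powr (- \<epsilon>) * B" by (rule mult_left_mono) simp
      moreover have "real l powr (- \<epsilon>) * (real l powr \<epsilon> * \<bar>d k l\<bar>) = \<bar>d k l\<bar>" using l by (simp add: powr_minus)
      ultimately show ?thesis by (simp only: mult.commute)
    qed
    have l1: "idx N y \<ge> 1" using y(2) by simp
    obtain n where n: "2 ^ n \<le> idx N y" "idx N y < 2 ^ (n + 1)" using nat_dyadic_level[OF l1] by blast
    have "\<bar>A (- int N) (idx N y)\<bar> \<le> B * (\<Sum>i\<le>n. (2 powr (- \<epsilon>)) ^ i)"
      by (rule telescope_bound[where A=A and d=d and B=B and \<epsilon>=\<epsilon> and y=y, OF top step bd _ e idx_mem n])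
         (use y in \<open>simp_all add: B_def\<close>)
    also have "(\<Sum>i\<le>n. (2 powr (- \<epsilon>)) ^ i) \<le> (\<Sum>i. (2 powr (- \<epsilon>)) ^ i :: real)"
      by (rule sum_le_suminf) (use r1 in \<open>auto intro!: summable_geometric\<close>)
    also have "\<dots> = G" unfolding G_def by (rule suminf_geometric) (use r1 in simp)
    finally have "\<bar>A (- int N) (idx N y)\<bar> \<le> B * G" by (simp add: mult_left_mono B_def)
    then have "\<bar>A (- int N) (idx N y)\<bar> powr q \<le> (B * G) powr q" using q by (intro powr_mono2) auto
    also have "\<dots> = G powr q * b" using G b q by (simp add: powr_mult B_def powr_powr mult.commute)
    finally show ?thesis using b by (simp add: ennreal_mult[symmetric] ennreal_leI)
  qed
  have "(\<integral>\<^sup>+y. ennreal ((1 + y) powr (2 - q) * \<bar>if idx N y = 0 then 0 else A (- int N) (idx N y)\<bar> powr q) \<partial>hl)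
    \<le> (\<integral>\<^sup>+y. (\<integral>\<^sup>+p. ennreal (G powr q) * (ennreal ((1 + y) powr (2 - q)) * (ennreal (T p) * indicator (dyint p) y)) \<partial>count_space UNIV) \<partial>hl)"
  proof (rule nn_integral_mono)
    fix y assume "y \<in> space hl"
    then have y: "y > 0" by simp
    have "ennreal ((1 + y) powr (2 - q) * \<bar>if idx N y = 0 then 0 else A (- int N) (idx N y)\<bar> powr q)
       \<le> ennreal ((1 + y) powr (2 - q)) * (ennreal (G powr q) * E y)"
    proof (cases "idx N y = 0")
      case False
      have "ennreal ((1 + y) powr (2 - q)) * ennreal (\<bar>A (- int N) (idx N y)\<bar> powr q) \<le> ennreal ((1 + y) powr (2 - q)) * (ennreal (G powr q) * E y)"
        by (rule mult_left_mono[OF pw[OF y False]]) simp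
      then show ?thesis using False by (simp add: ennreal_mult)
    qed simp
    also have "\<dots> = (\<integral>\<^sup>+p. ennreal (G powr q) * (ennreal ((1 + y) powr (2 - q)) * (ennreal (T p) * indicator (dyint p) y)) \<partial>count_space UNIV)"
      unfolding E_def mult.left_commute[of _ "ennreal (G powr q)"] by (simp only: nn_integral_cmult[OF borel_measurable_count_space])
    finally show "ennreal ((1 + y) powr (2 - q) * \<bar>if idx N y = 0 then 0 else A (- int N) (idx N y)\<bar> powr q)
       \<le> (\<integral>\<^sup>+p. ennreal (G powr q) * (ennreal ((1 + y) powr (2 - q)) * (ennreal (T p) * indicator (dyint p) y)) \<partial>count_space UNIV)" .
  qed
  also have "\<dots> = (\<integral>\<^sup>+p. (\<integral>\<^sup>+y. ennreal (G powr q) * (ennreal ((1 + y) powr (2 - q)) * (ennreal (T p) * indicator (dyint p) y)) \<partial>hl) \<partial>count_space UNIV)"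
    by (rule nn_integral_count_space_nn_integral, simp, rule borel_measurable_hlI, measurable)
  also have "\<dots> \<le> (\<integral>\<^sup>+p. ennreal (G powr q) * ennreal ((cw (1 - 3 / q) (3 / 2 - 2 / q) p * (d (fst p) (snd p))\<^sup>2) powr (q / 2)) \<partial>count_space UNIV)"
  proof (rule nn_integral_mono)
    fix p :: "int \<times> nat"
    obtain k l where p: "p = (k, l)" by force
    show "(\<integral>\<^sup>+y. ennreal (G powr q) * (ennreal ((1 + y) powr (2 - q)) * (ennreal (T p) * indicator (dyint p) y)) \<partial>hl)
      \<le> ennreal (G powr q) * ennreal ((cw (1 - 3 / q) (3 / 2 - 2 / q) p * (d (fst p) (snd p))\<^sup>2) powr (q / 2))"
    proof (cases "l = 0")
      case True then show ?thesis by (simp add: p T_def)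
    next
      case False
      then have l: "real l > 0" by simp
      have "(\<integral>\<^sup>+y. ennreal (G powr q) * (ennreal ((1 + y) powr (2 - q)) * (ennreal (T p) * indicator (dyint p) y)) \<partial>hl)
        \<le> (\<integral>\<^sup>+y. ennreal (G powr q * ((real l * dy k) powr (2 - q) * T p)) * indicator {real l * dy k..(real l + 1) * dy k} y \<partial>lborel)"
        unfolding nn_integral_hl
      proof (rule nn_integral_mono)
        fix y :: real
        show "ennreal (G powr q) * (ennreal ((1 + y) powr (2 - q)) * (ennreal (T p) * indicator (dyint p) y)) * indicator {0<..} y
          \<le> ennreal (G powr q * ((real l * dy k) powr (2 - q) * T p)) * indicator {real l * dy k..(real l + 1) * dy k} y"
        proof (cases "y \<in> dyint p")
          case True
          then have y: "real l * dy k \<le> y" "y < (real l + 1) * dy k" by (simp_all add: p dyint_def)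
          have ld: "real l * dy k > 0" using l by simp
          \<comment> \<open>The exponent 2 - q is negative and 1 + y exceeds the left end point l
            2^k, which is positive because l \<noteq> 0.\<close>
          have "(1 + y) powr (2 - q) \<le> (real l * dy k) powr (2 - q)" using y ld q by (intro powr_mono2') auto
          then have "G powr q * ((1 + y) powr (2 - q) * T p) \<le> G powr q * ((real l * dy k) powr (2 - q) * T p)"
            by (intro mult_left_mono mult_right_mono) (auto simp: T_def)
          then show ?thesis using y ld True by (simp add: ennreal_mult[symmetric] T_def ennreal_leI)
        qed simp
      qed
      also have "\<dots> = ennreal (G powr q * ((real l * dy k) powr (2 - q) * T p)) * ennreal (dy k)"
        by (subst nn_integral_cmult_indicator) (auto simp: algebra_simps)
      also have "\<dots> = ennreal (G powr q) * ennreal ((real l * dy k) powr (2 - q) * T p * dy k)"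
        by (simp add: ennreal_mult[symmetric] T_def mult.assoc)
      \<comment> \<open>Origin of the exponents: -s q = (2 - q) + 1, the 1 being the length of the
        interval, gives s = 1 - 3 / q; and -\<beta> q / 2 = (2 - q) + \<epsilon> q gives \<beta> = 3
        / 2 - 2 / q.\<close>
      also have "(real l * dy k) powr (2 - q) * T p * dy k = (cw (1 - 3 / q) (3 / 2 - 2 / q) p * (d (fst p) (snd p))\<^sup>2) powr (q / 2)"
      proof -
        have "\<bar>d k l\<bar> powr q = ((d k l)\<^sup>2) powr (q / 2)"
        proof -
          have "(d k l)\<^sup>2 = \<bar>d k l\<bar> powr 2" by simp
          then show ?thesis by (simp only: powr_powr) simp
        qed
        moreover have "(dy k powr (- 2 * (1 - 3 / q))) powr (q / 2) = dy k powr (2 - q) * dy k"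
        proof -
          have "- 2 * (1 - 3 / q) * (q / 2) = (2 - q) + 1" using q by (simp add: field_simps)
          then show ?thesis by (simp only: powr_powr powr_add powr_one[OF dy_pos(2)])
        qed
        moreover have "(real l powr (- (3 / 2 - 2 / q))) powr (q / 2) = real l powr (2 - q) * (real l powr \<epsilon>) powr q"
        proof -
          have "- (3 / 2 - 2 / q) * (q / 2) = (2 - q) + \<epsilon> * q" using q by (simp add: \<epsilon>_def field_simps)
          then show ?thesis by (simp only: powr_powr powr_add)
        qed
        ultimately show ?thesis by (simp add: p T_def cw_def powr_mult mult_ac)
      qed
      finally show ?thesis .
    qed
  qed
  also have "\<dots> = ennreal (G powr q) * (\<integral>\<^sup>+p. ennreal ((cw (1 - 3 / q) (3 / 2 - 2 / q) p * (d (fst p) (snd p))\<^sup>2) powr (q / 2)) \<partial>count_space UNIV)"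
    by (rule nn_integral_cmult) simp
  also have "\<dots> \<le> ennreal (G powr q) * ennreal (R powr (q / 2))"
    by (rule mult_left_mono[OF sum_powr_le_powr_sum[OF _ R]]) (use q in auto)
  also have "\<dots> = ennreal (G powr q * R powr (q / 2))" by (simp add: ennreal_mult)
  finally show ?thesis by (simp add: G_def \<epsilon>_def)
qed

section \<open>The weighted Lebesgue bound\<close>

lemma ST_inversion:
  assumes w: "nice w" and y: "y > 0"
  shows "sqrt (2 / pi) * (\<integral>l. sin (l * y) * ST w l \<partial>hl) = w y"
proof -
  define k where "k = sqrt (2 / pi)"
  have k: "k * k = 2 / pi" by (simp add: k_def)
  have k0: "k \<noteq> 0" by (simp add: k_def)
  have sw: "ST w l = k * (\<integral>y. sin (l * y) * w y \<partial>hl)" for l by (simp add: ST_def k_def)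
  obtain w' w'' M where d: "derivs2 w w' w'' M" by (rule nice_derivs2[OF w])
  have wc: "continuous_on UNIV w" and wz: "\<And>y. y > M \<Longrightarrow> w y = 0" using d by (auto simp: derivs2_def)
  obtain B where B: "\<And>y. y \<ge> 0 \<Longrightarrow> \<bar>w y\<bar> \<le> B" using compact_support_bounded[OF wc wz] by blast
  have "integrable hl (\<lambda>l. (1 / k) * ST w l)"
    by (intro integrable_mult_right tame_integrable tame_ST w)
  then have i: "integrable hl (\<lambda>l. \<integral>y. sin (l * y) * w y \<partial>hl)" using k0 by (simp add: sw)
  have "(\<integral>l. sin (l * y) * ST w l \<partial>hl) = (\<integral>l. k * (sin (l * y) * (\<integral>y. sin (l * y) * w y \<partial>hl)) \<partial>hl)"
    by (simp add: sw mult.left_commute)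
  also have "\<dots> = k * (pi / 2 * w y)"
    using sine_inversion[OF nice_integrable(1)[OF w] B _ _ i, of y] y wc
    by (simp add: continuous_on_eq_continuous_at)
  finally have X: "(\<integral>l. sin (l * y) * ST w l \<partial>hl) = k * (pi / 2 * w y)" .
  show ?thesis unfolding k_def[symmetric] X mult.assoc[symmetric] k by simp
qed

text \<open>Average the inversion formula for w over [a, b] and exchange the integrals. The double
  integral converges absolutely because the transform is integrable and the interval
  bounded.\<close>

lemma kap_pairing:
  assumes w: "nice w" and ab: "0 \<le> a" "a < b"
  shows "(\<integral>l. kap a b l * ST w l \<partial>hl) = avg w a b"
proof -
  define c where "c = sqrt (2 / pi) / (b - a)"
  have i: "integrable hl (ST w)" by (intro tame_integrable tame_ST w)
  have m [measurable]: "ST w \<in> borel_measurable hl" using i by auto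
  have [measurable]: "(\<lambda>l::real. l) \<in> borel_measurable hl" by (rule borel_measurable_hlI) simp
  have sI: "(\<integral>y. indicator {a..b} y * sin (l * y) \<partial>lborel) = (cos (l * a) - cos (l * b)) / l" if "l > 0" for l
  proof -
    have "(\<integral>y. sin (l * y) * indicator {a..b} y \<partial>lborel) = (- cos (l * b) / l) - (- cos (l * a) / l)"
      by (rule integral_FTC_Icc_real) (use ab that in \<open>auto intro!: derivative_eq_intros continuous_intros\<close>)
    then show ?thesis by (simp add: mult.commute diff_divide_distrib)
  qed
  have p: "integrable (hl \<Otimes>\<^sub>M lborel) (\<lambda>(l, y). indicator {a..b} y * (sin (l * y) * ST w l))"
  proof (rule hl_lborel.Fubini_integrable)
    show "(\<lambda>(l, y). indicator {a..b} y * (sin (l * y) * ST w l)) \<in> borel_measurable (hl \<Otimes>\<^sub>M lborel)" by measurable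
    have "integrable hl (\<lambda>l. \<integral>y. \<bar>indicator {a..b} y * (sin (l * y) * ST w l)\<bar> \<partial>lborel)"
    proof (rule Bochner_Integration.integrable_bound[OF integrable_mult_right[OF i, of "b - a"]])
      have "\<bar>\<integral>y. \<bar>indicator {a..b} y * (sin (l * y) * ST w l)\<bar> \<partial>lborel\<bar> \<le> \<bar>(b - a) * ST w l\<bar>" for l
      proof -
        have "(\<integral>y. \<bar>indicator {a..b} y * (sin (l * y) * ST w l)\<bar> \<partial>lborel) \<le> (\<integral>y. indicator {a..b} y * \<bar>ST w l\<bar> \<partial>lborel)"
        proof (rule integral_mono)
          have "set_integrable lborel {a..b} (\<lambda>y. sin (l * y) * ST w l)"
            by (rule borel_integrable_atLeastAtMost') (intro continuous_intros)
          then show "integrable lborel (\<lambda>y. \<bar>indicator {a..b} y * (sin (l * y) * ST w l)\<bar>)"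
            unfolding set_integrable_def real_scaleR_def by (rule integrable_abs)
          show "integrable lborel (\<lambda>y. indicator {a..b} y * \<bar>ST w l\<bar>)"
            by (rule integrable_mult_left) (simp add: emeasure_lborel_Icc_eq)
        qed (auto simp: abs_mult indicator_def mult_left_le_one_le)
        then show ?thesis using ab by (simp add: abs_mult)
      qed
      then show "AE l in hl. norm (\<integral>y. \<bar>indicator {a..b} y * (sin (l * y) * ST w l)\<bar> \<partial>lborel) \<le> norm ((b - a) * ST w l)" by simp
    qed measurable
    then show "integrable hl (\<lambda>l. \<integral>y. norm (case (l, y) of (l, y) \<Rightarrow> indicator {a..b} y * (sin (l * y) * ST w l)) \<partial>lborel)" by simp
    have "integrable lborel (\<lambda>y. indicator {a..b} y * (sin (l * y) * ST w l))" for l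
      using borel_integrable_atLeastAtMost'[of a b "\<lambda>y. sin (l * y) * ST w l"]
      by (simp add: set_integrable_def continuous_intros)
    then show "AE l in hl. integrable lborel (\<lambda>y. case (l, y) of (l, y) \<Rightarrow> indicator {a..b} y * (sin (l * y) * ST w l))" by simp
  qed
  have "(\<integral>l. kap a b l * ST w l \<partial>hl) = (\<integral>l. c * (\<integral>y. indicator {a..b} y * (sin (l * y) * ST w l) \<partial>lborel) \<partial>hl)"
  proof (rule Bochner_Integration.integral_cong[OF refl])
    fix l assume "l \<in> space hl"
    then have l: "l > 0" by simp
    have "(\<integral>y. indicator {a..b} y * (sin (l * y) * ST w l) \<partial>lborel) = (\<integral>y. indicator {a..b} y * sin (l * y) \<partial>lborel) * ST w l"
      by (simp add: mult.assoc[symmetric] del: mult.assoc)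
    then show "kap a b l * ST w l = c * (\<integral>y. indicator {a..b} y * (sin (l * y) * ST w l) \<partial>lborel)"
      by (simp add: sI[OF l] kap_def c_def)
  qed
  also have "\<dots> = c * (\<integral>l. (\<integral>y. indicator {a..b} y * (sin (l * y) * ST w l) \<partial>lborel) \<partial>hl)" by (rule integral_mult_right_zero)
  also have "(\<integral>l. (\<integral>y. indicator {a..b} y * (sin (l * y) * ST w l) \<partial>lborel) \<partial>hl)
      = (\<integral>y. (\<integral>l. indicator {a..b} y * (sin (l * y) * ST w l) \<partial>hl) \<partial>lborel)"
    using hl_lborel.Fubini_integral[OF p] by simp
  also have "\<dots> = (\<integral>y. indicator {a..b} y * (\<integral>l. sin (l * y) * ST w l \<partial>hl) \<partial>lborel)" by simp
  also have "c * \<dots> = (1 / (b - a)) * (\<integral>y. sqrt (2 / pi) * (indicator {a..b} y * (\<integral>l. sin (l * y) * ST w l \<partial>hl)) \<partial>lborel)"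
    by (simp add: c_def)
  also have "(\<integral>y. sqrt (2 / pi) * (indicator {a..b} y * (\<integral>l. sin (l * y) * ST w l \<partial>hl)) \<partial>lborel) = (LBINT y:{a..b}. w y)"
    unfolding set_lebesgue_integral_def
  proof (rule integral_cong_AE)
    obtain w' w'' M where d: "derivs2 w w' w'' M" by (rule nice_derivs2[OF w])
    then have wm: "w \<in> borel_measurable borel" by (auto simp: derivs2_def intro: borel_measurable_continuous_onI)
    show "(\<lambda>y. indicator {a..b} y *\<^sub>R w y) \<in> borel_measurable lborel"
      by (rule borel_measurable_scaleR) (simp_all add: wm)
    show "AE y in lborel. sqrt (2 / pi) * (indicator {a..b} y * (\<integral>l. sin (l * y) * ST w l \<partial>hl)) = indicator {a..b} y *\<^sub>R w y"
      using AE_lborel_singleton[of a]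
    proof eventually_elim
      case (elim y)
      show ?case
      proof (cases "y \<in> {a..b}")
        case True
        then have "y > 0" using elim ab by auto
        from ST_inversion[OF w this] show ?thesis using True by simp
      qed simp
    qed
  qed measurable
  finally show ?thesis by (simp add: avg_def)
qed

section \<open>Averages as functionals on the completion\<close>

context completion
begin

text \<open>Near 0 the squared weighted kernel is at most C^2 l^(2 - 2 \<sigma>), bounded by
  \<sigma> < 1; for large l it is at most C^2 l^(-2 - 2 \<sigma>), integrable by \<sigma> >
  0.\<close>

lemma adm_bounds:
  assumes s0: "\<sigma> > 0" and c: "continuous_on {0<..} \<kappa>"
    and C: "\<And>l. l > 0 \<Longrightarrow> \<bar>\<kappa> l\<bar> \<le> C * l" "\<And>l. l > 0 \<Longrightarrow> \<bar>\<kappa> l\<bar> \<le> C / l"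
  shows "adm \<kappa>"
proof -
  have C0: "C \<ge> 0" using C(1)[of 1] by simp
  have m: "\<kappa> \<in> borel_measurable hl" by (rule borel_measurable_hl_cont[OF c])
  have i: "integrable hl (\<lambda>l. C\<^sup>2 * (if l \<le> 1 then 1 else l powr (- 2 - 2 * \<sigma>)))"
    using powr_min_integrable[of "- 2 - 2 * \<sigma>"] s0 by (intro integrable_mult_right) auto
  have bb: "(\<kappa> l * l powr (- \<sigma>))\<^sup>2 \<le> C\<^sup>2 * (if l \<le> 1 then 1 else l powr (- 2 - 2 * \<sigma>))" if l: "l > 0" for l
  proof (cases "l \<le> 1")
    case True
    have "\<bar>\<kappa> l\<bar> * l powr (- \<sigma>) \<le> (C * l) * l powr (- \<sigma>)" by (rule mult_right_mono[OF C(1)[OF l]]) simp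
    also have "\<dots> = C * l powr (1 - \<sigma>)" using l by (simp add: powr_diff powr_minus divide_inverse)
    also have "\<dots> \<le> C * 1" using True l \<sigma> C0 by (intro mult_left_mono powr_le1) auto
    finally have "(\<bar>\<kappa> l\<bar> * l powr (- \<sigma>))\<^sup>2 \<le> C\<^sup>2" by (intro power_mono) auto
    then show ?thesis using True by (simp add: power_mult_distrib)
  next
    case False
    have "\<bar>\<kappa> l\<bar> * l powr (- \<sigma>) \<le> (C / l) * l powr (- \<sigma>)" by (rule mult_right_mono[OF C(2)[OF l]]) simp
    also have "\<dots> = C * l powr (- 1 - \<sigma>)" using l by (simp add: powr_diff powr_minus divide_inverse)
    finally have "(\<bar>\<kappa> l\<bar> * l powr (- \<sigma>))\<^sup>2 \<le> (C * l powr (- 1 - \<sigma>))\<^sup>2" by (intro power_mono) auto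
    also have "\<dots> = C\<^sup>2 * l powr ((- 1 - \<sigma>) + (- 1 - \<sigma>))"
      by (simp only: power_mult_distrib power2_eq_square powr_add mult_ac)
    also have "(- 1 - \<sigma>) + (- 1 - \<sigma>) = - 2 - 2 * \<sigma>" by simp
    finally show ?thesis using False by (simp add: power_mult_distrib algebra_simps)
  qed
  have b: "norm ((\<kappa> l * l powr (- \<sigma>))\<^sup>2) \<le> norm (C\<^sup>2 * (if l \<le> 1 then 1 else l powr (- 2 - 2 * \<sigma>)))" if "l > 0" for l
    unfolding real_norm_def abs_power2 by (rule order_trans[OF bb[OF that] abs_ge_self])
  have [measurable]: "(\<lambda>l::real. l powr p) \<in> borel_measurable hl" for p by (rule borel_measurable_hlI) simp
  have [measurable]: "\<kappa> \<in> borel_measurable hl" by fact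
  have "integrable hl (\<lambda>l. (\<kappa> l * l powr (- \<sigma>))\<^sup>2)"
    by (rule Bochner_Integration.integrable_bound[OF i]) (measurable, rule AE_hlI, rule b)
  then show ?thesis using m by (simp add: adm_def)
qed

lemma kap_adm:
  assumes "\<sigma> > 0" "0 \<le> a" "a < b"
  shows "adm (kap a b)"
proof (rule adm_bounds[OF assms(1) kap_cont[OF assms(3)]])
  fix l :: real assume l: "l > 0"
  have "\<bar>kap a b l\<bar> \<le> b * l" "b * l \<le> max b (2 / (b - a)) * l"
    using kap_bounds(2)[OF assms(2,3) l] l by (auto intro: mult_right_mono)
  then show "\<bar>kap a b l\<bar> \<le> max b (2 / (b - a)) * l" by (rule order_trans)
  have "2 / (b - a) / l \<le> max b (2 / (b - a)) / l" using l by (intro divide_right_mono) auto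
  with kap_bounds(3)[OF assms(2,3) l] show "\<bar>kap a b l\<bar> \<le> max b (2 / (b - a)) / l" by (rule order_trans)
qed

lemma kd_adm: "\<sigma> > 0 \<Longrightarrow> adm (kd k l)"
  unfolding kd_def by (rule kap_adm) auto

lemma adm_diff:
  assumes "adm \<kappa>" "adm \<kappa>'" shows "adm (\<lambda>l. \<kappa> l - \<kappa>' l)"
proof -
  have m [measurable]: "\<kappa> \<in> borel_measurable hl" "\<kappa>' \<in> borel_measurable hl" using assms by (auto simp: adm_def)
  have [measurable]: "(\<lambda>l::real. l powr p) \<in> borel_measurable hl" for p by (rule borel_measurable_hlI) simp
  have i: "integrable hl (\<lambda>l. 2 * ((\<kappa> l * l powr (- \<sigma>))\<^sup>2 + (\<kappa>' l * l powr (- \<sigma>))\<^sup>2))"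
    using assms by (intro integrable_mult_right Bochner_Integration.integrable_add) (auto simp: adm_def)
  have "(a - b)\<^sup>2 \<le> 2 * (a\<^sup>2 + b\<^sup>2)" for a b :: real
    using zero_le_power2[of "a + b"] by (simp add: power2_eq_square algebra_simps)
  then have b: "((\<kappa> l - \<kappa>' l) * l powr (- \<sigma>))\<^sup>2 \<le> 2 * ((\<kappa> l * l powr (- \<sigma>))\<^sup>2 + (\<kappa>' l * l powr (- \<sigma>))\<^sup>2)" for l
    unfolding left_diff_distrib .
  have "integrable hl (\<lambda>l. ((\<kappa> l - \<kappa>' l) * l powr (- \<sigma>))\<^sup>2)"
    by (rule Bochner_Integration.integrable_bound[OF i])
       (measurable, rule AE_I2, simp only: real_norm_def abs_power2, rule order_trans[OF b abs_ge_self])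
  then show ?thesis by (simp add: adm_def)
qed

lemma Lam_limit:
  assumes "adm \<kappa>" "(\<lambda>n. J (w n)) \<longlonglongrightarrow> h"
  shows "(\<lambda>n. Lam \<kappa> (J (w n))) \<longlonglongrightarrow> Lam \<kappa> h"
  by (rule bounded_linear.tendsto[OF Lam_bounded_linear[OF assms(1)] assms(2)])

text \<open>The functionals are chosen separately for each kernel, so linearity in the kernel has to
  be recovered from the integrals on bumps by density.\<close>

lemma Lam_diff:
  assumes "adm \<kappa>" "adm \<kappa>'"
  shows "Lam (\<lambda>l. \<kappa> l - \<kappa>' l) h = Lam \<kappa> h - Lam \<kappa>' h"
proof -
  obtain w where w: "\<forall>n. w n \<in> bumps" "(\<lambda>n. J (w n)) \<longlonglongrightarrow> h" using J_dense by blast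
  have "Lam (\<lambda>l. \<kappa> l - \<kappa>' l) (J (w n)) = Lam \<kappa> (J (w n)) - Lam \<kappa>' (J (w n))" for n
    using adm_pairing(1)[OF assms(1) bumps_pairing[OF spec[OF w(1)]]] adm_pairing(1)[OF assms(2) bumps_pairing[OF spec[OF w(1)]]]
    by (simp add: Lam_J adm_diff assms w(1)[rule_format] left_diff_distrib)
  then have "(\<lambda>n. Lam \<kappa> (J (w n)) - Lam \<kappa>' (J (w n))) \<longlonglongrightarrow> Lam (\<lambda>l. \<kappa> l - \<kappa>' l) h"
    using Lam_limit[OF adm_diff[OF assms] w(2)] by simp
  from LIMSEQ_unique[OF this tendsto_diff[OF Lam_limit[OF assms(1) w(2)] Lam_limit[OF assms(2) w(2)]]] show ?thesis .
qed

lemma eta_adm: "\<sigma> > 0 \<Longrightarrow> adm (eta p)"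
proof -
  assume s: "\<sigma> > 0"
  have "adm (\<lambda>_. 0)" by (simp add: adm_def)
  then show ?thesis using kd_adm[OF s] by (auto simp: eta_def split: prod.split intro!: adm_diff)
qed

text \<open>The recursion that \<open>step_function_bound\<close> asks for: the means of an element
  of the completion telescope like those of a function.\<close>

lemma Lam_eta:
  assumes "\<sigma> > 0"
  shows "Lam (eta (k, 1)) h = Lam (kd k 1) h"
    and "l \<ge> 2 \<Longrightarrow> Lam (kd k l) h = Lam (eta (k, l)) h + Lam (kd (k + 1) (l div 2)) h"
  using Lam_diff[OF kd_adm[OF assms, of k l] kd_adm[OF assms, of "k + 1" "l div 2"], of h]
  by (simp_all add: eta_def)

lemma Lam_kd_J: "\<sigma> > 0 \<Longrightarrow> w \<in> bumps \<Longrightarrow> Lam (kd k l) (J w) = avgd w k l"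
  using Lam_J[OF kd_adm, of w k l] kap_pairing[OF bumps_nice, of w "real l * dy k" "(real l + 1) * dy k"]
  by (simp add: kd_def)

end

section \<open>From elements of the completion to functions on the exterior domain\<close>

definition rshell :: "nat \<Rightarrow> (real ^ 3) set" where "rshell m = {x. norm x - 1 \<in> shell m}"

lemma rshell_sets [measurable]: "rshell m \<in> sets borel"
  unfolding rshell_def shell_def by measurable

lemma rshell_subset: "rshell m \<subseteq> Omega"
  using shell_pos by (fastforce simp: rshell_def Omega_def)

lemma dy_mono: "a \<le> b \<Longrightarrow> dy a \<le> dy b" by (simp add: dy_def)

lemma shell_incseq: "incseq shell"
proof (rule incseq_SucI, rule subsetI)
  fix m y assume "y \<in> shell m"
  then show "y \<in> shell (Suc m)"
    using dy_mono[of "- int (Suc m)" "- int m"] dy_mono[of "int m" "int (Suc m)"] by (auto simp: shell_def)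
qed

lemma shell_union: "y > 0 \<Longrightarrow> \<exists>m. y \<in> shell m"
proof -
  assume y: "y > 0"
  obtain a :: nat where a: "y < 2 ^ a" using real_arch_pow[of 2 y] by auto
  obtain b :: nat where b: "1 / y < 2 ^ b" using real_arch_pow[of 2 "1 / y"] by auto
  define m where "m = max a b"
  have d: "dy (int m) = 2 ^ m" "dy (- int m) = 1 / 2 ^ m" by (simp_all add: dy_def powr_realpow powr_minus divide_inverse)
  have "(2::real) ^ a \<le> 2 ^ m" "(2::real) ^ b \<le> 2 ^ m" by (simp_all add: m_def)
  then have "y < 2 ^ m" "1 / y < 2 ^ m" using a b by linarith+
  then have "y < dy (int m)" "dy (- int m) \<le> y" using y unfolding d by (auto simp: field_simps)
  then show ?thesis unfolding shell_def by auto
qed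

lemma nn_integral_rshell:
  assumes [measurable]: "u \<in> borel_measurable borel"
  shows "(\<integral>\<^sup>+x\<in>rshell m. ennreal \<bar>u (norm x - 1) / norm x\<bar> \<partial>restrict_space lborel Omega)
    = (\<integral>\<^sup>+y\<in>shell m. ennreal (4 * pi * (1 + y)) * ennreal \<bar>u y\<bar> \<partial>lborel)"
proof -
  have "(\<integral>\<^sup>+x\<in>rshell m. ennreal \<bar>u (norm x - 1) / norm x\<bar> \<partial>restrict_space lborel Omega)
     = (\<integral>\<^sup>+x. (\<lambda>r. ennreal \<bar>u (r - 1) / r\<bar> * indicator (shell m) (r - 1)) (norm x) \<partial>restrict_space lborel Omega)"
    by (rule nn_integral_cong) (simp add: rshell_def indicator_def)
  also have "\<dots> = (\<integral>\<^sup>+y. ennreal (4 * pi * (1 + y)\<^sup>2) * (ennreal \<bar>u (1 + y - 1) / (1 + y)\<bar> * indicator (shell m) (1 + y - 1)) \<partial>hl)"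
    by (rule nn_integral_Omega_radial) measurable
  also have "\<dots> = (\<integral>\<^sup>+y\<in>shell m. ennreal (4 * pi * (1 + y)) * ennreal \<bar>u y\<bar> \<partial>lborel)"
    unfolding nn_integral_hl
  proof (rule nn_integral_cong)
    fix y :: real
    show "ennreal (4 * pi * (1 + y)\<^sup>2) * (ennreal \<bar>u (1 + y - 1) / (1 + y)\<bar> * indicator (shell m) (1 + y - 1)) * indicator {0<..} y
      = ennreal (4 * pi * (1 + y)) * ennreal \<bar>u y\<bar> * indicator (shell m) y"
    proof (cases "y \<in> shell m")
      case True
      then have y: "y > 0" by (rule shell_pos)
      have "4 * pi * (1 + y)\<^sup>2 * \<bar>u y / (1 + y)\<bar> = 4 * pi * (1 + y) * \<bar>u y\<bar>"
        using y by (simp add: power2_eq_square)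
      then show ?thesis using True y by (simp add: ennreal_mult[symmetric])
    qed simp
  qed
  finally show ?thesis .
qed

lemma tendsto_zero_ennrealI:
  fixes f :: "nat \<Rightarrow> ennreal"
  assumes "\<And>\<epsilon>. \<epsilon> > 0 \<Longrightarrow> \<forall>\<^sub>F n in sequentially. f n \<le> ennreal \<epsilon>"
  shows "f \<longlonglongrightarrow> 0"
proof (rule order_tendstoI)
  fix a :: ennreal assume "0 < a"
  then obtain b where b: "0 < b" "b < a" using dense by blast
  then obtain \<epsilon> where e: "b = ennreal \<epsilon>" "\<epsilon> \<ge> 0" by (cases b) auto
  then have "\<epsilon> > 0" using b by (simp add: ennreal_less_zero_iff)
  from assms[OF this] show "\<forall>\<^sub>F n in sequentially. f n < a"
    by eventually_elim (use b e in auto)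
qed simp

text \<open>The ancestors of the interval with index 0 all have index 0, so its chain never reaches
  an interval with l = 1. The value there is set to 0, which affects no fixed shell once N is
  large.\<close>

definition stepf :: "(int \<Rightarrow> nat \<Rightarrow> real) \<Rightarrow> nat \<Rightarrow> real \<Rightarrow> real" where
  "stepf A N y = (if idx N y = 0 then 0 else A (- int N) (idx N y))"

lemma stepf_measurable [measurable]: "stepf A N \<in> borel_measurable borel"
proof -
  have "(\<lambda>l. if l = 0 then 0 else A (- int N) l) \<in> count_space UNIV \<rightarrow>\<^sub>M borel" by simp
  from measurable_compose[OF idx_measurable this] show ?thesis by (simp add: stepf_def[abs_def])
qed

lemma nn_integral_diff_triangle:
  fixes f g k :: "'a \<Rightarrow> real"
  assumes [measurable]: "f \<in> borel_measurable M" "g \<in> borel_measurable M" "k \<in> borel_measurable M" "S \<in> sets M"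
  shows "(\<integral>\<^sup>+x\<in>S. ennreal \<bar>f x - k x\<bar> \<partial>M) \<le> (\<integral>\<^sup>+x\<in>S. ennreal \<bar>f x - g x\<bar> \<partial>M) + (\<integral>\<^sup>+x\<in>S. ennreal \<bar>g x - k x\<bar> \<partial>M)"
proof -
  have "(\<integral>\<^sup>+x\<in>S. ennreal \<bar>f x - k x\<bar> \<partial>M) \<le> (\<integral>\<^sup>+x. ennreal \<bar>f x - g x\<bar> * indicator S x + ennreal \<bar>g x - k x\<bar> * indicator S x \<partial>M)"
    by (rule nn_integral_mono) (auto simp: indicator_def ennreal_plus[symmetric] simp del: ennreal_plus intro!: ennreal_leI)
  also have "\<dots> = (\<integral>\<^sup>+x\<in>S. ennreal \<bar>f x - g x\<bar> \<partial>M) + (\<integral>\<^sup>+x\<in>S. ennreal \<bar>g x - k x\<bar> \<partial>M)"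
    by (rule nn_integral_add) measurable
  finally show ?thesis .
qed

lemma measurable_Omega_radial:
  assumes [measurable]: "u \<in> borel_measurable borel"
  shows "(\<lambda>x :: real ^ 3. u (norm x - 1) / norm x) \<in> borel_measurable (restrict_space lborel Omega)"
proof -
  have "(\<lambda>x :: real ^ 3. u (norm x - 1) / norm x) \<in> borel_measurable borel" by measurable
  then show ?thesis by (intro measurable_restrict_space1) simp
qed

context completion
begin

text \<open>Links the element h with the function f by three comparisons: f with an approximating
  bump, by \<open>HD_function\<close>; the bump with its own dyadic means, by smoothness; and these
  means with those of h, by the L^1 contraction and Fatou. The third is uniform in N \<ge> m, so the
  bump can be fixed before N grows.\<close>

lemma stepf_L1_limit:
  assumes s0: "\<sigma> > 0" and HDf: "HD_function \<sigma> j h f"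
    and fm: "f \<in> borel_measurable (restrict_space lborel Omega)"
  shows "(\<lambda>N. \<integral>\<^sup>+x\<in>rshell m. ennreal \<bar>f x - stepf (\<lambda>k l. Lam (kd k l) h) N (norm x - 1) / norm x\<bar> \<partial>restrict_space lborel Omega) \<longlonglongrightarrow> 0"
proof (rule tendsto_zero_ennrealI)
  fix \<epsilon> :: real assume \<epsilon>: "\<epsilon> > 0"
  let ?M = "restrict_space lborel Omega"
  let ?A = "\<lambda>k l. Lam (kd k l) h"
  have [measurable]: "f \<in> borel_measurable ?M" by (rule fm)
  have rs [measurable]: "rshell m \<in> sets ?M" using rshell_subset[of m] by (simp add: sets_restrict_space_iff)
  obtain \<phi> where phi: "\<forall>n. \<phi> n \<in> tf ` bumps" "(\<lambda>n. j (\<phi> n)) \<longlonglongrightarrow> h"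
    "\<And>K. compact K \<Longrightarrow> K \<subseteq> Omega \<Longrightarrow> (\<lambda>n. \<integral>\<^sup>+x\<in>K. ennreal \<bar>\<phi> n x - f x\<bar> \<partial>lborel) \<longlonglongrightarrow> 0"
    using HDf unfolding HD_function_def HD_test_eq[OF \<sigma>] by blast
  have "\<forall>n. \<exists>v. v \<in> bumps \<and> \<phi> n = tf v" using phi(1) by blast
  from choice[OF this] obtain w where w': "\<forall>n. w n \<in> bumps \<and> \<phi> n = tf (w n)" by blast
  then have w: "w n \<in> bumps" "\<phi> n = tf (w n)" for n by auto
  have Jw: "(\<lambda>n. J (w n)) \<longlonglongrightarrow> h" using phi(2) by (simp add: w(2) J_def)
  have wc: "continuous_on UNIV (w n)" for n using w(1)[of n] by (auto simp: bumps_def intro: Ck1_cont)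
  have wm [measurable]: "w n \<in> borel_measurable borel" for n by (rule borel_measurable_continuous_onI[OF wc])
  let ?T = "\<lambda>n x. w n (norm x - 1) / norm x"
  have Tm [measurable]: "?T n \<in> borel_measurable ?M" for n by (rule measurable_Omega_radial) measurable
  define e where "e n = (\<integral>\<^sup>+x\<in>rshell m. ennreal \<bar>f x - ?T n x\<bar> \<partial>?M)" for n
  have e0: "e \<longlonglongrightarrow> 0"
  proof -
    let ?K = "{x :: real ^ 3. 1 + dy (- int m) \<le> norm x \<and> norm x \<le> 1 + dy (int m)}"
    have "closed ?K" by (intro closed_Collect_conj closed_Collect_le continuous_intros)
    moreover have "bounded ?K" by (rule bounded_subset[of "cball 0 (1 + dy (int m))"]) auto
    ultimately have K: "compact ?K" by (simp add: compact_eq_bounded_closed)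
    have KO: "?K \<subseteq> Omega"
    proof
      fix x :: "real ^ 3" assume "x \<in> ?K"
      then have "1 + dy (- int m) \<le> norm x" by simp
      with dy_pos(1)[of "- int m"] have "norm x > 1" by linarith
      then show "x \<in> Omega" by (simp add: Omega_def)
    qed
    have le: "e n \<le> (\<integral>\<^sup>+x\<in>?K. ennreal \<bar>\<phi> n x - f x\<bar> \<partial>lborel)" for n
    proof -
      have "e n = (\<integral>\<^sup>+x. ennreal \<bar>f x - ?T n x\<bar> * indicator (rshell m) x * indicator Omega x \<partial>lborel)"
        unfolding e_def by (subst nn_integral_restrict_space) auto
      also have "\<dots> \<le> (\<integral>\<^sup>+x\<in>?K. ennreal \<bar>\<phi> n x - f x\<bar> \<partial>lborel)"
        by (rule nn_integral_mono) (auto simp: indicator_def rshell_def shell_def w(2) tf_def abs_minus_commute)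
      finally show ?thesis .
    qed
    show ?thesis
      by (rule tendsto_sandwich[OF _ _ tendsto_const phi(3)[OF K KO]]) (simp_all add: le)
  qed
  define C where "C = 1 + dy (int m)"
  have C: "C \<ge> 1" by (simp add: C_def)
  \<comment> \<open>The three errors will be \<delta>, \<delta> and 2 C \<delta>, where
    \<open>C\<close> bounds 1 + y on the shell.\<close>
  define \<delta> where "\<delta> = \<epsilon> / (2 + 2 * C)"
  have \<delta>: "\<delta> > 0" using \<epsilon> C by (simp add: \<delta>_def)
  have "\<forall>\<^sub>F n in sequentially. e n < ennreal \<delta>" by (rule order_tendstoD(2)[OF e0]) (use \<delta> in simp)
  then obtain n where n: "\<And>n'. n' \<ge> n \<Longrightarrow> e n' < ennreal \<delta>" by (auto simp: eventually_sequentially)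
  let ?S = "\<lambda>n. stepf (avgd (w n))"
  obtain w1 w2 L where ders: "derivs2 (w n) w1 w2 L" by (rule nice_derivs2[OF bumps_nice[OF w(1)]])
  have w1: "continuous_on UNIV w1" "\<And>y. y > L \<Longrightarrow> w1 y = 0" using ders by (auto simp: derivs2_def)
  obtain B where B: "B \<ge> 0" "\<And>y. y \<ge> 0 \<Longrightarrow> \<bar>w1 y\<bar> \<le> B" using compact_support_bounded[OF w1] by blast
  have "(\<lambda>N. (1/2) ^ N * (4 * pi * C * B * dy (int m))) \<longlonglongrightarrow> 0 * (4 * pi * C * B * dy (int m))"
    by (intro tendsto_mult tendsto_const LIMSEQ_realpow_zero) auto
  then have "\<forall>\<^sub>F N in sequentially. (1/2) ^ N * (4 * pi * C * B * dy (int m)) < \<delta>"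
    using \<delta> by (intro order_tendstoD(2)) auto
  then show "\<forall>\<^sub>F N in sequentially. (\<integral>\<^sup>+x\<in>rshell m. ennreal \<bar>f x - stepf ?A N (norm x - 1) / norm x\<bar> \<partial>?M) \<le> ennreal \<epsilon>"
    using eventually_ge_at_top[of m]
  proof eventually_elim
    case (elim N)
    have dN: "dy (- int N) = (1/2) ^ N" by (simp add: dy_def powr_minus powr_realpow power_one_over inverse_eq_divide)
    have idx0: "idx N y \<noteq> 0" if "y \<in> shell m" for y
    proof -
      have "(0::nat) < 2 ^ (N - m)" by simp
      also have "\<dots> \<le> idx N y" using idx_shell[OF elim(2), of y] shell_pos[OF that] that by simp
      finally show ?thesis by simp
    qed
    have 2: "(\<integral>\<^sup>+x\<in>rshell m. ennreal \<bar>?T n x - ?S n N (norm x - 1) / norm x\<bar> \<partial>?M) \<le> ennreal \<delta>"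
    proof -
      have "(\<integral>\<^sup>+x\<in>rshell m. ennreal \<bar>?T n x - ?S n N (norm x - 1) / norm x\<bar> \<partial>?M)
         = (\<integral>\<^sup>+y\<in>shell m. ennreal (4 * pi * (1 + y)) * ennreal \<bar>w n y - ?S n N y\<bar> \<partial>lborel)"
        using nn_integral_rshell[of "\<lambda>y. w n y - ?S n N y" m] by (simp add: diff_divide_distrib)
      also have "\<dots> \<le> (\<integral>\<^sup>+y. ennreal (4 * pi * C * (B * dy (- int N))) * indicator {0..dy (int m)} y \<partial>lborel)"
      proof (rule nn_integral_mono)
        fix y :: real
        show "ennreal (4 * pi * (1 + y)) * ennreal \<bar>w n y - ?S n N y\<bar> * indicator (shell m) y
          \<le> ennreal (4 * pi * C * (B * dy (- int N))) * indicator {0..dy (int m)} y"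
        proof (cases "y \<in> shell m")
          case True
          have y: "0 < y" "y < dy (int m)" using True shell_pos[OF True] by (auto simp: shell_def)
          have "y \<in> dyint (- int N, idx N y)" using y by (intro idx_mem) simp
          then have "\<bar>w n y - avgd (w n) (- int N) (idx N y)\<bar> \<le> B * ((real (idx N y) + 1) * dy (- int N) - real (idx N y) * dy (- int N))"
            using ders B by (intro avg_near[of "w n" w1]) (auto simp: dyint_def derivs2_def)
          then have "\<bar>w n y - ?S n N y\<bar> \<le> B * dy (- int N)" using idx0[OF True] by (simp add: stepf_def algebra_simps)
          then have "4 * pi * (1 + y) * \<bar>w n y - ?S n N y\<bar> \<le> 4 * pi * C * (B * dy (- int N))"
            using y C by (intro mult_mono) (auto simp: C_def)
          then show ?thesis using True y by (simp add: ennreal_mult[symmetric] ennreal_leI)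
        qed simp
      qed
      also have "\<dots> = ennreal (4 * pi * C * (B * dy (- int N))) * ennreal (dy (int m))"
        by (subst nn_integral_cmult_indicator) auto
      also have "\<dots> = ennreal (4 * pi * C * (B * dy (- int N)) * dy (int m))"
        using B C by (intro ennreal_mult'[symmetric]) simp
      also have "\<dots> \<le> ennreal \<delta>" using elim(1) by (intro ennreal_leI) (simp add: dN mult_ac)
      finally show ?thesis .
    qed
    have 3: "(\<integral>\<^sup>+x\<in>rshell m. ennreal \<bar>?S n N (norm x - 1) / norm x - stepf ?A N (norm x - 1) / norm x\<bar> \<partial>?M) \<le> ennreal (2 * C * \<delta>)"
    proof -
      \<comment> \<open>Both bumps are \<delta>-close to f in L^1 of the radial shell; the passage
        to the half-line divides by 4 pi and uses 1 + y \<ge> 1.\<close>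
      have cau: "(\<integral>\<^sup>+y\<in>shell m. ennreal \<bar>w n y - w n' y\<bar> \<partial>lborel) \<le> ennreal (1 / (4 * pi)) * ennreal (2 * \<delta>)" if "n' \<ge> n" for n'
      proof -
        have "ennreal (4 * pi) * (\<integral>\<^sup>+y\<in>shell m. ennreal \<bar>w n y - w n' y\<bar> \<partial>lborel) = (\<integral>\<^sup>+y. ennreal (4 * pi) * (ennreal \<bar>w n y - w n' y\<bar> * indicator (shell m) y) \<partial>lborel)"
          by (rule nn_integral_cmult[symmetric]) measurable
        also have "\<dots> \<le> (\<integral>\<^sup>+y\<in>shell m. ennreal (4 * pi * (1 + y)) * ennreal \<bar>w n y - w n' y\<bar> \<partial>lborel)"
        proof (rule nn_integral_mono)
          fix y :: real
          show "ennreal (4 * pi) * (ennreal \<bar>w n y - w n' y\<bar> * indicator (shell m) y) \<le> ennreal (4 * pi * (1 + y)) * ennreal \<bar>w n y - w n' y\<bar> * indicator (shell m) y"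
          proof (cases "y \<in> shell m")
            case True
            then have "ennreal (4 * pi) \<le> ennreal (4 * pi * (1 + y))" using shell_pos[OF True] by (intro ennreal_leI) simp
            then show ?thesis using True by (simp add: mult_right_mono)
          qed simp
        qed
        also have "\<dots> = (\<integral>\<^sup>+x\<in>rshell m. ennreal \<bar>?T n x - ?T n' x\<bar> \<partial>?M)"
          using nn_integral_rshell[of "\<lambda>y. w n y - w n' y" m] by (simp add: diff_divide_distrib)
        also have "\<dots> \<le> (\<integral>\<^sup>+x\<in>rshell m. ennreal \<bar>?T n x - f x\<bar> \<partial>?M) + e n'"
          unfolding e_def by (rule nn_integral_diff_triangle) measurable
        also have "(\<integral>\<^sup>+x\<in>rshell m. ennreal \<bar>?T n x - f x\<bar> \<partial>?M) = e n" by (simp add: e_def abs_minus_commute)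
        also have "e n + e n' \<le> ennreal \<delta> + ennreal \<delta>" using n[of n] n[OF that] by (intro add_mono) (auto intro: less_imp_le)
        also have "\<dots> = ennreal (2 * \<delta>)" using \<delta> by (simp add: ennreal_plus[symmetric] del: ennreal_plus)
        finally have "ennreal (1 / (4 * pi)) * (ennreal (4 * pi) * (\<integral>\<^sup>+y\<in>shell m. ennreal \<bar>w n y - w n' y\<bar> \<partial>lborel)) \<le> ennreal (1 / (4 * pi)) * ennreal (2 * \<delta>)"
          by (rule mult_left_mono) simp
        moreover have "ennreal (1 / (4 * pi)) * ennreal (4 * pi) = 1" by (subst ennreal_mult'[symmetric]) auto
        ultimately show ?thesis by (simp add: mult.assoc[symmetric])
      qed
      have "(\<integral>\<^sup>+y\<in>shell m. ennreal \<bar>?S n N y - stepf ?A N y\<bar> \<partial>lborel)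
         = (\<integral>\<^sup>+y. liminf (\<lambda>n'. ennreal \<bar>?S n N y - ?S n' N y\<bar> * indicator (shell m) y) \<partial>lborel)"
      proof (rule nn_integral_cong)
        fix y :: real
        \<comment> \<open>Continuity of \<open>Lam\<close> makes the means of h the limits of the
          means of the bumps on each dyadic interval, so Fatou can be applied in the index of the
          bumps.\<close>
        have "(\<lambda>n'. ?S n' N y) \<longlonglongrightarrow> stepf ?A N y"
        proof (cases "idx N y = 0")
          case False
          then show ?thesis using Lam_limit[OF kd_adm[OF s0] Jw, of "- int N" "idx N y"]
            by (simp add: stepf_def Lam_kd_J[OF s0 w(1)])
        qed (simp add: stepf_def)
        then have "(\<lambda>n'. ennreal \<bar>?S n N y - ?S n' N y\<bar>) \<longlonglongrightarrow> ennreal \<bar>?S n N y - stepf ?A N y\<bar>"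
          by (intro tendsto_ennrealI tendsto_rabs tendsto_diff tendsto_const)
        then have "(\<lambda>n'. ennreal \<bar>?S n N y - ?S n' N y\<bar> * indicator (shell m) y) \<longlonglongrightarrow> ennreal \<bar>?S n N y - stepf ?A N y\<bar> * indicator (shell m) y"
          by (cases "y \<in> shell m") auto
        from lim_imp_Liminf[OF _ this]
        show "ennreal \<bar>?S n N y - stepf ?A N y\<bar> * indicator (shell m) y = liminf (\<lambda>n'. ennreal \<bar>?S n N y - ?S n' N y\<bar> * indicator (shell m) y)"
          by simp
      qed
      also have "\<dots> \<le> liminf (\<lambda>n'. \<integral>\<^sup>+y. ennreal \<bar>?S n N y - ?S n' N y\<bar> * indicator (shell m) y \<partial>lborel)"
        by (rule nn_integral_liminf) measurable
      also have "\<dots> \<le> liminf (\<lambda>n' :: nat. ennreal (1 / (4 * pi)) * ennreal (2 * \<delta>))"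
      proof (rule Liminf_mono)
        show "\<forall>\<^sub>F n' in sequentially. (\<integral>\<^sup>+y. ennreal \<bar>?S n N y - ?S n' N y\<bar> * indicator (shell m) y \<partial>lborel) \<le> ennreal (1 / (4 * pi)) * ennreal (2 * \<delta>)"
          using eventually_ge_at_top[of n]
        proof eventually_elim
          case (elim n')
          have "(\<integral>\<^sup>+y. ennreal \<bar>?S n N y - ?S n' N y\<bar> * indicator (shell m) y \<partial>lborel)
             = (\<integral>\<^sup>+y\<in>shell m. ennreal \<bar>avgd (\<lambda>y. w n y - w n' y) (- int N) (idx N y)\<bar> \<partial>lborel)"
          proof (rule nn_integral_cong)
            show "ennreal \<bar>?S n N y - ?S n' N y\<bar> * indicator (shell m) y = ennreal \<bar>avgd (\<lambda>y. w n y - w n' y) (- int N) (idx N y)\<bar> * indicator (shell m) y" for y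
              using idx0[of y] by (cases "y \<in> shell m") (simp_all add: stepf_def avg_diff wc)
          qed
          also have "\<dots> \<le> (\<integral>\<^sup>+y\<in>shell m. ennreal \<bar>w n y - w n' y\<bar> \<partial>lborel)"
            by (rule avg_contraction) (use \<open>m \<le> N\<close> in \<open>auto intro!: continuous_intros wc\<close>)
          also have "\<dots> \<le> ennreal (1 / (4 * pi)) * ennreal (2 * \<delta>)" by (rule cau[OF elim])
          finally show ?case .
        qed
      qed
      also have "\<dots> = ennreal (1 / (4 * pi)) * ennreal (2 * \<delta>)" by (rule Liminf_const) simp
      finally have lim: "(\<integral>\<^sup>+y\<in>shell m. ennreal \<bar>?S n N y - stepf ?A N y\<bar> \<partial>lborel) \<le> ennreal (1 / (4 * pi)) * ennreal (2 * \<delta>)" .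
      have "(\<integral>\<^sup>+x\<in>rshell m. ennreal \<bar>?S n N (norm x - 1) / norm x - stepf ?A N (norm x - 1) / norm x\<bar> \<partial>?M)
         = (\<integral>\<^sup>+y\<in>shell m. ennreal (4 * pi * (1 + y)) * ennreal \<bar>?S n N y - stepf ?A N y\<bar> \<partial>lborel)"
        using nn_integral_rshell[of "\<lambda>y. ?S n N y - stepf ?A N y" m] by (simp add: diff_divide_distrib)
      also have "\<dots> \<le> (\<integral>\<^sup>+y. ennreal (4 * pi * C) * (ennreal \<bar>?S n N y - stepf ?A N y\<bar> * indicator (shell m) y) \<partial>lborel)"
      proof (rule nn_integral_mono)
        fix y :: real
        show "ennreal (4 * pi * (1 + y)) * ennreal \<bar>?S n N y - stepf ?A N y\<bar> * indicator (shell m) y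
          \<le> ennreal (4 * pi * C) * (ennreal \<bar>?S n N y - stepf ?A N y\<bar> * indicator (shell m) y)"
        proof (cases "y \<in> shell m")
          case True
          then have "ennreal (4 * pi * (1 + y)) \<le> ennreal (4 * pi * C)" by (intro ennreal_leI) (simp add: shell_def C_def)
          then show ?thesis using True by (simp add: mult_right_mono)
        qed simp
      qed
      also have "\<dots> = ennreal (4 * pi * C) * (\<integral>\<^sup>+y\<in>shell m. ennreal \<bar>?S n N y - stepf ?A N y\<bar> \<partial>lborel)"
        by (rule nn_integral_cmult) measurable
      also have "\<dots> \<le> ennreal (4 * pi * C) * (ennreal (1 / (4 * pi)) * ennreal (2 * \<delta>))" by (rule mult_left_mono[OF lim]) simp
      also have "\<dots> = ennreal (2 * C * \<delta>)" using C \<delta> by (simp add: ennreal_mult[symmetric])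
      finally show ?thesis .
    qed
    have Sm [measurable]: "(\<lambda>x. ?S n N (norm x - 1) / norm x) \<in> borel_measurable ?M" "(\<lambda>x. stepf ?A N (norm x - 1) / norm x) \<in> borel_measurable ?M"
      by (rule measurable_Omega_radial[OF stepf_measurable])+
    have "(\<integral>\<^sup>+x\<in>rshell m. ennreal \<bar>f x - stepf ?A N (norm x - 1) / norm x\<bar> \<partial>?M)
      \<le> e n + (\<integral>\<^sup>+x\<in>rshell m. ennreal \<bar>?T n x - stepf ?A N (norm x - 1) / norm x\<bar> \<partial>?M)"
      unfolding e_def by (rule nn_integral_diff_triangle[OF fm Tm Sm(2) rs])
    also have "\<dots> \<le> e n + ((\<integral>\<^sup>+x\<in>rshell m. ennreal \<bar>?T n x - ?S n N (norm x - 1) / norm x\<bar> \<partial>?M)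
       + (\<integral>\<^sup>+x\<in>rshell m. ennreal \<bar>?S n N (norm x - 1) / norm x - stepf ?A N (norm x - 1) / norm x\<bar> \<partial>?M))"
      by (rule add_left_mono, rule nn_integral_diff_triangle[OF Tm Sm(1) Sm(2) rs])
    also have "\<dots> \<le> ennreal \<delta> + (ennreal \<delta> + ennreal (2 * C * \<delta>))"
      by (intro add_mono 2 3 less_imp_le[OF n]) simp
    also have "\<dots> = ennreal (\<delta> + (\<delta> + 2 * C * \<delta>))" using \<delta> C by (simp add: ennreal_plus[symmetric] del: ennreal_plus)
    also have "\<delta> + (\<delta> + 2 * C * \<delta>) = \<delta> * (2 + 2 * C)" by (simp add: algebra_simps)
    also have "\<dots> = \<epsilon>" using C by (simp add: \<delta>_def)
    finally show ?case .
  qed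
qed

text \<open>The bound for the step functions is uniform in N and survives the L^1 limit on shells.
  Polar coordinates and the division by the radius combine (1 + y)^2 and (1 + y)^(-q) to the weight
  (1 + y)^(2 - q).\<close>

lemma Lq_bound:
  assumes q: "q > 4" and sq: "\<sigma> = 1 - 3 / q" and HDf: "HD_function \<sigma> j h f"
    and fm: "f \<in> borel_measurable (restrict_space lborel Omega)"
    and R: "R \<ge> 0" "(\<integral>\<^sup>+p. ennreal (cw \<sigma> (3 / 2 - 2 / q) p * (Lam (eta p) h)\<^sup>2) \<partial>count_space UNIV) \<le> ennreal R"
  shows "(\<integral>\<^sup>+x. ennreal (\<bar>f x\<bar> powr q) \<partial>restrict_space lborel Omega)
    \<le> ennreal (4 * pi * ((1 / (1 - 2 powr (- (1 / 4 - 1 / q)))) powr q * R powr (q / 2)))"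
proof -
  let ?M = "restrict_space lborel Omega"
  let ?A = "\<lambda>k l. Lam (kd k l) h"
  have s0: "\<sigma> > 0" using q by (simp add: sq field_simps)
  define X where "X = (1 / (1 - 2 powr (- (1 / 4 - 1 / q)))) powr q * R powr (q / 2)"
  have b: "(\<integral>\<^sup>+x. ennreal (\<bar>stepf ?A N (norm x - 1) / norm x\<bar> powr q) \<partial>?M) \<le> ennreal (4 * pi * X)" for N
  proof -
    have "(\<integral>\<^sup>+x. ennreal (\<bar>stepf ?A N (norm x - 1) / norm x\<bar> powr q) \<partial>?M)
       = (\<integral>\<^sup>+y. ennreal (4 * pi * (1 + y)\<^sup>2) * ennreal (\<bar>stepf ?A N (1 + y - 1) / (1 + y)\<bar> powr q) \<partial>hl)"
      by (rule nn_integral_Omega_radial[of "\<lambda>r. ennreal (\<bar>stepf ?A N (r - 1) / r\<bar> powr q)"]) measurable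
    also have "\<dots> = (\<integral>\<^sup>+y. ennreal (4 * pi) * ennreal ((1 + y) powr (2 - q) * \<bar>stepf ?A N y\<bar> powr q) \<partial>hl)"
    proof (rule nn_integral_cong)
      fix y assume "y \<in> space hl"
      then have y: "1 + y > 0" by simp
      have "(1 + y)\<^sup>2 = (1 + y) powr 2" using y by simp
      then have "4 * pi * (1 + y)\<^sup>2 * (\<bar>stepf ?A N y / (1 + y)\<bar> powr q) = 4 * pi * ((1 + y) powr (2 - q) * \<bar>stepf ?A N y\<bar> powr q)"
        using y by (simp only: powr_diff abs_divide) (simp add: powr_divide)
      then show "ennreal (4 * pi * (1 + y)\<^sup>2) * ennreal (\<bar>stepf ?A N (1 + y - 1) / (1 + y)\<bar> powr q)
         = ennreal (4 * pi) * ennreal ((1 + y) powr (2 - q) * \<bar>stepf ?A N y\<bar> powr q)"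
        by (simp add: ennreal_mult[symmetric])
    qed
    also have "\<dots> = ennreal (4 * pi) * (\<integral>\<^sup>+y. ennreal ((1 + y) powr (2 - q) * \<bar>stepf ?A N y\<bar> powr q) \<partial>hl)"
      by (rule nn_integral_cmult, rule borel_measurable_hlI, measurable)
    finally have eq: "(\<integral>\<^sup>+x. ennreal (\<bar>stepf ?A N (norm x - 1) / norm x\<bar> powr q) \<partial>?M)
      = ennreal (4 * pi) * (\<integral>\<^sup>+y. ennreal ((1 + y) powr (2 - q) * \<bar>stepf ?A N y\<bar> powr q) \<partial>hl)" .
    have le: "(\<integral>\<^sup>+y. ennreal ((1 + y) powr (2 - q) * \<bar>stepf ?A N y\<bar> powr q) \<partial>hl) \<le> ennreal X"
      unfolding X_def stepf_def
      by (rule step_function_bound[OF q, where d="\<lambda>k l. Lam (eta (k, l)) h"])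
         (use Lam_eta[OF s0] R in \<open>simp_all add: sq[symmetric]\<close>)
    have "ennreal (4 * pi * X) = ennreal (4 * pi) * ennreal X" by (rule ennreal_mult') simp
    then show ?thesis unfolding eq using mult_left_mono[OF le, of "ennreal (4 * pi)"] by simp
  qed
  show ?thesis
    unfolding X_def[symmetric]
  proof (rule nn_integral_powr_le_of_L1_limit[where K=rshell and g="\<lambda>N x. stepf ?A N (norm x - 1) / norm x"])
    show "(\<lambda>x. stepf ?A N (norm x - 1) / norm x) \<in> borel_measurable ?M" for N
      by (rule measurable_Omega_radial[OF stepf_measurable])
    show "rshell m \<in> sets ?M" for m using rshell_subset[of m] by (simp add: sets_restrict_space_iff)
    show "incseq rshell"
      using shell_incseq by (auto simp: incseq_def rshell_def subset_eq)
    show "(\<Union>m. rshell m) = space ?M"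
    proof
      show "(\<Union>m. rshell m) \<subseteq> space ?M" using rshell_subset by (auto simp: space_restrict_space)
      show "space ?M \<subseteq> (\<Union>m. rshell m)"
      proof
        fix x assume "x \<in> space ?M"
        then have "norm x - 1 > 0" by (simp add: space_restrict_space Omega_def)
        from shell_union[OF this] show "x \<in> (\<Union>m. rshell m)" by (auto simp: rshell_def)
      qed
    qed
    show "(\<lambda>N. \<integral>\<^sup>+x\<in>rshell m. ennreal \<bar>f x - stepf ?A N (norm x - 1) / norm x\<bar> \<partial>?M) \<longlonglongrightarrow> 0" for m
      by (rule stepf_L1_limit[OF s0 HDf fm])
  qed (use b fm q in auto)
qed

end

section \<open>Square sums along the flow\<close>

lemma nn_integral_even_line:
  fixes f :: "real \<Rightarrow> ennreal"
  assumes [measurable]: "f \<in> borel_measurable borel" and even: "\<And>t. f (- t) = f t"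
  shows "(\<integral>\<^sup>+t. f t \<partial>lborel) = 2 * (\<integral>\<^sup>+t. f t \<partial>hl)"
proof -
  have "(\<integral>\<^sup>+t. f t \<partial>lborel) = (\<integral>\<^sup>+t. f t * indicator {0<..} t + f t * indicator {..<0} t \<partial>lborel)"
  proof (rule nn_integral_cong_AE)
    show "AE t in lborel. f t = f t * indicator {0<..} t + f t * indicator {..<0} t"
      using AE_lborel_singleton[of "0::real"] by eventually_elim (auto simp: indicator_def)
  qed
  also have "\<dots> = (\<integral>\<^sup>+t. f t * indicator {0<..} t \<partial>lborel) + (\<integral>\<^sup>+t. f t * indicator {..<0} t \<partial>lborel)"
    by (rule nn_integral_add) measurable
  also have "(\<integral>\<^sup>+t. f t * indicator {..<0} t \<partial>lborel) = (\<integral>\<^sup>+t. f t * indicator {0<..} t \<partial>lborel)"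
    by (subst nn_integral_real_affine[where c="-1" and t=0]) (auto intro!: nn_integral_cong simp: even indicator_def)
  finally show ?thesis by (simp add: nn_integral_hl mult_2)
qed

text \<open>The square of either trigonometric integral is even in t, so the constant pi / 2 of the
  half-line doubles.\<close>

lemma plancherel_time:
  fixes g :: "real \<Rightarrow> real"
  assumes trig: "trig = cos \<or> trig = sin"
    and int: "integrable hl g" and cont: "continuous_on {0<..} g" and bd: "\<And>x. x > 0 \<Longrightarrow> \<bar>g x\<bar> \<le> M"
  shows "(\<integral>\<^sup>+t. ennreal ((\<integral>l. trig (t * l) * g l \<partial>hl)\<^sup>2) \<partial>lborel) = (\<integral>\<^sup>+l. ennreal (pi * (g l)\<^sup>2) \<partial>hl)"
proof -
  have [measurable]: "g \<in> borel_measurable hl" using int by auto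
  have [measurable]: "(\<lambda>l::real. l) \<in> borel_measurable hl" by (rule borel_measurable_hlI) simp
  have "(\<lambda>t. \<integral>l. cos (t * l) * g l \<partial>hl) \<in> borel_measurable borel" "(\<lambda>t. \<integral>l. sin (t * l) * g l \<partial>hl) \<in> borel_measurable borel"
    by measurable
  then have tm: "(\<lambda>t. \<integral>l. trig (t * l) * g l \<partial>hl) \<in> borel_measurable borel" using trig by blast
  define U where "U t = (\<integral>l. trig (t * l) * g l \<partial>hl)" for t
  have [measurable]: "U \<in> borel_measurable borel" using tm by (simp add: U_def[abs_def])
  have "(U (- t))\<^sup>2 = (U t)\<^sup>2" for t using trig by (auto simp: U_def)
  then have "(\<integral>\<^sup>+t. ennreal ((U t)\<^sup>2) \<partial>lborel) = 2 * (\<integral>\<^sup>+t. ennreal ((U t)\<^sup>2) \<partial>hl)"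
    by (intro nn_integral_even_line[of "\<lambda>t. ennreal ((U t)\<^sup>2)"]) simp_all
  then have "(\<integral>\<^sup>+t. ennreal ((\<integral>l. trig (t * l) * g l \<partial>hl)\<^sup>2) \<partial>lborel) = 2 * (\<integral>\<^sup>+t. ennreal ((\<integral>l. trig (t * l) * g l \<partial>hl)\<^sup>2) \<partial>hl)"
    by (simp only: U_def)
  also have "(\<integral>\<^sup>+t. ennreal ((\<integral>l. trig (t * l) * g l \<partial>hl)\<^sup>2) \<partial>hl) = (\<integral>\<^sup>+l. ennreal (pi / 2 * (g l)\<^sup>2) \<partial>hl)"
    using plancherel_sin[OF int cont bd] plancherel_cos[OF int cont bd] trig by (auto simp: mult.commute[of _ "_ :: real"])
  also have "2 * \<dots> = (\<integral>\<^sup>+l. 2 * ennreal (pi / 2 * (g l)\<^sup>2) \<partial>hl)"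
    by (rule nn_integral_cmult[symmetric]) measurable
  also have "\<dots> = (\<integral>\<^sup>+l. ennreal (pi * (g l)\<^sup>2) \<partial>hl)"
  proof (rule nn_integral_cong)
    fix l
    have "2 * ennreal (pi / 2 * (g l)\<^sup>2) = ennreal 2 * ennreal (pi / 2 * (g l)\<^sup>2)" by simp
    also have "\<dots> = ennreal (2 * (pi / 2 * (g l)\<^sup>2))" by (rule ennreal_mult'[symmetric]) simp
    finally show "2 * ennreal (pi / 2 * (g l)\<^sup>2) = ennreal (pi * (g l)\<^sup>2)" by simp
  qed
  finally show ?thesis .
qed

text \<open>Plancherel in t for each dyadic interval separately, then Tonelli: the sum over
  intervals is carried out at a fixed frequency l, where the hypothesis on K bounds it by a multiple
  of l^(2 s).\<close>

lemma flow_sum_le: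
  assumes trig: "trig = cos \<or> trig = sin" and K: "K \<ge> 0"
    "\<And>x. x > 0 \<Longrightarrow> (\<integral>\<^sup>+p. ennreal (cw s \<beta> p * (eta p x)\<^sup>2) \<partial>count_space UNIV) \<le> ennreal (K * x powr (2 * s))"
    and ac: "continuous_on {0<..} a" and ab: "\<And>l. l > 0 \<Longrightarrow> \<bar>a l\<bar> \<le> B" and ai: "\<And>p. integrable hl (\<lambda>l. eta p l * a l)"
  shows "(\<integral>\<^sup>+p. \<integral>\<^sup>+t. ennreal (cw s \<beta> p * (\<integral>l. trig (t * l) * (eta p l * a l) \<partial>hl)\<^sup>2) \<partial>lborel \<partial>count_space UNIV)
    \<le> ennreal (pi * K) * (\<integral>\<^sup>+l. ennreal ((l powr s * a l)\<^sup>2) \<partial>hl)"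
proof -
  have [measurable]: "eta p \<in> borel_measurable hl" for p by (rule borel_measurable_hl_cont[OF eta_cont])
  have [measurable]: "a \<in> borel_measurable hl" by (rule borel_measurable_hl_cont[OF ac])
  have [measurable]: "(\<lambda>l::real. l) \<in> borel_measurable hl" by (rule borel_measurable_hlI) simp
  have "(\<lambda>t. \<integral>l. cos (t * l) * (eta p l * a l) \<partial>hl) \<in> borel_measurable borel"
    "(\<lambda>t. \<integral>l. sin (t * l) * (eta p l * a l) \<partial>hl) \<in> borel_measurable borel" for p
    by measurable
  then have tm: "(\<lambda>t. \<integral>l. trig (t * l) * (eta p l * a l) \<partial>hl) \<in> borel_measurable borel" for p using trig by blast
  have "(\<integral>\<^sup>+p. \<integral>\<^sup>+t. ennreal (cw s \<beta> p * (\<integral>l. trig (t * l) * (eta p l * a l) \<partial>hl)\<^sup>2) \<partial>lborel \<partial>count_space UNIV)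
    = (\<integral>\<^sup>+p. \<integral>\<^sup>+l. ennreal (cw s \<beta> p) * ennreal (pi * (eta p l * a l)\<^sup>2) \<partial>hl \<partial>count_space UNIV)"
  proof (rule nn_integral_cong)
    fix p :: "int \<times> nat"
    obtain k n where p: "p = (k, n)" by force
    have B: "B \<ge> 0" using ab[of 1] by simp
    have b: "\<bar>eta p x * a x\<bar> \<le> 2 * B" if "x > 0" for x
      unfolding abs_mult p using eta_bounds(1)[OF that, of k n] ab[OF that] by (intro mult_mono) auto
    have "(\<integral>\<^sup>+t. ennreal (cw s \<beta> p * (\<integral>l. trig (t * l) * (eta p l * a l) \<partial>hl)\<^sup>2) \<partial>lborel)
      = (\<integral>\<^sup>+t. ennreal (cw s \<beta> p) * ennreal ((\<integral>l. trig (t * l) * (eta p l * a l) \<partial>hl)\<^sup>2) \<partial>lborel)"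
      by (simp add: ennreal_mult)
    also have "\<dots> = ennreal (cw s \<beta> p) * (\<integral>\<^sup>+t. ennreal ((\<integral>l. trig (t * l) * (eta p l * a l) \<partial>hl)\<^sup>2) \<partial>lborel)"
      using measurable_compose[OF tm[of p], of "\<lambda>u. ennreal (u\<^sup>2)" borel]
      by (intro nn_integral_cmult) simp
    also have "(\<integral>\<^sup>+t. ennreal ((\<integral>l. trig (t * l) * (eta p l * a l) \<partial>hl)\<^sup>2) \<partial>lborel) = (\<integral>\<^sup>+l. ennreal (pi * (eta p l * a l)\<^sup>2) \<partial>hl)"
      by (rule plancherel_time[OF trig ai _ b]) (intro continuous_intros eta_cont ac)
    also have "ennreal (cw s \<beta> p) * \<dots> = (\<integral>\<^sup>+l. ennreal (cw s \<beta> p) * ennreal (pi * (eta p l * a l)\<^sup>2) \<partial>hl)"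
      by (rule nn_integral_cmult[symmetric]) measurable
    finally show "(\<integral>\<^sup>+t. ennreal (cw s \<beta> p * (\<integral>l. trig (t * l) * (eta p l * a l) \<partial>hl)\<^sup>2) \<partial>lborel)
      = (\<integral>\<^sup>+l. ennreal (cw s \<beta> p) * ennreal (pi * (eta p l * a l)\<^sup>2) \<partial>hl)" .
  qed
  also have "\<dots> = (\<integral>\<^sup>+l. \<integral>\<^sup>+p. ennreal (cw s \<beta> p) * ennreal (pi * (eta p l * a l)\<^sup>2) \<partial>count_space UNIV \<partial>hl)"
    by (rule nn_integral_count_space_nn_integral[symmetric]) (simp, measurable)
  also have "\<dots> \<le> (\<integral>\<^sup>+l. ennreal (pi * K) * ennreal ((l powr s * a l)\<^sup>2) \<partial>hl)"
  proof (rule nn_integral_mono)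
    fix l assume "l \<in> space hl"
    then have l: "l > 0" by simp
    have "(\<integral>\<^sup>+p. ennreal (cw s \<beta> p) * ennreal (pi * (eta p l * a l)\<^sup>2) \<partial>count_space UNIV)
       = (\<integral>\<^sup>+p. ennreal (pi * (a l)\<^sup>2) * ennreal (cw s \<beta> p * (eta p l)\<^sup>2) \<partial>count_space UNIV)"
      by (rule nn_integral_cong) (simp add: ennreal_mult[symmetric] power_mult_distrib mult_ac)
    also have "\<dots> = ennreal (pi * (a l)\<^sup>2) * (\<integral>\<^sup>+p. ennreal (cw s \<beta> p * (eta p l)\<^sup>2) \<partial>count_space UNIV)"
      by (rule nn_integral_cmult) simp
    also have "\<dots> \<le> ennreal (pi * (a l)\<^sup>2) * ennreal (K * l powr (2 * s))" by (rule mult_left_mono[OF K(2)[OF l]]) simp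
    also have "\<dots> = ennreal (pi * K * (l powr s * a l)\<^sup>2)"
    proof -
      have "l powr (2 * s) = (l powr s)\<^sup>2" by (simp only: power2_eq_square powr_add[symmetric] mult_2)
      then show ?thesis using K(1) by (simp add: ennreal_mult[symmetric] power_mult_distrib mult_ac)
    qed
    also have "\<dots> = ennreal (pi * K) * ennreal ((l powr s * a l)\<^sup>2)" using K(1) by (simp add: ennreal_mult)
    finally show "(\<integral>\<^sup>+p. ennreal (cw s \<beta> p) * ennreal (pi * (eta p l * a l)\<^sup>2) \<partial>count_space UNIV)
       \<le> ennreal (pi * K) * ennreal ((l powr s * a l)\<^sup>2)" .
  qed
  also have "\<dots> = ennreal (pi * K) * (\<integral>\<^sup>+l. ennreal ((l powr s * a l)\<^sup>2) \<partial>hl)"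
    by (rule nn_integral_cmult) measurable
  finally show ?thesis .
qed

context completion
begin

text \<open>Along bumps converging to h the functionals converge for every p and t, so Fatou,
  applied to the time integral and to the sum, transfers the estimate. The factor 4 pi in the norm
  is again given away.\<close>

lemma flow_estimate:
  fixes m :: "real \<Rightarrow> real \<Rightarrow> real"
  assumes adm: "\<And>p t. adm (\<lambda>l. eta p l * m t l)" and K: "K \<ge> 0"
    and meas: "\<And>p w. w \<in> bumps \<Longrightarrow> (\<lambda>t. \<integral>l. eta p l * m t l * ST w l \<partial>hl) \<in> borel_measurable borel"
    and test: "\<And>w. w \<in> bumps \<Longrightarrow> (\<integral>\<^sup>+p. \<integral>\<^sup>+t. ennreal (cw s \<beta> p * (\<integral>l. eta p l * m t l * ST w l \<partial>hl)\<^sup>2) \<partial>lborel \<partial>count_space UNIV)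
       \<le> ennreal (K * Nsq \<sigma> (ST w))"
  shows "(\<integral>\<^sup>+p. \<integral>\<^sup>+t. ennreal (cw s \<beta> p * (Lam (\<lambda>l. eta p l * m t l) h)\<^sup>2) \<partial>lborel \<partial>count_space UNIV) \<le> ennreal (K * (norm h)\<^sup>2)"
proof -
  obtain w where w: "\<forall>n. w n \<in> bumps" "(\<lambda>n. J (w n)) \<longlonglongrightarrow> h" using J_dense by blast
  define L where "L n p t = (\<integral>l. eta p l * m t l * ST (w n) l \<partial>hl)" for n p t
  have Lm [measurable]: "L n p \<in> borel_measurable borel" for n p
    unfolding L_def using meas w(1) by simp
  have lim: "(\<lambda>n. L n p t) \<longlonglongrightarrow> Lam (\<lambda>l. eta p l * m t l) h" for p t
    using Lam_limit[OF adm w(2), of p t] w(1) by (simp add: Lam_J[OF adm] L_def)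
  have "(\<integral>\<^sup>+p. \<integral>\<^sup>+t. ennreal (cw s \<beta> p * (Lam (\<lambda>l. eta p l * m t l) h)\<^sup>2) \<partial>lborel \<partial>count_space UNIV)
    = (\<integral>\<^sup>+p. \<integral>\<^sup>+t. liminf (\<lambda>n. ennreal (cw s \<beta> p * (L n p t)\<^sup>2)) \<partial>lborel \<partial>count_space UNIV)"
  proof (intro nn_integral_cong)
    fix p :: "int \<times> nat" and t :: real
    have "(\<lambda>n. ennreal (cw s \<beta> p * (L n p t)\<^sup>2)) \<longlonglongrightarrow> ennreal (cw s \<beta> p * (Lam (\<lambda>l. eta p l * m t l) h)\<^sup>2)"
      by (intro tendsto_ennrealI tendsto_mult tendsto_const tendsto_power lim)
    from lim_imp_Liminf[OF _ this] show "ennreal (cw s \<beta> p * (Lam (\<lambda>l. eta p l * m t l) h)\<^sup>2) = liminf (\<lambda>n. ennreal (cw s \<beta> p * (L n p t)\<^sup>2))" by simp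
  qed
  also have "\<dots> \<le> (\<integral>\<^sup>+p. liminf (\<lambda>n. \<integral>\<^sup>+t. ennreal (cw s \<beta> p * (L n p t)\<^sup>2) \<partial>lborel) \<partial>count_space UNIV)"
    by (intro nn_integral_mono nn_integral_liminf) measurable
  also have "\<dots> \<le> liminf (\<lambda>n. \<integral>\<^sup>+p. \<integral>\<^sup>+t. ennreal (cw s \<beta> p * (L n p t)\<^sup>2) \<partial>lborel \<partial>count_space UNIV)"
    by (rule nn_integral_liminf) simp
  also have "\<dots> \<le> liminf (\<lambda>n. ennreal (K * (norm (J (w n)))\<^sup>2))"
  proof (rule Liminf_mono, rule always_eventually, rule allI)
    fix n
    have wn: "w n \<in> bumps" using w by simp
    have "1 * Nsq \<sigma> (ST (w n)) \<le> 4 * pi * Nsq \<sigma> (ST (w n))" using pi_gt3 by (intro mult_right_mono) auto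
    also have "\<dots> = (norm (J (w n)))\<^sup>2" by (simp add: norm_J[OF wn])
    finally have "ennreal (K * Nsq \<sigma> (ST (w n))) \<le> ennreal (K * (norm (J (w n)))\<^sup>2)"
      using K by (intro ennreal_leI mult_left_mono) auto
    then show "(\<integral>\<^sup>+p. \<integral>\<^sup>+t. ennreal (cw s \<beta> p * (L n p t)\<^sup>2) \<partial>lborel \<partial>count_space UNIV) \<le> ennreal (K * (norm (J (w n)))\<^sup>2)"
      unfolding L_def by (rule order_trans[OF test[OF wn]])
  qed
  also have "\<dots> = ennreal (K * (norm h)\<^sup>2)"
  proof (rule lim_imp_Liminf)
    show "(\<lambda>n. ennreal (K * (norm (J (w n)))\<^sup>2)) \<longlonglongrightarrow> ennreal (K * (norm h)\<^sup>2)"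
      by (intro tendsto_ennrealI tendsto_mult tendsto_const tendsto_power tendsto_norm w(2))
  qed simp
  finally show ?thesis .
qed

text \<open>Joint continuity in (t, h): the uniform bound makes the functionals equally Lipschitz in
  h, which reduces continuity in t to bumps. A joint statement is called for because h will be the
  value of the forcing at another time.\<close>

lemma Lam_joint_measurable:
  fixes \<kappa> :: "real \<Rightarrow> real \<Rightarrow> real"
  assumes adm: "\<And>t. adm (\<kappa> t)" and B: "\<And>t. Nsq (- \<sigma>) (\<kappa> t) \<le> B"
    and cont: "\<And>w. w \<in> bumps \<Longrightarrow> continuous_on UNIV (\<lambda>t. \<integral>l. \<kappa> t l * ST w l \<partial>hl)"
  shows "(\<lambda>p. Lam (\<kappa> (fst p)) (snd p)) \<in> borel_measurable (borel \<Otimes>\<^sub>M borel)"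
proof -
  have lip: "\<bar>Lam (\<kappa> t) h - Lam (\<kappa> t) h'\<bar> \<le> sqrt B * norm (h - h')" for t h h'
  proof -
    have "Lam (\<kappa> t) h - Lam (\<kappa> t) h' = Lam (\<kappa> t) (h - h')"
      using Lam_bounded_linear[OF adm, of t] by (simp add: linear_diff bounded_linear.linear)
    also have "\<bar>\<dots>\<bar> \<le> sqrt (Nsq (- \<sigma>) (\<kappa> t)) * norm (h - h')" by (rule Lam_le[OF adm])
    also have "\<dots> \<le> sqrt B * norm (h - h')" using B by (intro mult_right_mono) auto
    finally show ?thesis .
  qed
  have "continuous_on UNIV (\<lambda>p. Lam (\<kappa> (fst p)) (snd p))"
  proof (rule continuous_at_imp_continuous_on, rule ballI)
    fix p :: "real \<times> 'h"
    obtain t h where p: "p = (t, h)" by force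
    show "isCont (\<lambda>p. Lam (\<kappa> (fst p)) (snd p)) p"
      unfolding continuous_at_eps_delta
    proof (intro allI impI)
      fix e :: real assume e: "e > 0"
      have B0: "B \<ge> 0" using B[of 0] Nsq_nonneg[of "- \<sigma>" "\<kappa> 0"] by linarith
      \<comment> \<open>Four comparisons of size e / 4 follow; the summand 1 keeps the divisor
        positive when B = 0.\<close>
      define S where "S = sqrt B + 1"
      define d where "d = e / 4 / S"
      have sB: "S > 0" using B0 by (simp add: S_def add_nonneg_pos)
      then have d: "d > 0" using e by (simp add: d_def)
      have sd: "sqrt B * x \<le> e / 4" if "x \<le> d" "x \<ge> 0" for x
      proof -
        have "sqrt B * x \<le> S * d" using that B0 d by (intro mult_mono) (auto simp: S_def)
        also have "\<dots> = e / 4" using sB by (simp add: d_def)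
        finally show ?thesis .
      qed
      obtain w where w: "\<forall>n. w n \<in> bumps" "(\<lambda>n. J (w n)) \<longlonglongrightarrow> h" using J_dense by blast
      obtain N where N: "norm (J (w N) - h) < d" using LIMSEQ_D[OF w(2) d] by blast
      have wN: "w N \<in> bumps" using w by simp
      have "isCont (\<lambda>t. \<integral>l. \<kappa> t l * ST (w N) l \<partial>hl) t"
        using cont[OF wN] by (simp add: continuous_on_eq_continuous_at)
      then obtain d' where d': "d' > 0" "\<And>t'. dist t' t < d' \<Longrightarrow> dist (\<integral>l. \<kappa> t' l * ST (w N) l \<partial>hl) (\<integral>l. \<kappa> t l * ST (w N) l \<partial>hl) < e / 4"
        unfolding continuous_at_eps_delta using e by (metis zero_less_divide_iff zero_less_numeral)
      have "dist (Lam (\<kappa> (fst p')) (snd p')) (Lam (\<kappa> (fst p)) (snd p)) < e" if "dist p' p < min d d'" for p'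
      proof -
        obtain t' h' where p': "p' = (t', h')" by force
        have "dist t' t < d'" "dist h' h < d"
          using that dist_fst_le[of p' p] dist_snd_le[of p' p] by (auto simp: p p')
        then have c: "\<bar>Lam (\<kappa> t') (J (w N)) - Lam (\<kappa> t) (J (w N))\<bar> < e / 4" and hh: "norm (h' - h) \<le> d"
          using d'(2)[of t'] by (auto simp: Lam_J[OF adm wN] dist_real_def dist_norm)
        have "\<bar>Lam (\<kappa> t') h' - Lam (\<kappa> t') h\<bar> \<le> e / 4" using lip[of t' h' h] sd[OF hh] by simp
        moreover have "\<bar>Lam (\<kappa> t') (J (w N)) - Lam (\<kappa> t') h\<bar> \<le> e / 4" "\<bar>Lam (\<kappa> t) (J (w N)) - Lam (\<kappa> t) h\<bar> \<le> e / 4"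
          using lip[of t' "J (w N)" h] lip[of t "J (w N)" h] sd[of "norm (J (w N) - h)"] N by auto
        ultimately have "\<bar>Lam (\<kappa> t') h' - Lam (\<kappa> t) h\<bar> < e" using c by linarith
        then show ?thesis by (simp add: p p' dist_real_def)
      qed
      then show "\<exists>d>0. \<forall>p'. dist p' p < d \<longrightarrow> dist (Lam (\<kappa> (fst p')) (snd p')) (Lam (\<kappa> (fst p)) (snd p)) < e"
        using d d'(1) by (intro exI[of _ "min d d'"]) auto
    qed
  qed
  then show ?thesis unfolding borel_prod by (rule borel_measurable_continuous_onI)
qed

end

text \<open>The segment between 0 and t lies in I, and the orientation disappears in the absolute
  value. For a non-integrable integrand the Bochner integral is 0 by default and the bound is
  trivial, which spares strong measurability of the Duhamel integrand.\<close>

lemma bounded_linear_interval_integral_le: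
  fixes G :: "real \<Rightarrow> 'a::{banach, second_countable_topology}" and L :: "'a \<Rightarrow> real"
  assumes L: "bounded_linear L" and I: "is_interval I" "0 \<in> I" "t \<in> I"
  shows "ennreal \<bar>L (LBINT \<tau>=ereal 0..ereal t. G \<tau>)\<bar> \<le> (\<integral>\<^sup>+\<tau>\<in>I. ennreal \<bar>L (G \<tau>)\<bar> \<partial>lborel)"
proof -
  interpret bounded_linear L by (rule L)
  have main: "ennreal \<bar>L (LBINT \<tau>:S. G \<tau>)\<bar> \<le> (\<integral>\<^sup>+\<tau>\<in>I. ennreal \<bar>L (G \<tau>)\<bar> \<partial>lborel)" if S: "S \<subseteq> I" for S
  proof (cases "set_integrable lborel S G")
    case True
    then have i: "integrable lborel (\<lambda>\<tau>. indicator S \<tau> *\<^sub>R G \<tau>)" by (simp add: set_integrable_def)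
    have iL: "integrable lborel (\<lambda>\<tau>. L (indicator S \<tau> *\<^sub>R G \<tau>))" by (rule integrable_bounded_linear[OF L i])
    have "L (LBINT \<tau>:S. G \<tau>) = (\<integral>\<tau>. L (indicator S \<tau> *\<^sub>R G \<tau>) \<partial>lborel)"
      unfolding set_lebesgue_integral_def by (rule integral_bounded_linear[OF L i, symmetric])
    then have "ennreal \<bar>L (LBINT \<tau>:S. G \<tau>)\<bar> \<le> ennreal (\<integral>\<tau>. \<bar>L (indicator S \<tau> *\<^sub>R G \<tau>)\<bar> \<partial>lborel)"
      by (simp add: ennreal_leI integral_abs_bound)
    also have "\<dots> = (\<integral>\<^sup>+\<tau>. ennreal \<bar>L (indicator S \<tau> *\<^sub>R G \<tau>)\<bar> \<partial>lborel)"
      by (rule nn_integral_eq_integral[symmetric, OF integrable_abs[OF iL]]) simp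
    also have "\<dots> \<le> (\<integral>\<^sup>+\<tau>\<in>I. ennreal \<bar>L (G \<tau>)\<bar> \<partial>lborel)"
      by (rule nn_integral_mono) (use S in \<open>auto simp: indicator_def zero\<close>)
    finally show ?thesis .
  next
    case False
    then have "(LBINT \<tau>:S. G \<tau>) = 0"
      unfolding set_lebesgue_integral_def set_integrable_def by (rule not_integrable_integral_eq)
    then show ?thesis by (simp add: zero)
  qed
  have sub: "einterval (ereal a) (ereal b) \<subseteq> I" if "a \<in> I" "b \<in> I" for a b
  proof
    fix x assume "x \<in> einterval (ereal a) (ereal b)"
    then have "a \<le> x" "x \<le> b" by (simp_all add: einterval_def)
    then show "x \<in> I" by (rule mem_is_interval_1_I[OF I(1) that])
  qed
  show ?thesis
    using main[OF sub[OF I(2,3)]] main[OF sub[OF I(3,2)]]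
    by (cases "0 \<le> t") (simp_all add: interval_lebesgue_integral_def neg)
qed

section \<open>The two multipliers of the wave flow and their square sums\<close>

lemma continuous_trig_integral:
  fixes g :: "real \<Rightarrow> real"
  assumes trig: "trig = cos \<or> trig = sin" and g: "integrable hl g"
  shows "continuous_on UNIV (\<lambda>t. \<integral>l. trig (t * l) * g l \<partial>hl)"
proof (rule continuous_at_imp_continuous_on, rule ballI)
  fix t :: real
  have gm: "g \<in> borel_measurable hl" using g by auto
  have tb: "\<bar>trig x\<bar> \<le> 1" and tc: "isCont trig x" for x :: real using trig by auto
  have tm: "(\<lambda>l. trig (u * l)) \<in> borel_measurable hl" for u
    using trig by (intro borel_measurable_hlI) auto
  show "isCont (\<lambda>t. \<integral>l. trig (t * l) * g l \<partial>hl) t"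
    unfolding continuous_at_sequentially
  proof (intro allI impI)
    fix u :: "nat \<Rightarrow> real" assume u: "u \<longlonglongrightarrow> t"
    show "((\<lambda>t. \<integral>l. trig (t * l) * g l \<partial>hl) \<circ> u) \<longlonglongrightarrow> (\<integral>l. trig (t * l) * g l \<partial>hl)"
      unfolding comp_def
    proof (rule integral_dominated_convergence[where w="\<lambda>l. \<bar>g l\<bar>"])
      show "AE l in hl. (\<lambda>i. trig (u i * l) * g l) \<longlonglongrightarrow> trig (t * l) * g l"
      proof (rule AE_I2)
        fix l
        have "(\<lambda>i. u i * l) \<longlonglongrightarrow> t * l" by (rule tendsto_mult[OF u tendsto_const])
        from tendsto_mult[OF isCont_tendsto_compose[OF tc this] tendsto_const[of "g l"]]
        show "(\<lambda>i. trig (u i * l) * g l) \<longlonglongrightarrow> trig (t * l) * g l" .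
      qed
      show "AE l in hl. norm (trig (u i * l) * g l) \<le> \<bar>g l\<bar>" for i
        using tb by (intro AE_I2) (simp add: abs_mult mult_left_le_one_le)
      show "integrable hl (\<lambda>l. \<bar>g l\<bar>)" by (rule integrable_abs[OF g])
    qed (intro borel_measurable_times tm gm)+
  qed
qed

lemma multiplier_cos:
  assumes "completion s j" "0 < s"
  shows "multiplier s j s j (\<lambda>l. cos (t * l)) 1"
proof -
  interpret completion s j by fact
  show ?thesis
  proof (unfold_locales)
    show "\<exists>w. wavelike w \<and> (\<forall>l>0. ST w l = cos (t * l) * ST v l)" if v: "v \<in> bumps" for v
      by (rule wave_cos[OF v, of t]) blast
    show "continuous_on {0<..} (\<lambda>l. cos (t * l))" by (intro continuous_intros)
    show "\<bar>cos (t * l)\<bar> * l powr s \<le> 1 * l powr s" if "l > 0" for l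
      by (rule mult_right_mono) auto
  qed (use assms(2) in auto)
qed

text \<open>The factor 1 / l is exactly the gain of one order, so the constant is 1 for every
  t.\<close>

lemma multiplier_sin:
  assumes "completion s j" "0 < s" "completion (s - 1) j'"
  shows "multiplier (s - 1) j' s j (\<lambda>l. sin (t * l) / l) 1"
proof -
  interpret completion s j by fact
  interpret c: completion "s - 1" j' by fact
  show ?thesis
  proof (unfold_locales)
    show "\<exists>w. wavelike w \<and> (\<forall>l>0. ST w l = sin (t * l) / l * ST v l)" if v: "v \<in> bumps" for v
      by (rule wave_sin[OF v, of t]) blast
    show "continuous_on {0<..} (\<lambda>l. sin (t * l) / l)" by (intro continuous_intros) auto
    show "\<bar>sin (t * l) / l\<bar> * l powr s \<le> 1 * l powr (s - 1)" if "l > 0" for l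
    proof -
      have "\<bar>sin (t * l) / l\<bar> * l powr s = \<bar>sin (t * l)\<bar> * l powr (s - 1)" using that by (simp add: powr_diff)
      also have "\<dots> \<le> 1 * l powr (s - 1)" by (rule mult_right_mono) auto
      finally show ?thesis .
    qed
  qed (use assms(2) in auto)
qed

context completion
begin

lemma eta_ST_integrable: "w \<in> bumps \<Longrightarrow> integrable hl (\<lambda>l. eta p l * ST w l)"
proof -
  assume w: "w \<in> bumps"
  obtain k n where p: "p = (k, n)" by force
  have i: "integrable hl (\<lambda>l. 2 * ST w l)" by (intro integrable_mult_right tame_integrable tame_ST bumps_nice w)
  have m: "eta p \<in> borel_measurable hl" "ST w \<in> borel_measurable hl"
    using borel_measurable_hl_cont[OF eta_cont] bumps_pairing(1)[OF w] by auto
  show ?thesis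
  proof (rule Bochner_Integration.integrable_bound[OF i borel_measurable_times[OF m]], rule AE_hlI)
    fix l :: real assume "l > 0"
    from mult_right_mono[OF eta_bounds(1)[OF this, of k n] abs_ge_zero[of "ST w l"]]
    show "norm (eta p l * ST w l) \<le> norm (2 * ST w l)" by (simp add: p abs_mult)
  qed
qed

text \<open>The linear vanishing of the kernel at low frequency absorbs the division by l.\<close>

lemma eta_ST_divide_integrable: "w \<in> bumps \<Longrightarrow> integrable hl (\<lambda>l. eta p l * (ST w l / l))"
proof -
  assume w: "w \<in> bumps"
  obtain k n where p: "p = (k, n)" by force
  have i: "integrable hl (\<lambda>l. 2 * dy k * ST w l)" by (intro integrable_mult_right tame_integrable tame_ST bumps_nice w)
  have "continuous_on {0<..} (\<lambda>l. eta p l * (ST w l / l))"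
    using tame_ST[OF bumps_nice[OF w]] by (intro continuous_intros eta_cont) (auto simp: tame_def)
  then have m: "(\<lambda>l. eta p l * (ST w l / l)) \<in> borel_measurable hl" by (rule borel_measurable_hl_cont)
  show ?thesis
  proof (rule Bochner_Integration.integrable_bound[OF i m], rule AE_hlI)
    fix l :: real assume l: "l > 0"
    from mult_right_mono[OF eta_bounds(2)[OF l, of k n], of "\<bar>ST w l\<bar> / l"]
    show "norm (eta p l * (ST w l / l)) \<le> norm (2 * dy k * ST w l)" using l by (simp add: p abs_mult)
  qed
qed

lemma cos_flow:
  assumes s0: "\<sigma> > 0" and K: "K \<ge> 0"
    "\<And>x. x > 0 \<Longrightarrow> (\<integral>\<^sup>+p. ennreal (cw \<sigma> \<beta> p * (eta p x)\<^sup>2) \<partial>count_space UNIV) \<le> ennreal (K * x powr (2 * \<sigma>))"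
  shows "(\<integral>\<^sup>+p. \<integral>\<^sup>+t. ennreal (cw \<sigma> \<beta> p * (Lam (\<lambda>l. eta p l * cos (t * l)) h)\<^sup>2) \<partial>lborel \<partial>count_space UNIV) \<le> ennreal (pi * K * (norm h)\<^sup>2)"
    and "(\<lambda>x. Lam (\<lambda>l. eta p l * cos (fst x * l)) (snd x)) \<in> borel_measurable (borel \<Otimes>\<^sub>M borel)"
proof -
  interpret m: multiplier \<sigma> j \<sigma> j "\<lambda>l. cos (t * l)" 1 for t by (rule multiplier_cos[OF completion_axioms s0])
  have eq: "(\<integral>l. eta p l * cos (t * l) * ST w l \<partial>hl) = (\<integral>l. cos (t * l) * (eta p l * ST w l) \<partial>hl)" for p t w
    by (simp only: mult_ac)
  have c: "continuous_on UNIV (\<lambda>t. \<integral>l. eta p l * cos (t * l) * ST w l \<partial>hl)" if "w \<in> bumps" for p w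
    unfolding eq by (rule continuous_trig_integral[OF _ eta_ST_integrable[OF that]]) simp
  show "(\<integral>\<^sup>+p. \<integral>\<^sup>+t. ennreal (cw \<sigma> \<beta> p * (Lam (\<lambda>l. eta p l * cos (t * l)) h)\<^sup>2) \<partial>lborel \<partial>count_space UNIV) \<le> ennreal (pi * K * (norm h)\<^sup>2)"
  proof (rule flow_estimate)
    show "adm (\<lambda>l. eta p l * cos (t * l))" for p t by (rule m.adm_mult(1)[OF eta_adm[OF s0]])
    show "(\<lambda>t. \<integral>l. eta p l * cos (t * l) * ST w l \<partial>hl) \<in> borel_measurable borel" if "w \<in> bumps" for p w
      by (rule borel_measurable_continuous_onI[OF c[OF that]])
    show "(\<integral>\<^sup>+p. \<integral>\<^sup>+t. ennreal (cw \<sigma> \<beta> p * (\<integral>l. eta p l * cos (t * l) * ST w l \<partial>hl)\<^sup>2) \<partial>lborel \<partial>count_space UNIV)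
       \<le> ennreal (pi * K * Nsq \<sigma> (ST w))" if w: "w \<in> bumps" for w
    proof -
      have t: "tame (ST w)" by (intro tame_ST bumps_nice w)
      obtain B where B: "\<And>l. l > 0 \<Longrightarrow> \<bar>l powr 0 * ST w l\<bar> \<le> B" using tame_powr(3)[OF t, of 0] by auto
      have "(\<integral>\<^sup>+p. \<integral>\<^sup>+t. ennreal (cw \<sigma> \<beta> p * (\<integral>l. cos (t * l) * (eta p l * ST w l) \<partial>hl)\<^sup>2) \<partial>lborel \<partial>count_space UNIV)
        \<le> ennreal (pi * K) * (\<integral>\<^sup>+l. ennreal ((l powr \<sigma> * ST w l)\<^sup>2) \<partial>hl)"
      proof (rule flow_sum_le[OF _ K])
        show "continuous_on {0<..} (ST w)" using t by (simp add: tame_def)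
        show "\<bar>ST w l\<bar> \<le> B" if "l > 0" for l using B[OF that] that by simp
        show "integrable hl (\<lambda>l. eta p l * ST w l)" for p by (rule eta_ST_integrable[OF w])
      qed simp
      then show ?thesis unfolding eq nn_integral_Nsq[OF t \<sigma>] using K(1) by (simp add: ennreal_mult)
    qed
  qed (use K in simp)
  show "(\<lambda>x. Lam (\<lambda>l. eta p l * cos (fst x * l)) (snd x)) \<in> borel_measurable (borel \<Otimes>\<^sub>M borel)"
  proof (rule Lam_joint_measurable)
    show "adm (\<lambda>l. eta p l * cos (t * l))" for t by (rule m.adm_mult(1)[OF eta_adm[OF s0]])
    show "Nsq (- \<sigma>) (\<lambda>l. eta p l * cos (t * l)) \<le> 1\<^sup>2 * Nsq (- \<sigma>) (eta p)" for t by (rule m.adm_mult(2)[OF eta_adm[OF s0]])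
  qed (rule c)
qed

text \<open>Applied to data of order s - 1. With a = \<open>ST w\<close> / l the weight l^(\<sigma>
  + 1) of the square sum turns into l^\<sigma>. Admissibility is inherited through
  \<open>adm_mult\<close> from order \<sigma> + 1, which is positive, so that \<open>eta\<close> is
  admissible there.\<close>

lemma sin_flow:
  assumes s0: "\<sigma> < 0" and j': "completion (\<sigma> + 1) j'" and K: "K \<ge> 0"
    "\<And>x. x > 0 \<Longrightarrow> (\<integral>\<^sup>+p. ennreal (cw (\<sigma> + 1) \<beta> p * (eta p x)\<^sup>2) \<partial>count_space UNIV) \<le> ennreal (K * x powr (2 * (\<sigma> + 1)))"
  shows "(\<integral>\<^sup>+p. \<integral>\<^sup>+t. ennreal (cw (\<sigma> + 1) \<beta> p * (Lam (\<lambda>l. eta p l * (sin (t * l) / l)) h)\<^sup>2) \<partial>lborel \<partial>count_space UNIV) \<le> ennreal (pi * K * (norm h)\<^sup>2)"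
    and "(\<lambda>x. Lam (\<lambda>l. eta p l * (sin (fst x * l) / l)) (snd x)) \<in> borel_measurable (borel \<Otimes>\<^sub>M borel)"
proof -
  interpret d: completion "\<sigma> + 1" j' by (rule j')
  have s1: "\<sigma> + 1 > 0" using \<sigma> by simp
  have "multiplier (\<sigma> + 1 - 1) j (\<sigma> + 1) j' (\<lambda>l. sin (t * l) / l) 1" for t
    by (rule multiplier_sin[OF j' s1]) (simp add: completion_axioms)
  then interpret m: multiplier \<sigma> j "\<sigma> + 1" j' "\<lambda>l. sin (t * l) / l" 1 for t by simp
  have eq: "(\<integral>l. eta p l * (sin (t * l) / l) * ST w l \<partial>hl) = (\<integral>l. sin (t * l) * (eta p l * (ST w l / l)) \<partial>hl)" for p t w
    by (simp add: mult_ac)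
  have c: "continuous_on UNIV (\<lambda>t. \<integral>l. eta p l * (sin (t * l) / l) * ST w l \<partial>hl)" if "w \<in> bumps" for p w
    unfolding eq by (rule continuous_trig_integral[OF _ eta_ST_divide_integrable[OF that]]) simp
  show "(\<integral>\<^sup>+p. \<integral>\<^sup>+t. ennreal (cw (\<sigma> + 1) \<beta> p * (Lam (\<lambda>l. eta p l * (sin (t * l) / l)) h)\<^sup>2) \<partial>lborel \<partial>count_space UNIV) \<le> ennreal (pi * K * (norm h)\<^sup>2)"
  proof (rule flow_estimate)
    show "adm (\<lambda>l. eta p l * (sin (t * l) / l))" for p t by (rule m.adm_mult(1)[OF d.eta_adm[OF s1]])
    show "(\<lambda>t. \<integral>l. eta p l * (sin (t * l) / l) * ST w l \<partial>hl) \<in> borel_measurable borel" if "w \<in> bumps" for p w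
      by (rule borel_measurable_continuous_onI[OF c[OF that]])
    show "(\<integral>\<^sup>+p. \<integral>\<^sup>+t. ennreal (cw (\<sigma> + 1) \<beta> p * (\<integral>l. eta p l * (sin (t * l) / l) * ST w l \<partial>hl)\<^sup>2) \<partial>lborel \<partial>count_space UNIV)
       \<le> ennreal (pi * K * Nsq \<sigma> (ST w))" if w: "w \<in> bumps" for w
    proof -
      have t: "tame (ST w)" by (intro tame_ST bumps_nice w)
      then obtain C where C: "\<And>l. l > 0 \<Longrightarrow> \<bar>ST w l\<bar> \<le> C * l" unfolding tame_def by blast
      have "(\<integral>\<^sup>+p. \<integral>\<^sup>+t. ennreal (cw (\<sigma> + 1) \<beta> p * (\<integral>l. sin (t * l) * (eta p l * (ST w l / l)) \<partial>hl)\<^sup>2) \<partial>lborel \<partial>count_space UNIV)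
        \<le> ennreal (pi * K) * (\<integral>\<^sup>+l. ennreal ((l powr (\<sigma> + 1) * (ST w l / l))\<^sup>2) \<partial>hl)"
      proof (rule flow_sum_le[OF _ K])
        show "continuous_on {0<..} (\<lambda>l. ST w l / l)" using t by (intro continuous_intros) (auto simp: tame_def)
        show "\<bar>ST w l / l\<bar> \<le> C" if "l > 0" for l using C[OF that] that by (simp add: pos_divide_le_eq)
        show "integrable hl (\<lambda>l. eta p l * (ST w l / l))" for p by (rule eta_ST_divide_integrable[OF w])
      qed simp
      also have "(\<integral>\<^sup>+l. ennreal ((l powr (\<sigma> + 1) * (ST w l / l))\<^sup>2) \<partial>hl) = (\<integral>\<^sup>+l. ennreal ((l powr \<sigma> * ST w l)\<^sup>2) \<partial>hl)"
        by (rule nn_integral_cong) (simp add: powr_add)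
      finally show ?thesis unfolding eq nn_integral_Nsq[OF t \<sigma>] using K(1) by (simp add: ennreal_mult)
    qed
  qed (use K in simp)
  show "(\<lambda>x. Lam (\<lambda>l. eta p l * (sin (fst x * l) / l)) (snd x)) \<in> borel_measurable (borel \<Otimes>\<^sub>M borel)"
  proof (rule Lam_joint_measurable)
    show "adm (\<lambda>l. eta p l * (sin (t * l) / l))" for t by (rule m.adm_mult(1)[OF d.eta_adm[OF s1]])
    show "Nsq (- \<sigma>) (\<lambda>l. eta p l * (sin (t * l) / l)) \<le> 1\<^sup>2 * Nsq (- (\<sigma> + 1)) (eta p)" for t by (rule m.adm_mult(2)[OF d.eta_adm[OF s1]])
  qed (rule c)
qed

end

section \<open>The square sum of the Duhamel term\<close>

lemma borel_measurable_compose_pair: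
  assumes "(\<lambda>x. H (fst x) (snd x)) \<in> borel_measurable (borel \<Otimes>\<^sub>M borel)"
    and "f \<in> borel_measurable M" "g \<in> borel_measurable M"
  shows "(\<lambda>x. H (f x) (g x)) \<in> borel_measurable M"
  using measurable_compose[OF measurable_Pair[OF assms(2,3)] assms(1)] by simp

text \<open>Cauchy--Schwarz in \<open>\<tau>\<close> with weight \<open>\<parallel>F(\<tau>)\<parallel>\<close>, in place of Minkowski's inequality in \<open>\<ell>\<^sup>2 L\<^sup>2\<close>.\<close>

lemma duhamel_square_bound:
  fixes H :: "int \<times> nat \<Rightarrow> real \<Rightarrow> 'b::{banach, second_countable_topology} \<Rightarrow> real" and F :: "real \<Rightarrow> 'b"
  assumes Hm: "\<And>p. (\<lambda>x. H p (fst x) (snd x)) \<in> borel_measurable (borel \<Otimes>\<^sub>M borel)" and H0: "\<And>p t. H p t 0 = 0"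
    and flow: "\<And>h. (\<integral>\<^sup>+p. \<integral>\<^sup>+t. ennreal (c p * (H p t h)\<^sup>2) \<partial>lborel \<partial>count_space UNIV) \<le> ennreal (K * (norm h)\<^sup>2)"
    and F: "integrable lborel F" and c: "\<And>p. c p \<ge> 0" and K: "K \<ge> 0"
  shows "(\<integral>\<^sup>+p. \<integral>\<^sup>+t. ennreal (c p) * (\<integral>\<^sup>+\<tau>. ennreal \<bar>H p (t - \<tau>) (F \<tau>)\<bar> \<partial>lborel)\<^sup>2 \<partial>lborel \<partial>count_space UNIV)
    \<le> ennreal (K * (\<integral>\<tau>. norm (F \<tau>) \<partial>lborel)\<^sup>2)"
proof -
  have [measurable]: "F \<in> borel_measurable borel" using F by auto
  note Hc = borel_measurable_compose_pair[OF Hm]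
  have H1 [measurable]: "(\<lambda>\<tau>. H p (t - \<tau>) (F \<tau>)) \<in> borel_measurable borel" for p t by (rule Hc) measurable
  have H2 [measurable]: "(\<lambda>x. H p (fst x - snd x) (F (snd x))) \<in> borel_measurable (borel \<Otimes>\<^sub>M borel)" for p by (rule Hc) measurable
  have H3 [measurable]: "(\<lambda>x. H p (snd x - fst x) (F (fst x))) \<in> borel_measurable (borel \<Otimes>\<^sub>M borel)" for p by (rule Hc) measurable
  have H4 [measurable]: "(\<lambda>t. H p (t - \<tau>) (F \<tau>)) \<in> borel_measurable borel" for p \<tau> by (rule Hc) measurable
  have H5 [measurable]: "(\<lambda>t. H p t h) \<in> borel_measurable borel" for p h by (rule Hc) measurable
  define W where "W = (\<integral>\<tau>. norm (F \<tau>) \<partial>lborel)"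
  have W: "(\<integral>\<^sup>+\<tau>. ennreal (norm (F \<tau>)) \<partial>lborel) = ennreal W"
    unfolding W_def by (rule nn_integral_eq_integral) (use F in auto)
  have W0: "W \<ge> 0" by (simp add: W_def)
  have CS: "(\<integral>\<^sup>+\<tau>. ennreal \<bar>H p (t - \<tau>) (F \<tau>)\<bar> \<partial>lborel)\<^sup>2 \<le> ennreal W * (\<integral>\<^sup>+\<tau>. ennreal ((H p (t - \<tau>) (F \<tau>))\<^sup>2 / norm (F \<tau>)) \<partial>lborel)" for p t
  proof -
    have "(\<integral>\<^sup>+\<tau>. ennreal \<bar>H p (t - \<tau>) (F \<tau>)\<bar> \<partial>lborel) = (\<integral>\<^sup>+\<tau>. ennreal (sqrt (norm (F \<tau>))) * ennreal (\<bar>H p (t - \<tau>) (F \<tau>)\<bar> / sqrt (norm (F \<tau>))) \<partial>lborel)"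
    proof (rule nn_integral_cong)
      fix \<tau>
      \<comment> \<open>Where F(\<tau>) = 0 both sides are 0, by \<open>H0\<close> and the
        convention for division by 0.\<close>
      have "\<bar>H p (t - \<tau>) (F \<tau>)\<bar> = sqrt (norm (F \<tau>)) * (\<bar>H p (t - \<tau>) (F \<tau>)\<bar> / sqrt (norm (F \<tau>)))"
        using H0[of p "t - \<tau>"] by (cases "F \<tau> = 0") auto
      then show "ennreal \<bar>H p (t - \<tau>) (F \<tau>)\<bar> = ennreal (sqrt (norm (F \<tau>))) * ennreal (\<bar>H p (t - \<tau>) (F \<tau>)\<bar> / sqrt (norm (F \<tau>)))"
        by (simp only: ennreal_mult' real_sqrt_ge_zero norm_ge_zero flip: ennreal_mult')
    qed
    then have "(\<integral>\<^sup>+\<tau>. ennreal \<bar>H p (t - \<tau>) (F \<tau>)\<bar> \<partial>lborel)\<^sup>2 \<le>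
       (\<integral>\<^sup>+\<tau>. (ennreal (sqrt (norm (F \<tau>))))\<^sup>2 \<partial>lborel) * (\<integral>\<^sup>+\<tau>. (ennreal (\<bar>H p (t - \<tau>) (F \<tau>)\<bar> / sqrt (norm (F \<tau>))))\<^sup>2 \<partial>lborel)"
      by (simp only:) (rule Cauchy_Schwarz_nn_integral; measurable)
    also have "(\<integral>\<^sup>+\<tau>. (ennreal (sqrt (norm (F \<tau>))))\<^sup>2 \<partial>lborel) = ennreal W" by (simp add: ennreal_power W)
    also have "(\<integral>\<^sup>+\<tau>. (ennreal (\<bar>H p (t - \<tau>) (F \<tau>)\<bar> / sqrt (norm (F \<tau>))))\<^sup>2 \<partial>lborel) = (\<integral>\<^sup>+\<tau>. ennreal ((H p (t - \<tau>) (F \<tau>))\<^sup>2 / norm (F \<tau>)) \<partial>lborel)"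
      by (simp add: ennreal_power power_divide)
    finally show ?thesis .
  qed
  have "(\<integral>\<^sup>+p. \<integral>\<^sup>+t. ennreal (c p) * (\<integral>\<^sup>+\<tau>. ennreal \<bar>H p (t - \<tau>) (F \<tau>)\<bar> \<partial>lborel)\<^sup>2 \<partial>lborel \<partial>count_space UNIV)
    \<le> (\<integral>\<^sup>+p. \<integral>\<^sup>+t. \<integral>\<^sup>+\<tau>. ennreal W * (ennreal (c p) * ennreal ((H p (t - \<tau>) (F \<tau>))\<^sup>2 / norm (F \<tau>))) \<partial>lborel \<partial>lborel \<partial>count_space UNIV)"
  proof (intro nn_integral_mono)
    fix p t
    have "ennreal (c p) * (\<integral>\<^sup>+\<tau>. ennreal \<bar>H p (t - \<tau>) (F \<tau>)\<bar> \<partial>lborel)\<^sup>2 \<le> ennreal (c p) * (ennreal W * (\<integral>\<^sup>+\<tau>. ennreal ((H p (t - \<tau>) (F \<tau>))\<^sup>2 / norm (F \<tau>)) \<partial>lborel))"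
      by (rule mult_left_mono[OF CS]) simp
    also have "\<dots> = ennreal W * (ennreal (c p) * (\<integral>\<^sup>+\<tau>. ennreal ((H p (t - \<tau>) (F \<tau>))\<^sup>2 / norm (F \<tau>)) \<partial>lborel))" by (rule mult.left_commute)
    also have "\<dots> = (\<integral>\<^sup>+\<tau>. ennreal W * (ennreal (c p) * ennreal ((H p (t - \<tau>) (F \<tau>))\<^sup>2 / norm (F \<tau>))) \<partial>lborel)"
      by (subst nn_integral_cmult[symmetric], measurable) (rule nn_integral_cmult[symmetric], measurable)
    finally show "ennreal (c p) * (\<integral>\<^sup>+\<tau>. ennreal \<bar>H p (t - \<tau>) (F \<tau>)\<bar> \<partial>lborel)\<^sup>2 \<le> (\<integral>\<^sup>+\<tau>. ennreal W * (ennreal (c p) * ennreal ((H p (t - \<tau>) (F \<tau>))\<^sup>2 / norm (F \<tau>))) \<partial>lborel)" .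
  qed
  also have "\<dots> = (\<integral>\<^sup>+p. \<integral>\<^sup>+\<tau>. \<integral>\<^sup>+t. ennreal W * (ennreal (c p) * ennreal ((H p (t - \<tau>) (F \<tau>))\<^sup>2 / norm (F \<tau>))) \<partial>lborel \<partial>lborel \<partial>count_space UNIV)"
    by (rule nn_integral_cong, rule lborel_pair.Fubini', simp add: split_beta' del: ennreal_mult')
  also have "\<dots> = (\<integral>\<^sup>+\<tau>. \<integral>\<^sup>+p. \<integral>\<^sup>+t. ennreal W * (ennreal (c p) * ennreal ((H p (t - \<tau>) (F \<tau>))\<^sup>2 / norm (F \<tau>))) \<partial>lborel \<partial>count_space UNIV \<partial>lborel)"
    by (rule nn_integral_count_space_nn_integral[symmetric], simp, measurable)
  also have "\<dots> \<le> (\<integral>\<^sup>+\<tau>. ennreal (W * K) * ennreal (norm (F \<tau>)) \<partial>lborel)"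
  proof (rule nn_integral_mono)
    fix \<tau> :: real
    have "(\<integral>\<^sup>+p. \<integral>\<^sup>+t. ennreal W * (ennreal (c p) * ennreal ((H p (t - \<tau>) (F \<tau>))\<^sup>2 / norm (F \<tau>))) \<partial>lborel \<partial>count_space UNIV)
      = (\<integral>\<^sup>+p. ennreal (W / norm (F \<tau>)) * (\<integral>\<^sup>+t. ennreal (c p * (H p t (F \<tau>))\<^sup>2) \<partial>lborel) \<partial>count_space UNIV)"
    proof (rule nn_integral_cong)
      fix p
      have "(\<integral>\<^sup>+t. ennreal W * (ennreal (c p) * ennreal ((H p (t - \<tau>) (F \<tau>))\<^sup>2 / norm (F \<tau>))) \<partial>lborel)
        = (\<integral>\<^sup>+t. ennreal (W / norm (F \<tau>)) * ennreal (c p * (H p (t - \<tau>) (F \<tau>))\<^sup>2) \<partial>lborel)"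
        by (rule nn_integral_cong) (simp add: ennreal_mult[symmetric] W0 c)
      also have "\<dots> = ennreal (W / norm (F \<tau>)) * (\<integral>\<^sup>+t. ennreal (c p * (H p (t - \<tau>) (F \<tau>))\<^sup>2) \<partial>lborel)"
        by (rule nn_integral_cmult) measurable
      \<comment> \<open>Translation in t removes \<tau>, and the homogeneous estimate applies with
        the fixed datum F(\<tau>).\<close>
      also have "(\<integral>\<^sup>+t. ennreal (c p * (H p (t - \<tau>) (F \<tau>))\<^sup>2) \<partial>lborel) = (\<integral>\<^sup>+t. ennreal (c p * (H p t (F \<tau>))\<^sup>2) \<partial>lborel)"
        using nn_integral_real_affine[of "\<lambda>t. ennreal (c p * (H p (t - \<tau>) (F \<tau>))\<^sup>2)" 1 \<tau>] by simp
      finally show "(\<integral>\<^sup>+t. ennreal W * (ennreal (c p) * ennreal ((H p (t - \<tau>) (F \<tau>))\<^sup>2 / norm (F \<tau>))) \<partial>lborel)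
        = ennreal (W / norm (F \<tau>)) * (\<integral>\<^sup>+t. ennreal (c p * (H p t (F \<tau>))\<^sup>2) \<partial>lborel)" .
    qed
    also have "\<dots> = ennreal (W / norm (F \<tau>)) * (\<integral>\<^sup>+p. \<integral>\<^sup>+t. ennreal (c p * (H p t (F \<tau>))\<^sup>2) \<partial>lborel \<partial>count_space UNIV)"
      by (rule nn_integral_cmult) simp
    also have "\<dots> \<le> ennreal (W / norm (F \<tau>)) * ennreal (K * (norm (F \<tau>))\<^sup>2)" by (rule mult_left_mono[OF flow]) simp
    also have "\<dots> = ennreal (W * K) * ennreal (norm (F \<tau>))"
    proof (cases "F \<tau> = 0")
      case False
      then have "W / norm (F \<tau>) * (K * (norm (F \<tau>))\<^sup>2) = W * K * norm (F \<tau>)" by (simp add: power2_eq_square)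
      then show ?thesis using W0 K by (simp add: ennreal_mult[symmetric])
    qed simp
    finally show "(\<integral>\<^sup>+p. \<integral>\<^sup>+t. ennreal W * (ennreal (c p) * ennreal ((H p (t - \<tau>) (F \<tau>))\<^sup>2 / norm (F \<tau>))) \<partial>lborel \<partial>count_space UNIV)
      \<le> ennreal (W * K) * ennreal (norm (F \<tau>))" .
  qed
  also have "\<dots> = ennreal (W * K) * ennreal W" by (subst nn_integral_cmult) (simp_all add: W)
  also have "\<dots> = ennreal (K * W\<^sup>2)" using W0 K by (simp add: ennreal_mult[symmetric] power2_eq_square mult_ac)
  finally show ?thesis by (simp add: W_def)
qed

section \<open>From the dyadic energy to the mixed norm\<close>

lemma enn_powr_mono: "x \<le> y \<Longrightarrow> p \<ge> 0 \<Longrightarrow> enn_powr x p \<le> enn_powr y p"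
proof -
  assume a: "x \<le> y" "p \<ge> 0"
  show ?thesis
  proof (cases "y = top")
    case False
    then obtain r where r: "y = ennreal r" "r \<ge> 0" by (cases y) auto
    then obtain r' where r': "x = ennreal r'" "r' \<ge> 0" using a(1) by (cases x) (auto simp: top_unique)
    then have "r' \<le> r" using a(1) r by (simp add: ennreal_le_iff)
    then show ?thesis using r r' a(2) by (simp add: enn_powr_ennreal ennreal_leI powr_mono2)
  qed (simp add: enn_powr_def)
qed

lemma section_measurable:
  assumes "(\<lambda>(t, x). u t x) \<in> borel_measurable (restrict_space borel (I \<times> Omega))" "t \<in> I"
  shows "u t \<in> borel_measurable (restrict_space lborel Omega)"
proof -
  have "(\<lambda>x :: real ^ 3. (t, x)) \<in> restrict_space lborel Omega \<rightarrow>\<^sub>M restrict_space borel (I \<times> Omega)"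
  proof (rule measurable_restrict_space2)
    have "(\<lambda>x :: real ^ 3. (t, x)) \<in> borel \<rightarrow>\<^sub>M borel" by (intro borel_measurable_continuous_onI continuous_intros)
    then show "(\<lambda>x :: real ^ 3. (t, x)) \<in> restrict_space lborel Omega \<rightarrow>\<^sub>M borel" by (intro measurable_restrict_space1) simp
  qed (use assms(2) in \<open>auto simp: space_restrict_space\<close>)
  from measurable_compose[OF this assms(1)] show ?thesis by simp
qed

text \<open>The square of the norm is linear in the energy because (R^(q / 2))^(2 / q) = R, and this
  allows integration in t. Infinite energy is included: X > 0 keeps the right-hand side
  infinite.\<close>

lemma (in completion) Lnorm_square_le:
  assumes q: "q > 4" and sq: "\<sigma> = 1 - 3 / q" and HDf: "HD_function \<sigma> j h f"
    and fm: "f \<in> borel_measurable (restrict_space lborel Omega)"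
    and X: "X = 4 * pi * (1 / (1 - 2 powr (- (1 / 4 - 1 / q)))) powr q"
  shows "enn_powr (Lnorm q (restrict_space lborel Omega) (\<lambda>x. ennreal \<bar>f x\<bar>)) 2
    \<le> ennreal (X powr (2 / q)) * (\<integral>\<^sup>+p. ennreal (cw \<sigma> (3 / 2 - 2 / q) p * (Lam (eta p) h)\<^sup>2) \<partial>count_space UNIV)"
    (is "_ \<le> _ * ?Q")
proof (cases "?Q = top")
  case True
  have "1 / q < 1 / 4" using q by (simp add: field_simps)
  then have "2 powr (- (1 / 4 - 1 / q)) < (1 :: real)" by (simp add: powr_less_one)
  then have "X > 0" unfolding X by (intro mult_pos_pos) auto
  then have "ennreal (X powr (2 / q)) * ?Q = top" unfolding True by (simp add: ennreal_mult_top)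
  then show ?thesis by simp
next
  case False
  then obtain R where R: "R \<ge> 0" "?Q = ennreal R" by (cases ?Q) auto
  have X0: "X \<ge> 0" by (simp add: X)
  have "(\<integral>\<^sup>+x. enn_powr (ennreal \<bar>f x\<bar>) q \<partial>restrict_space lborel Omega) \<le> ennreal (X * R powr (q / 2))"
    using Lq_bound[OF q sq HDf fm R(1)] R(2) by (simp add: enn_powr_ennreal X mult.assoc)
  then have "Lnorm q (restrict_space lborel Omega) (\<lambda>x. ennreal \<bar>f x\<bar>) \<le> enn_powr (ennreal (X * R powr (q / 2))) (1 / q)"
    unfolding Lnorm_def using q by (intro enn_powr_mono) auto
  then have "enn_powr (Lnorm q (restrict_space lborel Omega) (\<lambda>x. ennreal \<bar>f x\<bar>)) 2 \<le> enn_powr (enn_powr (ennreal (X * R powr (q / 2))) (1 / q)) 2"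
    by (rule enn_powr_mono) simp
  also have "\<dots> = ennreal (((X * R powr (q / 2)) powr (1 / q)) powr 2)"
    using X0 by (subst enn_powr_ennreal, simp) (rule enn_powr_ennreal, simp)
  also have "((X * R powr (q / 2)) powr (1 / q)) powr 2 = X powr (2 / q) * R"
    using X0 R(1) q by (simp add: powr_mult powr_powr del: powr_numeral)
  also have "ennreal (X powr (2 / q) * R) = ennreal (X powr (2 / q)) * ?Q"
    using R by (simp add: ennreal_mult)
  finally show ?thesis .
qed

lemma ennreal_triple_sum:
  "a \<ge> 0 \<Longrightarrow> b \<ge> 0 \<Longrightarrow> c \<ge> 0 \<Longrightarrow> ennreal (3 * (a + b + c)) = 3 * (ennreal a + ennreal b + ennreal c)"
  by (subst ennreal_mult) simp_all

text \<open>An enumeration turns the integral over the index set into a series of measurable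
  functions.\<close>

lemma borel_measurable_nn_integral_count_space:
  fixes f :: "'i \<Rightarrow> 'a \<Rightarrow> ennreal"
  assumes "countable I" "infinite I" and f: "\<And>i. i \<in> I \<Longrightarrow> f i \<in> borel_measurable M"
  shows "(\<lambda>x. \<integral>\<^sup>+i. f i x \<partial>count_space I) \<in> borel_measurable M"
proof -
  have b: "bij_betw (from_nat_into I) UNIV I" by (rule bij_betw_from_nat_into[OF assms(1,2)])
  have "(\<integral>\<^sup>+i. f i x \<partial>count_space I) = (\<Sum>n. f (from_nat_into I n) x)" for x
    by (simp add: nn_integral_bij_count_space[symmetric, OF b] nn_integral_count_space_nat)
  then show ?thesis
    using bij_betwE[OF b] by (simp add: f borel_measurable_suminf_order)
qed

text \<open>A measurable majorant g stands in for the energy itself: the latter is defined through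
  limits at each time separately, and its measurability in t is thereby bypassed. The factor 3 comes
  from squaring a sum of three terms.\<close>

lemma dyadic_energy_le:
  fixes j0 :: "(real ^ 3 \<Rightarrow> real) \<Rightarrow> 'a::{banach, second_countable_topology}"
    and j1 :: "(real ^ 3 \<Rightarrow> real) \<Rightarrow> 'b::{banach, second_countable_topology}"
    and I :: "real set"
  assumes j0: "completion s j0" and j1: "completion (s - 1) j1" and s: "0 < s" "s < 1" and K: "K \<ge> 0"
    "\<And>x. x > 0 \<Longrightarrow> (\<integral>\<^sup>+p. ennreal (cw s \<beta> p * (eta p x)\<^sup>2) \<partial>count_space UNIV) \<le> ennreal (K * x powr (2 * s))"
    and I: "is_interval I" "0 \<in> I" and F: "set_integrable lborel I F"
  shows "\<exists>g\<in>borel_measurable lborel.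
    (\<forall>t\<in>I. (\<integral>\<^sup>+p. ennreal (cw s \<beta> p * (completion.Lam s j0 (eta p) (duhamel s j0 j1 u0 u1 F t))\<^sup>2) \<partial>count_space UNIV) \<le> g t) \<and>
    (\<integral>\<^sup>+t. g t \<partial>lborel) \<le> ennreal (3 * pi * K * ((norm u0)\<^sup>2 + (norm u1)\<^sup>2 + (LINT \<tau>:I|lborel. norm (F \<tau>))\<^sup>2))"
proof -
  interpret a: completion s j0 by (rule j0)
  interpret b: completion "s - 1" j1 by (rule j1)
  interpret C: multiplier s j0 s j0 "\<lambda>l. cos (t * l)" 1 for t by (rule multiplier_cos[OF j0 s(1)])
  interpret S: multiplier "s - 1" j1 s j0 "\<lambda>l. sin (t * l) / l" 1 for t by (rule multiplier_sin[OF j0 s(1) j1])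
  define A where "A p t = a.Lam (\<lambda>l. eta p l * cos (t * l)) u0" for p t
  define H where "H p t = b.Lam (\<lambda>l. eta p l * (sin (t * l) / l))" for p t
  \<comment> \<open>The forcing cut off to I, so that time integrals run over the whole line and
    \<open>E\<close> has the form of a convolution in t.\<close>
  define G where "G \<tau> = indicator I \<tau> *\<^sub>R F \<tau>" for \<tau>
  define E where "E p t = (\<integral>\<^sup>+\<tau>. ennreal \<bar>H p (t - \<tau>) (G \<tau>)\<bar> \<partial>lborel)" for p t
  define W where "W = (LINT \<tau>:I|lborel. norm (F \<tau>))"
  have s1: "s - 1 < 0" "completion (s - 1 + 1) j0" using s j0 by simp_all
  have K': "\<And>x. x > 0 \<Longrightarrow> (\<integral>\<^sup>+p. ennreal (cw (s - 1 + 1) \<beta> p * (eta p x)\<^sup>2) \<partial>count_space UNIV) \<le> ennreal (K * x powr (2 * (s - 1 + 1)))"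
    using K(2) by simp
  have G: "integrable lborel G" using F by (simp add: set_integrable_def G_def[abs_def])
  have Gm [measurable]: "G \<in> borel_measurable borel" using G by auto
  have W: "(\<integral>\<tau>. norm (G \<tau>) \<partial>lborel) = W"
    unfolding W_def set_lebesgue_integral_def G_def by (rule Bochner_Integration.integral_cong) (auto simp: indicator_def)
  have ad: "a.adm (eta p)" for p by (rule a.eta_adm[OF s(1)])
  note aL = a.Lam_bounded_linear[OF ad] and bL = b.Lam_bounded_linear[OF S.adm_mult(1)[OF ad]]
  have H0: "H p t 0 = 0" for p t unfolding H_def by (rule linear_0[OF bounded_linear.linear[OF bL]])
  have HF: "a.Lam (eta p) (fcalc_ext (s - 1) j1 s j0 (\<lambda>l. sin (t * l) / l) h) = H p t h" for p t h
    unfolding H_def by (rule S.Lam_fcalc_ext[OF ad])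
  have AF: "a.Lam (eta p) (fcalc_ext s j0 s j0 (\<lambda>l. cos (t * l)) u0) = A p t" for p t
    unfolding A_def by (rule C.Lam_fcalc_ext[OF ad])
  have Hm: "(\<lambda>x. H p (fst x) (snd x)) \<in> borel_measurable (borel \<Otimes>\<^sub>M borel)" for p
    unfolding H_def by (rule b.sin_flow(2)[OF s1 K(1) K'])
  note Hc = borel_measurable_compose_pair[OF Hm]
  have [measurable]: "(\<lambda>x. H p (fst x - snd x) (G (snd x))) \<in> borel_measurable (borel \<Otimes>\<^sub>M borel)" for p by (rule Hc) measurable
  have [measurable]: "(\<lambda>t. H p t u1) \<in> borel_measurable borel" for p by (rule Hc) measurable
  have [measurable]: "A p \<in> borel_measurable borel" for p
    using measurable_compose[OF measurable_Pair[OF measurable_ident_sets[OF refl] measurable_const[of u0]] a.cos_flow(2)[OF s(1) K, of p]]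
    unfolding A_def by simp
  have [measurable]: "(\<lambda>t. E p t) \<in> borel_measurable borel" for p
  proof -
    have "(\<lambda>t. \<integral>\<^sup>+\<tau>. (\<lambda>x. ennreal \<bar>H p (fst x - snd x) (G (snd x))\<bar>) (t, \<tau>) \<partial>lborel) \<in> borel_measurable borel"
      by (rule lborel.borel_measurable_nn_integral_fst) measurable
    then show ?thesis unfolding E_def by simp
  qed
  have bound: "ennreal (cw s \<beta> p * (a.Lam (eta p) (duhamel s j0 j1 u0 u1 F t))\<^sup>2)
      \<le> 3 * (ennreal (cw s \<beta> p * (A p t)\<^sup>2) + ennreal (cw s \<beta> p * (H p t u1)\<^sup>2) + ennreal (cw s \<beta> p) * (E p t)\<^sup>2)"
    if t: "t \<in> I" for p t
  proof -
    define d where "d = a.Lam (eta p) (LBINT \<tau>=ereal 0..ereal t. fcalc_ext (s - 1) j1 s j0 (\<lambda>l. sin ((t - \<tau>) * l) / l) (F \<tau>))"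
    \<comment> \<open>Under the absolute value the integral over [0, t] may be enlarged to I. The
      retarded cut-off disappears, and the inhomogeneous estimate reduces to the homogeneous one
      without a further argument about causality.\<close>
    have "ennreal \<bar>d\<bar> \<le> (\<integral>\<^sup>+\<tau>\<in>I. ennreal \<bar>a.Lam (eta p) (fcalc_ext (s - 1) j1 s j0 (\<lambda>l. sin ((t - \<tau>) * l) / l) (F \<tau>))\<bar> \<partial>lborel)"
      unfolding d_def by (rule bounded_linear_interval_integral_le[OF aL I t])
    also have "\<dots> = E p t"
      unfolding E_def HF by (rule nn_integral_cong) (auto simp: G_def H0 indicator_def)
    finally have d: "ennreal \<bar>d\<bar> \<le> E p t" .
    have "a.Lam (eta p) (duhamel s j0 j1 u0 u1 F t) = A p t + H p t u1 + d"
      unfolding duhamel_def d_def linear_add[OF bounded_linear.linear[OF aL]] AF HF ..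
    then have "cw s \<beta> p * (a.Lam (eta p) (duhamel s j0 j1 u0 u1 F t))\<^sup>2 \<le> 3 * (cw s \<beta> p * (A p t)\<^sup>2 + cw s \<beta> p * (H p t u1)\<^sup>2 + cw s \<beta> p * d\<^sup>2)"
      using mult_left_mono[OF square_sum3_le[of "A p t" "H p t u1" d] cw_nonneg[of s \<beta> p]] by (simp add: algebra_simps)
    then have "ennreal (cw s \<beta> p * (a.Lam (eta p) (duhamel s j0 j1 u0 u1 F t))\<^sup>2)
      \<le> 3 * (ennreal (cw s \<beta> p * (A p t)\<^sup>2) + ennreal (cw s \<beta> p * (H p t u1)\<^sup>2) + ennreal (cw s \<beta> p * d\<^sup>2))"
      by (subst ennreal_triple_sum[symmetric]) (simp_all only: ennreal_leI mult_nonneg_nonneg cw_nonneg zero_le_power2)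
    also have "ennreal (cw s \<beta> p * d\<^sup>2) = ennreal (cw s \<beta> p) * (ennreal \<bar>d\<bar>)\<^sup>2"
      by (simp add: ennreal_mult ennreal_power)
    also have "\<dots> \<le> ennreal (cw s \<beta> p) * (E p t)\<^sup>2" by (intro mult_left_mono power_mono d) auto
    finally show ?thesis by (simp add: add_left_mono mult_left_mono)
  qed
  define g where "g t = (\<integral>\<^sup>+p. 3 * (ennreal (cw s \<beta> p * (A p t)\<^sup>2) + ennreal (cw s \<beta> p * (H p t u1)\<^sup>2) + ennreal (cw s \<beta> p) * (E p t)\<^sup>2) \<partial>count_space UNIV)" for t
  have "(\<integral>\<^sup>+t. g t \<partial>lborel) = (\<integral>\<^sup>+p. \<integral>\<^sup>+t. 3 * (ennreal (cw s \<beta> p * (A p t)\<^sup>2) + ennreal (cw s \<beta> p * (H p t u1)\<^sup>2) + ennreal (cw s \<beta> p) * (E p t)\<^sup>2) \<partial>lborel \<partial>count_space UNIV)"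
    unfolding g_def by (rule nn_integral_count_space_nn_integral) (simp, measurable)
  also have "\<dots> = 3 * ((\<integral>\<^sup>+p. \<integral>\<^sup>+t. ennreal (cw s \<beta> p * (A p t)\<^sup>2) \<partial>lborel \<partial>count_space UNIV)
      + (\<integral>\<^sup>+p. \<integral>\<^sup>+t. ennreal (cw s \<beta> p * (H p t u1)\<^sup>2) \<partial>lborel \<partial>count_space UNIV)
      + (\<integral>\<^sup>+p. \<integral>\<^sup>+t. ennreal (cw s \<beta> p) * (E p t)\<^sup>2 \<partial>lborel \<partial>count_space UNIV))"
    by (simp add: nn_integral_cmult nn_integral_add)
  also have "\<dots> \<le> 3 * (ennreal (pi * K * (norm u0)\<^sup>2) + ennreal (pi * K * (norm u1)\<^sup>2) + ennreal (pi * K * W\<^sup>2))"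
  proof (intro mult_left_mono add_mono)
    show "(\<integral>\<^sup>+p. \<integral>\<^sup>+t. ennreal (cw s \<beta> p * (A p t)\<^sup>2) \<partial>lborel \<partial>count_space UNIV) \<le> ennreal (pi * K * (norm u0)\<^sup>2)"
      unfolding A_def by (rule a.cos_flow(1)[OF s(1) K])
    have flow: "(\<integral>\<^sup>+p. \<integral>\<^sup>+t. ennreal (cw s \<beta> p * (H p t h)\<^sup>2) \<partial>lborel \<partial>count_space UNIV) \<le> ennreal (pi * K * (norm h)\<^sup>2)" for h
      using b.sin_flow(1)[OF s1 K(1) K', of h] unfolding H_def by simp
    show "(\<integral>\<^sup>+p. \<integral>\<^sup>+t. ennreal (cw s \<beta> p * (H p t u1)\<^sup>2) \<partial>lborel \<partial>count_space UNIV) \<le> ennreal (pi * K * (norm u1)\<^sup>2)"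
      by (rule flow)
    show "(\<integral>\<^sup>+p. \<integral>\<^sup>+t. ennreal (cw s \<beta> p) * (E p t)\<^sup>2 \<partial>lborel \<partial>count_space UNIV) \<le> ennreal (pi * K * W\<^sup>2)"
      unfolding E_def W[symmetric] by (rule duhamel_square_bound[OF Hm H0 flow G cw_nonneg]) (use K(1) in simp)
  qed simp
  also have "\<dots> = ennreal (3 * pi * K * ((norm u0)\<^sup>2 + (norm u1)\<^sup>2 + W\<^sup>2))"
    using K(1) by (subst ennreal_triple_sum[symmetric]) (simp_all add: algebra_simps)
  finally have "(\<integral>\<^sup>+t. g t \<partial>lborel) \<le> ennreal (3 * pi * K * ((norm u0)\<^sup>2 + (norm u1)\<^sup>2 + W\<^sup>2))" .
  moreover have "g \<in> borel_measurable lborel"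
    unfolding g_def[abs_def] by (rule borel_measurable_nn_integral_count_space) (simp_all add: finite_prod)
  moreover have "(\<integral>\<^sup>+p. ennreal (cw s \<beta> p * (a.Lam (eta p) (duhamel s j0 j1 u0 u1 F t))\<^sup>2) \<partial>count_space UNIV) \<le> g t" if "t \<in> I" for t
    unfolding g_def by (rule nn_integral_mono[OF bound[OF that]])
  ultimately show ?thesis
    unfolding W_def[symmetric] by blast
qed

theorem theorem3p5:
  fixes q s :: real
    and j0 :: "(real ^ 3 \<Rightarrow> real) \<Rightarrow> 'a::{banach, second_countable_topology}"
    and j1 :: "(real ^ 3 \<Rightarrow> real) \<Rightarrow> 'b::{banach, second_countable_topology}"
  assumes "q > 4" and "s = 1 - 3 / q"
    and "is_HD_rad s j0" and "is_HD_rad (s - 1) j1"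
  shows "\<exists>C>0. \<forall>(I :: real set) (u0 :: 'a) (u1 :: 'b) (F :: real \<Rightarrow> 'b)
            (u :: real \<Rightarrow> real ^ 3 \<Rightarrow> real).
          is_interval I \<longrightarrow> 0 \<in> I \<longrightarrow> set_integrable lborel I F \<longrightarrow>
          wave_solution s j0 j1 I u0 u1 F u \<longrightarrow>
          mixed_norm 2 q I u \<le> ennreal (C * (norm (u0, u1) + (LINT \<tau>:I|lborel. norm (F \<tau>))))"
proof -
  define \<beta> where "\<beta> = 3 / 2 - 2 / q"
  define X where "X = 4 * pi * (1 / (1 - 2 powr (- (1 / 4 - 1 / q)))) powr q"
  have "0 < 1 / q" "1 / q < 1 / 4" using assms(1) by (auto simp: field_simps)
  then have s: "0 < s" "s < 1" "\<beta> > 1" unfolding assms(2) \<beta>_def by linarith+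
  obtain K where K: "K \<ge> 0" "\<And>x. x > 0 \<Longrightarrow> (\<integral>\<^sup>+p. ennreal (cw s \<beta> p * (eta p x)\<^sup>2) \<partial>count_space UNIV) \<le> ennreal (K * x powr (2 * s))"
    using eta_sum_le[OF s] by auto
  interpret a: completion s j0 using assms(3) s by unfold_locales auto
  have j1: "completion (s - 1) j1" using assms(4) s by unfold_locales auto
  \<comment> \<open>X^(2 / q) is the price of passing from the energy to the squared norm, and 3 pi
    K that of the energy estimate. All of it is fixed by q and s before I and the data are
    chosen.\<close>
  define D where "D = X powr (2 / q) * (3 * pi * K)"
  have D: "D \<ge> 0" using K by (simp add: D_def)
  \<comment> \<open>The summand 1 ensures that the constant is strictly positive.\<close>
  have main: "mixed_norm 2 q I u \<le> ennreal ((sqrt D + 1) * (norm (u0, u1) + (LINT \<tau>:I|lborel. norm (F \<tau>))))"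
    if I: "is_interval I" "0 \<in> I" and F: "set_integrable lborel I F" and u: "wave_solution s j0 j1 I u0 u1 F u"
    for I u0 u1 F u
  proof -
    define W where "W = (LINT \<tau>:I|lborel. norm (F \<tau>))"
    have W: "W \<ge> 0" unfolding W_def set_lebesgue_integral_def by (rule Bochner_Integration.integral_nonneg) simp
    define N where "N = (norm u0)\<^sup>2 + (norm u1)\<^sup>2 + W\<^sup>2"
    have N: "N \<ge> 0" by (simp add: N_def)
    have Ib: "I \<in> sets lborel" using real_interval_borel_measurable[OF I(1)] by simp
    define L where "L t = enn_powr (Lnorm q (restrict_space lborel Omega) (\<lambda>x. ennreal \<bar>u t x\<bar>)) 2" for t
    define Q where "Q t = (\<integral>\<^sup>+p. ennreal (cw s \<beta> p * (a.Lam (eta p) (duhamel s j0 j1 u0 u1 F t))\<^sup>2) \<partial>count_space UNIV)" for t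
    have LQ: "L t \<le> ennreal (X powr (2 / q)) * Q t" if t: "t \<in> I" for t
      unfolding L_def Q_def \<beta>_def
      by (rule a.Lnorm_square_le[OF assms(1,2) _ section_measurable[OF _ t] X_def])
        (use u t in \<open>auto simp: wave_solution_def\<close>)
    obtain g where g: "g \<in> borel_measurable lborel" "\<And>t. t \<in> I \<Longrightarrow> Q t \<le> g t" "(\<integral>\<^sup>+t. g t \<partial>lborel) \<le> ennreal (3 * pi * K * N)"
      using dyadic_energy_le[OF a.completion_axioms j1 s(1,2) K I F, of u0 u1] unfolding Q_def N_def W_def by blast
    have "(\<integral>\<^sup>+t. L t \<partial>restrict_space lborel I) = (\<integral>\<^sup>+t\<in>I. L t \<partial>lborel)"
      using Ib by (simp add: nn_integral_restrict_space)
    also have "\<dots> \<le> (\<integral>\<^sup>+t. ennreal (X powr (2 / q)) * g t \<partial>lborel)"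
    proof (rule nn_integral_mono)
      fix t
      show "L t * indicator I t \<le> ennreal (X powr (2 / q)) * g t"
        using order_trans[OF LQ mult_left_mono[OF g(2)], of t] by (cases "t \<in> I") auto
    qed
    also have "\<dots> = ennreal (X powr (2 / q)) * (\<integral>\<^sup>+t. g t \<partial>lborel)"
      by (rule nn_integral_cmult[OF g(1)])
    also have "\<dots> \<le> ennreal (X powr (2 / q)) * ennreal (3 * pi * K * N)"
      by (rule mult_left_mono[OF g(3)]) simp
    also have "\<dots> = ennreal (D * N)"
      using K N by (simp add: D_def mult.assoc flip: ennreal_mult)
    finally have "mixed_norm 2 q I u \<le> enn_powr (ennreal (D * N)) (1 / 2)"
      unfolding mixed_norm_def Lnorm_def[of 2] L_def by (rule enn_powr_mono) simp
    also have "\<dots> = ennreal (sqrt D * sqrt N)" using D N by (simp add: enn_powr_half real_sqrt_mult)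
    also have "\<dots> \<le> ennreal ((sqrt D + 1) * (norm (u0, u1) + W))"
    proof (intro ennreal_leI mult_mono)
      have "N \<le> (norm (u0, u1) + W)\<^sup>2" using W by (simp add: N_def norm_Pair power2_sum)
      then show "sqrt N \<le> norm (u0, u1) + W" using W by (intro real_le_lsqrt) (auto simp: N_def)
    qed (use D N in auto)
    finally show ?thesis unfolding W_def .
  qed
  show ?thesis
    by (rule exI[of _ "sqrt D + 1"]) (use main D in \<open>auto simp: add_nonneg_pos\<close>)
qed

end
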